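(* There exists an absolute constant $c>0$ such that the following holds. Let $n$ be a positive integer and let $m$ be a positive factor of $n$ with $$n>c\,m^2\log n+1.$$ Let $A_1,\ldots,A_m$ be $n\times n$ real deterministic matrices with $\sigma_1(A_i)\le1$ for each $i=1,\ldots,m$. Suppose that there exists a positive real number $\alpha\le n^{-\log n}$ such that $$\sigma_{n-k+1}\left(\sum_{i=1}^k x_iA_i\right)\ge\alpha^k$$ for every $k\in\{1,\ldots,m\}$ and every unit vector $(x_1,\ldots,x_k)\in S^{k-1}$. Let $G$ be an $n\times\frac nm$ sparse Gaussian random matrix whose entries are independent, each entry being set to $\mathcal{N}(0,1)$ with probability $\frac hn$ and to $0$ otherwise, where $0\le h\le n$. Suppose that $$h\ge c\,m\log n\log\frac1\alpha.$$ Then the $n\times n$ Krylov space matrix $$K:=\left[\begin{array}{c|c|c|c}A_1G&A_2G&\cdots&A_mG\end{array}\right]$$ satisfies $$\mathbb{P}\left(\sigma_n(K)\le\alpha^{500m}\right)\le\alpha.$$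
   Context: For an $n\times n$ matrix $A$, $\sigma_1(A)\ge\cdots\ge\sigma_n(A)$ denote its singular values. $S^{k-1}$ is the unit sphere in $\mathbb{R}^k$. $\log$ is the natural logarithm. $K$ is the block matrix obtained by placing the $n\times\frac nm$ matrices $A_1G,\dots,A_mG$ side by side. *)

theory Defs
  imports
    "HOL-Probability.Probability"
    "Jordan_Normal_Form.Schur_Decomposition"
begin

section \<open>Singular values\<close>

text \<open>
  The singular values of \<open>A\<close> are the square roots of the eigenvalues of \<open>A\<^sup>T A\<close>, counted with
  multiplicity (as roots of the characteristic polynomial) and listed in decreasing order.
  Lemma \<open>length_singular_values\<close> below shows that an \<open>n \<times> n\<close> matrix has exactly \<open>n\<close> of them.
\<close>

definition singular_values :: "real mat \<Rightarrow> real list" where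
  "singular_values A =
     rev (sorted_list_of_multiset (image_mset sqrt (proots (char_poly (transpose_mat A * A)))))"

text \<open>Indices start at 1, so \<open>singular_value 1 A\<close> is the largest singular value.\<close>

definition singular_value :: "nat \<Rightarrow> real mat \<Rightarrow> real" where
  "singular_value k A = singular_values A ! (k - 1)"

lemma symmetric_eigenvalue_real:
  fixes B :: "real mat"
  assumes B: "B \<in> carrier_mat n n" and sym: "transpose_mat B = B"
    and ev: "eigenvalue (map_mat complex_of_real B) e"
  shows "Im e = 0"
proof -
  define C where "C = map_mat complex_of_real B"
  have C: "C \<in> carrier_mat n n" using B by (simp add: C_def)
  obtain v where v: "v \<in> carrier_vec n" "v \<noteq> 0\<^sub>v n" "C *\<^sub>v v = e \<cdot>\<^sub>v v"
    using ev C unfolding eigenvalue_def eigenvector_def C_def[symmetric] by auto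
  have cC: "C *\<^sub>v conjugate v = cnj e \<cdot>\<^sub>v conjugate v"
  proof -
    have "C *\<^sub>v conjugate v = conjugate (C *\<^sub>v v)"
      by (rule eq_vecI)
        (use v(1) C B in \<open>auto simp: C_def scalar_prod_def\<close>)
    then show ?thesis using v by (auto simp: conjugate_smult_vec)
  qed
  have tC: "transpose_mat C = C"
    unfolding C_def by (subst sym[symmetric]) (use B in \<open>auto intro!: eq_matI\<close>)
  have "e * (v \<bullet>c v) = (C *\<^sub>v v) \<bullet> conjugate v"
    using v by simp
  also have "\<dots> = v \<bullet> (C *\<^sub>v conjugate v)"
    using v C tC transpose_vec_mult_scalar[of C n n "conjugate v" v] 
    by (metis carrier_vec_conjugate comm_scalar_prod mult_mat_vec_carrier)
  also have "\<dots> = cnj e * (v \<bullet>c v)"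
    using v cC by simp
  finally have "e = cnj e"
    using v conjugate_square_eq_0_vec[OF v(1)] by auto
  then show ?thesis by (metis Reals_cnj_iff complex_is_Real_iff)
qed

lemma length_singular_values:
  assumes A: "A \<in> carrier_mat n n"
  shows "length (singular_values A) = n"
proof -
  interpret mh: map_poly_inj_idom_hom complex_of_real ..
  define B where "B = transpose_mat A * A"
  have B: "B \<in> carrier_mat n n" using A by (simp add: B_def)
  have sym: "transpose_mat B = B"
    using A by (simp add: B_def transpose_mult[of _ n n _ n])
  let ?C = "map_mat complex_of_real B"
  have C: "?C \<in> carrier_mat n n" using B by simp
  obtain as where as: "char_poly ?C = (\<Prod>a\<leftarrow>as. [:- a, 1:])"
    using char_poly_factorized[OF C] by auto
  have re: "a = of_real (Re a)" if "a \<in> set as" for a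
  proof -
    have "poly (char_poly ?C) a = 0"
      unfolding as using that by (auto simp: poly_prod_list prod_list_zero_iff image_iff)
    then have "eigenvalue ?C a" using eigenvalue_root_char_poly[OF C] by simp
    then show ?thesis
      using symmetric_eigenvalue_real[OF B sym] by (simp add: complex_eq_iff)
  qed
  have "map_poly of_real (char_poly B) = char_poly ?C"
    by (rule of_real_hom.char_poly_hom[OF B, symmetric])
  also have "\<dots> = (\<Prod>a\<leftarrow>map Re as. [:- of_real a, 1:])"
    unfolding as using re by (auto intro!: arg_cong[where f = prod_list])
  also have "\<dots> = map_poly of_real (\<Prod>a\<leftarrow>map Re as. [:- a, 1:])"
    by (simp add: mh.hom_prod_list o_def)
  finally have eq: "char_poly B = (\<Prod>a\<leftarrow>map Re as. [:- a, 1:])"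
    by (rule mh.injectivity)
  have "degree (char_poly B) = n" by (rule degree_monic_char_poly[OF B, THEN conjunct1])
  moreover have "size (proots (\<Prod>a\<leftarrow>xs. [:- a, 1:])) = degree (\<Prod>a\<leftarrow>xs. [:- a, 1:])"
    for xs :: "real list"
    by (induction xs) (simp_all add: proots_mult degree_mult_eq prod_list_zero_iff image_iff
          del: mult_pCons_left)
  ultimately show ?thesis
    by (simp add: singular_values_def B_def[symmetric] eq size_mset[symmetric] del: size_mset map_map)
qed


section \<open>Linear combinations and the Krylov space matrix\<close>

definition lincomb_mats :: "nat \<Rightarrow> nat \<Rightarrow> (nat \<Rightarrow> real) \<Rightarrow> (nat \<Rightarrow> real mat) \<Rightarrow> real mat" where
  "lincomb_mats n k x A = mat n n (\<lambda>rs. \<Sum>i=1..k. x i * A i $$ rs)"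

text \<open>
  The blocks \<open>A\<^sub>1 G, \<dots>, A\<^sub>m G\<close> (with \<open>A\<^sub>i\<close> of size \<open>n \<times> n\<close> and \<open>G\<close> of size \<open>n \<times> q\<close>) side by side:
  column \<open>s\<close> (counted from 0) of the result is column \<open>s mod q\<close> of block number \<open>s div q + 1\<close>.
\<close>

definition krylov_mat :: "nat \<Rightarrow> nat \<Rightarrow> nat \<Rightarrow> (nat \<Rightarrow> real mat) \<Rightarrow> real mat \<Rightarrow> real mat" where
  "krylov_mat n m q A G =
     mat n (m * q) (\<lambda>(r, s). (A (s div q + 1) * G) $$ (r, s mod q))"


section \<open>Sparse Gaussian random matrices\<close>

text \<open>
  The law of \<open>if b then z else 0\<close>, where \<open>b\<close> is Bernoulli with parameter \<open>p \<in> [0,1]\<close> and \<open>z\<close> is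
  standard normal, independent of \<open>b\<close>.
\<close>

definition sparse_gaussian :: "real \<Rightarrow> real measure" where
  "sparse_gaussian p =
     distr (measure_pmf (bernoulli_pmf p) \<Otimes>\<^sub>M density lborel (\<lambda>x. ennreal (std_normal_density x)))
       borel (\<lambda>(b, z). if b then z else 0)"

text \<open>
  The joint law of the entries of an \<open>n \<times> q\<close> matrix with independent \<open>sparse_gaussian p\<close> entries.
  Working with this law rather than with a random matrix on an arbitrary probability space keeps
  constants quantified outside independent of the type of the sample space; lemma
  \<open>distr_sparse_gaussian_entries\<close> below shows that nothing is lost.
\<close>

definition sparse_gaussian_entries :: "nat \<Rightarrow> nat \<Rightarrow> real \<Rightarrow> (nat \<times> nat \<Rightarrow> real) measure" where
  "sparse_gaussian_entries n q p = (\<Pi>\<^sub>M rs\<in>{..<n} \<times> {..<q}. sparse_gaussian p)"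

lemma measurable_sparse_gaussian_map [measurable]:
  "(\<lambda>(b, z). if b then z else 0) \<in>
     measure_pmf (bernoulli_pmf p) \<Otimes>\<^sub>M density lborel (\<lambda>x. ennreal (std_normal_density x))
       \<rightarrow>\<^sub>M (borel :: real measure)"
  by measurable

lemma prob_space_sparse_gaussian: "prob_space (sparse_gaussian p)"
proof -
  interpret N: prob_space "density lborel (\<lambda>x. ennreal (std_normal_density x))"
    by (rule prob_space_normal_density) simp
  interpret P: pair_prob_space "measure_pmf (bernoulli_pmf p)"
    "density lborel (\<lambda>x. ennreal (std_normal_density x))" ..
  show ?thesis
    unfolding sparse_gaussian_def by (rule P.prob_space_distr) measurable
qed

lemma emeasure_sparse_gaussian:
  assumes p: "0 \<le> p" "p \<le> 1" and B: "B \<in> sets borel"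
  shows "emeasure (sparse_gaussian p) B =
           ennreal p * emeasure (density lborel (\<lambda>x. ennreal (std_normal_density x))) B
             + ennreal (1 - p) * indicator B 0"
proof -
  let ?N = "density lborel (\<lambda>x. ennreal (std_normal_density x))"
  interpret N: prob_space ?N
    by (rule prob_space_normal_density) simp
  let ?f = "\<lambda>(b, z). if b then z else (0::real)"
  let ?M = "measure_pmf (bernoulli_pmf p) \<Otimes>\<^sub>M ?N"
  have S: "?f -` B \<inter> space ?M \<in> sets ?M"
    by (rule measurable_sets[OF measurable_sparse_gaussian_map B])
  have sec: "Pair b -` (?f -` B \<inter> space ?M) = (if b then B else if 0 \<in> B then UNIV else {})" for b
    by (auto simp: space_pair_measure)
  have "emeasure (sparse_gaussian p) B = emeasure ?M (?f -` B \<inter> space ?M)"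
    unfolding sparse_gaussian_def by (rule emeasure_distr[OF measurable_sparse_gaussian_map B])
  also have "\<dots> = (\<integral>\<^sup>+b. emeasure ?N (Pair b -` (?f -` B \<inter> space ?M)) \<partial>bernoulli_pmf p)"
    by (rule N.emeasure_pair_measure_alt[OF S])
  also have "\<dots> = ennreal p * emeasure ?N B + ennreal (1 - p) * indicator B 0"
    unfolding sec using p N.emeasure_space_1
    by (simp add: nn_integral_bernoulli_pmf mult.commute)
  finally show ?thesis .
qed

lemma (in prob_space) distr_sparse_gaussian_entries:
  assumes "indep_vars (\<lambda>_. borel) X ({..<n} \<times> {..<q})" "0 < n" "0 < q"
    and "\<And>rs. rs \<in> {..<n} \<times> {..<q} \<Longrightarrow> distr M borel (X rs) = sparse_gaussian p"
  shows "distr M (\<Pi>\<^sub>M rs\<in>{..<n} \<times> {..<q}. borel) (\<lambda>\<omega>. \<lambda>rs\<in>{..<n} \<times> {..<q}. X rs \<omega>)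
           = sparse_gaussian_entries n q p"
proof -
  let ?I = "{..<n} \<times> {..<q}"
  have rv: "random_variable borel (X rs)" if "rs \<in> ?I" for rs
    using assms(1) that unfolding indep_vars_def by blast
  have ne: "?I \<noteq> {}" using assms(2,3) by blast
  have "distr M (\<Pi>\<^sub>M rs\<in>?I. borel) (\<lambda>\<omega>. \<lambda>rs\<in>?I. X rs \<omega>) = (\<Pi>\<^sub>M rs\<in>?I. distr M borel (X rs))"
    using indep_vars_iff_distr_eq_PiM'[where I = ?I and M' = "\<lambda>_. borel" and X = X, OF ne rv]
      assms(1) by blast
  also have "\<dots> = sparse_gaussian_entries n q p"
    unfolding sparse_gaussian_entries_def by (intro PiM_cong assms(4)) auto
  finally show ?thesis .
qed

end

(*
  Write G = [g_1 ... g_q] with q = n / m. If K is almost singular, then for some column g_j the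
  columns A_i g_j (i = 1, ..., m), compressed to the m-dimensional orthogonal complement of all the
  other columns of K, form an almost degenerate m x m matrix whose entries are linear in g_j.

  Its determinant is controlled by a growth argument: if every bilinear form y M z is spread over
  many coordinates of g_j, then a random support lets the largest rho x rho minor grow step by step
  up to rho = m, and a Gaussian slice argument turns this into anticoncentration of det M relative to
  the (m - 1)-minors.

  The spread condition says that for every y that is almost orthogonal to the columns already
  exposed, every unit combination (sum x_i A_i)^T y with r coefficients has many large coordinates.
  For r = 1 it follows from nets and repeated doubling. To pass from c to r <= 4 c, a failure for
  (x, y) places y in an eigenspace of small dimension of a psd matrix Q. Each fresh column g
  multiplies det(Q + tau + ...) by a large factor as long as a c-dimensional space of small
  directions survives, while the determinant has a bounded budget, so after enough columns fewer
  than c directions survive, and a second round with single directions removes these.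
*)

theory Submission
  imports Defs
begin

text \<open>A net over the vectors y would have a size exponential in n. Only the coefficients x and
  the set T of large coordinates enter a union bound; y is covered by a determinant argument that
  handles a whole eigenspace at once. Using c directions at a time makes this affordable: a good
  column then gains a c-th power, so the number of columns needed is of the order of the number of
  large coordinates divided by c, which is the same at every stage. The step r <= 4 c keeps the loss
  geometric: the threshold goes from \<open>\<alpha> ^ (17 * c)\<close> to
  \<open>\<alpha> ^ (68 * c)\<close>, so its final exponent is linear in m. In the last step an
  absolute bound on det M would raise this threshold to the power m and make the exponent quadratic
  in m; relative to the (m - 1)-minors it is lost only once, which is how
  \<open>\<alpha> ^ (500 * m)\<close> is reached. The hypothesis on \<open>\<alpha>\<close> pays for
  the doubling of single directions: each doubling refines the mesh by a power of n, after about log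
  n of them a coordinate costs of the order of (log n)^2 in entropy, and (log n)^2 is at most log (1
  / \<open>\<alpha>\<close>).\<close>

no_notation inner (infix "\<bullet>" 70)
no_notation vec_nth (infixl "$" 90)

section \<open>Real spectral theory\<close>

text \<open>The \<open>p\<close> equations become the first rows of an \<open>N\<close> by
  \<open>N\<close> matrix whose other rows vanish. Its transpose kills the unit vector at index
  \<open>p\<close>, so the determinant is 0 and the kernel is nontrivial.\<close>

lemma homogeneous_solution:
 fixes W :: "nat => real vec"
 assumes pN: "p < N" and W: "!!i. i < p ==> W i \<in> carrier_vec N"
 obtains et where "et \<in> carrier_vec N" "et \<noteq> 0\<^sub>v N" "!!i. i < p ==> W i \<bullet> et = 0"
proof -
 define M where "M = mat N N (%(i,j). if i < p then W i $ j else (0::real))"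
 have M: "M \<in> carrier_mat N N" by (simp add: M_def)
 have "M\<^sup>T *\<^sub>v unit_vec N p = 0\<^sub>v N"
  by (rule eq_vecI) (use pN in \<open>auto simp: M_def\<close>)
 moreover have "unit_vec N p \<noteq> (0\<^sub>v N :: real vec)" using pN
  by (metis index_unit_vec(1) index_zero_vec(1) zero_neq_one)
 ultimately have "det M\<^sup>T = 0"
  using det_0_iff_vec_prod_zero[of "M\<^sup>T" N] M by (metis transpose_carrier_mat unit_vec_carrier)
 hence "det M = 0" using det_transpose[OF M] by simp
 then obtain et where et: "et \<in> carrier_vec N" "et \<noteq> 0\<^sub>v N" "M *\<^sub>v et = 0\<^sub>v N"
  using det_0_iff_vec_prod_zero[OF M] by blast
 have "W i \<bullet> et = 0" if "i < p" for i
 proof -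
  have "W i \<bullet> et = (M *\<^sub>v et) $ i"
   using that pN et(1) W[OF that] by (auto simp: M_def scalar_prod_def)
  thus ?thesis using et(3) that pN by simp
 qed
 thus ?thesis using that et by blast
qed

definition orthon :: "nat => nat => (nat => real vec) => bool" where
 "orthon n k ph \<longleftrightarrow> (\<forall>i<k. ph i \<in> carrier_vec n) \<and> (\<forall>i<k. \<forall>j<k. ph i \<bullet> ph j = (if i = j then 1 else 0))"

definition comb :: "nat => nat => (nat => real vec) => (nat => real) => real vec" where
 "comb n k ph et = vec n (%a. \<Sum>i<k. et i * ph i $ a)"

lemma comb_carrier [simp]: "comb n k ph et \<in> carrier_vec n"
 by (simp add: comb_def)

lemma scalar_prod_comb:
 assumes "u \<in> carrier_vec n" "!!i. i < k ==> ph i \<in> carrier_vec n"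
 shows "u \<bullet> comb n k ph et = (\<Sum>i<k. et i * (u \<bullet> ph i))"
proof -
 have "u \<bullet> comb n k ph et = (\<Sum>a=0..<n. \<Sum>i<k. u $ a * (et i * ph i $ a))"
  by (simp add: scalar_prod_def comb_def sum_distrib_left)
 also have "... = (\<Sum>i<k. \<Sum>a=0..<n. u $ a * (et i * ph i $ a))" by (rule sum.swap)
 also have "... = (\<Sum>i<k. et i * (u \<bullet> ph i))"
  using assms(2)[THEN carrier_vecD]
  by (intro sum.cong) (auto simp: scalar_prod_def sum_distrib_left ac_simps)
 finally show ?thesis .
qed

lemma comb_scalar_prod_self:
 assumes "orthon n k ph"
 shows "comb n k ph et \<bullet> comb n k ph ze = (\<Sum>i<k. et i * ze i)"
proof -
 have c: "!!i. i < k ==> ph i \<in> carrier_vec n" using assms by (auto simp: orthon_def)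
 have "comb n k ph et \<bullet> ph i = et i" if "i < k" for i
 proof -
  have "comb n k ph et \<bullet> ph i = ph i \<bullet> comb n k ph et"
   using c[OF that] by (intro comm_scalar_prod) auto
  also have "... = (\<Sum>j<k. et j * (ph i \<bullet> ph j))" by (rule scalar_prod_comb) (use c that in auto)
  also have "... = (\<Sum>j<k. if j = i then et i else 0)"
   using assms that by (intro sum.cong) (auto simp: orthon_def)
  finally show ?thesis using that by simp
 qed
 thus ?thesis by (subst scalar_prod_comb) (auto simp: c mult.commute)
qed

lemma sq_nonneg [simp]: "0 <= (y::real vec) \<bullet> y"
 by (simp add: scalar_prod_def sum_nonneg)

lemma sq_zero_iff:
 assumes "(y::real vec) \<in> carrier_vec n" shows "y \<bullet> y = 0 \<longleftrightarrow> y = 0\<^sub>v n"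
 using assms conjugate_square_eq_0_vec[of y n] by simp

lemma normalize_vec:
 assumes "(y::real vec) \<in> carrier_vec n" "y \<noteq> 0\<^sub>v n"
 obtains c where "c > 0" "(c \<cdot>\<^sub>v y) \<bullet> (c \<cdot>\<^sub>v y) = 1" "c * c * (y \<bullet> y) = 1"
proof -
 have p: "y \<bullet> y > 0" using sq_zero_iff[OF assms(1)] assms(2) sq_nonneg[of y] by linarith
 let ?c = "1 / sqrt (y \<bullet> y)"
 have c: "?c * ?c * (y \<bullet> y) = 1" using p by simp
 moreover have "(?c \<cdot>\<^sub>v y) \<bullet> (?c \<cdot>\<^sub>v y) = ?c * ?c * (y \<bullet> y)"
  using assms(1) by (subst smult_scalar_prod_distrib[of _ n]) (auto simp: scalar_prod_smult_right)
 ultimately show ?thesis using p by (intro that[of ?c]) auto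
qed

lemma orthon_extend:
 assumes "orthon n k ph" "k <= n"
 obtains ps where "orthon n n ps" "!!i. i < k ==> ps i = ph i"
proof -
 have "\<exists>ps. orthon n (k + j) ps \<and> (\<forall>i<k. ps i = ph i)" if "k + j <= n" for j
  using that
 proof (induction j)
  case 0
  thus ?case using assms by auto
 next
  case (Suc j)
  then obtain ps where ps: "orthon n (k + j) ps" "\<forall>i<k. ps i = ph i" by auto
  have "k + j < n" using Suc by simp
  then obtain et where et: "et \<in> carrier_vec n" "et \<noteq> 0\<^sub>v n" "!!i. i < k + j ==> ps i \<bullet> et = 0"
   by (rule homogeneous_solution[of "k+j" n ps]) (use ps in \<open>auto simp: orthon_def\<close>)
  obtain c where c: "c > 0" "(c \<cdot>\<^sub>v et) \<bullet> (c \<cdot>\<^sub>v et) = 1" using normalize_vec[OF et(1,2)] by blast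
  let ?ps = "ps(k + j := c \<cdot>\<^sub>v et)"
  have cv: "ps i \<in> carrier_vec n" if "i < k + j" for i using ps(1) that by (auto simp: orthon_def)
  have z: "ps i \<bullet> (c \<cdot>\<^sub>v et) = 0" "(c \<cdot>\<^sub>v et) \<bullet> ps i = 0" if "i < k + j" for i
  proof -
   show "ps i \<bullet> (c \<cdot>\<^sub>v et) = 0" using et(1,3) cv[OF that] that by simp
   thus "(c \<cdot>\<^sub>v et) \<bullet> ps i = 0"
    using et(1) cv[OF that] by (subst comm_scalar_prod[of _ n]) auto
  qed
  have "orthon n (k + Suc j) ?ps"
   using ps(1) c(2) z et(1) by (auto simp: orthon_def less_Suc_eq)
  moreover have "\<forall>i<k. ?ps i = ph i" using ps(2) by simp
  ultimately show ?case by (intro exI[of _ ?ps] conjI)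
 qed
 from this[of "n - k"] assms(2) show ?thesis using that by auto
qed

lemma orthon_basis_mats:
 assumes "orthon n n ph"
 defines "Q \<equiv> mat n n (%(a,i). ph i $ a)"
 shows "Q \<in> carrier_mat n n" "Q\<^sup>T * Q = 1\<^sub>m n" "Q * Q\<^sup>T = 1\<^sub>m n"
proof -
 show Q: "Q \<in> carrier_mat n n" by (simp add: Q_def)
 have c: "ph i \<in> carrier_vec n" if "i < n" for i using assms that by (auto simp: orthon_def)
 have col: "col Q i = ph i" if "i < n" for i
  using c[OF that] that by (auto simp: Q_def)
 show 1: "Q\<^sup>T * Q = 1\<^sub>m n"
  by (rule eq_matI) (use Q col assms(1) in \<open>auto simp: orthon_def\<close>)
 show "Q * Q\<^sup>T = 1\<^sub>m n"
  using mat_mult_left_right_inverse[OF _ Q 1] Q by auto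
qed

lemma parseval:
 assumes "orthon n n ph" "y \<in> carrier_vec n" "z \<in> carrier_vec n"
 shows "y = comb n n ph (%i. ph i \<bullet> y)" "y \<bullet> z = (\<Sum>i<n. (ph i \<bullet> y) * (ph i \<bullet> z))"
proof -
 define Q where "Q = mat n n (%(a,i). ph i $ a)"
 note Q = orthon_basis_mats[OF assms(1), folded Q_def]
 have c: "ph i \<in> carrier_vec n" if "i < n" for i using assms that by (auto simp: orthon_def)
 have e: "x = comb n n ph (%i. ph i \<bullet> x)" if x: "x \<in> carrier_vec n" for x
 proof -
  have "x = (Q * Q\<^sup>T) *\<^sub>v x" using Q x by simp
  also have "... = Q *\<^sub>v (Q\<^sup>T *\<^sub>v x)" using Q x by (intro assoc_mult_mat_vec) auto
  also have "Q\<^sup>T *\<^sub>v x = vec n (%i. ph i \<bullet> x)"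
   by (rule eq_vecI) (use Q x c in \<open>auto simp: Q_def scalar_prod_def\<close>)
  also have "Q *\<^sub>v vec n (%i. ph i \<bullet> x) = comb n n ph (%i. ph i \<bullet> x)"
   by (rule eq_vecI) (auto simp: Q_def comb_def scalar_prod_def lessThan_atLeast0 mult.commute)
  finally show ?thesis .
 qed
 show "y = comb n n ph (%i. ph i \<bullet> y)" by (rule e) fact
 show "y \<bullet> z = (\<Sum>i<n. (ph i \<bullet> y) * (ph i \<bullet> z))"
  using e[OF assms(2)] e[OF assms(3)] comb_scalar_prod_self[OF assms(1)] by metis
qed

lemma mat_sym_bilinear:
 fixes A :: "real mat"
 assumes "A \<in> carrier_mat n n" "A\<^sup>T = A" "u \<in> carrier_vec n" "v \<in> carrier_vec n"
 shows "u \<bullet> (A *\<^sub>v v) = (A *\<^sub>v u) \<bullet> v"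
 using assms transpose_vec_mult_scalar[of A n n v u] by simp

text \<open>Over the complex numbers the characteristic polynomial splits. Its roots are real by
  \<open>symmetric_eigenvalue_real\<close>, so one of them is a root of the real polynomial.\<close>

lemma symmetric_real_eigenvector:
 fixes A :: "real mat"
 assumes A: "A \<in> carrier_mat n n" and sym: "A\<^sup>T = A" and n: "n > 0"
 obtains b v where "v \<in> carrier_vec n" "v \<noteq> 0\<^sub>v n" "A *\<^sub>v v = b \<cdot>\<^sub>v v"
proof -
 let ?C = "map_mat complex_of_real A"
 have C: "?C \<in> carrier_mat n n" using A by simp
 obtain as where as: "char_poly ?C = (\<Prod>a\<leftarrow>as. [:- a, 1:])" "length as = n"
  using char_poly_factorized[OF C] by auto
 then obtain a where a: "a \<in> set as" using n by (cases as) auto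
 have "poly (char_poly ?C) a = 0"
  unfolding as(1) using a by (auto simp: poly_prod_list prod_list_zero_iff image_iff)
 hence ev: "eigenvalue ?C a" using eigenvalue_root_char_poly[OF C] by simp
 hence "a = of_real (Re a)" using symmetric_eigenvalue_real[OF A sym] by (simp add: complex_eq_iff)
 hence "poly (char_poly ?C) (of_real (Re a)) = 0" using ev eigenvalue_root_char_poly[OF C] by simp
 moreover have "char_poly ?C = map_poly of_real (char_poly A)"
  by (rule of_real_hom.char_poly_hom[OF A])
 ultimately have "poly (char_poly A) (Re a) = 0" by simp
 hence "eigenvalue A (Re a)" using eigenvalue_root_char_poly[OF A] by simp
 thus ?thesis using that A unfolding eigenvalue_def eigenvector_def by auto
qed

text \<open>Induction by deflation: the complement of the \<open>k\<close> eigenvectors already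
  found is invariant because \<open>A\<close> is symmetric, so an eigenvector of the compression of
  \<open>A\<close> to that complement is an eigenvector of \<open>A\<close>.\<close>

theorem spectral_theorem_real:
 fixes A :: "real mat"
 assumes A: "A \<in> carrier_mat n n" and sym: "A\<^sup>T = A"
 obtains ph d where "orthon n n ph" "!!i. i < n ==> A *\<^sub>v ph i = d i \<cdot>\<^sub>v ph i"
proof -
 have "\<exists>ph d. orthon n k ph \<and> (\<forall>i<k. A *\<^sub>v ph i = d i \<cdot>\<^sub>v ph i)" if "k <= n" for k
  using that
 proof (induction k)
  case 0
  show ?case by (auto simp: orthon_def)
 next
  case (Suc k)
  then obtain ph d where ph: "orthon n k ph" "\<forall>i<k. A *\<^sub>v ph i = d i \<cdot>\<^sub>v ph i" by auto
  obtain w where w: "orthon n n w" "!!i. i < k ==> w i = ph i"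
   using orthon_extend[OF ph(1)] Suc.prems by auto
  have wc: "w i \<in> carrier_vec n" if "i < n" for i using w(1) that by (auto simp: orthon_def)
  have worth: "w i \<bullet> w j = (if i = j then 1 else 0)" if "i < n" "j < n" for i j
   using w(1) that by (auto simp: orthon_def)
  let ?l = "n - k"
  have kn: "k < n" using Suc.prems by simp
  \<comment> \<open>The compression of \<open>A\<close> to the span of the basis vectors that are
    not yet known to be eigenvectors.\<close>
  define C where "C = mat ?l ?l (%(i,j). w (k+i) \<bullet> (A *\<^sub>v w (k+j)))"
  have C: "C \<in> carrier_mat ?l ?l" by (simp add: C_def)
  have "C\<^sup>T = C"
  proof (rule eq_matI)
   fix i j assume ij: "i < dim_row C" "j < dim_col C"
   have "w (k+j) \<bullet> (A *\<^sub>v w (k+i)) = (A *\<^sub>v w (k+j)) \<bullet> w (k+i)"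
    by (rule mat_sym_bilinear[OF A sym]) (use ij C wc in auto)
   also have "... = w (k+i) \<bullet> (A *\<^sub>v w (k+j))"
    using ij C A wc by (intro comm_scalar_prod[of _ n]) auto
   finally show "C\<^sup>T $$ (i, j) = C $$ (i, j)" using ij by (auto simp: C_def)
  qed (auto simp: C_def)
  then obtain et b where et: "et \<in> carrier_vec ?l" "et \<noteq> 0\<^sub>v ?l" "C *\<^sub>v et = b \<cdot>\<^sub>v et"
   by (rule symmetric_real_eigenvector[OF C]) (use kn in auto)
  define y where "y = comb n ?l (%j. w (k+j)) (($) et)"
  have y: "y \<in> carrier_vec n" by (simp add: y_def)
  have wy1: "w i \<bullet> y = 0" if "i < k" for i
   unfolding y_def using that kn wc worth by (subst scalar_prod_comb) auto
  have wy2: "w (k+i) \<bullet> y = et $ i" if "i < ?l" for i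
  proof -
   have "w (k+i) \<bullet> y = (\<Sum>j<?l. et $ j * (w (k+i) \<bullet> w (k+j)))"
    unfolding y_def using that kn wc by (subst scalar_prod_comb) auto
   also have "... = (\<Sum>j<?l. if j = i then et $ i else 0)"
    using that by (intro sum.cong) (auto simp: worth)
   finally show ?thesis using that by simp
  qed
  \<comment> \<open>The eigenvector equation is tested against the basis \<open>w\<close>: on the
    old eigenvectors both sides are 0, on the others it is the equation for
    \<open>C\<close>.\<close>
  have A2: "w i \<bullet> (A *\<^sub>v y) = b * (w i \<bullet> y)" if "i < n" for i
  proof (cases "i < k")
   case True
   have "w i \<bullet> (A *\<^sub>v y) = (A *\<^sub>v w i) \<bullet> y"
    by (rule mat_sym_bilinear[OF A sym]) (use wc that y in auto)
   also have "... = (d i \<cdot>\<^sub>v w i) \<bullet> y" using True ph(2) w(2) by simp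
   also have "... = d i * (w i \<bullet> y)" using wc[OF that] y by simp
   finally show ?thesis using wy1[OF True] by simp
  next
   case False
   define i' where "i' = i - k"
   have i': "i = k + i'" "i' < ?l" using False that by (auto simp: i'_def)
   have Aw: "A *\<^sub>v w i \<in> carrier_vec n" using A wc[OF that] by simp
   have "w i \<bullet> (A *\<^sub>v y) = (A *\<^sub>v w i) \<bullet> y"
    by (rule mat_sym_bilinear[OF A sym]) (use wc that y in auto)
   also have "... = (\<Sum>j<?l. et $ j * ((A *\<^sub>v w i) \<bullet> w (k+j)))"
    unfolding y_def using Aw wc kn by (subst scalar_prod_comb) auto
   also have "... = (\<Sum>j<?l. et $ j * (w i \<bullet> (A *\<^sub>v w (k+j))))"
    using wc that kn by (intro sum.cong) (auto simp: mat_sym_bilinear[OF A sym])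
   also have "... = (C *\<^sub>v et) $ i'"
    using i' et(1) by (auto simp: C_def scalar_prod_def lessThan_atLeast0 mult.commute)
   also have "... = b * (w i \<bullet> y)" using et i' wy2[OF i'(2)] by auto
   finally show ?thesis .
  qed
  have Ay: "A *\<^sub>v y = b \<cdot>\<^sub>v y"
  proof -
   have Ayc: "A *\<^sub>v y \<in> carrier_vec n" using A y by simp
   have "A *\<^sub>v y = comb n n w (%i. w i \<bullet> (A *\<^sub>v y))" by (rule parseval(1)[OF w(1) Ayc Ayc])
   also have "... = comb n n w (%i. b * (w i \<bullet> y))" by (auto simp: comb_def A2)
   also have "... = b \<cdot>\<^sub>v comb n n w (%i. w i \<bullet> y)"
    by (rule eq_vecI) (auto simp: comb_def sum_distrib_left ac_simps)
   also have "comb n n w (%i. w i \<bullet> y) = y" by (rule parseval(1)[OF w(1) y y, symmetric])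
   finally show ?thesis .
  qed
  have "y \<noteq> 0\<^sub>v n"
  proof
   assume "y = 0\<^sub>v n"
   hence "et $ i = 0" if "i < ?l" for i using wy2[OF that] wc[of "k+i"] that by simp
   hence "et = 0\<^sub>v ?l" using et(1) by auto
   thus False using et(2) by simp
  qed
  then obtain c where c: "c > 0" "(c \<cdot>\<^sub>v y) \<bullet> (c \<cdot>\<^sub>v y) = 1" using normalize_vec[OF y] by blast
  let ?ph = "ph(k := c \<cdot>\<^sub>v y)"
  have pc: "ph i \<in> carrier_vec n" if "i < k" for i using ph(1) that by (auto simp: orthon_def)
  have z: "ph i \<bullet> (c \<cdot>\<^sub>v y) = 0" "(c \<cdot>\<^sub>v y) \<bullet> ph i = 0" if "i < k" for i
  proof -
   show "ph i \<bullet> (c \<cdot>\<^sub>v y) = 0" using y wy1[OF that] w(2)[OF that] pc[OF that] by simp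
   thus "(c \<cdot>\<^sub>v y) \<bullet> ph i = 0"
    using y pc[OF that] by (subst comm_scalar_prod[of _ n]) auto
  qed
  have "orthon n (Suc k) ?ph"
   using ph(1) c(2) z y by (auto simp: orthon_def less_Suc_eq)
  moreover have "A *\<^sub>v (c \<cdot>\<^sub>v y) = b \<cdot>\<^sub>v (c \<cdot>\<^sub>v y)"
   using mult_mat_vec[OF A y] Ay by (simp add: smult_smult_assoc mult.commute)
  hence "\<forall>i<Suc k. A *\<^sub>v ?ph i = (d(k := b)) i \<cdot>\<^sub>v ?ph i"
   using ph(2) by (auto simp: less_Suc_eq)
  ultimately show ?case by blast
 qed
 from this[of n] show ?thesis using that by auto
qed

definition eigensys :: "nat => real mat => (nat => real vec) => (nat => real) => bool" where
 "eigensys n A ph d \<longleftrightarrow> A \<in> carrier_mat n n \<and> orthon n n ph \<and> (\<forall>i<n. A *\<^sub>v ph i = d i \<cdot>\<^sub>v ph i)"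

lemma eigensys_exists:
 assumes "(A :: real mat) \<in> carrier_mat n n" "A\<^sup>T = A"
 obtains ph d where "eigensys n A ph d"
 using spectral_theorem_real[OF assms] assms(1) unfolding eigensys_def by metis

lemma eigensys_carrier:
 assumes "eigensys n A ph d" shows "i < n ==> ph i \<in> carrier_vec n" "A \<in> carrier_mat n n" "orthon n n ph"
 using assms by (auto simp: eigensys_def orthon_def)

lemma eigensys_mult:
 assumes "eigensys n A ph d" "y \<in> carrier_vec n"
 shows "A *\<^sub>v y = comb n n ph (%i. d i * (ph i \<bullet> y))"
proof (rule eq_vecI)
 show "dim_vec (A *\<^sub>v y) = dim_vec (comb n n ph (%i. d i * (ph i \<bullet> y)))"
  using assms by (auto simp: eigensys_def comb_def)
 fix a assume "a < dim_vec (comb n n ph (%i. d i * (ph i \<bullet> y)))"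
 hence a: "a < n" by (simp add: comb_def)
 note A = eigensys_carrier[OF assms(1)]
 have ra: "row A a \<in> carrier_vec n" using A a by auto
 have "(A *\<^sub>v y) $ a = row A a \<bullet> y" using A a by simp
 also have "... = row A a \<bullet> comb n n ph (%i. ph i \<bullet> y)"
  using parseval(1)[OF A(3) assms(2) assms(2)] by simp
 also have "... = (\<Sum>i<n. (ph i \<bullet> y) * (row A a \<bullet> ph i))"
  by (rule scalar_prod_comb) (use ra A in auto)
 also have "... = (\<Sum>i<n. (ph i \<bullet> y) * (d i * ph i $ a))"
 proof (rule sum.cong[OF refl])
  fix i assume "i \<in> {..<n}"
  hence i: "i < n" by simp
  have "row A a \<bullet> ph i = (A *\<^sub>v ph i) $ a" using A a by simp
  also have "... = d i * ph i $ a" using assms(1) i a A(1)[OF i] by (simp add: eigensys_def)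
  finally show "(ph i \<bullet> y) * (row A a \<bullet> ph i) = (ph i \<bullet> y) * (d i * ph i $ a)" by simp
 qed
 finally show "(A *\<^sub>v y) $ a = comb n n ph (%i. d i * (ph i \<bullet> y)) $ a"
  using a by (simp add: comb_def ac_simps)
qed

lemma eigensys_quad:
 assumes "eigensys n A ph d" "y \<in> carrier_vec n"
 shows "y \<bullet> (A *\<^sub>v y) = (\<Sum>i<n. d i * (ph i \<bullet> y)^2)"
proof -
 note A = eigensys_carrier[OF assms(1)]
 have "y \<bullet> (A *\<^sub>v y) = (\<Sum>i<n. d i * (ph i \<bullet> y) * (y \<bullet> ph i))"
  unfolding eigensys_mult[OF assms] by (rule scalar_prod_comb) (use assms A in auto)
 also have "... = (\<Sum>i<n. d i * (ph i \<bullet> y)^2)"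
  using A assms(2) by (intro sum.cong) (auto simp: comm_scalar_prod[of y n] power2_eq_square)
 finally show ?thesis .
qed

lemma eigensys_mat:
 assumes "eigensys n A ph d"
 defines "Q \<equiv> mat n n (%(a,i). ph i $ a)" and "D \<equiv> mat n n (%(i,j). if i = j then d i else 0)"
 shows "A = Q * D * Q\<^sup>T" "similar_mat A D"
proof -
 note A = eigensys_carrier[OF assms(1)]
 note Q = orthon_basis_mats[OF A(3), folded Q_def]
 have D: "D \<in> carrier_mat n n" by (simp add: D_def)
 have "A * Q = Q * D"
 proof (rule eq_matI)
  fix a i assume "a < dim_row (Q * D)" "i < dim_col (Q * D)"
  hence ai: "a < n" "i < n" using Q D by auto
  have "(A * Q) $$ (a,i) = (A *\<^sub>v ph i) $ a"
  proof -
   have "col Q i = ph i" using ai A(1)[OF ai(2)] by (intro eq_vecI) (auto simp: Q_def)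
   thus ?thesis using ai A Q(1) by simp
  qed
  also have "... = d i * ph i $ a" using assms(1) ai A(1)[OF ai(2)] by (simp add: eigensys_def)
  also have "... = (\<Sum>j=0..<n. ph j $ a * (if j = i then d j else 0))"
   using ai by (simp add: if_distrib cong: if_cong)
  also have "... = (Q * D) $$ (a,i)" using ai Q D by (auto simp: Q_def D_def scalar_prod_def)
  finally show "(A * Q) $$ (a,i) = (Q * D) $$ (a,i)" .
 qed (use A Q D in auto)
 hence "A * Q * Q\<^sup>T = Q * D * Q\<^sup>T" by simp
 moreover have "A * Q * Q\<^sup>T = A" using A Q by (subst assoc_mult_mat[of _ n n _ n _ n]) auto
 ultimately show "A = Q * D * Q\<^sup>T" by simp
 thus "similar_mat A D" unfolding similar_mat_def similar_mat_wit_def Let_def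
  using A Q D by (intro exI[of _ Q] exI[of _ "Q\<^sup>T"]) auto
qed

lemma eigensys_char_poly:
 assumes "eigensys n A ph d"
 shows "char_poly A = (\<Prod>i<n. [:- d i, 1:])"
proof -
 let ?D = "mat n n (%(i,j). if i = j then d i else 0)"
 have "char_poly A = char_poly ?D" by (rule char_poly_similar[OF eigensys_mat(2)[OF assms]])
 also have "... = (\<Prod>a\<leftarrow>diag_mat ?D. [:- a, 1:])"
  by (rule char_poly_upper_triangular[of _ n]) (auto simp: upper_triangular_def)
 also have "diag_mat ?D = map d [0..<n]" by (auto simp: diag_mat_def)
 also have "(\<Prod>a\<leftarrow>map d [0..<n]. [:- a, 1:]) = (\<Prod>i<n. [:- d i, 1:])"
  by (simp add: prod.distinct_set_conv_list[symmetric] lessThan_atLeast0 o_def flip: atLeast_upt)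
 finally show ?thesis .
qed

lemma smult_mat_mult_vec:
 assumes "(A :: real mat) \<in> carrier_mat n k" "v \<in> carrier_vec k"
 shows "(c \<cdot>\<^sub>m A) *\<^sub>v v = c \<cdot>\<^sub>v (A *\<^sub>v v)"
 by (rule eq_vecI) (use assms in \<open>auto simp: scalar_prod_def sum_distrib_left ac_simps\<close>)

lemma eigensys_shift:
 assumes "eigensys n A ph d"
 shows "eigensys n (A + c \<cdot>\<^sub>m 1\<^sub>m n) ph (%i. d i + c)"
proof -
 note A = eigensys_carrier[OF assms]
 have "(A + c \<cdot>\<^sub>m 1\<^sub>m n) *\<^sub>v ph i = (d i + c) \<cdot>\<^sub>v ph i" if i: "i < n" for i
 proof -
  have "(A + c \<cdot>\<^sub>m 1\<^sub>m n) *\<^sub>v ph i = A *\<^sub>v ph i + (c \<cdot>\<^sub>m 1\<^sub>m n) *\<^sub>v ph i"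
   by (rule add_mult_distrib_mat_vec) (use A i in auto)
  also have "... = d i \<cdot>\<^sub>v ph i + c \<cdot>\<^sub>v ph i" using assms i A(1)[OF i]
   by (simp add: eigensys_def smult_mat_mult_vec[of "1\<^sub>m n" n n])
  finally show ?thesis by (simp add: add_smult_distrib_vec)
 qed
 thus ?thesis using assms A by (auto simp: eigensys_def)
qed

lemma eigensys_det:
 assumes "eigensys n A ph d" shows "det A = (\<Prod>i<n. d i)"
proof -
 let ?D = "mat n n (%(i,j). if i = j then d i else 0)"
 have "det A = det ?D" by (rule det_similar[OF eigensys_mat(2)[OF assms]])
 also have "... = prod_list (diag_mat ?D)"
  by (rule det_upper_triangular[of _ n]) (auto simp: upper_triangular_def)
 also have "diag_mat ?D = map d [0..<n]" by (auto simp: diag_mat_def)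
 also have "prod_list (map d [0..<n]) = (\<Prod>i<n. d i)"
  by (simp add: prod.distinct_set_conv_list[symmetric] lessThan_atLeast0 flip: atLeast_upt)
 finally show ?thesis .
qed

lemma eigensys_eigenvalue:
 assumes "eigensys n A ph d" "i < n" shows "d i = ph i \<bullet> (A *\<^sub>v ph i)" "ph i \<bullet> ph i = 1"
proof -
 show 1: "ph i \<bullet> ph i = 1" using assms by (auto simp: eigensys_def orthon_def)
 show "d i = ph i \<bullet> (A *\<^sub>v ph i)" using assms 1 eigensys_carrier(1)[OF assms(1,2)]
  by (simp add: eigensys_def)
qed

section \<open>Positive definite forms and determinants of Gram perturbations\<close>

definition pos_def_mat :: "nat => real mat => bool" where
 "pos_def_mat n S \<longleftrightarrow> S \<in> carrier_mat n n \<and> S\<^sup>T = S \<and>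
   (\<forall>y\<in>carrier_vec n. y \<noteq> 0\<^sub>v n --> 0 < y \<bullet> (S *\<^sub>v y))"

definition psd_mat :: "nat => real mat => bool" where
 "psd_mat n S \<longleftrightarrow> S \<in> carrier_mat n n \<and> S\<^sup>T = S \<and> (\<forall>y\<in>carrier_vec n. 0 <= y \<bullet> (S *\<^sub>v y))"

lemma mat_eq_by_vec:
 fixes A B :: "real mat"
 assumes "A \<in> carrier_mat n k" "B \<in> carrier_mat n k"
  and "!!v. v \<in> carrier_vec k ==> A *\<^sub>v v = B *\<^sub>v v"
 shows "A = B"
proof (rule eq_matI)
 fix i j assume ij: "i < dim_row B" "j < dim_col B"
 have "(A *\<^sub>v unit_vec k j) $ i = (B *\<^sub>v unit_vec k j) $ i" using assms(3) by simp
 thus "A $$ (i,j) = B $$ (i,j)" using ij assms(1,2) by simp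
qed (use assms in auto)

text \<open>\<open>W\<close> is given spectrally, by dividing the eigenprojections by the
  eigenvalues. Besides the inverse the lemma delivers the Cauchy-Schwarz inequality for the dual
  forms \<open>S\<close> and \<open>W\<close>, through which \<open>det_gain\<close> turns an upper
  bound on \<open>S\<close> into a lower bound on \<open>W\<close>.\<close>

lemma pos_def_inverse:
 assumes "pos_def_mat n S"
 obtains W where "W \<in> carrier_mat n n" "S * W = 1\<^sub>m n" "W * S = 1\<^sub>m n" "psd_mat n W"
  "!!y k. y \<in> carrier_vec n ==> k \<in> carrier_vec n ==> (y \<bullet> k)\<^sup>2 <= (y \<bullet> (S *\<^sub>v y)) * (k \<bullet> (W *\<^sub>v k))"
  "det S > 0"
proof -
 have S: "S \<in> carrier_mat n n" "S\<^sup>T = S" using assms by (auto simp: pos_def_mat_def)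
 obtain ph d where e: "eigensys n S ph d" using eigensys_exists[OF S] by blast
 note c = eigensys_carrier[OF e]
 have dpos: "d i > 0" if "i < n" for i
 proof -
  have "ph i \<noteq> 0\<^sub>v n" using eigensys_eigenvalue(2)[OF e that] c(1)[OF that] by auto
  thus ?thesis using eigensys_eigenvalue(1)[OF e that] assms c(1)[OF that] by (simp add: pos_def_mat_def)
 qed
 define W where "W = mat n n (%(a,b). \<Sum>i<n. ph i $ a * ph i $ b / d i)"
 have W: "W \<in> carrier_mat n n" by (simp add: W_def)
 have Wv: "W *\<^sub>v y = comb n n ph (%i. (ph i \<bullet> y) / d i)" if y: "y \<in> carrier_vec n" for y
 proof (rule eq_vecI)
  fix a assume "a < dim_vec (comb n n ph (%i. (ph i \<bullet> y) / d i))"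
  hence a: "a < n" by (simp add: comb_def)
  have "(W *\<^sub>v y) $ a = (\<Sum>b=0..<n. \<Sum>i<n. ph i $ a * ph i $ b / d i * y $ b)"
   using a y by (simp add: W_def scalar_prod_def sum_distrib_right)
  also have "... = (\<Sum>i<n. \<Sum>b=0..<n. ph i $ a * ph i $ b / d i * y $ b)" by (rule sum.swap)
  also have "... = (\<Sum>i<n. (ph i \<bullet> y) / d i * ph i $ a)"
   using y by (intro sum.cong refl) (simp add: scalar_prod_def sum_distrib_left sum_distrib_right sum_divide_distrib field_simps)
  finally show "(W *\<^sub>v y) $ a = comb n n ph (%i. (ph i \<bullet> y) / d i) $ a" using a by (simp add: comb_def)
 qed (use W in \<open>auto simp: comb_def\<close>)
 have pW: "ph j \<bullet> (W *\<^sub>v y) = (ph j \<bullet> y) / d j" if y: "y \<in> carrier_vec n" and j: "j < n" for y j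
 proof -
  have "ph j \<bullet> (W *\<^sub>v y) = (\<Sum>i<n. (ph i \<bullet> y) / d i * (ph j \<bullet> ph i))"
   unfolding Wv[OF y] by (rule scalar_prod_comb) (use c j in auto)
  also have "... = (\<Sum>i<n. if i = j then (ph j \<bullet> y) / d j else 0)"
   using c(3) j by (intro sum.cong) (auto simp: orthon_def)
  finally show ?thesis using j by simp
 qed
 have SW: "S * W = 1\<^sub>m n"
 proof (rule mat_eq_by_vec)
  fix v :: "real vec" assume v: "v \<in> carrier_vec n"
  have Wvc: "W *\<^sub>v v \<in> carrier_vec n" using W v by simp
  have "(S * W) *\<^sub>v v = S *\<^sub>v (W *\<^sub>v v)" using S W v by (intro assoc_mult_mat_vec) auto
  also have "... = comb n n ph (%i. d i * (ph i \<bullet> (W *\<^sub>v v)))" by (rule eigensys_mult[OF e Wvc])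
  also have "... = comb n n ph (%i. ph i \<bullet> v)"
   unfolding comb_def
   by (intro eq_vecI) (auto simp: pW[OF v] intro!: sum.cong dest: dpos)
  also have "... = 1\<^sub>m n *\<^sub>v v" using parseval(1)[OF c(3) v v] v by simp
  finally show "(S * W) *\<^sub>v v = 1\<^sub>m n *\<^sub>v v" .
 qed (use S W in auto)
 have WS: "W * S = 1\<^sub>m n" using mat_mult_left_right_inverse[OF S(1) W SW] .
 have quadW: "k \<bullet> (W *\<^sub>v k) = (\<Sum>i<n. (ph i \<bullet> k)^2 / d i)" if k: "k \<in> carrier_vec n" for k
 proof -
  have "k \<bullet> (W *\<^sub>v k) = (\<Sum>i<n. (ph i \<bullet> k) * (ph i \<bullet> (W *\<^sub>v k)))"
   by (rule parseval(2)[OF c(3) k]) (use W k in auto)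
  thus ?thesis using pW[OF k] by (simp add: power2_eq_square)
 qed
 have psdW: "psd_mat n W"
  unfolding psd_mat_def using W quadW dpos
  by (auto simp: W_def mult.commute intro!: eq_matI sum_nonneg divide_nonneg_pos)
 have cs: "(y \<bullet> k)^2 <= (y \<bullet> (S *\<^sub>v y)) * (k \<bullet> (W *\<^sub>v k))"
  if y: "y \<in> carrier_vec n" and k: "k \<in> carrier_vec n" for y k
 proof -
  have "(y \<bullet> k)^2 = (\<Sum>i<n. (sqrt (d i) * (ph i \<bullet> y)) * ((ph i \<bullet> k) / sqrt (d i)))^2"
   unfolding parseval(2)[OF c(3) y k] using dpos
   by (intro arg_cong[of _ _ "%x. x\<^sup>2"] sum.cong refl) (simp add: less_imp_neq[symmetric])
  also have "... <= (\<Sum>i<n. (sqrt (d i) * (ph i \<bullet> y))^2) * (\<Sum>i<n. ((ph i \<bullet> k) / sqrt (d i))^2)"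
   by (rule Cauchy_Schwarz_ineq_sum)
  also have "(\<Sum>i<n. (sqrt (d i) * (ph i \<bullet> y))^2) = y \<bullet> (S *\<^sub>v y)"
   unfolding eigensys_quad[OF e y] using dpos
   by (intro sum.cong refl) (simp add: power_mult_distrib less_imp_le)
  also have "(\<Sum>i<n. ((ph i \<bullet> k) / sqrt (d i))^2) = k \<bullet> (W *\<^sub>v k)"
   unfolding quadW[OF k] using dpos
   by (intro sum.cong refl) (simp add: power_divide less_imp_le)
  finally show ?thesis .
 qed
 have "det S > 0" unfolding eigensys_det[OF e] using dpos by (intro prod_pos) auto
 thus ?thesis using that W SW WS psdW cs by blast
qed

lemma det_one_plus_psd:
 assumes "psd_mat n N"
 shows "1 <= det (N + 1\<^sub>m n)" "det N <= det (N + 1\<^sub>m n)" "0 <= det N"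
proof -
 obtain ph d where e: "eigensys n N ph d" using eigensys_exists assms unfolding psd_mat_def by metis
 note c = eigensys_carrier[OF e]
 have d: "d i \<ge> 0" if "i < n" for i
  using eigensys_eigenvalue(1)[OF e that] assms c(1)[OF that] by (simp add: psd_mat_def)
 have "eigensys n (N + 1\<^sub>m n) ph (%i. d i + 1)"
 proof -
  have "(1::real) \<cdot>\<^sub>m 1\<^sub>m n = 1\<^sub>m n" by (rule eq_matI) auto
  thus ?thesis using eigensys_shift[OF e, of 1] by simp
 qed
 hence D: "det (N + 1\<^sub>m n) = (\<Prod>i<n. d i + 1)" by (rule eigensys_det)
 show "1 <= det (N + 1\<^sub>m n)" unfolding D using d by (intro prod_ge_1) auto
 show "det N <= det (N + 1\<^sub>m n)" unfolding D eigensys_det[OF e] using d by (intro prod_mono) auto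
 show "0 <= det N" unfolding eigensys_det[OF e] using d by (intro prod_nonneg) auto
qed

text \<open>Sylvester's determinant identity, by two block factorisations of the same matrix.\<close>

lemma det_add_gram:
 fixes S :: "real mat"
 assumes S: "S \<in> carrier_mat n n" and W: "W \<in> carrier_mat n n" and WS: "W * S = 1\<^sub>m n"
  and K: "K \<in> carrier_mat n c"
 shows "det (S + K * K\<^sup>T) = det S * det (K\<^sup>T * W * K + 1\<^sub>m c)"
proof -
 let ?M = "four_block_mat S K (- K\<^sup>T) (1\<^sub>m c)"
 have KT: "K\<^sup>T \<in> carrier_mat c n" using K by simp
 have KTW: "K\<^sup>T * W \<in> carrier_mat c n" using KT W by simp
 have KTWK: "K\<^sup>T * W * K \<in> carrier_mat c c" using KTW K by simp
 have KK: "K * K\<^sup>T \<in> carrier_mat n n" using K by simp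
 have 1: "?M = four_block_mat (S + K * K\<^sup>T) K (0\<^sub>m c n) (1\<^sub>m c) * four_block_mat (1\<^sub>m n) (0\<^sub>m n c) (- K\<^sup>T) (1\<^sub>m c)"
 proof -
  have "S = (S + K * K\<^sup>T) * 1\<^sub>m n + K * (- K\<^sup>T)"
  proof -
   have "K * (- K\<^sup>T) = - (K * K\<^sup>T)"
    using K by (auto intro!: eq_matI simp: scalar_prod_def sum_negf)
   thus ?thesis using S KK by (auto intro!: eq_matI)
  qed
  thus ?thesis
   using S K KT KK by (subst mult_four_block_mat[of _ n n _ c _ c _ _ n _ c]) auto
 qed
 have d1: "det ?M = det (S + K * K\<^sup>T)"
  unfolding 1 using S K KT KK
  by (subst det_mult[of _ "n + c"])
    (auto simp: det_four_block_mat_lower_left_zero[of _ n _ c] det_four_block_mat_upper_right_zero[of _ n _ c])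
 have 2: "?M = four_block_mat (1\<^sub>m n) (0\<^sub>m n c) (- (K\<^sup>T * W)) (1\<^sub>m c) * four_block_mat S K (0\<^sub>m c n) (K\<^sup>T * W * K + 1\<^sub>m c)"
 proof -
  have "- (K\<^sup>T * W) * S = - K\<^sup>T"
  proof -
   have "- (K\<^sup>T * W) * S = - (K\<^sup>T * W * S)" by (rule uminus_mult_left_mat) (use W S in auto)
   also have "K\<^sup>T * W * S = K\<^sup>T * (W * S)" using KT W S by (rule assoc_mult_mat)
   finally show ?thesis using WS KT by simp
  qed
  moreover have "- (K\<^sup>T * W) * K + 1\<^sub>m c * (K\<^sup>T * W * K + 1\<^sub>m c) = 1\<^sub>m c"
  proof -
   have "- (K\<^sup>T * W) * K = - (K\<^sup>T * W * K)" by (rule uminus_mult_left_mat) (use W K in auto)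
   thus ?thesis using KTWK by (auto intro!: eq_matI)
  qed
  ultimately show ?thesis
   using S K KT KTW KTWK by (subst mult_four_block_mat[of _ n n _ c _ c _ _ n _ c]) auto
 qed
 have d2: "det ?M = det S * det (K\<^sup>T * W * K + 1\<^sub>m c)"
  unfolding 2 using S K KTW KTWK
  by (subst det_mult[of _ "n + c"])
    (auto simp: det_four_block_mat_lower_left_zero[of _ n _ c] det_four_block_mat_upper_right_zero[of _ n _ c])
 show ?thesis using d1 d2 by simp
qed

lemma quad_gram:
 fixes K :: "real mat"
 assumes K: "K \<in> carrier_mat n c" and W: "W \<in> carrier_mat n n" and z: "z \<in> carrier_vec c"
 shows "z \<bullet> ((K\<^sup>T * W * K) *\<^sub>v z) = (K *\<^sub>v z) \<bullet> (W *\<^sub>v (K *\<^sub>v z))"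
proof -
 have Kz: "K *\<^sub>v z \<in> carrier_vec n" using K z by simp
 have "(K\<^sup>T * W * K) *\<^sub>v z = (K\<^sup>T * W) *\<^sub>v (K *\<^sub>v z)" using K W z by (intro assoc_mult_mat_vec) auto
 also have "... = K\<^sup>T *\<^sub>v (W *\<^sub>v (K *\<^sub>v z))" using K W Kz by (intro assoc_mult_mat_vec) auto
 finally have 1: "(K\<^sup>T * W * K) *\<^sub>v z = K\<^sup>T *\<^sub>v (W *\<^sub>v (K *\<^sub>v z))" .
 have Wc: "W *\<^sub>v (K *\<^sub>v z) \<in> carrier_vec n" using W Kz by simp
 have "z \<bullet> (K\<^sup>T *\<^sub>v (W *\<^sub>v (K *\<^sub>v z))) = (K\<^sup>T *\<^sub>v (W *\<^sub>v (K *\<^sub>v z))) \<bullet> z"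
  using K z Wc by (intro comm_scalar_prod[of _ c]) auto
 also have "... = (W *\<^sub>v (K *\<^sub>v z)) \<bullet> (K *\<^sub>v z)" by (rule transpose_vec_mult_scalar[OF K z Wc])
 also have "... = (K *\<^sub>v z) \<bullet> (W *\<^sub>v (K *\<^sub>v z))" using Wc Kz by (intro comm_scalar_prod[of _ n]) auto
 finally show ?thesis unfolding 1 .
qed

lemma psd_gram:
 fixes K :: "real mat"
 assumes K: "K \<in> carrier_mat n c" and W: "psd_mat n W"
 shows "psd_mat c (K\<^sup>T * W * K)"
proof -
 have Wc: "W \<in> carrier_mat n n" "W\<^sup>T = W" using W by (auto simp: psd_mat_def)
 have "(K\<^sup>T * W * K)\<^sup>T = K\<^sup>T * (K\<^sup>T * W)\<^sup>T" using K Wc by (subst transpose_mult[of _ c n _ c]) auto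
 also have "(K\<^sup>T * W)\<^sup>T = W * K" using K Wc by (subst transpose_mult[of _ c n _ n]) auto
 also have "K\<^sup>T * (W * K) = K\<^sup>T * W * K" using K Wc by (subst assoc_mult_mat[of _ c n _ n _ c]) auto
 finally have s: "(K\<^sup>T * W * K)\<^sup>T = K\<^sup>T * W * K" .
 show ?thesis unfolding psd_mat_def
  using s K Wc W quad_gram[OF K Wc(1)] by (auto simp: psd_mat_def)
qed

lemma psd_factor:
 assumes "psd_mat n N"
 obtains K where "K \<in> carrier_mat n n" "N = K * K\<^sup>T"
proof -
 obtain ph d where e: "eigensys n N ph d" using eigensys_exists assms unfolding psd_mat_def by metis
 note c = eigensys_carrier[OF e]
 have d: "d i \<ge> 0" if "i < n" for i
  using eigensys_eigenvalue(1)[OF e that] assms c(1)[OF that] by (simp add: psd_mat_def)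
 define K where "K = mat n n (%(a,i). sqrt (d i) * ph i $ a)"
 have "N = K * K\<^sup>T"
 proof (rule mat_eq_by_vec[of _ n n])
  fix v :: "real vec" assume v: "v \<in> carrier_vec n"
  show "N *\<^sub>v v = (K * K\<^sup>T) *\<^sub>v v"
  proof (rule eq_vecI)
   fix a assume "a < dim_vec ((K * K\<^sup>T) *\<^sub>v v)"
   hence a: "a < n" by (simp add: K_def)
   have "(K * K\<^sup>T) *\<^sub>v v = K *\<^sub>v (K\<^sup>T *\<^sub>v v)" using v by (intro assoc_mult_mat_vec) (auto simp: K_def)
   moreover have "K\<^sup>T *\<^sub>v v = vec n (%i. sqrt (d i) * (ph i \<bullet> v))"
    using v by (intro eq_vecI) (auto simp: K_def scalar_prod_def sum_distrib_left mult.assoc)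
   moreover have "(K *\<^sub>v vec n f) $ a = (\<Sum>i<n. sqrt (d i) * ph i $ a * f i)" for f
    using a by (simp add: K_def scalar_prod_def lessThan_atLeast0)
   ultimately have "((K * K\<^sup>T) *\<^sub>v v) $ a = (\<Sum>i<n. sqrt (d i) * ph i $ a * (sqrt (d i) * (ph i \<bullet> v)))"
    by simp
   also have "... = (\<Sum>i<n. (sqrt (d i) * sqrt (d i)) * (ph i \<bullet> v) * ph i $ a)"
    by (intro sum.cong refl) (simp only: ac_simps)
   also have "... = (\<Sum>i<n. d i * (ph i \<bullet> v) * ph i $ a)" using d by (intro sum.cong refl) simp
   finally show "(N *\<^sub>v v) $ a = ((K * K\<^sup>T) *\<^sub>v v) $ a"
    unfolding eigensys_mult[OF e v] using a by (simp add: comb_def)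
  qed (use c in \<open>auto simp: K_def\<close>)
 qed (use c in \<open>auto simp: K_def\<close>)
 thus ?thesis using that[of K] by (auto simp: K_def)
qed

lemma quad_add:
 fixes A B :: "real mat"
 assumes "A \<in> carrier_mat n n" "B \<in> carrier_mat n n" "y \<in> carrier_vec n"
 shows "y \<bullet> ((A + B) *\<^sub>v y) = y \<bullet> (A *\<^sub>v y) + y \<bullet> (B *\<^sub>v y)"
 using assms by (simp add: add_mult_distrib_mat_vec scalar_prod_add_distrib[of _ n])

lemma quad_smult:
 fixes A :: "real mat"
 assumes "A \<in> carrier_mat n n" "y \<in> carrier_vec n"
 shows "y \<bullet> ((c \<cdot>\<^sub>m A) *\<^sub>v y) = c * (y \<bullet> (A *\<^sub>v y))"
 using assms by (simp add: smult_mat_mult_vec)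

text \<open>\<open>B - A\<close> is positive semidefinite, hence of the form
  \<open>K * K\<^sup>T\<close>. By \<open>det_add_gram\<close> the quotient of the determinants is
  the determinant of the identity plus a positive semidefinite matrix, so it is at least 1.\<close>

lemma det_mono:
 assumes A: "pos_def_mat n A" and B: "B \<in> carrier_mat n n" "B\<^sup>T = B"
  and le: "!!y. y \<in> carrier_vec n ==> y \<bullet> (A *\<^sub>v y) <= y \<bullet> (B *\<^sub>v y)"
 shows "det A <= det B"
proof -
 have Ac: "A \<in> carrier_mat n n" "A\<^sup>T = A" using A by (auto simp: pos_def_mat_def)
 define D where "D = B + (-1) \<cdot>\<^sub>m A"
 have D: "D \<in> carrier_mat n n" using Ac B by (simp add: D_def)
 have "D\<^sup>T = B\<^sup>T + (-1) \<cdot>\<^sub>m A\<^sup>T" using Ac(1) B(1) by (auto simp: D_def intro!: eq_matI)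
 hence "D\<^sup>T = D" using Ac B by (simp add: D_def)
 moreover have "y \<bullet> (D *\<^sub>v y) = y \<bullet> (B *\<^sub>v y) - y \<bullet> (A *\<^sub>v y)" if "y \<in> carrier_vec n" for y
  unfolding D_def using Ac B that by (subst quad_add) (auto simp: quad_smult[of _ n])
 ultimately have "psd_mat n D" using D le by (auto simp: psd_mat_def)
 then obtain K where K: "K \<in> carrier_mat n n" "D = K * K\<^sup>T" by (rule psd_factor)
 obtain W where W: "W \<in> carrier_mat n n" "W * A = 1\<^sub>m n" "psd_mat n W" "det A > 0"
  using pos_def_inverse[OF A] by metis
 have "B = A + K * K\<^sup>T" unfolding K(2)[symmetric] D_def using Ac B by (auto intro!: eq_matI)
 hence "det B = det A * det (K\<^sup>T * W * K + 1\<^sub>m n)" using det_add_gram[OF Ac(1) W(1,2) K(1)] by simp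
 moreover have "1 <= det (K\<^sup>T * W * K + 1\<^sub>m n)" by (rule det_one_plus_psd(1)[OF psd_gram[OF K(1) W(3)]])
 ultimately show ?thesis using W(4) by (simp add: mult_le_cancel_left1)
qed

lemma mult_mat_vec_inner:
 fixes K :: "real mat"
 assumes "K \<in> carrier_mat n c" "u \<in> carrier_vec n" "z \<in> carrier_vec c"
 shows "u \<bullet> (K *\<^sub>v z) = (\<Sum>j<c. (u \<bullet> col K j) * z $ j)"
proof -
 have "u \<bullet> (K *\<^sub>v z) = (K\<^sup>T *\<^sub>v u) \<bullet> z"
  using transpose_vec_mult_scalar[OF assms(1,3,2)] by simp
 also have "... = (\<Sum>j<c. (u \<bullet> col K j) * z $ j)"
  using assms comm_scalar_prod[of u n] by (auto simp: scalar_prod_def[of _ z] lessThan_atLeast0 intro!: sum.cong)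
 finally show ?thesis .
qed

text \<open>The gain from one column. By \<open>det_add_gram\<close> the determinant grows by the
  factor \<open>det (K\<^sup>T * W * K + 1\<^sub>m c)\<close>. Smallness of \<open>S\<close> on the
  span of \<open>ph\<close> makes its inverse \<open>W\<close> large there: by Cauchy-Schwarz
  \<open>K\<^sup>T * W * K\<close> dominates \<open>M\<^sup>T * M\<close> divided by
  \<open>t\<close>, whose determinant is \<open>(det M)^2 / t ^ c\<close>.\<close>

lemma det_gain:
 assumes S: "pos_def_mat n S" and U: "orthon n c ph" and K: "K \<in> carrier_mat n c" and t: "t > 0"
  and small: "!!et. comb n c ph et \<bullet> (S *\<^sub>v comb n c ph et) <= t * (\<Sum>i<c. (et i)^2)"
 defines "M \<equiv> mat c c (%(i,j). ph i \<bullet> col K j)"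
 shows "det S * ((det M)^2 / t ^ c) <= det (S + K * K\<^sup>T)" "det S <= det (S + K * K\<^sup>T)" "0 < det S"
proof -
 have Sc: "S \<in> carrier_mat n n" "S\<^sup>T = S" using S by (auto simp: pos_def_mat_def)
 have M: "M \<in> carrier_mat c c" by (simp add: M_def)
 have phc: "ph i \<in> carrier_vec n" if "i < c" for i using U that by (auto simp: orthon_def)
 obtain W where W: "W \<in> carrier_mat n n" "W * S = 1\<^sub>m n" "psd_mat n W"
  "!!y k. y \<in> carrier_vec n ==> k \<in> carrier_vec n ==> (y \<bullet> k)\<^sup>2 <= (y \<bullet> (S *\<^sub>v y)) * (k \<bullet> (W *\<^sub>v k))"
  "det S > 0"
  using pos_def_inverse[OF S] by metis
 let ?N = "K\<^sup>T * W * K"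
 have N: "psd_mat c ?N" by (rule psd_gram[OF K W(3)])
 hence Nc: "?N \<in> carrier_mat c c" "?N\<^sup>T = ?N" by (auto simp: psd_mat_def)
 let ?G = "M\<^sup>T * 1\<^sub>m c * M"
 let ?N' = "(1/t) \<cdot>\<^sub>m ?G"
 have G: "psd_mat c ?G" by (rule psd_gram[OF M]) (auto simp: psd_mat_def)
 hence Gc: "?G \<in> carrier_mat c c" "?G\<^sup>T = ?G" by (auto simp: psd_mat_def)
 have N'T: "?N'\<^sup>T = (1/t) \<cdot>\<^sub>m ?G\<^sup>T" using Gc(1) by (auto intro!: eq_matI)
 have N': "psd_mat c ?N'"
  unfolding psd_mat_def using G Gc t N'T
  by (auto simp: quad_smult[OF Gc(1)] psd_mat_def simp del: assoc_mult_mat intro!: divide_nonneg_pos)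
 have key: "z \<bullet> (?N' *\<^sub>v z) <= z \<bullet> (?N *\<^sub>v z)" if z: "z \<in> carrier_vec c" for z
 proof -
  let ?k = "K *\<^sub>v z"
  have k: "?k \<in> carrier_vec n" using K z by simp
  have Mz: "M *\<^sub>v z = vec c (%i. ph i \<bullet> ?k)"
   by (rule eq_vecI) (use M z phc in \<open>auto simp: M_def mult_mat_vec_inner[OF K _ z] scalar_prod_def[of _ z] lessThan_atLeast0\<close>)
  define s where "s = (\<Sum>i<c. (ph i \<bullet> ?k)^2)"
  have Mzc: "M *\<^sub>v z \<in> carrier_vec c" using M z by simp
  have "z \<bullet> (?G *\<^sub>v z) = (M *\<^sub>v z) \<bullet> (M *\<^sub>v z)" using quad_gram[OF M one_carrier_mat z] Mzc by simp
  also have "... = s" unfolding Mz s_def by (simp add: scalar_prod_def lessThan_atLeast0 power2_eq_square)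
  finally have zG: "z \<bullet> (?G *\<^sub>v z) = s" .
  have zN: "z \<bullet> (?N *\<^sub>v z) = ?k \<bullet> (W *\<^sub>v ?k)" by (rule quad_gram[OF K W(1) z])
  \<comment> \<open>The orthogonal projection of \<open>?k\<close> to the span of \<open>ph\<close>,
    used as test vector in the Cauchy-Schwarz inequality for \<open>S\<close> and
    \<open>W\<close>.\<close>
  define y where "y = comb n c ph (%i. ph i \<bullet> ?k)"
  have y: "y \<in> carrier_vec n" by (simp add: y_def)
  have "y \<bullet> ?k = ?k \<bullet> y" using y k by (intro comm_scalar_prod[of _ n])
  also have "... = (\<Sum>i<c. (ph i \<bullet> ?k) * (?k \<bullet> ph i))" unfolding y_def by (rule scalar_prod_comb[OF k phc])
  also have "... = s" unfolding s_def using k phc by (intro sum.cong) (auto simp: comm_scalar_prod[of ?k n] power2_eq_square)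
  finally have yk: "y \<bullet> ?k = s" .
  have s0: "s \<ge> 0" by (simp add: s_def sum_nonneg)
  have kW: "0 <= ?k \<bullet> (W *\<^sub>v ?k)" using W(3) k by (auto simp: psd_mat_def)
  have "s\<^sup>2 <= (y \<bullet> (S *\<^sub>v y)) * (?k \<bullet> (W *\<^sub>v ?k))" using W(4)[OF y k] yk by simp
  also have "... <= (t * s) * (?k \<bullet> (W *\<^sub>v ?k))"
   using small[of "%i. ph i \<bullet> ?k"] kW by (intro mult_right_mono) (auto simp: y_def s_def)
  finally have "s * s <= s * (t * (?k \<bullet> (W *\<^sub>v ?k)))" by (simp add: power2_eq_square ac_simps)
  hence "s <= t * (?k \<bullet> (W *\<^sub>v ?k))"
  proof (cases "s = 0")
   case False
   hence "s > 0" using s0 by simp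
   thus ?thesis using \<open>s * s <= s * (t * (?k \<bullet> (W *\<^sub>v ?k)))\<close> by (rule mult_left_le_imp_le[rotated])
  qed (use t kW in simp)
  hence "(1/t) * s <= ?k \<bullet> (W *\<^sub>v ?k)" using t by (simp add: field_simps)
  moreover have "z \<bullet> (?N' *\<^sub>v z) = (1/t) * s" unfolding quad_smult[OF Gc(1) z] zG ..
  ultimately show ?thesis unfolding zN by linarith
 qed
 have zz: "0 < z \<bullet> z" if "z \<in> carrier_vec c" "z \<noteq> 0\<^sub>v c" for z :: "real vec"
  using sq_zero_iff[OF that(1)] that(2) sq_nonneg[of z] by linarith
 have N'c: "?N' \<in> carrier_mat c c" "?N'\<^sup>T = ?N'" using N' by (auto simp: psd_mat_def)
 have pd: "pos_def_mat c (?N' + 1\<^sub>m c)"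
  unfolding pos_def_mat_def
 proof (intro conjI ballI impI)
  show "?N' + 1\<^sub>m c \<in> carrier_mat c c" using N'c by simp
  show "(?N' + 1\<^sub>m c)\<^sup>T = ?N' + 1\<^sub>m c" using N'c transpose_add[OF N'c(1) one_carrier_mat] by simp
  fix z :: "real vec" assume z: "z \<in> carrier_vec c" "z \<noteq> 0\<^sub>v c"
  show "0 < z \<bullet> ((?N' + 1\<^sub>m c) *\<^sub>v z)"
   using N' z zz[OF z] by (subst quad_add[OF N'c(1)]) (auto simp: psd_mat_def add_nonneg_pos)
 qed
 have "det (?N' + 1\<^sub>m c) <= det (?N + 1\<^sub>m c)"
 proof (rule det_mono[OF pd])
  show "?N + 1\<^sub>m c \<in> carrier_mat c c" using Nc by simp
  show "(?N + 1\<^sub>m c)\<^sup>T = ?N + 1\<^sub>m c" using Nc transpose_add[OF Nc(1) one_carrier_mat] by simp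
  fix z :: "real vec" assume z: "z \<in> carrier_vec c"
  show "z \<bullet> ((?N' + 1\<^sub>m c) *\<^sub>v z) <= z \<bullet> ((?N + 1\<^sub>m c) *\<^sub>v z)"
   using key[OF z] quad_add[OF N'c(1) one_carrier_mat z] quad_add[OF Nc(1) one_carrier_mat z] by linarith
 qed
 moreover have "det ?N' <= det (?N' + 1\<^sub>m c)" by (rule det_one_plus_psd(2)[OF N'])
 moreover have "det ?N' = (det M)^2 / t ^ c"
 proof -
  have "det ?N' = (1/t) ^ c * det ?G" using Gc(1) by (subst det_smult) auto
  also have "det ?G = det M * det M" using M by (simp add: det_mult[of _ c] det_transpose)
  finally show ?thesis by (simp add: power2_eq_square power_divide)
 qed
 ultimately have "(det M)^2 / t ^ c <= det (?N + 1\<^sub>m c)" by linarith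
 thus "det S * ((det M)^2 / t ^ c) <= det (S + K * K\<^sup>T)"
  unfolding det_add_gram[OF Sc(1) W(1,2) K] using W(5) by (intro mult_left_mono) auto
 show "det S <= det (S + K * K\<^sup>T)"
  unfolding det_add_gram[OF Sc(1) W(1,2) K] using W(5) det_one_plus_psd(1)[OF N] by (simp add: mult_le_cancel_left1)
 show "0 < det S" by fact
qed

section \<open>Forms that are large off few directions\<close>

text \<open>The Courant-Fischer form of having at most \<open>p\<close> eigenvalues below
  \<open>lam\<close>. Linear constraints replace eigenvectors, so that the property passes to larger
  forms and to larger \<open>p\<close> without spectral theory.\<close>

definition codim_bound :: "nat => real mat => real => nat => bool" where
 "codim_bound n A lam p \<longleftrightarrow> (\<exists>zs. (\<forall>i<p. zs i \<in> carrier_vec n) \<and>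
   (\<forall>y\<in>carrier_vec n. (\<forall>i<p. zs i \<bullet> y = 0) --> lam * (y \<bullet> y) <= y \<bullet> (A *\<^sub>v y)))"

lemma codim_bound_mono:
 assumes "codim_bound n A lam p" "p <= p'" "!!y. y \<in> carrier_vec n ==> y \<bullet> (A *\<^sub>v y) <= y \<bullet> (B *\<^sub>v y)"
 shows "codim_bound n B lam p'"
proof -
 obtain zs where zs: "\<forall>i<p. zs i \<in> carrier_vec n"
  "\<forall>y\<in>carrier_vec n. (\<forall>i<p. zs i \<bullet> y = 0) --> lam * (y \<bullet> y) <= y \<bullet> (A *\<^sub>v y)"
  using assms(1) unfolding codim_bound_def by blast
 show ?thesis unfolding codim_bound_def
 proof (rule exI[of _ "%i. if i < p then zs i else 0\<^sub>v n"], intro conjI ballI impI allI)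
  fix y :: "real vec" assume y: "y \<in> carrier_vec n" "\<forall>i<p'. (if i < p then zs i else 0\<^sub>v n) \<bullet> y = 0"
  have "zs i \<bullet> y = 0" if "i < p" for i using y(2)[rule_format, of i] that assms(2) by simp
  hence "lam * (y \<bullet> y) <= y \<bullet> (A *\<^sub>v y)" using zs(2) y(1) by simp
  thus "lam * (y \<bullet> y) <= y \<bullet> (B *\<^sub>v y)" using assms(3)[OF y(1)] by linarith
 qed (use zs(1) in auto)
qed

lemma eigensys_comb_quad:
 assumes e: "eigensys n A ph d" and f: "inj_on f {..<N}" "f ` {..<N} \<subseteq> {..<n}"
 shows "orthon n N (%i. ph (f i))"
  "comb n N (%i. ph (f i)) et \<bullet> (A *\<^sub>v comb n N (%i. ph (f i)) et) = (\<Sum>i<N. d (f i) * (et i)^2)"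
proof -
 note c = eigensys_carrier[OF e]
 have fn: "f i < n" if "i < N" for i using f(2) that by auto
 show o: "orthon n N (%i. ph (f i))"
  using c(3) fn f(1) by (auto simp: orthon_def inj_on_def)
 let ?y = "comb n N (%i. ph (f i)) et"
 have "A *\<^sub>v ?y = comb n N (%i. ph (f i)) (%i. d (f i) * et i)"
 proof (rule eq_vecI)
  fix a assume "a < dim_vec (comb n N (%i. ph (f i)) (%i. d (f i) * et i))"
  hence a: "a < n" by (simp add: comb_def)
  have "(A *\<^sub>v ?y) $ a = row A a \<bullet> ?y" using c a by simp
  also have "... = (\<Sum>i<N. et i * (row A a \<bullet> ph (f i)))"
   by (rule scalar_prod_comb) (use c a fn in auto)
  also have "... = (\<Sum>i<N. et i * (d (f i) * ph (f i) $ a))"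
  proof (rule sum.cong[OF refl])
   fix i assume "i \<in> {..<N}"
   hence i: "f i < n" using fn by simp
   have "row A a \<bullet> ph (f i) = (A *\<^sub>v ph (f i)) $ a" using c a by simp
   also have "... = d (f i) * ph (f i) $ a" using e i a c(1)[OF i] by (simp add: eigensys_def)
   finally show "et i * (row A a \<bullet> ph (f i)) = et i * (d (f i) * ph (f i) $ a)" by simp
  qed
  finally show "(A *\<^sub>v ?y) $ a = comb n N (%i. ph (f i)) (%i. d (f i) * et i) $ a"
   using a by (simp add: comb_def ac_simps)
 qed (use c in \<open>auto simp: comb_def\<close>)
 thus "?y \<bullet> (A *\<^sub>v ?y) = (\<Sum>i<N. d (f i) * (et i)^2)"
  using comb_scalar_prod_self[OF o] by (simp add: power2_eq_square ac_simps)
qed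

text \<open>More than \<open>p\<close> eigenvectors with eigenvalues below \<open>lam\<close> would
  leave a nonzero combination that satisfies all \<open>p\<close> constraints, and on it the form is
  too small.\<close>

lemma card_small_eigenvalues_le:
 assumes e: "eigensys n A ph d" and cb: "codim_bound n A lam p"
 shows "card {i. i < n \<and> d i < lam} <= p"
proof (rule ccontr)
 let ?S = "{i. i < n \<and> d i < lam}"
 assume "\<not> card ?S <= p"
 hence lt: "p < card ?S" by simp
 obtain f where f: "bij_betw f {..<card ?S} ?S"
  using ex_bij_betw_nat_finite[of ?S] by (auto simp: lessThan_atLeast0)
 let ?N = "card ?S"
 have f1: "inj_on f {..<?N}" "f ` {..<?N} \<subseteq> {..<n}" "!!i. i < ?N ==> d (f i) < lam"
  using f by (auto simp: bij_betw_def)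
 obtain zs where zs: "\<forall>i<p. zs i \<in> carrier_vec n"
  "\<forall>y\<in>carrier_vec n. (\<forall>i<p. zs i \<bullet> y = 0) --> lam * (y \<bullet> y) <= y \<bullet> (A *\<^sub>v y)"
  using cb unfolding codim_bound_def by blast
 note o = eigensys_comb_quad[OF e f1(1,2)]
 have fc: "ph (f i) \<in> carrier_vec n" if "i < ?N" for i using o(1) that by (auto simp: orthon_def)
 obtain et where et: "et \<in> carrier_vec ?N" "et \<noteq> 0\<^sub>v ?N"
  "!!i. i < p ==> vec ?N (%j. zs i \<bullet> ph (f j)) \<bullet> et = 0"
  using homogeneous_solution[OF lt, of "%i. vec ?N (%j. zs i \<bullet> ph (f j))"] by auto
 let ?y = "comb n ?N (%i. ph (f i)) (($) et)"
 have "zs i \<bullet> ?y = 0" if "i < p" for i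
 proof -
  have "zs i \<bullet> ?y = (\<Sum>j<?N. et $ j * (zs i \<bullet> ph (f j)))"
   by (rule scalar_prod_comb) (use zs(1) that fc in auto)
  also have "... = vec ?N (%j. zs i \<bullet> ph (f j)) \<bullet> et"
   using et(1) by (auto simp: scalar_prod_def[of _ et] lessThan_atLeast0 ac_simps)
  finally show ?thesis using et(3)[OF that] by simp
 qed
 hence "lam * (?y \<bullet> ?y) <= ?y \<bullet> (A *\<^sub>v ?y)" using zs(2) by simp
 hence le: "lam * (\<Sum>i<?N. (et $ i)^2) <= (\<Sum>i<?N. d (f i) * (et $ i)^2)"
  unfolding o(2) comb_scalar_prod_self[OF o(1)] by (simp add: power2_eq_square)
 obtain i0 where i0: "i0 < ?N" "et $ i0 \<noteq> 0" using et(1,2) by (metis carrier_vecD eq_vecI index_zero_vec)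
 have "(\<Sum>i<?N. d (f i) * (et $ i)^2) < (\<Sum>i<?N. lam * (et $ i)^2)"
 proof (rule sum_strict_mono_ex1)
  show "\<forall>i\<in>{..<?N}. d (f i) * (et $ i)^2 <= lam * (et $ i)^2"
   using f1(3) by (intro ballI mult_right_mono) (auto intro: less_imp_le)
  show "\<exists>i\<in>{..<?N}. d (f i) * (et $ i)^2 < lam * (et $ i)^2"
   using f1(3)[OF i0(1)] i0 by (intro bexI[of _ i0] mult_strict_right_mono) auto
 qed simp
 thus False using le by (simp add: sum_distrib_left)
qed

text \<open>The dichotomy behind \<open>reduction\<close>: either fewer than \<open>c\<close>
  eigenvalues lie below \<open>ta\<close>, or \<open>c\<close> of the corresponding eigenvectors
  span a space on which the form is at most \<open>ta\<close>.\<close>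

lemma codim_bound_or_small:
 assumes A: "(A :: real mat) \<in> carrier_mat n n" "A\<^sup>T = A" and c: "c \<ge> 1"
 shows "codim_bound n A ta (c - 1) \<or> (\<exists>ph. orthon n c ph \<and>
   (\<forall>et. comb n c ph et \<bullet> (A *\<^sub>v comb n c ph et) <= ta * (\<Sum>i<c. (et i)^2)))"
proof -
 obtain ph d where e: "eigensys n A ph d" using eigensys_exists[OF A] by blast
 note cc = eigensys_carrier[OF e]
 let ?S = "{i. i < n \<and> d i < ta}"
 have fin: "finite ?S" by simp
 obtain f where f: "bij_betw f {..<card ?S} ?S"
  using ex_bij_betw_nat_finite[OF fin] by (auto simp: lessThan_atLeast0)
 show ?thesis
 proof (cases "card ?S \<ge> c")
  case True
  have f1: "inj_on f {..<c}" "f ` {..<c} \<subseteq> {..<n}"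
   using f True by (auto simp: bij_betw_def intro: inj_on_subset)
  have f2: "d (f i) < ta" if "i < c" for i using f True that by (auto simp: bij_betw_def)
  have "(\<Sum>i<c. d (f i) * (et i)^2) <= ta * (\<Sum>i<c. (et i)^2)" for et :: "nat => real"
   unfolding sum_distrib_left using f2 by (intro sum_mono mult_right_mono) (auto intro: less_imp_le)
  thus ?thesis using eigensys_comb_quad[OF e f1] by metis
 next
  case False
  have "codim_bound n A ta (card ?S)"
   unfolding codim_bound_def
  proof (rule exI[of _ "%i. ph (f i)"], intro conjI allI ballI impI)
   show "ph (f i) \<in> carrier_vec n" if "i < card ?S" for i using f that cc(1) by (auto simp: bij_betw_def)
   fix y :: "real vec" assume y: "y \<in> carrier_vec n" "\<forall>i<card ?S. ph (f i) \<bullet> y = 0"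
   have z: "ph i \<bullet> y = 0" if "i < n" "d i < ta" for i
   proof -
    have "i \<in> f ` {..<card ?S}" using f that by (auto simp: bij_betw_def)
    thus ?thesis using y(2) by auto
   qed
   have "ta * (y \<bullet> y) = (\<Sum>i<n. ta * (ph i \<bullet> y)^2)"
    unfolding parseval(2)[OF cc(3) y(1) y(1)] by (simp add: sum_distrib_left power2_eq_square)
   also have "... <= (\<Sum>i<n. d i * (ph i \<bullet> y)^2)"
   proof (rule sum_mono)
    fix i assume "i \<in> {..<n}"
    thus "ta * (ph i \<bullet> y)^2 <= d i * (ph i \<bullet> y)^2"
     using z[of i] by (cases "d i < ta") (auto intro: mult_right_mono)
   qed
   also have "... = y \<bullet> (A *\<^sub>v y)" using eigensys_quad[OF e y(1)] by simp
   finally show "ta * (y \<bullet> y) <= y \<bullet> (A *\<^sub>v y)" .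
  qed
  hence "codim_bound n A ta (c - 1)" by (rule codim_bound_mono) (use False in auto)
  thus ?thesis ..
 qed
qed

text \<open>The budget against which the gains of \<open>det_gain\<close> are played. Each of the at
  most \<open>d\<close> small eigenvalues of \<open>Q\<close> can make its factor grow by
  \<open>1 + La / ta\<close>. Every other one is at least \<open>n * La\<close> and contributes at
  most \<open>1 + 1 / n\<close>, and these factors multiply to at most e, hence to at most
  3.\<close>

lemma det_budget:
 assumes Q: "psd_mat n Q" and cb: "codim_bound n Q (real n * La) d" and La: "La > 0" and ta: "ta > 0"
  and X: "psd_mat n X" and Xle: "!!y. y \<in> carrier_vec n ==> y \<bullet> (X *\<^sub>v y) <= La * (y \<bullet> y)"
 shows "det (Q + ta \<cdot>\<^sub>m 1\<^sub>m n + X) <= 3 * (1 + La / ta) ^ d * det (Q + ta \<cdot>\<^sub>m 1\<^sub>m n)"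
proof -
 have Qc: "Q \<in> carrier_mat n n" "Q\<^sup>T = Q" using Q by (auto simp: psd_mat_def)
 have Xc: "X \<in> carrier_mat n n" "X\<^sup>T = X" using X by (auto simp: psd_mat_def)
 obtain ph q where e: "eigensys n Q ph q" using eigensys_exists[OF Qc] by blast
 note cc = eigensys_carrier[OF e]
 have q0: "q i \<ge> 0" if "i < n" for i
  using eigensys_eigenvalue(1)[OF e that] Q cc(1)[OF that] by (simp add: psd_mat_def)
 have t1: "(c \<cdot>\<^sub>m 1\<^sub>m n)\<^sup>T = c \<cdot>\<^sub>m (1\<^sub>m n :: real mat)" for c by (rule eq_matI) auto
 have sc: "c \<cdot>\<^sub>m 1\<^sub>m n \<in> carrier_mat n n" for c :: real by simp
 have q1: "y \<bullet> ((c \<cdot>\<^sub>m 1\<^sub>m n) *\<^sub>v y) = c * (y \<bullet> y)" if "y \<in> carrier_vec n" for y :: "real vec" and c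
  using that by (subst quad_smult[of _ n]) auto
 have yy: "0 < z \<bullet> z" if "z \<in> carrier_vec n" "z \<noteq> 0\<^sub>v n" for z :: "real vec"
  using sq_zero_iff[OF that(1)] that(2) sq_nonneg[of z] by linarith
 let ?A = "Q + ta \<cdot>\<^sub>m 1\<^sub>m n"
 have A: "?A \<in> carrier_mat n n" "?A\<^sup>T = ?A" using Qc sc t1 by (auto simp: transpose_add[of _ n n])
 have AX: "?A + X \<in> carrier_mat n n" "(?A + X)\<^sup>T = ?A + X"
  using A Xc transpose_add[OF A(1) Xc(1)] by auto
 have quadA: "y \<bullet> (?A *\<^sub>v y) = y \<bullet> (Q *\<^sub>v y) + ta * (y \<bullet> y)" if "y \<in> carrier_vec n" for y
  using quad_add[OF Qc(1) sc that] q1[OF that] by simp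
 have pd: "pos_def_mat n (?A + X)"
  unfolding pos_def_mat_def
 proof (intro conjI ballI impI AX)
  fix y :: "real vec" assume y: "y \<in> carrier_vec n" "y \<noteq> 0\<^sub>v n"
  have "0 <= y \<bullet> (Q *\<^sub>v y)" "0 <= y \<bullet> (X *\<^sub>v y)" "0 < ta * (y \<bullet> y)"
   using Q X y ta yy[OF y] by (auto simp: psd_mat_def)
  thus "0 < y \<bullet> ((?A + X) *\<^sub>v y)" unfolding quad_add[OF A(1) Xc(1) y(1)] quadA[OF y(1)] by linarith
 qed
 let ?B = "Q + (ta + La) \<cdot>\<^sub>m 1\<^sub>m n"
 \<comment> \<open>\<open>X\<close> is dominated by \<open>La\<close> times the identity, which
   shares the eigenvectors of \<open>Q\<close>; after this replacement both determinants are
   products over the same eigenbasis.\<close>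
 have "det (?A + X) <= det ?B"
 proof (rule det_mono[OF pd])
  show "?B \<in> carrier_mat n n" "?B\<^sup>T = ?B" using Qc sc t1 by (auto simp: transpose_add[of _ n n])
  fix y :: "real vec" assume y: "y \<in> carrier_vec n"
  have "y \<bullet> (?B *\<^sub>v y) = y \<bullet> (Q *\<^sub>v y) + (ta + La) * (y \<bullet> y)"
   using quad_add[OF Qc(1) sc y] q1[OF y] by simp
  thus "y \<bullet> ((?A + X) *\<^sub>v y) <= y \<bullet> (?B *\<^sub>v y)"
   unfolding quad_add[OF A(1) Xc(1) y] quadA[OF y] using Xle[OF y] by (simp add: algebra_simps)
 qed
 also have "det ?B = (\<Prod>i<n. q i + (ta + La))" by (rule eigensys_det[OF eigensys_shift[OF e]])
 also have "... = (\<Prod>i<n. (1 + La / (q i + ta)) * (q i + ta))"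
 proof (rule prod.cong[OF refl])
  fix i assume "i \<in> {..<n}"
  hence "q i + ta > 0" using q0[of i] ta by simp
  thus "q i + (ta + La) = (1 + La / (q i + ta)) * (q i + ta)" by (simp add: field_simps)
 qed
 also have "... = (\<Prod>i<n. 1 + La / (q i + ta)) * det ?A"
  unfolding eigensys_det[OF eigensys_shift[OF e]] by (simp add: prod.distrib)
 finally have 1: "det (?A + X) <= (\<Prod>i<n. 1 + La / (q i + ta)) * det ?A" .
 let ?S = "{i. i < n \<and> q i < real n * La}"
 have "(\<Prod>i<n. 1 + La / (q i + ta)) <= (\<Prod>i<n. (if i \<in> ?S then 1 + La/ta else 1) * (1 + 1 / real n))"
 proof (intro prod_mono conjI)
  fix i assume "i \<in> {..<n}"
  hence i: "i < n" by simp
  hence q0i: "q i \<ge> 0" and n: "real n > 0" using q0 by auto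
  show "0 <= 1 + La / (q i + ta)" using q0i ta La by simp
  show "1 + La / (q i + ta) <= (if i \<in> ?S then 1 + La/ta else 1) * (1 + 1 / real n)"
  proof (cases "i \<in> ?S")
   case True
   have "La / (q i + ta) <= La / ta" using q0i ta La by (intro divide_left_mono) auto
   hence "1 + La / (q i + ta) <= (1 + La / ta) * 1" by simp
   also have "... <= (1 + La/ta) * (1 + 1 / real n)"
    using La ta n by (intro mult_left_mono add_nonneg_nonneg) auto
   finally show ?thesis using True by simp
  next
   case False
   hence "real n * La <= q i + ta" using i ta by simp
   hence "La / (q i + ta) <= La / (real n * La)" using La n by (intro divide_left_mono) (auto intro!: mult_pos_pos add_nonneg_pos q0i ta)
   also have "... = 1 / real n" using La by simp
   finally show ?thesis unfolding if_not_P[OF False] by simp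
  qed
 qed
 also have "... = (1 + La/ta) ^ card ?S * (1 + 1 / real n) ^ n"
 proof -
  have "(\<Prod>i<n. if i \<in> ?S then 1 + La/ta else 1) = (\<Prod>i\<in>?S. 1 + La/ta)"
   by (subst prod.If_cases) (auto intro!: prod.cong simp: Int_def)
  thus ?thesis by (simp add: prod.distrib)
 qed
 also have "... <= (1 + La/ta) ^ d * 3"
 proof (rule mult_mono)
  show "(1 + La/ta) ^ card ?S <= (1 + La/ta) ^ d"
   using card_small_eigenvalues_le[OF e cb] La ta by (intro power_increasing) auto
  show "(1 + 1 / real n) ^ n <= 3"
  proof -
   have "(1 + 1 / real n) ^ n <= exp (1 / real n) ^ n" by (intro power_mono exp_ge_add_one_self) auto
   also have "... = exp (real n * (1 / real n))" by (rule exp_of_nat_mult[symmetric])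
   also have "... <= exp 1" by (cases "n = 0") auto
   also have "... <= 3" by (rule exp_le)
   finally show ?thesis .
  qed
 qed (use La ta in auto)
 finally have 2: "(\<Prod>i<n. 1 + La / (q i + ta)) <= 3 * (1 + La/ta) ^ d" by (simp add: mult.commute)
 have "0 <= det ?A" unfolding eigensys_det[OF eigensys_shift[OF e]] using q0 ta by (intro prod_nonneg) (auto intro: add_nonneg_nonneg less_imp_le)
 thus ?thesis using 1 mult_right_mono[OF 2] by (meson order_trans)
qed

section \<open>Singular values through Gram matrices\<close>

lemma proots_prod_linear:
 fixes d :: "'b => real"
 assumes "finite A"
 shows "proots (\<Prod>i\<in>A. [:- d i, 1:]) = image_mset d (mset_set A)"
 using assms
proof (induction A rule: finite_induct)
 case (insert x A)
 have "(\<Prod>i\<in>A. [:- d i, 1:]) \<noteq> 0" using insert by simp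
 thus ?case using insert by (simp add: proots_mult del: mult_pCons_left)
qed simp

lemma singular_values_eigensys:
 assumes "eigensys n (A\<^sup>T * A) ph d"
 shows "singular_values A = rev (sort (map (%i. sqrt (d i)) [0..<n]))"
proof -
 have "image_mset sqrt (proots (char_poly (A\<^sup>T * A))) = mset (map (%i. sqrt (d i)) [0..<n])"
  unfolding eigensys_char_poly[OF assms]
  by (simp add: proots_prod_linear image_mset.compositionality o_def lessThan_atLeast0 flip: mset_upt)
 thus ?thesis unfolding singular_values_def by (simp only: sorted_list_of_multiset_mset)
qed

lemma sort_nth_count:
 fixes xs :: "real list"
 assumes "k < length xs" "be <= sort xs ! k"
 shows "length (filter (%x. x < be) xs) <= k"
proof -
 have "mset (filter (%x. x < be) xs) = mset (filter (%x. x < be) (sort xs))"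
  by (simp only: mset_filter mset_sort)
 hence "length (filter (%x. x < be) xs) = length (filter (%x. x < be) (sort xs))"
  by (rule mset_eq_length)
 also have "... = card {i. i < length (sort xs) \<and> sort xs ! i < be}" by (rule length_filter_conv_card)
 also have "... <= card {..<k}"
 proof (rule card_mono)
  show "{i. i < length (sort xs) \<and> sort xs ! i < be} \<subseteq> {..<k}"
  proof
   fix i assume "i \<in> {i. i < length (sort xs) \<and> sort xs ! i < be}"
   hence i: "i < length xs" "sort xs ! i < be" by auto
   show "i \<in> {..<k}"
   proof (rule ccontr)
    assume "i \<notin> {..<k}"
    hence "sort xs ! k <= sort xs ! i" using i assms by (intro sorted_nth_mono) auto
    thus False using i assms by linarith
   qed
  qed
 qed simp
 finally show ?thesis by simp
qed

lemma gram_quad: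
 fixes A :: "real mat"
 assumes "A \<in> carrier_mat n k" "y \<in> carrier_vec k"
 shows "y \<bullet> ((A\<^sup>T * A) *\<^sub>v y) = (A *\<^sub>v y) \<bullet> (A *\<^sub>v y)"
proof -
 have Ay: "A *\<^sub>v y \<in> carrier_vec n" using assms by simp
 have "(A\<^sup>T * A) *\<^sub>v y = A\<^sup>T *\<^sub>v (A *\<^sub>v y)" using assms by (intro assoc_mult_mat_vec) auto
 hence "y \<bullet> ((A\<^sup>T * A) *\<^sub>v y) = (A\<^sup>T *\<^sub>v (A *\<^sub>v y)) \<bullet> y"
  using assms Ay by (simp add: comm_scalar_prod[of y k])
 also have "... = (A *\<^sub>v y) \<bullet> (A *\<^sub>v y)" by (rule transpose_vec_mult_scalar[OF assms Ay])
 finally show ?thesis .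
qed

lemma gram_eigensys:
 assumes A: "(A :: real mat) \<in> carrier_mat n n"
 obtains ph d where "eigensys n (A\<^sup>T * A) ph d" "!!i. i < n ==> d i \<ge> 0"
  "!!i. i < n ==> (A *\<^sub>v ph i) \<bullet> (A *\<^sub>v ph i) = d i"
proof -
 have "A\<^sup>T * A \<in> carrier_mat n n" "(A\<^sup>T * A)\<^sup>T = A\<^sup>T * A" using A by (auto simp: transpose_mult[of _ n n _ n])
 then obtain ph d where e: "eigensys n (A\<^sup>T * A) ph d" by (rule eigensys_exists)
 have "(A *\<^sub>v ph i) \<bullet> (A *\<^sub>v ph i) = d i" if "i < n" for i
  using eigensys_eigenvalue(1)[OF e that] gram_quad[OF A eigensys_carrier(1)[OF e that]] by simp
 moreover from this have "d i \<ge> 0" if "i < n" for i using that sq_nonneg by metis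
 ultimately show ?thesis using that e by blast
qed

lemma singular_value_one_bound:
 assumes A: "A \<in> carrier_mat n n" and sv: "singular_value 1 A <= 1" and y: "y \<in> carrier_vec n"
 shows "(A *\<^sub>v y) \<bullet> (A *\<^sub>v y) <= y \<bullet> y"
proof -
 obtain ph d where e: "eigensys n (A\<^sup>T * A) ph d" "!!i. i < n ==> d i \<ge> 0" using gram_eigensys[OF A] by metis
 let ?xs = "map (%i. sqrt (d i)) [0..<n]"
 have d1: "d i <= 1" if i: "i < n" for i
 proof -
  have "sqrt (d i) \<in> set (sort ?xs)" using i by simp
  then obtain k where k: "k < n" "sort ?xs ! k = sqrt (d i)" by (auto simp: in_set_conv_nth simp del: set_sort)
  have "sort ?xs ! k <= sort ?xs ! (n - 1)" using k by (intro sorted_nth_mono) auto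
  also have "... = singular_value 1 A"
   unfolding singular_value_def singular_values_eigensys[OF e(1)] using i by (simp add: rev_nth)
  finally have "sqrt (d i) <= 1" using sv k(2) by linarith
  thus ?thesis by simp
 qed
 have "(A *\<^sub>v y) \<bullet> (A *\<^sub>v y) = (\<Sum>i<n. d i * (ph i \<bullet> y)^2)"
  using gram_quad[OF A y] eigensys_quad[OF e(1) y] by simp
 also have "... <= (\<Sum>i<n. 1 * (ph i \<bullet> y)^2)" using d1 by (intro sum_mono mult_right_mono) auto
 also have "... = y \<bullet> y"
  unfolding parseval(2)[OF eigensys_carrier(3)[OF e(1)] y y] by (simp add: power2_eq_square)
 finally show ?thesis .
qed

lemma scalar_prod_Cauchy_Schwarz:
 fixes u v :: "real vec"
 assumes "u \<in> carrier_vec n" "v \<in> carrier_vec n"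
 shows "(u \<bullet> v)^2 <= (u \<bullet> u) * (v \<bullet> v)"
 using Cauchy_Schwarz_ineq_sum[of "($) u" "($) v" "{0..<n}"] assms
 by (simp add: scalar_prod_def power2_eq_square)

text \<open>The squared length of \<open>?u\<close> is the pairing of \<open>y\<close> with
  \<open>A *\<^sub>v ?u\<close>. Cauchy-Schwarz and the bound for \<open>A\<close> give the claim
  times one factor \<open>?u \<bullet> ?u\<close>, which is cancelled.\<close>

lemma singular_value_one_bound_transpose:
 assumes A: "A \<in> carrier_mat n n" and sv: "singular_value 1 A <= 1" and y: "y \<in> carrier_vec n"
 shows "(A\<^sup>T *\<^sub>v y) \<bullet> (A\<^sup>T *\<^sub>v y) <= y \<bullet> y"
proof -
 let ?u = "A\<^sup>T *\<^sub>v y"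
 have u: "?u \<in> carrier_vec n" using A y by simp
 have Au: "A *\<^sub>v ?u \<in> carrier_vec n" using A u by simp
 have "?u \<bullet> ?u = y \<bullet> (A *\<^sub>v ?u)" by (rule transpose_vec_mult_scalar[OF A u y])
 hence "(?u \<bullet> ?u)^2 <= (y \<bullet> y) * ((A *\<^sub>v ?u) \<bullet> (A *\<^sub>v ?u))"
  using scalar_prod_Cauchy_Schwarz[OF y Au] by simp
 also have "... <= (y \<bullet> y) * (?u \<bullet> ?u)"
  by (intro mult_left_mono singular_value_one_bound[OF A sv u]) simp
 finally have "(?u \<bullet> ?u) * (?u \<bullet> ?u) <= (y \<bullet> y) * (?u \<bullet> ?u)" by (simp add: power2_eq_square)
 thus ?thesis
 proof (cases "?u \<bullet> ?u = 0")
  case False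
  hence "?u \<bullet> ?u > 0" using sq_nonneg[of ?u] by linarith
  thus ?thesis using \<open>(?u \<bullet> ?u) * (?u \<bullet> ?u) <= (y \<bullet> y) * (?u \<bullet> ?u)\<close> by (rule mult_right_le_imp_le[rotated])
 qed simp
qed

text \<open>The singular value condition is transferred to \<open>A * A\<^sup>T\<close>, the form
  seen by vectors on the left. At most \<open>r - 1\<close> eigenvalues of
  \<open>A\<^sup>T * A\<close> fall below \<open>be\<^sup>2\<close>, and the eigenvectors of the
  others are carried over to eigenvectors of \<open>A * A\<^sup>T\<close>.\<close>

lemma singular_value_codim_bound:
 assumes A: "A \<in> carrier_mat n n" and r: "1 <= r" "r <= n" and be: "be > 0"
  and sv: "be <= singular_value (n - r + 1) A"
 shows "codim_bound n (A * A\<^sup>T) (be\<^sup>2) (r - 1)"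
proof -
 obtain ph d where e: "eigensys n (A\<^sup>T * A) ph d" "!!i. i < n ==> d i \<ge> 0"
  "!!i. i < n ==> (A *\<^sub>v ph i) \<bullet> (A *\<^sub>v ph i) = d i" using gram_eigensys[OF A] by metis
 note c = eigensys_carrier[OF e(1)]
 let ?xs = "map (%i. sqrt (d i)) [0..<n]"
 have "singular_value (n - r + 1) A = sort ?xs ! (r - 1)"
  unfolding singular_value_def singular_values_eigensys[OF e(1)] using r by (simp add: rev_nth)
 hence "length (filter (%x. x < be) ?xs) <= r - 1"
  using r sv by (intro sort_nth_count) auto
 hence "card {i. i < n \<and> sqrt (d i) < be} <= r - 1"
  by (simp add: length_filter_conv_card cong: conj_cong)
 moreover have "{i. i < n \<and> sqrt (d i) < be} = {i. i < n \<and> d i < be\<^sup>2}"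
  using be e(2) by (auto simp: real_less_lsqrt dest!: real_less_rsqrt) (metis abs_of_pos real_sqrt_abs real_sqrt_less_iff)
 ultimately have cS: "card {i. i < n \<and> d i < be\<^sup>2} <= r - 1" by simp
 define T where "T = {i. i < n \<and> be\<^sup>2 <= d i}"
 define N where "N = card T"
 have "{..<n} = {i. i < n \<and> d i < be\<^sup>2} \<union> T" by (auto simp: T_def)
 hence "n = card ({i. i < n \<and> d i < be\<^sup>2} \<union> T)" by (metis card_lessThan)
 also have "... <= card {i. i < n \<and> d i < be\<^sup>2} + N" unfolding N_def by (rule card_Un_le)
 finally have nN: "n - N <= r - 1" using cS by linarith
 have "N <= card {..<n}" unfolding N_def by (intro card_mono) (auto simp: T_def)
 hence Nn: "N <= n" by simp
 obtain f where f: "bij_betw f {..<N} T"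
  using ex_bij_betw_nat_finite[of T] by (auto simp: lessThan_atLeast0 N_def T_def)
 have fi: "f i < n" "be\<^sup>2 <= d (f i)" if "i < N" for i using f that by (auto simp: bij_betw_def T_def)
 have dpos: "d (f i) > 0" if "i < N" for i using fi(2)[OF that] be by (meson less_le_trans zero_less_power)
 \<comment> \<open>Left singular vectors. The division is harmless since only indices with
   \<open>d (f i)\<close> at least \<open>be\<^sup>2\<close> occur.\<close>
 define ps0 where "ps0 i = (1 / sqrt (d (f i))) \<cdot>\<^sub>v (A *\<^sub>v ph (f i))" for i
 have Ac: "A *\<^sub>v ph (f i) \<in> carrier_vec n" if "i < N" for i using A c(1)[OF fi(1)[OF that]] by simp
 have AA: "(A *\<^sub>v ph (f i)) \<bullet> (A *\<^sub>v ph (f j)) = (if i = j then d (f i) else 0)" if "i < N" "j < N" for i j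
 proof -
  have pj: "ph (f j) \<in> carrier_vec n" "ph (f i) \<in> carrier_vec n" using c(1) fi(1) that by auto
  have "(A *\<^sub>v ph (f i)) \<bullet> (A *\<^sub>v ph (f j)) = (A\<^sup>T *\<^sub>v (A *\<^sub>v ph (f i))) \<bullet> ph (f j)"
   using transpose_vec_mult_scalar[OF A pj(1) Ac[OF that(1)]] by simp
  also have "A\<^sup>T *\<^sub>v (A *\<^sub>v ph (f i)) = (A\<^sup>T * A) *\<^sub>v ph (f i)" using A pj by (intro assoc_mult_mat_vec[symmetric]) auto
  also have "... = d (f i) \<cdot>\<^sub>v ph (f i)" using e(1) fi(1)[OF that(1)] by (simp add: eigensys_def)
  also have "... \<bullet> ph (f j) = d (f i) * (ph (f i) \<bullet> ph (f j))" using pj by simp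
  also have "ph (f i) \<bullet> ph (f j) = (if i = j then 1 else 0)"
   using c(3) fi(1) that f by (auto simp: orthon_def bij_betw_def inj_on_def)
  finally show ?thesis by simp
 qed
 have o: "orthon n N ps0"
  unfolding orthon_def
 proof (intro conjI allI impI)
  fix i j assume ij: "i < N" "j < N"
  have "ps0 i \<bullet> ps0 j = (1 / sqrt (d (f i))) * ((1 / sqrt (d (f j))) * ((A *\<^sub>v ph (f i)) \<bullet> (A *\<^sub>v ph (f j))))"
   unfolding ps0_def using Ac[OF ij(1)] Ac[OF ij(2)] by simp
  thus "ps0 i \<bullet> ps0 j = (if i = j then 1 else 0)" unfolding AA[OF ij] using dpos[OF ij(1)] by auto
 qed (use Ac in \<open>auto simp: ps0_def\<close>)
 obtain ps where ps: "orthon n n ps" "!!i. i < N ==> ps i = ps0 i" using orthon_extend[OF o Nn] by blast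
 have psc: "ps i \<in> carrier_vec n" if "i < n" for i using ps(1) that by (auto simp: orthon_def)
 \<comment> \<open>The constraints are the \<open>n - N\<close> vectors that complete the left
   singular vectors to an orthonormal basis.\<close>
 have "codim_bound n (A * A\<^sup>T) (be\<^sup>2) (n - N)"
  unfolding codim_bound_def
 proof (rule exI[of _ "%j. ps (N + j)"], intro conjI allI ballI impI)
  show "ps (N + j) \<in> carrier_vec n" if "j < n - N" for j using psc that by simp
  fix y :: "real vec" assume y: "y \<in> carrier_vec n" and z: "\<forall>j<n - N. ps (N + j) \<bullet> y = 0"
  have z': "ps i \<bullet> y = 0" if "i < n" "\<not> i < N" for i using z[rule_format, of "i - N"] that by simp
  have ATy: "A\<^sup>T *\<^sub>v y \<in> carrier_vec n" using A y by simp
  have "be\<^sup>2 * (y \<bullet> y) = (\<Sum>i<n. be\<^sup>2 * (ps i \<bullet> y)^2)"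
   unfolding parseval(2)[OF ps(1) y y] by (simp add: sum_distrib_left power2_eq_square)
  also have "... = (\<Sum>i<N. be\<^sup>2 * (ps i \<bullet> y)^2)"
   using z' Nn by (intro sum.mono_neutral_right) auto
  also have "... <= (\<Sum>i<N. (ph (f i) \<bullet> (A\<^sup>T *\<^sub>v y))^2)"
  proof (rule sum_mono)
   fix i assume "i \<in> {..<N}"
   hence i: "i < N" by simp
   have p: "ph (f i) \<in> carrier_vec n" using c(1) fi(1)[OF i] .
   have "ph (f i) \<bullet> (A\<^sup>T *\<^sub>v y) = (A\<^sup>T *\<^sub>v y) \<bullet> ph (f i)" using ATy p by (intro comm_scalar_prod)
   also have "... = y \<bullet> (A *\<^sub>v ph (f i))" by (rule transpose_vec_mult_scalar[OF A p y])
   finally have 1: "ph (f i) \<bullet> (A\<^sup>T *\<^sub>v y) = (A *\<^sub>v ph (f i)) \<bullet> y"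
    using y Ac[OF i] by (simp add: comm_scalar_prod[of y n])
   have "ps i \<bullet> y = (1 / sqrt (d (f i))) * ((A *\<^sub>v ph (f i)) \<bullet> y)"
    unfolding ps(2)[OF i] ps0_def using Ac[OF i] y by simp
   hence "(ps i \<bullet> y)^2 * d (f i) = (ph (f i) \<bullet> (A\<^sup>T *\<^sub>v y))^2"
    unfolding 1 using dpos[OF i] by (simp add: power_mult_distrib power_divide)
   moreover have "be\<^sup>2 * (ps i \<bullet> y)^2 <= d (f i) * (ps i \<bullet> y)^2" using fi(2)[OF i] by (intro mult_right_mono) auto
   ultimately show "be\<^sup>2 * (ps i \<bullet> y)^2 <= (ph (f i) \<bullet> (A\<^sup>T *\<^sub>v y))^2" by (simp add: mult.commute)
  qed
  also have "... = (\<Sum>j\<in>T. (ph j \<bullet> (A\<^sup>T *\<^sub>v y))^2)" by (rule sum.reindex_bij_betw[OF f])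
  also have "... <= (\<Sum>j<n. (ph j \<bullet> (A\<^sup>T *\<^sub>v y))^2)" by (intro sum_mono2) (auto simp: T_def)
  also have "... = (A\<^sup>T *\<^sub>v y) \<bullet> (A\<^sup>T *\<^sub>v y)"
   unfolding parseval(2)[OF c(3) ATy ATy] by (simp add: power2_eq_square)
  also have "... = y \<bullet> ((A * A\<^sup>T) *\<^sub>v y)" using gram_quad[of "A\<^sup>T" n n y] A y by simp
  finally show "be\<^sup>2 * (y \<bullet> y) <= y \<bullet> ((A * A\<^sup>T) *\<^sub>v y)" .
 qed
 thus ?thesis by (rule codim_bound_mono) (use nN in auto)
qed

lemma singular_value_least:
 assumes K: "K \<in> carrier_mat n n" and n: "n > 0" and sv: "singular_value n K <= ep"
 obtains z where "z \<in> carrier_vec n" "z \<bullet> z = 1" "(K *\<^sub>v z) \<bullet> (K *\<^sub>v z) <= ep\<^sup>2"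
proof -
 obtain ph d where e: "eigensys n (K\<^sup>T * K) ph d" "!!i. i < n ==> d i \<ge> 0"
  "!!i. i < n ==> (K *\<^sub>v ph i) \<bullet> (K *\<^sub>v ph i) = d i" using gram_eigensys[OF K] by metis
 let ?xs = "map (%i. sqrt (d i)) [0..<n]"
 have "singular_value n K = sort ?xs ! 0"
  unfolding singular_value_def singular_values_eigensys[OF e(1)] using n by (simp add: rev_nth)
 moreover have "sort ?xs ! 0 \<in> set (sort ?xs)" by (rule nth_mem) (use n in simp)
 ultimately obtain i where i: "i < n" "sqrt (d i) <= ep" using sv by auto
 have "d i = (sqrt (d i))^2" using e(2)[OF i(1)] by simp
 also have "... <= ep\<^sup>2" using i e(2)[OF i(1)] by (intro power_mono) auto
 finally show ?thesis
  using that[of "ph i"] i e(3)[OF i(1)] eigensys_carrier(1)[OF e(1) i(1)] eigensys_eigenvalue(2)[OF e(1) i(1)] by simp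
qed

section \<open>Polynomial determinants and the growth of minors\<close>

text \<open>A crude Markov inequality at the end point 0, by induction on the degree. The
  combination \<open>q\<close> of p (l t) and p (t) cancels the leading coefficient; it doubles the
  bound and multiplies the linear coefficient by \<open>l - l ^ Suc D\<close>, which is at least
  \<open>1 / (4 * D0)\<close>. The fixed \<open>D0\<close> makes the loss \<open>8 * D0\<close> the
  same in every step.\<close>

lemma coeff_one_bound:
 fixes p :: "real poly"
 assumes "degree p <= D" "1 <= D" "D <= D0" "!!t. 0 <= t ==> t <= 1 ==> \<bar>poly p t\<bar> <= B"
 shows "\<bar>coeff p 1\<bar> <= 2 * (8 * real D0) ^ (D - 1) * B"
 using assms(2,1,3,4)
proof (induction D arbitrary: p B rule: nat_induct_at_least)
 case base
 have e: "p = [:coeff p 0, coeff p 1:]"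
  by (rule poly_eqI) (use base(1) in \<open>auto simp: coeff_pCons coeff_eq_0 split: nat.split\<close>)
 have "poly p 1 = coeff p 0 + coeff p 1" "poly p 0 = coeff p 0"
  by (subst e, simp)+
 thus ?case using base(3)[of 0] base(3)[of 1] by simp
next
 case (Suc D)
 define l where "l = 1 - 1 / (2 * real D0)"
 have D0: "real D0 \<ge> 1" using Suc by simp
 have l: "1/2 <= l" "l < 1" "0 <= l" using D0 by (auto simp: l_def field_simps)
 define q where "q = pcompose p [:0, l:] - Polynomial.smult (l ^ Suc D) p"
 have cq: "coeff q i = (l ^ i - l ^ Suc D) * coeff p i" for i
  by (simp add: q_def coeff_pcompose_linear algebra_simps)
 have "degree q <= D"
 proof (rule degree_le, intro allI impI)
  fix i assume "i > D"
  hence "i = Suc D \<or> i > Suc D" by auto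
  thus "coeff q i = 0" using cq[of i] Suc.prems(1) by (auto simp: coeff_eq_0)
 qed
 moreover have "\<bar>poly q t\<bar> <= 2 * B" if t: "0 <= t" "t <= 1" for t
 proof -
  have "\<bar>poly p (t * l)\<bar> <= B" using t l by (intro Suc.prems(3)) (auto simp: mult_le_one)
  moreover have "\<bar>l ^ Suc D * poly p t\<bar> <= 1 * B"
   unfolding abs_mult using l Suc.prems(3)[OF t] power_le_one[of l "Suc D"]
   by (intro mult_mono) (auto simp del: power_Suc)
  ultimately show ?thesis by (simp add: q_def poly_pcompose abs_le_iff del: power_Suc)
 qed
 ultimately have IH: "\<bar>coeff q 1\<bar> <= 2 * (8 * real D0) ^ (D - 1) * (2 * B)"
  using Suc.IH[of q "2 * B"] Suc.prems(2) by simp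
 have "l ^ D <= l ^ 1" using l Suc.hyps by (intro power_decreasing) auto
 hence "1 / (2 * real D0) <= 1 - l ^ D" by (simp add: l_def)
 hence "1/2 * (1 / (2 * real D0)) <= l * (1 - l ^ D)" using l D0 by (intro mult_mono) auto
 also have "l * (1 - l ^ D) = l ^ 1 - l ^ Suc D" by (simp add: algebra_simps)
 finally have "1 / (4 * real D0) * \<bar>coeff p 1\<bar> <= (l ^ 1 - l ^ Suc D) * \<bar>coeff p 1\<bar>"
  by (intro mult_right_mono) auto
 also have "... <= \<bar>coeff q 1\<bar>" unfolding cq abs_mult by (intro mult_right_mono) auto
 finally have "\<bar>coeff p 1\<bar> <= 4 * real D0 * \<bar>coeff q 1\<bar>" using D0 by (simp add: field_simps)
 also have "... <= 4 * real D0 * (2 * (8 * real D0) ^ (D - 1) * (2 * B))"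
  using IH D0 by (intro mult_left_mono) auto
 also have "... = 2 * (8 * real D0 * (8 * real D0) ^ (D - 1)) * B" by simp
 also have "8 * real D0 * (8 * real D0) ^ (D - 1) = (8 * real D0) ^ (Suc D - 1)"
  using Suc.hyps by (cases D) auto
 finally show ?case .
qed

lemma poly_det:
 fixes A :: "real poly mat"
 assumes A: "A \<in> carrier_mat n n"
 shows "poly (det A) t = det (map_mat (%p. poly p t) A)"
 using A by (simp add: det_def'[of _ n] poly_sum poly_prod
   permutes_in_image[where S = "{0..<n}", simplified] if_distrib[of "%p. poly p t"] cong: if_cong)

lemma adj_mat_hom:
 fixes A :: "real poly mat"
 assumes A: "A \<in> carrier_mat n n" and ij: "i < n" "j < n"
 shows "poly (adj_mat A $$ (i,j)) t = adj_mat (map_mat (%p. poly p t) A) $$ (i,j)"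
proof -
 have "map_mat (%p. poly p t) (mat_delete A j i) = mat_delete (map_mat (%p. poly p t) A) j i"
  using A by (auto simp: mat_delete_def)
 moreover have "mat_delete A j i \<in> carrier_mat (n - 1) (n - 1)" using A by (rule mat_delete_carrier)
 ultimately show ?thesis using A ij by (simp add: adj_mat_def cofactor_def poly_det poly_power)
qed

text \<open>A Jacobi type identity for the linear family \<open>A + t E\<close>: the last row of adj
  P times P equals det P times a unit row; differentiate this at 0 and pair it with the last column
  of adj A. The product \<open>A * adj_mat A\<close> turns the terms with the derivative of the
  adjugate into \<open>coeff p 1\<close> times the determinant.\<close>

lemma adj_derivative_identity:
 fixes A E :: "real mat"
 assumes A: "A \<in> carrier_mat (Suc rh) (Suc rh)" and E: "E \<in> carrier_mat (Suc rh) (Suc rh)"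
 defines "P \<equiv> mat (Suc rh) (Suc rh) (%(k,l). [: A $$ (k,l), E $$ (k,l) :])"
 defines "d \<equiv> det P" and "p \<equiv> adj_mat P $$ (rh,rh)"
 shows "(\<Sum>k<Suc rh. \<Sum>l<Suc rh. adj_mat A $$ (rh,k) * E $$ (k,l) * adj_mat A $$ (l,rh))
   = coeff d 1 * poly p 0 - poly d 0 * coeff p 1"
proof -
 let ?n = "Suc rh"
 have P: "P \<in> carrier_mat ?n ?n" by (simp add: P_def)
 have P0: "map_mat (%p. poly p 0) P = A" using A by (auto simp: P_def)
 have d0: "poly d 0 = det A"
  unfolding d_def using poly_det[OF P, of 0] P0 by simp
 define Ap where "Ap k = adj_mat P $$ (rh,k)" for k
 have Ap0: "poly (Ap k) 0 = adj_mat A $$ (rh,k)" if "k < ?n" for k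
  unfolding Ap_def using adj_mat_hom[OF P _ that, of rh 0] P0 by simp
 have c1: "poly (pderiv x) 0 = coeff x 1" for x :: "real poly" by (simp add: poly_0_coeff_0 coeff_pderiv)
 have adjc: "adj_mat P \<in> carrier_mat ?n ?n" "adj_mat A \<in> carrier_mat ?n ?n"
  using adj_mat(1)[OF P] adj_mat(1)[OF A] .
 have e1: "(\<Sum>k<?n. Ap k * P $$ (k,l)) = (if l = rh then d else 0)" if l: "l < ?n" for l
 proof -
  have "(\<Sum>k<?n. Ap k * P $$ (k,l)) = (adj_mat P * P) $$ (rh,l)"
   using l P adjc by (simp add: times_mat_def scalar_prod_def Ap_def lessThan_atLeast0 del: sum.op_ivl_Suc)
  also have "... = (if l = rh then d else 0)" unfolding adj_mat(3)[OF P] using l by (auto simp: d_def)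
  finally show ?thesis .
 qed
 \<comment> \<open>The product rule applied to \<open>e1\<close> at the point 0, where
   \<open>P\<close> is \<open>A\<close> and its derivative is \<open>E\<close>.\<close>
 have e2: "(\<Sum>k<?n. coeff (Ap k) 1 * A $$ (k,l) + adj_mat A $$ (rh,k) * E $$ (k,l)) = (if l = rh then coeff d 1 else 0)"
  if l: "l < ?n" for l
 proof -
  have "poly (pderiv (\<Sum>k<?n. Ap k * P $$ (k,l))) 0
    = (\<Sum>k<?n. poly (pderiv (Ap k * P $$ (k,l))) 0)" by (simp add: pderiv_sum poly_sum del: sum.lessThan_Suc)
  also have "... = (\<Sum>k<?n. coeff (Ap k) 1 * A $$ (k,l) + adj_mat A $$ (rh,k) * E $$ (k,l))"
  proof (rule sum.cong[OF refl])
   fix k assume "k \<in> {..<?n}"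
   hence k: "k < ?n" by simp
   have "P $$ (k,l) = [: A $$ (k,l), E $$ (k,l) :]" using k l by (simp add: P_def)
   thus "poly (pderiv (Ap k * P $$ (k,l))) 0 = coeff (Ap k) 1 * A $$ (k,l) + adj_mat A $$ (rh,k) * E $$ (k,l)"
    by (simp add: pderiv_mult pderiv_pCons c1 Ap0[OF k, unfolded poly_0_coeff_0])
  qed
  finally show ?thesis unfolding e1[OF l] by (auto simp: c1)
 qed
 have e3: "(\<Sum>l<?n. A $$ (k,l) * adj_mat A $$ (l,rh)) = (if k = rh then det A else 0)" if k: "k < ?n" for k
 proof -
  have "(\<Sum>l<?n. A $$ (k,l) * adj_mat A $$ (l,rh)) = (A * adj_mat A) $$ (k,rh)"
   using k A adjc by (simp add: times_mat_def scalar_prod_def lessThan_atLeast0 del: sum.op_ivl_Suc)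
  also have "... = (if k = rh then det A else 0)" unfolding adj_mat(2)[OF A] using k by auto
  finally show ?thesis .
 qed
 have "coeff d 1 * poly p 0 = (\<Sum>l<?n. (if l = rh then coeff d 1 else 0) * adj_mat A $$ (l,rh))"
  using Ap0[of rh] by (simp add: p_def Ap_def if_distrib[of "%x. x * _"] cong: if_cong)
 also have "... = (\<Sum>l<?n. (\<Sum>k<?n. coeff (Ap k) 1 * A $$ (k,l) + adj_mat A $$ (rh,k) * E $$ (k,l)) * adj_mat A $$ (l,rh))"
  by (intro sum.cong refl) (simp only: e2 lessThan_iff)
 also have "... = (\<Sum>l<?n. \<Sum>k<?n. coeff (Ap k) 1 * (A $$ (k,l) * adj_mat A $$ (l,rh)))
   + (\<Sum>l<?n. \<Sum>k<?n. adj_mat A $$ (rh,k) * E $$ (k,l) * adj_mat A $$ (l,rh))"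
  by (simp only: sum_distrib_right distrib_right sum.distrib mult.assoc)
 also have "(\<Sum>l<?n. \<Sum>k<?n. coeff (Ap k) 1 * (A $$ (k,l) * adj_mat A $$ (l,rh)))
   = (\<Sum>k<?n. coeff (Ap k) 1 * (\<Sum>l<?n. A $$ (k,l) * adj_mat A $$ (l,rh)))"
  unfolding sum_distrib_left by (rule sum.swap)
 also have "... = (\<Sum>k<?n. coeff (Ap k) 1 * (if k = rh then det A else 0))"
  by (intro sum.cong refl) (simp only: e3 lessThan_iff)
 also have "... = coeff p 1 * det A" by (simp add: p_def Ap_def if_distrib[of "%x. _ * x"] cong: if_cong)
 also have "(\<Sum>l<?n. \<Sum>k<?n. adj_mat A $$ (rh,k) * E $$ (k,l) * adj_mat A $$ (l,rh))
   = (\<Sum>k<?n. \<Sum>l<?n. adj_mat A $$ (rh,k) * E $$ (k,l) * adj_mat A $$ (l,rh))" by (rule sum.swap)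
 finally show ?thesis unfolding d0 by (simp add: mult.commute)
qed

text \<open>A subset with at most \<open>rh\<close> elements is listed by a map on
  \<open>{..<rh}\<close>, with \<open>None\<close> filling the places that are left over.\<close>

lemma card_small_subsets_le:
 assumes "finite S"
 shows "card {J. J \<subseteq> S \<and> card J <= rh} <= (card S + 1) ^ rh"
proof -
 let ?O = "insert None (Some ` S)"
 let ?F = "PiE {..<rh} (%_. ?O)"
 let ?h = "%f. {a. Some a \<in> f ` {..<rh}}"
 have "{J. J \<subseteq> S \<and> card J <= rh} \<subseteq> ?h ` ?F"
 proof
  fix J assume "J \<in> {J. J \<subseteq> S \<and> card J <= rh}"
  hence J: "J \<subseteq> S" "card J <= rh" "finite J" using assms finite_subset by auto
  obtain g where g: "bij_betw g {..<card J} J"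
   using ex_bij_betw_nat_finite[OF J(3)] by (auto simp: lessThan_atLeast0)
  have gS: "g i \<in> S" if "i < card J" for i using g J that by (auto simp: bij_betw_def)
  define f where "f i = (if i < rh then if i < card J then Some (g i) else None else undefined)" for i
  have "f \<in> ?F" using gS by (auto simp: f_def PiE_def extensional_def)
  moreover have "?h f = J"
  proof
   show "?h f \<subseteq> J" using g by (auto simp: f_def bij_betw_def split: if_splits)
   show "J \<subseteq> ?h f"
   proof
    fix a assume "a \<in> J"
    hence "a \<in> g ` {..<card J}" using g by (simp add: bij_betw_def)
    then obtain i where i: "i < card J" "g i = a" by auto
    hence "f i = Some a" "i < rh" using J(2) by (auto simp: f_def)
    thus "a \<in> ?h f" by (auto intro!: rev_image_eqI[of i])
   qed
  qed
  ultimately show "J \<in> ?h ` ?F" by blast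
 qed
 moreover have fin: "finite ?F" using assms by (intro finite_PiE) auto
 ultimately have "card {J. J \<subseteq> S \<and> card J <= rh} <= card ?F"
  by (meson card_image_le card_mono finite_imageI order_trans)
 also have "card ?F = (card S + 1) ^ rh"
  using assms by (subst card_PiE) (auto simp: card_insert_if card_image)
 finally show ?thesis .
qed

section \<open>Minors of linear families of matrices\<close>

text \<open>The variables \<open>u\<close> will be entries of a random column and \<open>N a\<close>
  the matrix multiplied by the variable \<open>a\<close>. The index maps are arbitrary: a repeated
  index gives the value 0, which spares injectivity conditions.\<close>

definition minor :: "('i => nat => nat => real) => 'i set => nat => (nat => nat) => (nat => nat) => ('i => real) => real" where
 "minor N J rh f g u = det (mat rh rh (%(i,j). \<Sum>a\<in>J. u a * N a (f i) (g j)))"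

lemma minor_expand:
 assumes "finite J"
 shows "minor N J rh f g u = (\<Sum>ph\<in>PiE {0..<rh} (%_. J).
   \<Sum>pm\<in>{pm. pm permutes {0..<rh}}. signof pm * (\<Prod>i\<in>{0..<rh}. u (ph i) * N (ph i) (f i) (g (pm i))))"
proof -
 have "minor N J rh f g u = (\<Sum>pm\<in>{pm. pm permutes {0..<rh}}. signof pm * (\<Prod>i=0..<rh. \<Sum>a\<in>J. u a * N a (f i) (g (pm i))))"
  unfolding minor_def
  by (subst det_def'[of _ rh]) (auto intro!: sum.cong prod.cong simp: permutes_in_image[where S = "{0..<rh}", simplified])
 also have "... = (\<Sum>pm\<in>{pm. pm permutes {0..<rh}}. \<Sum>ph\<in>PiE {0..<rh} (%_. J).
    signof pm * (\<Prod>i\<in>{0..<rh}. u (ph i) * N (ph i) (f i) (g (pm i))))"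
  using assms by (subst prod_sum_PiE) (auto simp: sum_distrib_left)
 also have "... = (\<Sum>ph\<in>PiE {0..<rh} (%_. J). \<Sum>pm\<in>{pm. pm permutes {0..<rh}}.
    signof pm * (\<Prod>i\<in>{0..<rh}. u (ph i) * N (ph i) (f i) (g (pm i))))" by (rule sum.swap)
 finally show ?thesis .
qed

text \<open>
 A \<open>rh\<close>-minor is a form of degree \<open>rh\<close>, hence a combination of monomials that involve at most \<open>rh\<close> of
 the variables; Moebius inversion over the subsets of variables then controls it by its values
 with at most \<open>rh\<close> nonzero variables.
\<close>

lemma minor_bound_by_small_supports:
 assumes fin: "finite S" and B: "!!J. J \<subseteq> S ==> card J <= rh ==> \<bar>minor N J rh f g u\<bar> <= B"
 shows "\<bar>minor N S rh f g u\<bar> <= (2 * (real (card S) + 1)) ^ rh * B"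
proof -
 let ?R = "{0..<rh}"
 define w where "w ph = (\<Sum>pm\<in>{pm. pm permutes ?R}. signof pm * (\<Prod>i\<in>?R. u (ph i) * N (ph i) (f i) (g (pm i))))" for ph
 \<comment> \<open>The part of the form made of the monomials whose set of variables is exactly
   \<open>I\<close>; by \<open>h\<close> the minor on \<open>J\<close> is the sum of these parts
   over all subsets of \<open>J\<close>.\<close>
 define W where "W I = (\<Sum>ph\<in>{ph\<in>PiE ?R (%_. I). ph ` ?R = I}. w ph)" for I
 have h: "minor N J rh f g u = sum W (Pow J)" if J: "finite J" for J
 proof -
  have "minor N J rh f g u = (\<Sum>ph\<in>PiE ?R (%_. J). w ph)" using minor_expand[OF J] by (simp add: w_def)
  also have "PiE ?R (%_. J) = (\<Union>I\<in>Pow J. {ph\<in>PiE ?R (%_. I). ph ` ?R = I})"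
  proof (intro equalityI subsetI)
   fix ph assume "ph \<in> PiE ?R (%_. J)"
   hence "ph ` ?R \<in> Pow J" "ph \<in> PiE ?R (%_. ph ` ?R)" by (auto simp: PiE_def)
   thus "ph \<in> (\<Union>I\<in>Pow J. {ph\<in>PiE ?R (%_. I). ph ` ?R = I})" by blast
  qed (auto simp: PiE_def)
  also have "(\<Sum>ph\<in>.... w ph) = sum W (Pow J)"
   unfolding W_def using J
  proof (intro sum.UNION_disjoint ballI impI)
   fix I assume "I \<in> Pow J"
   hence "finite (PiE ?R (%_. I))" using J finite_subset by (intro finite_PiE) auto
   thus "finite {ph\<in>PiE ?R (%_. I). ph ` ?R = I}" by simp
  qed (use J in auto)
  finally show ?thesis .
 qed
 have W0: "W I = 0" if "finite I" "card I > rh" for I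
 proof -
  have "{ph\<in>PiE ?R (%_. I). ph ` ?R = I} = {}"
  proof -
   have "card (ph ` ?R) <= rh" for ph :: "nat => 'a" using card_image_le[of ?R ph] by simp
   hence "ph ` ?R \<noteq> I" for ph :: "nat => 'a" using that(2) by (metis not_le)
   thus ?thesis by blast
  qed
  thus ?thesis unfolding W_def by (simp only: sum.empty)
 qed
 have B0: "B \<ge> 0" using B[of "{}"] abs_ge_zero order_trans by (metis card.empty empty_subsetI zero_le)
 have WB: "\<bar>W I\<bar> <= 2 ^ rh * B" if I: "I \<subseteq> S" "card I <= rh" for I
 proof -
  have fI: "finite I" using I fin finite_subset by auto
  have "W I = (\<Sum>T\<in>Pow I. (-1) ^ (card I - card T) * minor N T rh f g u)"
   by (rule inclusion_exclusion_mobius[OF h fI])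
  hence "\<bar>W I\<bar> <= (\<Sum>T\<in>Pow I. \<bar>(-1) ^ (card I - card T) * minor N T rh f g u\<bar>)" by (simp only: sum_abs)
  also have "... <= (\<Sum>T\<in>Pow I. B)"
  proof (rule sum_mono)
   fix T assume "T \<in> Pow I"
   hence "T \<subseteq> S" "card T <= rh" using I card_mono[OF fI] by (auto intro: order_trans)
   thus "\<bar>(-1) ^ (card I - card T) * minor N T rh f g u\<bar> <= B" using B by (simp add: abs_mult power_abs)
  qed
  also have "... = 2 ^ card I * B" using fI by (simp add: card_Pow)
  also have "... <= 2 ^ rh * B" using I B0 by (intro mult_right_mono power_increasing) auto
  finally show ?thesis .
 qed
 have "minor N S rh f g u = sum W {J. J \<subseteq> S \<and> card J <= rh}"
  unfolding h[OF fin]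
 proof (rule sum.mono_neutral_right)
  show "\<forall>i\<in>Pow S - {J. J \<subseteq> S \<and> card J <= rh}. W i = 0"
  proof
   fix i assume "i \<in> Pow S - {J. J \<subseteq> S \<and> card J <= rh}"
   hence "i \<subseteq> S" "card i > rh" by auto
   thus "W i = 0" using W0 fin finite_subset by blast
  qed
 qed (use fin in auto)
 hence "\<bar>minor N S rh f g u\<bar> <= (\<Sum>J\<in>{J. J \<subseteq> S \<and> card J <= rh}. \<bar>W J\<bar>)" by (simp only: sum_abs)
 also have "... <= (\<Sum>J\<in>{J. J \<subseteq> S \<and> card J <= rh}. 2 ^ rh * B)" by (intro sum_mono WB) auto
 also have "... = real (card {J. J \<subseteq> S \<and> card J <= rh}) * (2 ^ rh * B)" by simp
 also have "... <= real ((card S + 1) ^ rh) * (2 ^ rh * B)"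
  using card_small_subsets_le[OF fin, of rh] B0
  by (intro mult_right_mono mult_nonneg_nonneg) (simp_all only: of_nat_le_iff zero_le_power zero_le_numeral)
 also have "... = (2 * (real (card S) + 1)) ^ rh * B" by (simp only: power_mult_distrib of_nat_power of_nat_add of_nat_1 ac_simps)
 finally show ?thesis .
qed

text \<open>The supremum runs over a whole cube of values because \<open>coeff_one_bound\<close>
  needs a bound along a segment of values of a new variable.\<close>

definition sup_minor :: "('i => nat => nat => real) => nat => nat => 'i set => real" where
 "sup_minor N c rh I = Sup {\<bar>minor N I rh f g u\<bar> |f g u. (\<forall>a. \<bar>u a\<bar> <= 1) \<and> (\<forall>i<rh. f i < c \<and> g i < c)}"

lemma minor_bdd:
 assumes "finite I"
 shows "\<exists>K. \<forall>f g u. (\<forall>a. \<bar>u a\<bar> <= 1) --> (\<forall>i<rh. f i < c \<and> g i < c) --> \<bar>minor N I rh f g u\<bar> <= K"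
proof -
 define Bn where "Bn = (\<Sum>a\<in>I. \<Sum>i<c. \<Sum>j<c. \<bar>N a i j\<bar>)"
 have entry: "\<bar>\<Sum>a\<in>I. u a * N a i j\<bar> <= Bn" if u: "\<forall>a. \<bar>u a\<bar> <= 1" and ij: "i < c" "j < c" for u i j
 proof -
  have "\<bar>\<Sum>a\<in>I. u a * N a i j\<bar> <= (\<Sum>a\<in>I. \<bar>u a * N a i j\<bar>)" by (rule sum_abs)
  also have "... <= (\<Sum>a\<in>I. \<Sum>i<c. \<Sum>j<c. \<bar>N a i j\<bar>)"
  proof (rule sum_mono)
   fix a
   have "\<bar>u a * N a i j\<bar> <= 1 * \<bar>N a i j\<bar>" unfolding abs_mult using u by (intro mult_right_mono) auto
   also have "... <= (\<Sum>j<c. \<bar>N a i j\<bar>)"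
    using ij member_le_sum[of j "{..<c}" "%j. \<bar>N a i j\<bar>"] by simp
   also have "... <= (\<Sum>i<c. \<Sum>j<c. \<bar>N a i j\<bar>)"
    using ij by (intro member_le_sum[of i "{..<c}" "%i. \<Sum>j<c. \<bar>N a i j\<bar>"]) (auto intro: sum_nonneg)
   finally show "\<bar>u a * N a i j\<bar> <= (\<Sum>i<c. \<Sum>j<c. \<bar>N a i j\<bar>)" .
  qed
  finally show ?thesis by (simp add: Bn_def)
 qed
 let ?K = "real (card {pm. pm permutes {0..<rh}}) * Bn ^ rh"
 show ?thesis
 proof (rule exI[of _ ?K], intro allI impI)
  fix f g :: "nat => nat" and u :: "'a => real"
  assume u: "\<forall>a. \<bar>u a\<bar> <= 1" and fg: "\<forall>i<rh. f i < c \<and> g i < c"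
  have "minor N I rh f g u = (\<Sum>pm\<in>{pm. pm permutes {0..<rh}}. signof pm * (\<Prod>i=0..<rh. \<Sum>a\<in>I. u a * N a (f i) (g (pm i))))"
   unfolding minor_def
   by (subst det_def'[of _ rh]) (auto intro!: sum.cong prod.cong simp: permutes_in_image[where S = "{0..<rh}", simplified])
  hence "\<bar>minor N I rh f g u\<bar> <= (\<Sum>pm\<in>{pm. pm permutes {0..<rh}}. \<bar>signof pm * (\<Prod>i=0..<rh. \<Sum>a\<in>I. u a * N a (f i) (g (pm i)))\<bar>)"
   by (simp only: sum_abs)
  also have "... <= (\<Sum>pm\<in>{pm. pm permutes {0..<rh}}. Bn ^ rh)"
  proof (rule sum_mono)
   fix pm assume "pm \<in> {pm. pm permutes {0..<rh}}"
   hence pm: "pm i < rh" if "i < rh" for i using that permutes_in_image[of pm "{0..<rh}" i] by auto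
   have "\<bar>signof pm * (\<Prod>i=0..<rh. \<Sum>a\<in>I. u a * N a (f i) (g (pm i)))\<bar>
     = (\<Prod>i=0..<rh. \<bar>\<Sum>a\<in>I. u a * N a (f i) (g (pm i))\<bar>)"
    by (simp add: abs_mult abs_prod sign_def)
   also have "... <= (\<Prod>i=0..<rh. Bn)" using fg pm by (intro prod_mono) (auto intro!: entry u)
   finally show "\<bar>signof pm * (\<Prod>i=0..<rh. \<Sum>a\<in>I. u a * N a (f i) (g (pm i)))\<bar> <= Bn ^ rh" by simp
  qed
  finally show "\<bar>minor N I rh f g u\<bar> <= ?K" by simp
 qed
qed

lemma sup_minor_upper:
 assumes "finite I" "!!a. \<bar>u a\<bar> <= 1" "!!i. i < rh ==> f i < c \<and> g i < c"
 shows "\<bar>minor N I rh f g u\<bar> <= sup_minor N c rh I"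
proof -
 obtain K where K: "\<forall>f g u. (\<forall>a. \<bar>u a\<bar> <= 1) --> (\<forall>i<rh. f i < c \<and> g i < c) --> \<bar>minor N I rh f g u\<bar> <= K"
  using minor_bdd[OF assms(1), of rh c N] by blast
 show ?thesis unfolding sup_minor_def
  by (rule cSup_upper) (use assms K in \<open>auto intro!: bdd_aboveI[of _ K]\<close>)
qed

lemma sup_minor_least:
 assumes "rh <= c" "!!f g u. (\<forall>a. \<bar>u a\<bar> <= 1) ==> (\<forall>i<rh. f i < c \<and> g i < c) ==> \<bar>minor N I rh f g u\<bar> <= K"
 shows "sup_minor N c rh I <= K"
 unfolding sup_minor_def
proof (rule cSup_least)
 have "\<forall>i<rh. i < c \<and> i < c" using assms(1) by auto
 thus "{\<bar>minor N I rh f g u\<bar> |f g u. (\<forall>a. \<bar>u a\<bar> <= 1) \<and> (\<forall>i<rh. f i < c \<and> g i < c)} \<noteq> {}"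
  by (auto intro!: exI[of _ "%i. i"] exI[of _ "%_. 0"])
qed (use assms(2) in auto)

lemma sup_minor_near:
 assumes "rh <= c" "x < sup_minor N c rh I"
 obtains f g u where "!!a. \<bar>u a\<bar> <= 1" "!!i. i < rh ==> f i < c \<and> g i < c" "x < \<bar>minor N I rh f g u\<bar>"
 using sup_minor_least[OF assms(1), of N I x] assms(2) by (meson leD not_le)

lemma sup_minor_nonneg:
 assumes "finite I" "rh <= c" shows "0 <= sup_minor N c rh I"
proof -
 have "\<bar>minor N I rh id id (%_. 0)\<bar> <= sup_minor N c rh I"
  by (rule sup_minor_upper[OF assms(1)]) (use assms(2) in auto)
 thus ?thesis by linarith
qed

lemma adj_mat_corner:
 "adj_mat (mat (Suc rh) (Suc rh) h) $$ (rh,rh) = det (mat rh rh h)"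
proof -
 have "mat_delete (mat (Suc rh) (Suc rh) h) rh rh = mat rh rh h" by (auto simp: mat_delete_def)
 thus ?thesis by (simp add: adj_mat_def cofactor_def flip: mult_2)
qed

lemma sum_rotate:
 "(\<Sum>j\<in>J. \<Sum>k\<in>K. \<Sum>l\<in>L. h j k l) = (\<Sum>k\<in>K. \<Sum>l\<in>L. \<Sum>j\<in>J. h j k l)"
proof -
 have "(\<Sum>j\<in>J. \<Sum>k\<in>K. \<Sum>l\<in>L. h j k l) = (\<Sum>k\<in>K. \<Sum>j\<in>J. \<Sum>l\<in>L. h j k l)" by (rule sum.swap)
 also have "... = (\<Sum>k\<in>K. \<Sum>l\<in>L. \<Sum>j\<in>J. h j k l)" by (rule sum.cong[OF refl], rule sum.swap)
 finally show ?thesis .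
qed

lemma exists_fresh_index:
 fixes f :: "nat => nat"
 assumes "rh < c" obtains i where "i < c" "i \<notin> f ` {..<rh}"
proof -
 have "card (f ` {..<rh}) <= rh" using card_image_le[of "{..<rh}" f] by simp
 hence "\<not> {..<c} \<subseteq> f ` {..<rh}" using assms card_mono[of "f ` {..<rh}" "{..<c}"] by auto
 thus ?thesis using that by auto
qed

text \<open>
 The vectors \<open>y\<close> and \<open>z\<close> are the last row and the last column of the adjugate of a bordered
 nearly maximal minor \<open>p\<close>, divided by \<open>p\<close>.  Along the new variable \<open>a\<close> the derivative of
 \<open>det / p\<close> is \<open>y\<^sup>T N\<^sub>a z\<close>; since polynomials that are bounded on \<open>[0,1]\<close> have bounded derivatives,
 a large \<open>y\<^sup>T N\<^sub>a z\<close> forces a large minor of the next size.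
\<close>

lemma growth_pair:
 fixes N :: "'i => nat => nat => real"
 assumes fin: "finite I" and rh: "rh < c" and pos: "0 < sup_minor N c rh I"
 shows "\<exists>y z. (\<exists>i<c. y i = (1::real)) \<and> (\<exists>j<c. z j = (1::real)) \<and>
  (\<forall>a Bd Bp. a \<notin> I --> sup_minor N c (Suc rh) (insert a I) <= Bd --> sup_minor N c rh (insert a I) <= Bp -->
    (sup_minor N c rh I)\<^sup>2 * \<bar>\<Sum>i<c. \<Sum>j<c. y i * N a i j * z j\<bar> <= 16 * (8 * real (Suc rh)) ^ rh * (Bd * Bp))"
proof -
 define F where "F = sup_minor N c rh I"
 have "F / 2 < F" using pos by (simp add: F_def)
 then obtain f g u where fgu: "!!a. \<bar>u a\<bar> <= 1" "!!i. i < rh ==> f i < c \<and> g i < c" "F / 2 < \<bar>minor N I rh f g u\<bar>"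
  unfolding F_def by (rule sup_minor_near[rotated]) (use rh in auto)
 define p0 where "p0 = minor N I rh f g u"
 have p0: "F / 2 < \<bar>p0\<bar>" "p0 \<noteq> 0" using fgu(3) pos by (auto simp: p0_def F_def)
 \<comment> \<open>A row outside the range of \<open>f\<close> borders the minor. It occurs only in
   the last place, so the entry of \<open>y\<close> at \<open>i0\<close> is the corner of the
   adjugate divided by itself, that is 1.\<close>
 obtain i0 where i0: "i0 < c" "i0 \<notin> f ` {..<rh}" by (rule exists_fresh_index[OF rh])
 obtain j0 where j0: "j0 < c" "j0 \<notin> g ` {..<rh}" by (rule exists_fresh_index[OF rh])
 define f' where "f' = f(rh := i0)"
 define g' where "g' = g(rh := j0)"
 have fg': "f' k < c" "g' k < c" if "k < Suc rh" for k
  using that fgu(2) i0(1) j0(1) by (auto simp: f'_def g'_def less_Suc_eq)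
 let ?n = "Suc rh"
 define hA where "hA = (%(k,l). \<Sum>a\<in>I. u a * N a (f' k) (g' l))"
 define A where "A = mat ?n ?n hA"
 have A: "A \<in> carrier_mat ?n ?n" by (simp add: A_def)
 have corner: "adj_mat A $$ (rh,rh) = p0"
  unfolding A_def adj_mat_corner p0_def minor_def hA_def
  by (intro arg_cong[of _ _ det] eq_matI) (auto simp: f'_def g'_def)
 \<comment> \<open>Written as a sum over positions, so that injectivity of \<open>f'\<close> does
   not have to be established.\<close>
 define y where "y b = (\<Sum>k<?n. if f' k = b then adj_mat A $$ (rh,k) / p0 else 0)" for b
 define z where "z b = (\<Sum>k<?n. if g' k = b then adj_mat A $$ (k,rh) / p0 else 0)" for b
 have y1: "y i0 = 1"
 proof -
  have "f' k \<noteq> i0" if "k < rh" for k using that i0(2) by (auto simp: f'_def)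
  hence "(\<Sum>k<rh. if f' k = i0 then adj_mat A $$ (rh,k) / p0 else 0) = 0" by (intro sum.neutral) auto
  thus ?thesis using p0(2) corner by (simp add: y_def f'_def)
 qed
 have z1: "z j0 = 1"
 proof -
  have "g' k \<noteq> j0" if "k < rh" for k using that j0(2) by (auto simp: g'_def)
  hence "(\<Sum>k<rh. if g' k = j0 then adj_mat A $$ (k,rh) / p0 else 0) = 0" by (intro sum.neutral) auto
  thus ?thesis using p0(2) corner by (simp add: z_def g'_def)
 qed
 have bound: "F\<^sup>2 * \<bar>\<Sum>i<c. \<Sum>j<c. y i * N a i j * z j\<bar> <= 16 * (8 * real ?n) ^ rh * (Bd * Bp)"
  if a: "a \<notin> I" and Bd: "sup_minor N c ?n (insert a I) <= Bd" and Bp: "sup_minor N c rh (insert a I) <= Bp" for a Bd Bp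
 proof -
  define E where "E = mat ?n ?n (%(k,l). N a (f' k) (g' l))"
  have E: "E \<in> carrier_mat ?n ?n" by (simp add: E_def)
  define hP where "hP = (%(k,l). [: A $$ (k,l), E $$ (k,l) :])"
  define P where "P = mat ?n ?n hP"
  have P: "P \<in> carrier_mat ?n ?n" by (simp add: P_def)
  define d where "d = det P"
  define p where "p = adj_mat P $$ (rh,rh)"
  have pdet: "p = det (mat rh rh hP)" unfolding p_def P_def by (rule adj_mat_corner)
  have id: "(\<Sum>k<?n. \<Sum>l<?n. adj_mat A $$ (rh,k) * E $$ (k,l) * adj_mat A $$ (l,rh))
    = coeff d 1 * poly p 0 - poly d 0 * coeff p 1"
   using adj_derivative_identity[OF A E] unfolding d_def p_def P_def hP_def .
  have ut: "\<bar>(u(a := t)) b\<bar> <= 1" if "0 <= t" "t <= 1" for t b using fgu(1) that by auto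
  have PA: "poly (hP (k,l)) t = (\<Sum>b\<in>insert a I. (u(a := t)) b * N b (f' k) (g' l))" if "k < ?n" "l < ?n" for k l t
  proof -
   have "(\<Sum>b\<in>insert a I. (u(a := t)) b * N b (f' k) (g' l)) = t * N a (f' k) (g' l) + (\<Sum>b\<in>I. (u(a := t)) b * N b (f' k) (g' l))"
    using fin a by simp
   also have "(\<Sum>b\<in>I. (u(a := t)) b * N b (f' k) (g' l)) = (\<Sum>b\<in>I. u b * N b (f' k) (g' l))"
    using a by (intro sum.cong) auto
   finally show ?thesis using that by (simp add: hP_def A_def E_def hA_def)
  qed
  have dt: "poly d t = minor N (insert a I) ?n f' g' (u(a := t))" for t
   unfolding d_def minor_def poly_det[OF P]
   by (intro arg_cong[of _ _ det] eq_matI) (auto simp: P_def PA)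
  have pt: "poly p t = minor N (insert a I) rh f g (u(a := t))" for t
   unfolding pdet minor_def poly_det[OF mat_carrier]
   by (intro arg_cong[of _ _ det] eq_matI) (auto simp: PA f'_def g'_def)
  have fin': "finite (insert a I)" using fin by simp
  have db: "\<bar>poly d t\<bar> <= Bd" if "0 <= t" "t <= 1" for t
   unfolding dt by (rule order_trans[OF sup_minor_upper[OF fin' ut[OF that]] Bd]) (use fg' in auto)
  have pb: "\<bar>poly p t\<bar> <= Bp" if "0 <= t" "t <= 1" for t
   unfolding pt by (rule order_trans[OF sup_minor_upper[OF fin' ut[OF that]] Bp]) (use fgu(2) in auto)
  have degP: "degree (hP kl) <= 1" for kl by (simp add: hP_def split_beta)
  have "degree d <= 1 * ?n" unfolding d_def by (rule degree_det_le[OF _ P]) (use degP in \<open>simp add: P_def\<close>)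
  hence dd: "degree d <= ?n" by simp
  have "degree p <= 1 * rh" unfolding pdet by (rule degree_det_le) (use degP in auto)
  hence dp: "degree p <= ?n" by simp
  have c1: "\<bar>coeff d 1\<bar> <= 2 * (8 * real ?n) ^ rh * Bd" using coeff_one_bound[OF dd _ order_refl, of Bd] db by simp
  have c2: "\<bar>coeff p 1\<bar> <= 2 * (8 * real ?n) ^ rh * Bp" using coeff_one_bound[OF dp _ order_refl, of Bp] pb by simp
  have Bd0: "0 <= Bd" and Bp0: "0 <= Bp" using db[of 0] pb[of 0] by auto
  have "(\<Sum>i<c. \<Sum>j<c. y i * N a i j * z j)
    = (\<Sum>k<?n. \<Sum>l<?n. (adj_mat A $$ (rh,k) / p0) * N a (f' k) (g' l) * (adj_mat A $$ (l,rh) / p0))"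
  proof -
   have "(\<Sum>i<c. \<Sum>j<c. y i * N a i j * z j)
     = (\<Sum>i<c. \<Sum>j<c. \<Sum>k<?n. \<Sum>l<?n. (if f' k = i \<and> g' l = j then (adj_mat A $$ (rh,k) / p0) * N a i j * (adj_mat A $$ (l,rh) / p0) else 0))"
   proof (intro sum.cong refl)
    fix i j
    have "y i * N a i j * z j = N a i j * (y i * z j)" by simp
    also have "y i * z j = (\<Sum>k<?n. \<Sum>l<?n. (if f' k = i then adj_mat A $$ (rh,k) / p0 else 0) * (if g' l = j then adj_mat A $$ (l,rh) / p0 else 0))"
     unfolding y_def z_def by (rule sum_product)
    also have "N a i j * (\<Sum>k<?n. \<Sum>l<?n. (if f' k = i then adj_mat A $$ (rh,k) / p0 else 0) * (if g' l = j then adj_mat A $$ (l,rh) / p0 else 0))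
     = (\<Sum>k<?n. \<Sum>l<?n. (if f' k = i \<and> g' l = j then (adj_mat A $$ (rh,k) / p0) * N a i j * (adj_mat A $$ (l,rh) / p0) else 0))"
     unfolding sum_distrib_left by (intro sum.cong refl) auto
    finally show "y i * N a i j * z j = (\<Sum>k<?n. \<Sum>l<?n. (if f' k = i \<and> g' l = j then (adj_mat A $$ (rh,k) / p0) * N a i j * (adj_mat A $$ (l,rh) / p0) else 0))" .
   qed
   also have "... = (\<Sum>i<c. \<Sum>k<?n. \<Sum>l<?n. \<Sum>j<c. (if f' k = i \<and> g' l = j then (adj_mat A $$ (rh,k) / p0) * N a i j * (adj_mat A $$ (l,rh) / p0) else 0))"
    by (rule sum.cong[OF refl], rule sum_rotate)
   also have "... = (\<Sum>k<?n. \<Sum>l<?n. \<Sum>i<c. \<Sum>j<c. (if f' k = i \<and> g' l = j then (adj_mat A $$ (rh,k) / p0) * N a i j * (adj_mat A $$ (l,rh) / p0) else 0))"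
    by (rule sum_rotate)
   also have "... = (\<Sum>k<?n. \<Sum>l<?n. (adj_mat A $$ (rh,k) / p0) * N a (f' k) (g' l) * (adj_mat A $$ (l,rh) / p0))"
   proof (intro sum.cong refl)
    fix k l assume "k \<in> {..<?n}" "l \<in> {..<?n}"
    hence kl: "f' k \<in> {..<c}" "g' l \<in> {..<c}" using fg' by auto
    let ?t = "%i j. (adj_mat A $$ (rh,k) / p0) * N a i j * (adj_mat A $$ (l,rh) / p0)"
    have "(\<Sum>i<c. \<Sum>j<c. (if f' k = i \<and> g' l = j then ?t i j else 0)) = (\<Sum>i<c. if f' k = i then ?t i (g' l) else 0)"
     using kl(2) by (intro sum.cong refl) auto
    also have "... = ?t (f' k) (g' l)" using kl(1) by simp
    finally show "(\<Sum>i<c. \<Sum>j<c. (if f' k = i \<and> g' l = j then ?t i j else 0)) = ?t (f' k) (g' l)" .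
   qed
   finally show ?thesis .
  qed
  also have "... = (\<Sum>k<?n. \<Sum>l<?n. adj_mat A $$ (rh,k) * E $$ (k,l) * adj_mat A $$ (l,rh)) / p0\<^sup>2"
   unfolding sum_divide_distrib
   by (intro sum.cong refl) (simp add: E_def power2_eq_square field_simps)
  finally have "p0\<^sup>2 * (\<Sum>i<c. \<Sum>j<c. y i * N a i j * z j) = coeff d 1 * poly p 0 - poly d 0 * coeff p 1"
   unfolding id using p0(2) by simp
  hence "p0\<^sup>2 * \<bar>\<Sum>i<c. \<Sum>j<c. y i * N a i j * z j\<bar> = \<bar>coeff d 1 * poly p 0 - poly d 0 * coeff p 1\<bar>"
   using abs_mult[of "p0\<^sup>2" "\<Sum>i<c. \<Sum>j<c. y i * N a i j * z j"] by (simp only: abs_power2)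
  also have "... <= \<bar>coeff d 1\<bar> * \<bar>poly p 0\<bar> + \<bar>poly d 0\<bar> * \<bar>coeff p 1\<bar>"
   using abs_triangle_ineq4[of "coeff d 1 * poly p 0" "poly d 0 * coeff p 1"] by (simp only: abs_mult)
  also have "... <= (2 * (8 * real ?n) ^ rh * Bd) * Bp + Bd * (2 * (8 * real ?n) ^ rh * Bp)"
   using c1 c2 db[of 0] pb[of 0] Bd0 Bp0 by (intro add_mono mult_mono) auto
  finally have 1: "p0\<^sup>2 * \<bar>\<Sum>i<c. \<Sum>j<c. y i * N a i j * z j\<bar> <= 4 * (8 * real ?n) ^ rh * (Bd * Bp)"
   by (simp add: algebra_simps)
  \<comment> \<open>\<open>p0\<close> is only known to exceed half of the supremum; this costs a
    factor 4 and explains the constant 16.\<close>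
  have "(F / 2)^2 <= p0\<^sup>2" using p0(1) pos by (subst power2_abs[symmetric], intro power_mono) (auto simp: F_def)
  hence "F\<^sup>2 <= 4 * p0\<^sup>2" by (simp add: power_divide)
  hence "F\<^sup>2 * \<bar>\<Sum>i<c. \<Sum>j<c. y i * N a i j * z j\<bar> <= 4 * p0\<^sup>2 * \<bar>\<Sum>i<c. \<Sum>j<c. y i * N a i j * z j\<bar>"
   by (intro mult_right_mono) auto
  thus ?thesis using 1 by linarith
 qed
 show ?thesis
 proof (rule exI[of _ y], rule exI[of _ z], intro conjI allI impI)
  show "\<exists>i<c. y i = 1" using y1 i0(1) by blast
  show "\<exists>j<c. z j = 1" using z1 j0(1) by blast
 qed (use bound in \<open>simp add: F_def\<close>)
qed

text \<open>By \<open>minor_bound_by_small_supports\<close> the supports with at most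
  \<open>rh\<close> variables determine the size of all \<open>rh\<close>-minors on \<open>S\<close>
  up to constants. A maximal one is therefore small, and there are few candidates for it in a union
  bound.\<close>

definition top_minor :: "('i => nat => nat => real) => nat => nat => 'i set => real" where
 "top_minor N c rh S = Max (sup_minor N c rh ` {I. I \<subseteq> S \<and> card I <= rh})"

lemma top_minor_upper:
 assumes "finite S" "I \<subseteq> S" "card I <= rh" shows "sup_minor N c rh I <= top_minor N c rh S"
 unfolding top_minor_def using assms by (intro Max_ge) auto

lemma top_minor_attained:
 assumes "finite S"
 obtains I where "I \<subseteq> S" "card I <= rh" "top_minor N c rh S = sup_minor N c rh I"
proof -
 have "{} \<in> {I. I \<subseteq> S \<and> card I <= rh}" by simp
 hence "top_minor N c rh S \<in> sup_minor N c rh ` {I. I \<subseteq> S \<and> card I <= rh}"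
  unfolding top_minor_def using assms by (intro Max_in) auto
 thus ?thesis using that by auto
qed

lemma top_minor_nonneg:
 assumes "finite S" "rh <= c" shows "0 <= top_minor N c rh S"
 using sup_minor_nonneg[of "{}" rh c N] top_minor_upper[OF assms(1), of "{}" rh N c] assms by simp

lemma top_minor_0:
 assumes "finite S" shows "1 <= top_minor N c 0 S"
proof -
 have "minor N {} 0 id id (%_. 0) = 1" by (simp add: minor_def det_dim_zero)
 hence "1 <= sup_minor N c 0 {}"
  using sup_minor_upper[of "{}" "%_. 0" 0 id c id N] by simp
 thus ?thesis using top_minor_upper[OF assms, of "{}" 0 N c] by simp
qed

lemma minor_le_top_minor:
 assumes "finite S" "!!a. \<bar>u a\<bar> <= 1" "!!i. i < rh ==> f i < c \<and> g i < c"
 shows "\<bar>minor N S rh f g u\<bar> <= (2 * (real (card S) + 1)) ^ rh * top_minor N c rh S"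
proof (rule minor_bound_by_small_supports[OF assms(1)])
 fix J assume J: "J \<subseteq> S" "card J <= rh"
 have "\<bar>minor N J rh f g u\<bar> <= sup_minor N c rh J"
  by (rule sup_minor_upper) (use assms J finite_subset in auto)
 also have "... <= top_minor N c rh S" by (rule top_minor_upper[OF assms(1) J])
 finally show "\<bar>minor N J rh f g u\<bar> <= top_minor N c rh S" .
qed

text \<open>The first factors are the loss in \<open>growth_pair\<close>; the last bounds the growth
  of the \<open>rh\<close>-minors when one variable joins a small support.\<close>

definition growth_const :: "nat => real" where
 "growth_const c = 16 * (8 * real c) ^ c * (2 * real c + 2) ^ c"

text \<open>
 The set \<open>T rh I\<close> depends on the variables in \<open>I\<close> only, so that the condition on a random
 support \<open>S\<close> can be handled by a union bound over the few small sets \<open>I\<close>.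
\<close>

lemma growth_sets:
 fixes N :: "'i => nat => nat => real"
 assumes fin: "finite Om" and th: "th > 0"
  and spread: "!!y z. \<exists>i<c. y i = 1 ==> \<exists>j<c. z j = 1 ==>
    k <= card {a\<in>Om. th <= \<bar>\<Sum>i<c. \<Sum>j<c. y i * N a i j * z j\<bar>}"
 obtains T :: "nat => 'i set => 'i set" where "!!rh I. rh < c ==> T rh I \<subseteq> Om \<and> k <= card (T rh I)"
  "!!S. S \<subseteq> Om ==> (!!rh I. rh < c ==> I \<subseteq> S ==> card I <= rh ==> (S - I) \<inter> T rh I \<noteq> {}) ==>
    (\<forall>rh<c. th * top_minor N c rh S <= growth_const c * top_minor N c (Suc rh) S)"
proof -
 \<comment> \<open>The conclusion of \<open>growth_pair\<close>, guarded so that a pair exists for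
   all \<open>rh\<close> and \<open>I\<close>. A choice function then makes the pair depend on these
   two alone, and not on the support \<open>S\<close>.\<close>
 let ?good = "%rh I y z. (\<exists>i<c. y i = (1::real)) \<and> (\<exists>j<c. z j = (1::real)) \<and> (finite I --> 0 < sup_minor N c rh I -->
  (\<forall>a Bd Bp. a \<notin> I --> sup_minor N c (Suc rh) (insert a I) <= Bd --> sup_minor N c rh (insert a I) <= Bp -->
    (sup_minor N c rh I)\<^sup>2 * \<bar>\<Sum>i<c. \<Sum>j<c. y i * N a i j * z j\<bar> <= 16 * (8 * real (Suc rh)) ^ rh * (Bd * Bp)))"
 have ex: "\<exists>y z. rh < c --> ?good rh I y z" for rh I
 proof (cases "rh < c \<and> finite I \<and> 0 < sup_minor N c rh I")
  case True
  hence "rh < c" "finite I" "0 < sup_minor N c rh I" by auto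
  from growth_pair[OF this(2,1,3)] obtain y where "\<exists>z. (\<exists>i<c. y i = 1) \<and> (\<exists>j<c. z j = (1::real)) \<and> (\<forall>a Bd Bp. a \<notin> I --> sup_minor N c (Suc rh) (insert a I) <= Bd --> sup_minor N c rh (insert a I) <= Bp -->
    (sup_minor N c rh I)\<^sup>2 * \<bar>\<Sum>i<c. \<Sum>j<c. y i * N a i j * z j\<bar> <= 16 * (8 * real (Suc rh)) ^ rh * (Bd * Bp))"
   by (rule exE)
  then obtain z where yz: "(\<exists>i<c. y i = 1) \<and> (\<exists>j<c. z j = (1::real)) \<and> (\<forall>a Bd Bp. a \<notin> I --> sup_minor N c (Suc rh) (insert a I) <= Bd --> sup_minor N c rh (insert a I) <= Bp -->
    (sup_minor N c rh I)\<^sup>2 * \<bar>\<Sum>i<c. \<Sum>j<c. y i * N a i j * z j\<bar> <= 16 * (8 * real (Suc rh)) ^ rh * (Bd * Bp))"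
   by (rule exE)
  show ?thesis
   by (rule exI[of _ y], rule exI[of _ z], intro impI conjI yz[THEN conjunct1] yz[THEN conjunct2, THEN conjunct1] yz[THEN conjunct2, THEN conjunct2])
 next
  case False
  thus ?thesis by (intro exI[of _ "%_. 1"]) auto
 qed
 have "\<forall>p. \<exists>q. fst p < c --> ?good (fst p) (snd p) (fst q) (snd q)"
 proof
  fix p
  from ex[of "fst p" "snd p"] obtain y where "\<exists>z. fst p < c --> ?good (fst p) (snd p) y z" by (rule exE)
  then obtain z where yz: "fst p < c --> ?good (fst p) (snd p) y z" by (rule exE)
  show "\<exists>q. fst p < c --> ?good (fst p) (snd p) (fst q) (snd q)"
   by (rule exI[of _ "(y,z)"], unfold fst_conv snd_conv, rule yz)
 qed
 from choice[OF this] obtain H where H: "\<forall>p. fst p < c --> ?good (fst p) (snd p) (fst (H p)) (snd (H p))" by (rule exE)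
 define Y where "Y rh I = fst (H (rh, I))" for rh I
 define Z where "Z rh I = snd (H (rh, I))" for rh I
 have YZ: "?good rh I (Y rh I) (Z rh I)" if "rh < c" for rh I
  unfolding Y_def Z_def by (rule H[rule_format, of "(rh, I)", unfolded fst_conv snd_conv, OF that])
 define T where "T rh I = {a\<in>Om. th <= \<bar>\<Sum>i<c. \<Sum>j<c. Y rh I i * N a i j * Z rh I j\<bar>}" for rh I
 have T1: "T rh I \<subseteq> Om \<and> k <= card (T rh I)" if "rh < c" for rh I
  using spread[of "Y rh I" "Z rh I"] YZ[OF that, of I] by (auto simp: T_def)
 have T2: "th * top_minor N c rh S <= growth_const c * top_minor N c (Suc rh) S"
  if S: "S \<subseteq> Om" and hit: "!!rh I. rh < c ==> I \<subseteq> S ==> card I <= rh ==> (S - I) \<inter> T rh I \<noteq> {}"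
   and rh: "rh < c" for S rh
 proof -
  have finS: "finite S" using S fin finite_subset by blast
  let ?F = "top_minor N c rh S" and ?D = "top_minor N c (Suc rh) S"
  have F0: "?F \<ge> 0" and D0: "?D \<ge> 0" using top_minor_nonneg[OF finS] rh by (auto simp: Suc_le_eq)
  obtain I where I: "I \<subseteq> S" "card I <= rh" "?F = sup_minor N c rh I" by (rule top_minor_attained[OF finS])
  have finI: "finite I" using I finS finite_subset by blast
  show ?thesis
  proof (cases "?F = 0")
   case True
   thus ?thesis using D0 by (simp add: growth_const_def)
  next
   case False
   hence Fpos: "?F > 0" using F0 by simp
   obtain a where a: "a \<in> S" "a \<notin> I" "a \<in> T rh I" using hit[OF rh I(1,2)] by blast
   have aI: "insert a I \<subseteq> S" "card (insert a I) <= Suc rh" "finite (insert a I)"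
    using a I finI by (auto simp: card_insert_if)
   have Bd: "sup_minor N c (Suc rh) (insert a I) <= ?D" by (rule top_minor_upper[OF finS aI(1,2)])
   \<comment> \<open>\<open>insert a I\<close> has at most \<open>c\<close> elements, and its
     subsets with at most \<open>rh\<close> elements are among the supports counted in
     \<open>?F\<close>.\<close>
   let ?K = "(2 * real c + 2) ^ c"
   have Bp: "sup_minor N c rh (insert a I) <= ?K * ?F"
   proof (rule sup_minor_least)
    fix f g :: "nat => nat" and u :: "'i => real"
    assume u: "\<forall>a. \<bar>u a\<bar> <= 1" and fg: "\<forall>i<rh. f i < c \<and> g i < c"
    have "\<bar>minor N (insert a I) rh f g u\<bar> <= (2 * (real (card (insert a I)) + 1)) ^ rh * ?F"
    proof (rule minor_bound_by_small_supports[OF aI(3)])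
     fix J assume J: "J \<subseteq> insert a I" "card J <= rh"
     have "\<bar>minor N J rh f g u\<bar> <= sup_minor N c rh J"
      by (rule sup_minor_upper[OF finite_subset[OF J(1) aI(3)]]) (use u fg in auto)
     also have "... <= ?F" by (rule top_minor_upper[OF finS _ J(2)]) (use J aI(1) in auto)
     finally show "\<bar>minor N J rh f g u\<bar> <= ?F" .
    qed
    also have "(2 * (real (card (insert a I)) + 1)) ^ rh <= (2 * real c + 2) ^ rh"
     using aI(2) rh by (intro power_mono) auto
    also have "... <= ?K" using rh by (intro power_increasing) auto
    finally show "\<bar>minor N (insert a I) rh f g u\<bar> <= ?K * ?F" using F0 by (simp add: mult_right_mono)
   qed (use rh in auto)
   \<comment> \<open>The estimate is quadratic in \<open>?F\<close>, but one factor
     \<open>?F\<close> comes back on the right through \<open>Bp\<close> and is cancelled.\<close>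
   have "?F\<^sup>2 * th <= ?F\<^sup>2 * \<bar>\<Sum>i<c. \<Sum>j<c. Y rh I i * N a i j * Z rh I j\<bar>"
    using a(3) by (intro mult_left_mono) (auto simp: T_def)
   also have "... <= 16 * (8 * real (Suc rh)) ^ rh * (?D * (?K * ?F))"
    using YZ[OF rh, of I] finI Fpos a(2) Bd Bp unfolding I(3) by blast
   also have "... <= 16 * (8 * real c) ^ c * (?D * (?K * ?F))"
   proof -
    have "(8 * real (Suc rh)) ^ rh <= (8 * real c) ^ rh" using rh by (intro power_mono) auto
    also have "... <= (8 * real c) ^ c" using rh by (intro power_increasing) auto
    finally show ?thesis using D0 F0 by (intro mult_right_mono mult_left_mono) auto
   qed
   finally have "?F * (th * ?F) <= ?F * (growth_const c * ?D)"
    by (simp add: growth_const_def power2_eq_square ac_simps)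
   thus ?thesis using Fpos by (rule mult_left_le_imp_le)
  qed
 qed
 show ?thesis by (rule that[of T]) (use T1 T2 in blast)+
qed

lemma growth_const_pos: "c > 0 ==> growth_const c > 0"
 by (simp add: growth_const_def)

text \<open>The growth starts from the empty minor, whose value is 1.\<close>

lemma top_minor_growth:
 assumes fin: "finite S" and th: "th > 0" and c: "c > 0"
  and g: "\<forall>rh<c. th * top_minor N c rh S <= growth_const c * top_minor N c (Suc rh) S"
  and rh: "rh <= c"
 shows "(th / growth_const c) ^ rh <= top_minor N c rh S"
 using rh
proof (induction rh)
 case 0
 thus ?case using top_minor_0[OF fin] by simp
next
 case (Suc rh)
 note K = growth_const_pos[OF c]
 have "(th / growth_const c) ^ Suc rh <= (th / growth_const c) * top_minor N c rh S"
  using mult_left_mono[OF Suc.IH, of "th / growth_const c"] Suc.prems th K by simp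
 also have "... <= top_minor N c (Suc rh) S" using g Suc.prems K by (simp add: field_simps)
 finally show ?case .
qed

text \<open>A repeated index makes the determinant vanish; otherwise the maps permute rows and
  columns and change at most the sign.\<close>

lemma det_index_le:
 fixes h :: "nat => nat => real"
 assumes fg: "!!i. i < c ==> f i < c \<and> g i < c"
 shows "\<bar>det (mat c c (%(i,j). h (f i) (g j)))\<bar> <= \<bar>det (mat c c (%(i,j). h i j))\<bar>"
proof -
 have rows: "\<bar>det (mat c c (%(i,j). h (f i) j))\<bar> <= \<bar>det (mat c c (%(i,j). h i j))\<bar>"
  if f: "!!i. i < c ==> f i < c" for f :: "nat => nat" and h :: "nat => nat => real"
 proof (cases "inj_on f {..<c}")
  case True
  define p where "p i = (if i < c then f i else i)" for i
  have "f ` {..<c} = {..<c}" using True f by (intro endo_inj_surj) auto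
  hence "bij_betw f {..<c} {..<c}" using True by (simp add: bij_betw_def)
  hence "bij_betw p {0..<c} {0..<c}" unfolding lessThan_atLeast0[symmetric]
   by (subst bij_betw_cong[of _ p f]) (auto simp: p_def)
  hence p: "p permutes {0..<c}" by (intro bij_imp_permutes) (auto simp: p_def)
  let ?A = "mat c c (%(i,j). h i j)"
  have "det (mat c c (%(i,j). ?A $$ (p i, j))) = signof p * det ?A"
   by (rule det_permute_rows[OF _ p]) simp
  also have "mat c c (%(i,j). ?A $$ (p i, j)) = mat c c (%(i,j). h (f i) j)"
   by (rule eq_matI) (auto simp: p_def f)
  finally show ?thesis by (simp add: abs_mult sign_def)
 next
  case False
  then obtain i i' where ii: "i < c" "i' < c" "i \<noteq> i'" "f i = f i'" by (auto simp: inj_on_def)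
  have "det (mat c c (%(i,j). h (f i) j)) = 0"
   by (rule Determinant.det_identical_rows[of _ c i i']) (use ii in auto)
  thus ?thesis by simp
 qed
 have tr: "det (mat c c (%(i,j). k j i)) = det (mat c c (%(i,j). k i j))" for k :: "nat => nat => real"
 proof -
  have "(mat c c (%(i,j). k i j))\<^sup>T = mat c c (%(i,j). k j i)" by (rule eq_matI) auto
  thus ?thesis using det_transpose[of "mat c c (%(i,j). k i j)" c] by simp
 qed
 have "\<bar>det (mat c c (%(i,j). h (f i) (g j)))\<bar> <= \<bar>det (mat c c (%(i,j). h i (g j)))\<bar>"
  using rows[of f "%i j. h i (g j)"] fg by simp
 also have "det (mat c c (%(i,j). h i (g j))) = det (mat c c (%(i,j). h j (g i)))" by (rule tr[symmetric])
 also have "\<bar>...\<bar> <= \<bar>det (mat c c (%(i,j). h j i))\<bar>" using rows[of g "%i j. h j i"] fg by simp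
 also have "det (mat c c (%(i,j). h j i)) = det (mat c c (%(i,j). h i j))" by (rule tr)
 finally show ?thesis .
qed

lemma top_minor_full:
 assumes fin: "finite S" and pos: "x < top_minor N c c S"
 obtains u where "!!a. \<bar>u a\<bar> <= 1" "!!a. a \<notin> S ==> u a = 0" "x < \<bar>minor N S c id id u\<bar>"
proof -
 obtain I where I: "I \<subseteq> S" "card I <= c" "top_minor N c c S = sup_minor N c c I" by (rule top_minor_attained[OF fin])
 obtain f g u where fgu: "!!a. \<bar>u a\<bar> <= 1" "!!i. i < c ==> f i < c \<and> g i < c" "x < \<bar>minor N I c f g u\<bar>"
  using sup_minor_near[OF order_refl pos[unfolded I(3)]] by metis
 define v where "v a = (if a \<in> I then u a else 0)" for a
 have "minor N S c id id v = minor N I c id id u"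
 proof -
  have "(\<Sum>a\<in>S. v a * N a i j) = (\<Sum>a\<in>I. u a * N a i j)" for i j
   using I(1) fin by (intro sum.mono_neutral_cong_right) (auto simp: v_def)
  thus ?thesis by (simp add: minor_def)
 qed
 moreover have "\<bar>minor N I c f g u\<bar> <= \<bar>minor N I c id id u\<bar>"
  unfolding minor_def using det_index_le[of c f g "%i j. \<Sum>a\<in>I. u a * N a i j"] fgu(2) by simp
 ultimately have "x < \<bar>minor N S c id id v\<bar>" using fgu(3) by linarith
 moreover have "\<bar>v a\<bar> <= 1" for a using fgu(1) by (simp add: v_def)
 moreover have "v a = 0" if "a \<notin> S" for a using that I(1) by (auto simp: v_def)
 ultimately show ?thesis by (intro that)
qed

section \<open>Anticoncentration for sparse Gaussian vectors\<close>

text \<open>At distance at least \<open>t\<close> from every complex root the value is at least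
  \<open>t ^ D\<close> times the leading coefficient. So a point of the set lies within
  \<open>t\<close> of the real part of one of at most \<open>D\<close> roots. If the coefficient of
  degree \<open>D\<close> is 0, the set is empty.\<close>

lemma small_values_measure:
 fixes q :: "real poly"
 assumes "degree q <= D" "t \<ge> 0"
 shows "emeasure lborel {ta. \<bar>poly q ta\<bar> < t ^ D * \<bar>coeff q D\<bar>} <= ennreal (2 * t * real D)"
proof (cases "coeff q D = 0")
 case False
 hence D: "degree q = D" using assms(1) le_degree[of q D] by simp
 let ?q = "map_poly complex_of_real q"
 have "?q \<noteq> 0" using False by auto
 then obtain A where A: "size A = degree ?q" "?q = Polynomial.smult (lead_coeff ?q) (\<Prod>x\<in>#A. [:-x, 1:])"
  using alg_closed_imp_factorization by metis
 have lc: "lead_coeff ?q = of_real (coeff q D)" using D by simp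
 have sz: "size A = D" using A(1) D by simp
 have val: "\<bar>poly q ta\<bar> = \<bar>coeff q D\<bar> * (\<Prod>x\<in>#A. cmod (of_real ta - x))" for ta
 proof -
  have "complex_of_real (poly q ta) = poly ?q (of_real ta)" by simp
  also have "... = of_real (coeff q D) * (\<Prod>x\<in>#A. of_real ta - x)"
   by (subst A(2), unfold lc) (simp add: poly_prod_mset)
  finally have "cmod (complex_of_real (poly q ta)) = \<bar>coeff q D\<bar> * cmod (\<Prod>x\<in>#A. of_real ta - x)"
   by (simp add: norm_mult)
  also have "cmod (\<Prod>x\<in>#A. of_real ta - x) = (\<Prod>x\<in>#A. cmod (of_real ta - x))"
   by (induction A) (auto simp: norm_mult)
  finally show ?thesis by simp
 qed
 have "{ta. \<bar>poly q ta\<bar> < t ^ D * \<bar>coeff q D\<bar>} \<subseteq> (\<Union>x\<in>set_mset A. {Re x - t..Re x + t})"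
 proof
  fix ta assume "ta \<in> {ta. \<bar>poly q ta\<bar> < t ^ D * \<bar>coeff q D\<bar>}"
  hence lt: "(\<Prod>x\<in>#A. cmod (of_real ta - x)) < t ^ D" using False by (simp add: val mult.commute)
  have "\<exists>x\<in>#A. cmod (of_real ta - x) < t"
  proof (rule ccontr)
   assume "\<not> (\<exists>x\<in>#A. cmod (of_real ta - x) < t)"
   hence "t ^ size A <= (\<Prod>x\<in>#A. cmod (of_real ta - x))"
    using assms(2) by (induction A) (auto intro!: mult_mono)
   thus False using lt sz by simp
  qed
  then obtain x where x: "x \<in># A" "cmod (of_real ta - x) < t" by blast
  have "\<bar>ta - Re x\<bar> <= cmod (of_real ta - x)" using abs_Re_le_cmod[of "of_real ta - x"] by simp
  hence "ta \<in> {Re x - t..Re x + t}" using x(2) by auto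
  thus "ta \<in> (\<Union>x\<in>set_mset A. {Re x - t..Re x + t})" using x(1) by blast
 qed
 hence "emeasure lborel {ta. \<bar>poly q ta\<bar> < t ^ D * \<bar>coeff q D\<bar>} <= emeasure lborel (\<Union>x\<in>set_mset A. {Re x - t..Re x + t})"
  by (rule emeasure_mono) auto
 also have "... <= (\<Sum>x\<in>set_mset A. emeasure lborel {Re x - t..Re x + t})"
  by (rule emeasure_subadditive_finite) auto
 also have "... = (\<Sum>x\<in>set_mset A. ennreal (2 * t))"
  using assms(2) by (intro sum.cong) auto
 also have "... = ennreal (real (card (set_mset A)) * (2 * t))"
  using assms(2) by (simp add: ennreal_mult ennreal_of_nat_eq_real_of_nat)
 also have "... <= ennreal (2 * t * real D)"
 proof (rule ennreal_leI)
  have "card (set_mset A) <= size A" by (simp add: size_multiset_overloaded_eq card_eq_sum sum_mono Suc_le_eq del: sum_constant)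
  thus "real (card (set_mset A)) * (2 * t) <= 2 * t * real D" using assms(2) sz by (simp add: mult.commute mult_left_mono)
 qed
 finally show ?thesis .
qed simp

section \<open>Gaussian product measures along lines\<close>

abbreviation gaussian :: "real measure" where
 "gaussian \<equiv> density lborel (%x. ennreal (std_normal_density x))"

lemma prob_space_gaussian: "prob_space gaussian"
 by (rule prob_space_normal_density) simp

text \<open>The Cameron-Martin formula in one variable.\<close>

lemma gaussian_translate:
 assumes [measurable]: "F \<in> borel_measurable borel"
 shows "(\<integral>\<^sup>+y. F y \<partial>gaussian) = (\<integral>\<^sup>+y. F (y + s) * ennreal (exp (- s * y - s\<^sup>2 / 2)) \<partial>gaussian)"
proof -
 have "(\<integral>\<^sup>+y. F y \<partial>gaussian) = (\<integral>\<^sup>+y. ennreal (std_normal_density y) * F y \<partial>lborel)"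
  by (subst nn_integral_density) auto
 also have "... = (\<integral>\<^sup>+y. ennreal (std_normal_density (s + y)) * F (s + y) \<partial>lborel)"
  by (subst nn_integral_real_affine[of _ 1 s]) auto
 also have "... = (\<integral>\<^sup>+y. ennreal (std_normal_density y) * (F (y + s) * ennreal (exp (- s * y - s\<^sup>2 / 2))) \<partial>lborel)"
 proof (rule nn_integral_cong)
  fix y :: real
  have "std_normal_density (s + y) = std_normal_density y * exp (- s * y - s\<^sup>2 / 2)"
   by (simp add: std_normal_density_def power2_sum mult_exp_exp[symmetric] exp_add[symmetric])
  thus "ennreal (std_normal_density (s + y)) * F (s + y) = ennreal (std_normal_density y) * (F (y + s) * ennreal (exp (- s * y - s\<^sup>2 / 2)))"
   by (simp add: ennreal_mult' ac_simps)
 qed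
 also have "... = (\<integral>\<^sup>+y. F (y + s) * ennreal (exp (- s * y - s\<^sup>2 / 2)) \<partial>gaussian)"
  by (subst nn_integral_density) auto
 finally show ?thesis .
qed

lemma product_gaussian: "product_sigma_finite (%_::'i. gaussian)"
 unfolding product_sigma_finite_def using prob_space_gaussian prob_space_imp_sigma_finite by blast

lemma product_gaussian_translate:
 fixes u :: "'i => real"
 assumes fin: "finite J" and F: "F \<in> borel_measurable (\<Pi>\<^sub>M i\<in>J. gaussian)"
 shows "(\<integral>\<^sup>+w. F w \<partial>(\<Pi>\<^sub>M i\<in>J. gaussian)) =
  (\<integral>\<^sup>+w. F (\<lambda>b\<in>J. w b + u b) * ennreal (exp (\<Sum>b\<in>J. - u b * w b - (u b)\<^sup>2 / 2)) \<partial>(\<Pi>\<^sub>M i\<in>J. gaussian))"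
 using fin F
proof (induction J arbitrary: F rule: finite_induct)
 case empty
 show ?case by (simp add: PiM_empty nn_integral_count_space_finite)
next
 case (insert i J)
 interpret product_sigma_finite "%_::'i. gaussian" by (rule product_gaussian)
 note [measurable] = insert.prems
 let ?e = "%J w. ennreal (exp (\<Sum>b\<in>J. - u b * w b - (u b)\<^sup>2 / 2))"
 have m2: "(%w. F (\<lambda>b\<in>insert i J. w b + u b) * ?e (insert i J) w) \<in> borel_measurable (\<Pi>\<^sub>M i\<in>insert i J. gaussian)"
  using insert by measurable
 have "(\<integral>\<^sup>+w. F w \<partial>(\<Pi>\<^sub>M i\<in>insert i J. gaussian)) = (\<integral>\<^sup>+y. (\<integral>\<^sup>+x. F (x(i := y)) \<partial>(\<Pi>\<^sub>M i\<in>J. gaussian)) \<partial>gaussian)"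
  by (rule product_nn_integral_insert_rev[OF insert(1,2,4)])
 also have "... = (\<integral>\<^sup>+y. (\<integral>\<^sup>+x. F (x(i := y + u i)) \<partial>(\<Pi>\<^sub>M i\<in>J. gaussian)) * ennreal (exp (- u i * y - (u i)\<^sup>2 / 2)) \<partial>gaussian)"
 proof (rule gaussian_translate)
  interpret finite_product_sigma_finite "%_::'i. gaussian" J by standard (rule insert(1))
  have "(%y. \<integral>\<^sup>+x. F (x(i := y)) \<partial>(\<Pi>\<^sub>M i\<in>J. gaussian)) \<in> borel_measurable gaussian" by measurable
  thus "(%y. \<integral>\<^sup>+x. F (x(i := y)) \<partial>(\<Pi>\<^sub>M i\<in>J. gaussian)) \<in> borel_measurable borel" by simp
 qed
 also have "... = (\<integral>\<^sup>+y. (\<integral>\<^sup>+x. F (\<lambda>b\<in>insert i J. (x(i := y)) b + u b) * ?e (insert i J) (x(i := y)) \<partial>(\<Pi>\<^sub>M i\<in>J. gaussian)) \<partial>gaussian)"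
 proof (rule nn_integral_cong)
  fix y :: real
  have my [measurable]: "(%x. F (x(i := y + u i))) \<in> borel_measurable (\<Pi>\<^sub>M i\<in>J. gaussian)" by measurable
  have "(\<integral>\<^sup>+x. F (x(i := y + u i)) \<partial>(\<Pi>\<^sub>M i\<in>J. gaussian)) = (\<integral>\<^sup>+x. F ((\<lambda>b\<in>J. x b + u b)(i := y + u i)) * ?e J x \<partial>(\<Pi>\<^sub>M i\<in>J. gaussian))"
   by (rule insert.IH[OF my])
  hence "(\<integral>\<^sup>+x. F (x(i := y + u i)) \<partial>(\<Pi>\<^sub>M i\<in>J. gaussian)) * ennreal (exp (- u i * y - (u i)\<^sup>2 / 2))
   = (\<integral>\<^sup>+x. F ((\<lambda>b\<in>J. x b + u b)(i := y + u i)) * ?e J x \<partial>(\<Pi>\<^sub>M i\<in>J. gaussian)) * ennreal (exp (- u i * y - (u i)\<^sup>2 / 2))"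
   by (rule arg_cong)
  also have "... = (\<integral>\<^sup>+x. F ((\<lambda>b\<in>J. x b + u b)(i := y + u i)) * ?e J x * ennreal (exp (- u i * y - (u i)\<^sup>2 / 2)) \<partial>(\<Pi>\<^sub>M i\<in>J. gaussian))"
   by (rule nn_integral_multc[symmetric]) measurable
  also have "... = (\<integral>\<^sup>+x. F (\<lambda>b\<in>insert i J. (x(i := y)) b + u b) * ?e (insert i J) (x(i := y)) \<partial>(\<Pi>\<^sub>M i\<in>J. gaussian))"
  proof (rule nn_integral_cong)
   fix x :: "'i => real"
   have 1: "(\<lambda>b\<in>insert i J. (x(i := y)) b + u b) = (\<lambda>b\<in>J. x b + u b)(i := y + u i)"
    using insert(2) by (auto simp: fun_eq_iff)
   have "(\<Sum>b\<in>J. - u b * (x(i := y)) b - (u b)\<^sup>2 / 2) = (\<Sum>b\<in>J. - u b * x b - (u b)\<^sup>2 / 2)"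
    using insert(2) by (intro sum.cong) auto
   hence 2: "?e (insert i J) (x(i := y)) = ?e J x * ennreal (exp (- u i * y - (u i)\<^sup>2 / 2))"
    using insert(1,2) by (simp add: exp_add ennreal_mult' mult.commute)
   show "F ((\<lambda>b\<in>J. x b + u b)(i := y + u i)) * ?e J x * ennreal (exp (- u i * y - (u i)\<^sup>2 / 2))
    = F (\<lambda>b\<in>insert i J. (x(i := y)) b + u b) * ?e (insert i J) (x(i := y))"
    unfolding 1 2 by (simp add: mult.assoc)
  qed
  finally show "(\<integral>\<^sup>+x. F (x(i := y + u i)) \<partial>(\<Pi>\<^sub>M i\<in>J. gaussian)) * ennreal (exp (- u i * y - (u i)\<^sup>2 / 2))
   = (\<integral>\<^sup>+x. F (\<lambda>b\<in>insert i J. (x(i := y)) b + u b) * ?e (insert i J) (x(i := y)) \<partial>(\<Pi>\<^sub>M i\<in>J. gaussian))" .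
 qed
 also have "... = (\<integral>\<^sup>+w. F (\<lambda>b\<in>insert i J. w b + u b) * ?e (insert i J) w \<partial>(\<Pi>\<^sub>M i\<in>insert i J. gaussian))"
  by (rule product_nn_integral_insert_rev[OF insert(1,2) m2, symmetric])
 finally show ?case .
qed

text \<open>
 For fixed \<open>w\<close> the density along a line in direction \<open>u\<close> is that of a normal distribution
 with precision \<open>ka = 1 + \<Sum> (u b)\<^sup>2\<close>, up to normalisation; its supremum is therefore at most
 \<open>sqrt (ka / (2 * pi))\<close> times its integral.
\<close>

lemma gaussian_slice:
 fixes u :: "'i => real"
 assumes fin: "finite I" and a0: "a0 \<in> I" and u0: "u a0 = 1" and u1: "!!b. \<bar>u b\<bar> <= 1"
  and E: "E \<in> sets (\<Pi>\<^sub>M i\<in>I. gaussian)"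
  and slice: "!!w. emeasure lborel {ta. (\<lambda>b\<in>I. w b + ta * u b) \<in> E} <= ennreal l" and l0: "l \<ge> 0"
 shows "emeasure (\<Pi>\<^sub>M i\<in>I. gaussian) E <= ennreal (real (card I) * l)"
proof -
 interpret product_sigma_finite "%_::'i. gaussian" by (rule product_gaussian)
 interpret prob_space gaussian by (rule prob_space_gaussian)
 define J where "J = I - {a0}"
 have finJ: "finite J" and a0J: "a0 \<notin> J" and IJ: "I = insert a0 J" using fin a0 by (auto simp: J_def)
 interpret fJ: finite_product_sigma_finite "%_::'i. gaussian" J by standard (rule finJ)
 interpret fI: finite_product_prob_space "%_::'i. gaussian" I by standard (rule fin)
 define ka where "ka = 1 + (\<Sum>b\<in>J. (u b)^2)"
 have ka1: "ka \<ge> 1" by (simp add: ka_def sum_nonneg)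
 have kaI: "ka <= real (card I)"
 proof -
  have "(\<Sum>b\<in>J. (u b)^2) <= (\<Sum>b\<in>J. 1)" using u1 by (intro sum_mono) (simp add: abs_square_le_1)
  thus ?thesis using finJ a0J by (simp add: ka_def IJ)
 qed
 define B where "B w = (\<Sum>b\<in>J. u b * w b)" for w
 define ps where "ps w ta = std_normal_density ta * exp (\<Sum>b\<in>J. - (ta * u b) * w b - (ta * u b)\<^sup>2 / 2)" for w ta
 define C where "C w = exp ((B w)^2 / (2 * ka)) / sqrt ka" for w
 \<comment> \<open>Completing the square in \<open>ta\<close>.\<close>
 have psC: "ps w ta = C w * normal_density (- B w / ka) (1 / sqrt ka) ta" for w ta
 proof -
  have "(\<Sum>b\<in>J. - (ta * u b) * w b - (ta * u b)\<^sup>2 / 2) = - ta * B w - ta\<^sup>2 * (ka - 1) / 2"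
   by (simp add: B_def ka_def sum_subtractf sum_distrib_left sum_negf power_mult_distrib sum_divide_distrib mult.assoc)
  hence "ps w ta = 1 / sqrt (2 * pi) * (exp (- ta\<^sup>2 / 2) * exp (- ta * B w - ta\<^sup>2 * (ka - 1) / 2))"
   by (simp add: ps_def std_normal_density_def)
  also have "exp (- ta\<^sup>2 / 2) * exp (- ta * B w - ta\<^sup>2 * (ka - 1) / 2) = exp (- ta\<^sup>2 / 2 + (- ta * B w - ta\<^sup>2 * (ka - 1) / 2))"
   by (rule mult_exp_exp)
  also have "- ta\<^sup>2 / 2 + (- ta * B w - ta\<^sup>2 * (ka - 1) / 2) = (B w)^2 / (2 * ka) + - (ta - - B w / ka)\<^sup>2 / (2 * (1 / sqrt ka)^2)"
   using ka1 by (simp add: power2_eq_square field_simps)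
  also have "exp ((B w)^2 / (2 * ka) + - (ta - - B w / ka)\<^sup>2 / (2 * (1 / sqrt ka)^2))
    = exp ((B w)^2 / (2 * ka)) * exp (- (ta - - B w / ka)\<^sup>2 / (2 * (1 / sqrt ka)^2))" by (rule exp_add)
  also have "1 / sqrt (2 * pi) * ... = C w * normal_density (- B w / ka) (1 / sqrt ka) ta"
   using ka1 by (simp add: C_def normal_density_def real_sqrt_divide real_sqrt_mult power_divide)
  finally show ?thesis .
 qed
 have psbound: "ps w ta <= C w * ka" for w ta
 proof -
  have "normal_density (- B w / ka) (1 / sqrt ka) ta = sqrt ka / sqrt (2 * pi) * exp (- (ta - - B w / ka)\<^sup>2 / (2 * (1 / sqrt ka)^2))"
   using ka1 by (simp add: normal_density_def power_divide real_sqrt_divide)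
  also have "... <= sqrt ka / sqrt (2 * pi) * 1"
   using ka1 by (intro mult_left_mono) auto
  also have "... <= sqrt ka" using ka1 pi_gt3 by (simp add: divide_le_eq)
  also have "... <= ka" using ka1 by (simp add: sqrt_le_D real_le_lsqrt power2_eq_square)
  finally show ?thesis unfolding psC using ka1 by (intro mult_left_mono) (auto simp: C_def)
 qed
 have psint: "(\<integral>\<^sup>+ta. ennreal (ps w ta) \<partial>lborel) = ennreal (C w)" for w
 proof -
  interpret nd: prob_space "density lborel (%x. ennreal (normal_density (- B w / ka) (1 / sqrt ka) x))"
   by (rule prob_space_normal_density) (use ka1 in simp)
  have "(\<integral>\<^sup>+ta. ennreal (normal_density (- B w / ka) (1 / sqrt ka) ta) \<partial>lborel) = 1"
   using nd.emeasure_space_1 by (simp add: emeasure_density)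
  moreover have "(\<integral>\<^sup>+ta. ennreal (ps w ta) \<partial>lborel) = ennreal (C w) * (\<integral>\<^sup>+ta. ennreal (normal_density (- B w / ka) (1 / sqrt ka) ta) \<partial>lborel)"
  proof -
   have "C w \<ge> 0" using ka1 by (simp add: C_def)
   thus ?thesis unfolding psC by (subst nn_integral_cmult[symmetric]) (auto simp: ennreal_mult')
  qed
  ultimately show ?thesis by simp
 qed
 \<comment> \<open>Fubini along lines: fix the coordinate \<open>a0\<close> at \<open>ta\<close>,
   shift every other coordinate by \<open>ta * u b\<close>, and exchange the integrals. The points
   \<open>w(a0 := 0)\<close> then parametrise the lines of direction \<open>u\<close>.\<close>
 have main: "(\<integral>\<^sup>+x. F x \<partial>(\<Pi>\<^sub>M i\<in>I. gaussian)) =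
   (\<integral>\<^sup>+w. (\<integral>\<^sup>+ta. F (\<lambda>b\<in>I. (w(a0 := 0)) b + ta * u b) * ennreal (ps w ta) \<partial>lborel) \<partial>(\<Pi>\<^sub>M i\<in>J. gaussian))"
  if F[measurable]: "F \<in> borel_measurable (\<Pi>\<^sub>M i\<in>I. gaussian)" for F :: "('i => real) => ennreal"
 proof -
  let ?P = "\<Pi>\<^sub>M i\<in>J. gaussian"
  let ?e = "%w ta. ennreal (exp (\<Sum>b\<in>J. - (ta * u b) * w b - (ta * u b)\<^sup>2 / 2))"
  have F': "F \<in> borel_measurable (\<Pi>\<^sub>M i\<in>insert a0 J. gaussian)" using F by (simp add: IJ)
  have [measurable]: "(%x. F (x(a0 := ta))) \<in> borel_measurable ?P" for ta using F' by measurable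
  have eqf: "(\<lambda>b\<in>J. w b + ta * u b)(a0 := ta) = (\<lambda>b\<in>I. (w(a0 := 0)) b + ta * u b)" for w ta
   using u0 a0J by (auto simp: IJ fun_eq_iff)
  have mI: "(%p. (\<lambda>b\<in>I. ((snd p)(a0 := 0)) b + fst p * u b)) \<in> measurable (gaussian \<Otimes>\<^sub>M ?P) (\<Pi>\<^sub>M i\<in>I. gaussian)"
  proof (rule measurable_restrict)
   fix b assume "b \<in> I"
   show "(%p. ((snd p)(a0 := 0)) b + fst p * u b) \<in> measurable (gaussian \<Otimes>\<^sub>M ?P) gaussian"
   proof (cases "b = a0")
    case False
    hence "b \<in> J" using \<open>b \<in> I\<close> by (simp add: J_def)
    hence "(%p. snd p b) \<in> measurable (gaussian \<Otimes>\<^sub>M ?P) gaussian" by measurable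
    thus ?thesis using False by simp
   qed simp
  qed
  have mF: "(%p. F (\<lambda>b\<in>I. ((snd p)(a0 := 0)) b + fst p * u b)) \<in> borel_measurable (gaussian \<Otimes>\<^sub>M ?P)"
   using measurable_compose[OF mI F] .
  have me: "(%p. ?e (snd p) (fst p)) \<in> borel_measurable (gaussian \<Otimes>\<^sub>M ?P)"
   by measurable
  have mFe: "(%p. F (\<lambda>b\<in>I. ((snd p)(a0 := 0)) b + fst p * u b) * ?e (snd p) (fst p)) \<in> borel_measurable (gaussian \<Otimes>\<^sub>M ?P)"
   using mF me by measurable
  have "(\<integral>\<^sup>+x. F x \<partial>(\<Pi>\<^sub>M i\<in>I. gaussian)) = (\<integral>\<^sup>+ta. (\<integral>\<^sup>+w. F (w(a0 := ta)) \<partial>?P) \<partial>gaussian)"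
   unfolding IJ by (rule product_nn_integral_insert_rev[OF finJ a0J F'])
  also have "... = (\<integral>\<^sup>+ta. (\<integral>\<^sup>+w. F (\<lambda>b\<in>I. (w(a0 := 0)) b + ta * u b) * ?e w ta \<partial>?P) \<partial>gaussian)"
  proof (rule nn_integral_cong)
   fix ta :: real
   have "(%w. F (w(a0 := ta))) \<in> borel_measurable ?P" by measurable
   from product_gaussian_translate[OF finJ this, of "%b. ta * u b"]
   show "(\<integral>\<^sup>+w. F (w(a0 := ta)) \<partial>?P) = (\<integral>\<^sup>+w. F (\<lambda>b\<in>I. (w(a0 := 0)) b + ta * u b) * ?e w ta \<partial>?P)"
    unfolding eqf .
  qed
  also have "... = (\<integral>\<^sup>+w. (\<integral>\<^sup>+ta. F (\<lambda>b\<in>I. (w(a0 := 0)) b + ta * u b) * ?e w ta \<partial>gaussian) \<partial>?P)"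
  proof -
   interpret ps: pair_sigma_finite gaussian ?P ..
   show ?thesis using ps.Fubini'[of "%ta w. F (\<lambda>b\<in>I. (w(a0 := 0)) b + ta * u b) * ?e w ta"] mFe by (simp add: split_beta')
  qed
  also have "... = (\<integral>\<^sup>+w. (\<integral>\<^sup>+ta. F (\<lambda>b\<in>I. (w(a0 := 0)) b + ta * u b) * ennreal (ps w ta) \<partial>lborel) \<partial>?P)"
  proof (rule nn_integral_cong)
   fix w assume w: "w \<in> space ?P"
   have "(%ta. (ta, w)) \<in> measurable gaussian (gaussian \<Otimes>\<^sub>M ?P)" using w by simp
   from measurable_compose[OF this mFe]
   have m: "(%ta. F (\<lambda>b\<in>I. (w(a0 := 0)) b + ta * u b) * ?e w ta) \<in> borel_measurable lborel" by simp
   have "(\<integral>\<^sup>+ta. F (\<lambda>b\<in>I. (w(a0 := 0)) b + ta * u b) * ?e w ta \<partial>gaussian)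
    = (\<integral>\<^sup>+ta. ennreal (std_normal_density ta) * (F (\<lambda>b\<in>I. (w(a0 := 0)) b + ta * u b) * ?e w ta) \<partial>lborel)"
    by (rule nn_integral_density) (use m in auto)
   thus "(\<integral>\<^sup>+ta. F (\<lambda>b\<in>I. (w(a0 := 0)) b + ta * u b) * ?e w ta \<partial>gaussian)
    = (\<integral>\<^sup>+ta. F (\<lambda>b\<in>I. (w(a0 := 0)) b + ta * u b) * ennreal (ps w ta) \<partial>lborel)"
    by (simp add: ps_def ennreal_mult' ac_simps)
  qed
  finally show ?thesis .
 qed
 \<comment> \<open>Applying \<open>main\<close> to the constant 1 gives the total mass of the
   factors \<open>C\<close> without computing any integral of them.\<close>
 have total: "(\<integral>\<^sup>+w. ennreal (C w) \<partial>(\<Pi>\<^sub>M i\<in>J. gaussian)) = 1"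
  using main[of "%_. 1"] fI.emeasure_space_1 by (simp add: psint)
 have Esl: "{ta. (\<lambda>b\<in>I. w b + ta * u b) \<in> E} \<in> sets lborel" for w
 proof -
  have "(%ta. (\<lambda>b\<in>I. w b + ta * u b)) \<in> measurable borel (\<Pi>\<^sub>M i\<in>I. gaussian)" by (rule measurable_restrict) measurable
  from measurable_sets[OF this E] show ?thesis by (simp add: vimage_def)
 qed
 have "emeasure (\<Pi>\<^sub>M i\<in>I. gaussian) E = (\<integral>\<^sup>+x. indicator E x \<partial>(\<Pi>\<^sub>M i\<in>I. gaussian))" using E by simp
 also have "... = (\<integral>\<^sup>+w. (\<integral>\<^sup>+ta. indicator E (\<lambda>b\<in>I. (w(a0 := 0)) b + ta * u b) * ennreal (ps w ta) \<partial>lborel) \<partial>(\<Pi>\<^sub>M i\<in>J. gaussian))"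
  by (rule main) (use E in simp)
 also have "... <= (\<integral>\<^sup>+w. ennreal (C w) * ennreal (ka * l) \<partial>(\<Pi>\<^sub>M i\<in>J. gaussian))"
 proof (rule nn_integral_mono)
  fix w
  let ?S = "{ta. (\<lambda>b\<in>I. (w(a0 := 0)) b + ta * u b) \<in> E}"
  have "(\<integral>\<^sup>+ta. indicator E (\<lambda>b\<in>I. (w(a0 := 0)) b + ta * u b) * ennreal (ps w ta) \<partial>lborel)
    <= (\<integral>\<^sup>+ta. ennreal (C w * ka) * indicator ?S ta \<partial>lborel)"
   by (intro nn_integral_mono) (auto simp: indicator_def intro!: ennreal_leI psbound)
  also have "... = ennreal (C w * ka) * emeasure lborel ?S" using Esl by (rule nn_integral_cmult_indicator)
  also have "... <= ennreal (C w * ka) * ennreal l" by (intro mult_left_mono slice) simp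
  also have "... = ennreal (C w) * ennreal (ka * l)"
  proof -
   have "C w \<ge> 0" using ka1 by (simp add: C_def)
   thus ?thesis using ka1 l0 by (simp add: ennreal_mult mult.assoc)
  qed
  finally show "(\<integral>\<^sup>+ta. indicator E (\<lambda>b\<in>I. (w(a0 := 0)) b + ta * u b) * ennreal (ps w ta) \<partial>lborel) <= ennreal (C w) * ennreal (ka * l)" .
 qed
 also have "... = ennreal (ka * l)"
 proof -
  have "(%w. ennreal (C w)) \<in> borel_measurable (\<Pi>\<^sub>M i\<in>J. gaussian)" unfolding C_def B_def by measurable
  thus ?thesis by (subst nn_integral_multc) (simp_all add: total)
 qed
 also have "... <= ennreal (real (card I) * l)" using kaI l0 by (intro ennreal_leI mult_right_mono)
 finally show ?thesis .
qed

section \<open>Sparse Gaussian vectors as mixtures over supports\<close>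

lemma sets_sparse_gaussian [simp, measurable_cong]: "sets (sparse_gaussian p) = sets borel"
 by (simp add: sparse_gaussian_def)

lemma space_sparse_gaussian [simp]: "space (sparse_gaussian p) = UNIV"
 by (simp add: sparse_gaussian_def)

lemma nn_integral_sparse_gaussian:
 assumes p: "0 <= p" "p <= 1" and F[measurable]: "F \<in> borel_measurable borel"
 shows "(\<integral>\<^sup>+x. F x \<partial>sparse_gaussian p) = ennreal p * (\<integral>\<^sup>+x. F x \<partial>gaussian) + ennreal (1 - p) * F 0"
proof -
 interpret N: prob_space gaussian by (rule prob_space_gaussian)
 let ?M = "measure_pmf (bernoulli_pmf p)"
 have m: "(%x. F (case x of (b, z) => if b then z else 0)) \<in> borel_measurable (?M \<Otimes>\<^sub>M gaussian)"
  by (rule measurable_compose[OF measurable_sparse_gaussian_map F])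
 have "(\<integral>\<^sup>+x. F x \<partial>sparse_gaussian p) = (\<integral>\<^sup>+x. F (case x of (b, z) => if b then z else 0) \<partial>(?M \<Otimes>\<^sub>M gaussian))"
  unfolding sparse_gaussian_def by (rule nn_integral_distr[OF measurable_sparse_gaussian_map]) simp
 also have "... = (\<integral>\<^sup>+b. (\<integral>\<^sup>+z. F (if b then z else 0) \<partial>gaussian) \<partial>?M)"
  using N.nn_integral_fst[OF m] by simp
 also have "... = (\<integral>\<^sup>+z. F z \<partial>gaussian) * ennreal p + F 0 * ennreal (1 - p)"
  using p N.emeasure_space_1 by (simp add: nn_integral_bernoulli_pmf)
 finally show ?thesis by (simp add: mult.commute)
qed

lemma product_sparse: "product_prob_space (%_::'i. sparse_gaussian p)"
 by (intro product_prob_spaceI prob_space_sparse_gaussian)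

text \<open>The probability that exactly the coordinates in \<open>S\<close> are switched
  on.\<close>

definition support_weight :: "real => 'i set => 'i set => real" where
 "support_weight p I S = p ^ card S * (1 - p) ^ card (I - S)"

lemma sum_Pow_insert:
 fixes f :: "'i set => 'b::comm_monoid_add"
 assumes "finite I" "i \<notin> I"
 shows "(\<Sum>S\<in>Pow (insert i I). f S) = (\<Sum>S\<in>Pow I. f (insert i S)) + (\<Sum>S\<in>Pow I. f S)"
proof -
 have "inj_on (insert i) (Pow I)" using assms(2) by (auto simp: inj_on_def)
 hence "(\<Sum>S\<in>insert i ` Pow I. f S) = (\<Sum>S\<in>Pow I. f (insert i S))" by (simp add: sum.reindex)
 moreover have "(\<Sum>S\<in>Pow (insert i I). f S) = (\<Sum>S\<in>Pow I. f S) + (\<Sum>S\<in>insert i ` Pow I. f S)"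
  unfolding Pow_insert using assms by (intro sum.union_disjoint) auto
 ultimately show ?thesis by (simp add: add.commute)
qed

lemma support_weight_insert:
 assumes "finite I" "i \<notin> I" "S \<subseteq> I"
 shows "support_weight p (insert i I) (insert i S) = p * support_weight p I S"
  "support_weight p (insert i I) S = (1 - p) * support_weight p I S"
proof -
 have fS: "finite S" "i \<notin> S" using assms finite_subset by auto
 have "insert i I - insert i S = I - S" using assms by auto
 thus "support_weight p (insert i I) (insert i S) = p * support_weight p I S"
  using fS by (simp add: support_weight_def)
 have "insert i I - S = insert i (I - S)" using assms by auto
 thus "support_weight p (insert i I) S = (1 - p) * support_weight p I S"
  using assms by (simp add: support_weight_def)
qed

lemma sum_support_weight:
 assumes "finite I" shows "(\<Sum>S\<in>Pow I. support_weight p I S) = 1"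
 using assms
proof (induction I rule: finite_induct)
 case (insert i I)
 have "(\<Sum>S\<in>Pow (insert i I). support_weight p (insert i I) S)
   = (\<Sum>S\<in>Pow I. p * support_weight p I S) + (\<Sum>S\<in>Pow I. (1 - p) * support_weight p I S)"
  unfolding sum_Pow_insert[OF insert(1,2)] by (intro arg_cong2[of _ _ _ _ "(+)"] sum.cong) (auto simp: support_weight_insert insert)
 thus ?case using insert.IH by (simp add: sum_distrib_left[symmetric])
qed (simp add: support_weight_def)

lemma sum_support_weight_avoid:
 assumes "finite I" "T \<subseteq> I"
 shows "(\<Sum>S\<in>{S. S \<subseteq> I \<and> S \<inter> T = {}}. support_weight p I S) = (1 - p) ^ card T"
proof -
 have "{S. S \<subseteq> I \<and> S \<inter> T = {}} = Pow (I - T)" by auto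
 moreover have "support_weight p I S = (1 - p) ^ card T * support_weight p (I - T) S" if "S \<in> Pow (I - T)" for S
 proof -
  have "I - S = (I - T - S) \<union> T" using that assms by auto
  hence "card (I - S) = card (I - T - S) + card T"
   using assms finite_subset by (subst card_Un_disjoint[symmetric]) auto
  thus ?thesis by (simp add: support_weight_def power_add)
 qed
 ultimately show ?thesis
  using sum_support_weight[of "I - T" p] assms by (simp add: sum_distrib_left[symmetric])
qed

lemma sets_PiM_gaussian: "sets (\<Pi>\<^sub>M i\<in>I. gaussian) = sets (\<Pi>\<^sub>M i\<in>I. (borel :: real measure))"
 by (intro sets_PiM_cong) auto

lemma sets_PiM_sparse: "sets (\<Pi>\<^sub>M i\<in>I. sparse_gaussian p) = sets (\<Pi>\<^sub>M i\<in>I. (borel :: real measure))"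
 by (intro sets_PiM_cong) auto

lemma mask_measurable:
 "(%z. \<lambda>a\<in>I. if a \<in> S then z a else 0) \<in> measurable (\<Pi>\<^sub>M i\<in>I. (borel :: real measure)) (\<Pi>\<^sub>M i\<in>I. (borel :: real measure))"
proof (rule measurable_restrict)
 fix a assume "a \<in> I"
 thus "(%z. if a \<in> S then z a else 0) \<in> measurable (\<Pi>\<^sub>M i\<in>I. (borel :: real measure)) borel" by measurable
qed

text \<open>Conditioning on the support, one coordinate at a time: a new coordinate joins the
  support with weight \<open>p\<close> or is frozen at 0 with weight \<open>1 - p\<close>.\<close>

lemma sparse_mixture:
 fixes F :: "('i => real) => ennreal"
 assumes fin: "finite I" and p: "0 <= p" "p <= 1" and F: "F \<in> borel_measurable (\<Pi>\<^sub>M i\<in>I. (borel :: real measure))"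
 shows "(\<integral>\<^sup>+x. F x \<partial>(\<Pi>\<^sub>M i\<in>I. sparse_gaussian p)) =
  (\<Sum>S\<in>Pow I. ennreal (support_weight p I S) * (\<integral>\<^sup>+z. F (\<lambda>a\<in>I. if a \<in> S then z a else 0) \<partial>(\<Pi>\<^sub>M i\<in>I. gaussian)))"
 using fin F
proof (induction I arbitrary: F rule: finite_induct)
 case empty
 show ?case by (simp add: PiM_empty nn_integral_count_space_finite support_weight_def restrict_def)
next
 case (insert i I)
 interpret g: product_sigma_finite "%_::'i. gaussian" by (rule product_gaussian)
 interpret s: product_prob_space "%_::'i. sparse_gaussian p" by (rule product_sparse)
 interpret N: prob_space gaussian by (rule prob_space_gaussian)
 let ?B = "\<Pi>\<^sub>M i\<in>I. (borel :: real measure)"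
 let ?G = "\<Pi>\<^sub>M i\<in>I. gaussian"
 have Fs: "F \<in> borel_measurable (\<Pi>\<^sub>M i\<in>insert i I. sparse_gaussian p)"
  using insert.prems by (auto cong: measurable_cong_sets simp: sets_PiM_sparse)
 note Fb[measurable] = insert.prems
 have m0: "(%x. F (x(i := 0))) \<in> borel_measurable ?B" by measurable
 have my: "(%y. F (x(i := y))) \<in> borel_measurable borel" if x: "x \<in> space ?B" for x
  using x by measurable
 have mi: "(%x. \<integral>\<^sup>+y. F (x(i := y)) \<partial>gaussian) \<in> borel_measurable ?B" by measurable
 have ms: "f \<in> borel_measurable ?B ==> f \<in> borel_measurable (\<Pi>\<^sub>M i\<in>I. sparse_gaussian p)" for f :: "_ => ennreal"
  by (auto cong: measurable_cong_sets simp: sets_PiM_sparse)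
 have w0: "support_weight p I S \<ge> 0" for S :: "'i set" using p by (simp add: support_weight_def)
 have "(\<integral>\<^sup>+x. F x \<partial>(\<Pi>\<^sub>M i\<in>insert i I. sparse_gaussian p))
   = (\<integral>\<^sup>+x. (\<integral>\<^sup>+y. F (x(i := y)) \<partial>sparse_gaussian p) \<partial>(\<Pi>\<^sub>M i\<in>I. sparse_gaussian p))"
  by (rule s.product_nn_integral_insert[OF insert(1,2) Fs])
 also have "... = (\<integral>\<^sup>+x. ennreal p * (\<integral>\<^sup>+y. F (x(i := y)) \<partial>gaussian) + ennreal (1 - p) * F (x(i := 0)) \<partial>(\<Pi>\<^sub>M i\<in>I. sparse_gaussian p))"
  by (intro nn_integral_cong nn_integral_sparse_gaussian p my) (simp add: space_PiM)
 also have "... = ennreal p * (\<integral>\<^sup>+x. (\<integral>\<^sup>+y. F (x(i := y)) \<partial>gaussian) \<partial>(\<Pi>\<^sub>M i\<in>I. sparse_gaussian p))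
   + ennreal (1 - p) * (\<integral>\<^sup>+x. F (x(i := 0)) \<partial>(\<Pi>\<^sub>M i\<in>I. sparse_gaussian p))"
  using ms[OF mi] ms[OF m0] by (simp add: nn_integral_add nn_integral_cmult)
 also have "(\<integral>\<^sup>+x. (\<integral>\<^sup>+y. F (x(i := y)) \<partial>gaussian) \<partial>(\<Pi>\<^sub>M i\<in>I. sparse_gaussian p))
   = (\<Sum>S\<in>Pow I. ennreal (support_weight p I S) * (\<integral>\<^sup>+z. F (\<lambda>a\<in>insert i I. if a \<in> insert i S then z a else 0) \<partial>(\<Pi>\<^sub>M i\<in>insert i I. gaussian)))"
  unfolding insert.IH[OF mi]
 proof (intro sum.cong refl arg_cong2[of _ _ _ _ "(*)"])
  fix S assume "S \<in> Pow I"
  have eq: "(\<lambda>a\<in>insert i I. if a \<in> insert i S then (z(i := y)) a else 0) = (\<lambda>a\<in>I. if a \<in> S then z a else 0)(i := y)" for z y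
   using insert(2) by (auto simp: fun_eq_iff)
  have "(%z. F (\<lambda>a\<in>insert i I. if a \<in> insert i S then z a else 0)) \<in> borel_measurable (\<Pi>\<^sub>M i\<in>insert i I. gaussian)"
   using measurable_compose[OF mask_measurable Fb] by (auto cong: measurable_cong_sets simp: sets_PiM_gaussian)
  from g.product_nn_integral_insert[OF insert(1,2) this]
  show "(\<integral>\<^sup>+z. (\<integral>\<^sup>+y. F ((\<lambda>a\<in>I. if a \<in> S then z a else 0)(i := y)) \<partial>gaussian) \<partial>?G)
   = (\<integral>\<^sup>+z. F (\<lambda>a\<in>insert i I. if a \<in> insert i S then z a else 0) \<partial>(\<Pi>\<^sub>M i\<in>insert i I. gaussian))"
   unfolding eq by simp
 qed
 also have "(\<integral>\<^sup>+x. F (x(i := 0)) \<partial>(\<Pi>\<^sub>M i\<in>I. sparse_gaussian p))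
   = (\<Sum>S\<in>Pow I. ennreal (support_weight p I S) * (\<integral>\<^sup>+z. F (\<lambda>a\<in>insert i I. if a \<in> S then z a else 0) \<partial>(\<Pi>\<^sub>M i\<in>insert i I. gaussian)))"
  unfolding insert.IH[OF m0]
 proof (intro sum.cong refl arg_cong2[of _ _ _ _ "(*)"])
  fix S assume S: "S \<in> Pow I"
  have eq: "(\<lambda>a\<in>insert i I. if a \<in> S then (z(i := y)) a else 0) = (\<lambda>a\<in>I. if a \<in> S then z a else 0)(i := 0)" for z y
   using insert(2) S by (auto simp: fun_eq_iff)
  have "(%z. F (\<lambda>a\<in>insert i I. if a \<in> S then z a else 0)) \<in> borel_measurable (\<Pi>\<^sub>M i\<in>insert i I. gaussian)"
   using measurable_compose[OF mask_measurable Fb] by (auto cong: measurable_cong_sets simp: sets_PiM_gaussian)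
  from g.product_nn_integral_insert[OF insert(1,2) this]
  show "(\<integral>\<^sup>+z. F ((\<lambda>a\<in>I. if a \<in> S then z a else 0)(i := 0)) \<partial>?G)
   = (\<integral>\<^sup>+z. F (\<lambda>a\<in>insert i I. if a \<in> S then z a else 0) \<partial>(\<Pi>\<^sub>M i\<in>insert i I. gaussian))"
   unfolding eq using N.emeasure_space_1 by simp
 qed
 also have "ennreal p * (\<Sum>S\<in>Pow I. ennreal (support_weight p I S) * (\<integral>\<^sup>+z. F (\<lambda>a\<in>insert i I. if a \<in> insert i S then z a else 0) \<partial>(\<Pi>\<^sub>M i\<in>insert i I. gaussian)))
   = (\<Sum>S\<in>Pow I. ennreal (support_weight p (insert i I) (insert i S)) * (\<integral>\<^sup>+z. F (\<lambda>a\<in>insert i I. if a \<in> insert i S then z a else 0) \<partial>(\<Pi>\<^sub>M i\<in>insert i I. gaussian)))"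
  unfolding sum_distrib_left
  by (intro sum.cong refl) (use p w0 in \<open>simp add: support_weight_insert(1)[OF insert(1,2)] ennreal_mult' mult.assoc\<close>)
 also have "ennreal (1 - p) * (\<Sum>S\<in>Pow I. ennreal (support_weight p I S) * (\<integral>\<^sup>+z. F (\<lambda>a\<in>insert i I. if a \<in> S then z a else 0) \<partial>(\<Pi>\<^sub>M i\<in>insert i I. gaussian)))
   = (\<Sum>S\<in>Pow I. ennreal (support_weight p (insert i I) S) * (\<integral>\<^sup>+z. F (\<lambda>a\<in>insert i I. if a \<in> S then z a else 0) \<partial>(\<Pi>\<^sub>M i\<in>insert i I. gaussian)))"
  unfolding sum_distrib_left
  by (intro sum.cong refl) (use p w0 in \<open>simp add: support_weight_insert(2)[OF insert(1,2)] ennreal_mult' mult.assoc\<close>)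
 finally show ?case unfolding sum_Pow_insert[OF insert(1,2)] .
qed

lemma minor_scale: "minor N I c f g (%a. k * u a) = k ^ c * minor N I c f g u"
proof -
 have "mat c c (%(i,j). \<Sum>a\<in>I. k * u a * N a (f i) (g j)) = k \<cdot>\<^sub>m mat c c (%(i,j). \<Sum>a\<in>I. u a * N a (f i) (g j))"
  by (rule eq_matI) (auto simp: sum_distrib_left mult.assoc)
 thus ?thesis by (simp add: minor_def)
qed

lemma coeff_prod_linear:
 fixes a b :: "'i => real"
 assumes "finite A"
 shows "degree (\<Prod>i\<in>A. [:a i, b i:]) <= card A \<and> coeff (\<Prod>i\<in>A. [:a i, b i:]) (card A) = (\<Prod>i\<in>A. b i)"
 using assms
proof (induction A rule: finite_induct)
 case (insert x A)
 let ?p = "\<Prod>i\<in>A. [:a i, b i:]"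
 have e: "[:a x, b x:] * ?p = Polynomial.smult (a x) ?p + pCons 0 (Polynomial.smult (b x) ?p)" by simp
 have "degree ([:a x, b x:] * ?p) <= degree [:a x, b x:] + degree ?p" by (rule degree_mult_le)
 also have "... <= 1 + card A" using insert.IH by (intro add_mono) auto
 finally have "degree ([:a x, b x:] * ?p) <= 1 + card A" .
 moreover have "coeff ?p (Suc (card A)) = 0" using insert.IH by (intro coeff_eq_0) auto
 hence "coeff ([:a x, b x:] * ?p) (Suc (card A)) = b x * (\<Prod>i\<in>A. b i)"
  unfolding e using insert.IH by simp
 ultimately show ?case using insert.hyps by (simp del: mult_pCons_left)
qed simp

lemma minor_line:
 fixes N :: "'i => nat => nat => real"
 obtains q where "degree q <= c" "coeff q c = minor N I c f g u"
  "!!ta. poly q ta = minor N I c f g (%a. w a + ta * u a)"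
proof -
 define \<alpha> where "\<alpha> i j = (\<Sum>a\<in>I. w a * N a (f i) (g j))" for i j
 define be where "be i j = (\<Sum>a\<in>I. u a * N a (f i) (g j))" for i j
 define P where "P = mat c c (%(i,j). [:\<alpha> i j, be i j:])"
 have P: "P \<in> carrier_mat c c" by (simp add: P_def)
 let ?\<Pi> = "{pm. pm permutes {0..<c}}"
 have pin: "pm i < c" if "pm \<in> ?\<Pi>" "i < c" for pm i using that permutes_in_image[of pm "{0..<c}" i] by auto
 have dP: "det P = (\<Sum>pm\<in>?\<Pi>. signof pm * (\<Prod>i=0..<c. [:\<alpha> i (pm i), be i (pm i):]))"
  unfolding det_def'[OF P] by (intro sum.cong prod.cong refl arg_cong2[of _ _ _ _ "(*)"]) (auto simp: P_def pin)
 have "coeff (det P) c = (\<Sum>pm\<in>?\<Pi>. signof pm * (\<Prod>i=0..<c. be i (pm i)))"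
  unfolding dP coeff_sum
 proof (intro sum.cong refl)
  fix pm :: "nat => nat"
  have "coeff (\<Prod>i=0..<c. [:\<alpha> i (pm i), be i (pm i):]) c = (\<Prod>i=0..<c. be i (pm i))"
   using coeff_prod_linear[of "{0..<c}" "%i. \<alpha> i (pm i)" "%i. be i (pm i)"] by simp
  thus "coeff (signof pm * (\<Prod>i=0..<c. [:\<alpha> i (pm i), be i (pm i):])) c = signof pm * (\<Prod>i=0..<c. be i (pm i))"
   by (simp add: sign_def)
 qed
 also have "... = minor N I c f g u"
  unfolding minor_def by (subst det_def'[of _ c]) (auto intro!: sum.cong prod.cong simp: be_def pin)
 finally have c1: "coeff (det P) c = minor N I c f g u" .
 have "degree (det P) <= 1 * c" by (rule degree_det_le[OF _ P]) (simp add: P_def)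
 hence d: "degree (det P) <= c" by simp
 have "poly (det P) ta = minor N I c f g (%a. w a + ta * u a)" for ta
  unfolding minor_def poly_det[OF P]
  by (intro arg_cong[of _ _ det] eq_matI)
    (auto simp: P_def \<alpha>_def be_def sum.distrib distrib_right sum_distrib_left mult.assoc)
 thus ?thesis using that[of "det P"] c1 d by blast
qed

lemma minor_measurable:
 "(%u. minor N I c f g u) \<in> borel_measurable (\<Pi>\<^sub>M i\<in>I. (borel :: real measure))"
proof -
 have "minor N I c f g = (%u. \<Sum>pm\<in>{pm. pm permutes {0..<c}}. signof pm * (\<Prod>i=0..<c. \<Sum>a\<in>I. u a * N a (f i) (g (pm i))))"
  unfolding minor_def
  by (intro ext, subst det_def'[of _ c]) (auto intro!: sum.cong prod.cong simp: permutes_in_image[where S = "{0..<c}", simplified])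
 thus ?thesis by simp measurable
qed

text \<open>Dividing \<open>u\<close> by its entry of largest modulus makes one entry equal to 1, as
  \<open>gaussian_slice\<close> requires, and does not decrease the minor in modulus, because it is
  homogeneous and the entries of \<open>u\<close> are at most 1. On each line in this direction the
  minor is a polynomial of degree at most \<open>c\<close> whose coefficient of degree
  \<open>c\<close> is at least \<open>F\<close> in modulus.\<close>

lemma gaussian_anticoncentration:
 fixes N :: "'i => nat => nat => real"
 assumes fin: "finite I" and S: "S \<subseteq> I" and c: "c > 0" and t: "t \<ge> 0" and F: "F > 0"
  and u: "!!a. \<bar>u a\<bar> <= 1" "!!a. a \<notin> S ==> u a = 0" "F <= \<bar>minor N I c id id u\<bar>"
 shows "emeasure (\<Pi>\<^sub>M i\<in>I. gaussian) {z\<in>space (\<Pi>\<^sub>M i\<in>I. gaussian). \<bar>minor N I c id id (\<lambda>a\<in>I. if a \<in> S then z a else 0)\<bar> < t ^ c * F}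
   <= ennreal (real (card I) * (2 * t * real c))" (is "emeasure ?M ?E <= _")
proof -
 let ?D = "minor N I c id id"
 have finS: "finite S" using S fin finite_subset by blast
 have "\<exists>a\<in>S. u a \<noteq> 0"
 proof (rule ccontr)
  assume "\<not> (\<exists>a\<in>S. u a \<noteq> 0)"
  hence "u = (%a. 0 * u a)" using u(2) by fastforce
  hence "?D u = 0 ^ c * ?D u" by (metis minor_scale)
  hence "?D u = 0" using c by (simp add: zero_power)
  thus False using u(3) F by simp
 qed
 hence "S \<noteq> {}" by auto
 define m where "m = Max ((%a. \<bar>u a\<bar>) ` S)"
 have "m \<in> (%a. \<bar>u a\<bar>) ` S" unfolding m_def using finS \<open>S \<noteq> {}\<close> by (intro Max_in) auto
 then obtain a0 where a0: "a0 \<in> S" "m = \<bar>u a0\<bar>" by auto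
 have um: "\<bar>u a\<bar> <= m" if "a \<in> S" for a unfolding m_def using finS that by (intro Max_ge) auto
 have mpos: "u a0 \<noteq> 0" using um a0 \<open>\<exists>a\<in>S. u a \<noteq> 0\<close> by fastforce
 define v where "v a = u a / u a0" for a
 have v1: "\<bar>v b\<bar> <= 1" for b
 proof (cases "b \<in> S")
  case True
  thus ?thesis using um[of b] a0(2) mpos by (simp add: v_def abs_divide)
 qed (simp add: v_def u(2))
 have "u = (%a. u a0 * v a)" using mpos by (auto simp: v_def)
 hence "?D u = u a0 ^ c * ?D v" by (metis minor_scale)
 hence "\<bar>?D u\<bar> = \<bar>u a0\<bar> ^ c * \<bar>?D v\<bar>" by (simp add: abs_mult power_abs)
 also have "... <= 1 * \<bar>?D v\<bar>" using u(1)[of a0] by (intro mult_right_mono power_le_one) auto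
 finally have Fv: "F <= \<bar>?D v\<bar>" using u(3) by linarith
 have mask: "(%z. \<lambda>a\<in>I. if a \<in> S then z a else 0) \<in> measurable ?M (\<Pi>\<^sub>M i\<in>I. (borel :: real measure))"
  using mask_measurable by (auto cong: measurable_cong_sets simp: sets_PiM_gaussian)
 have E: "?E \<in> sets ?M"
  using measurable_compose[OF mask minor_measurable[of N I c id id]] by measurable
 show ?thesis
 proof (rule gaussian_slice[OF fin _ _ v1 E])
  show "a0 \<in> I" using a0 S by auto
  show "v a0 = 1" using mpos by (simp add: v_def)
  show "0 <= 2 * t * real c" using t by simp
  fix w :: "'i => real"
  let ?w = "%a. if a \<in> S then w a else 0"
  obtain q where q: "degree q <= c" "coeff q c = ?D v" "!!ta. poly q ta = ?D (%a. ?w a + ta * v a)"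
   by (rule minor_line[of c N I id id v ?w]) blast
  have eq: "?D (\<lambda>a\<in>I. if a \<in> S then (\<lambda>b\<in>I. w b + ta * v b) a else 0) = poly q ta" for ta
  proof -
   have "(\<Sum>a\<in>I. (\<lambda>a\<in>I. if a \<in> S then (\<lambda>b\<in>I. w b + ta * v b) a else 0) a * N a i j) = (\<Sum>a\<in>I. (?w a + ta * v a) * N a i j)" for i j
    using u(2) by (intro sum.cong refl) (auto simp: v_def)
   thus ?thesis unfolding q(3) minor_def by simp
  qed
  have "{ta. (\<lambda>b\<in>I. w b + ta * v b) \<in> ?E} \<subseteq> {ta. \<bar>poly q ta\<bar> < t ^ c * \<bar>coeff q c\<bar>}"
  proof
   fix ta assume "ta \<in> {ta. (\<lambda>b\<in>I. w b + ta * v b) \<in> ?E}"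
   hence "\<bar>poly q ta\<bar> < t ^ c * F" using eq by simp
   also have "... <= t ^ c * \<bar>coeff q c\<bar>" unfolding q(2) using Fv t by (intro mult_left_mono) auto
   finally show "ta \<in> {ta. \<bar>poly q ta\<bar> < t ^ c * \<bar>coeff q c\<bar>}" by simp
  qed
  hence "emeasure lborel {ta. (\<lambda>b\<in>I. w b + ta * v b) \<in> ?E} <= emeasure lborel {ta. \<bar>poly q ta\<bar> < t ^ c * \<bar>coeff q c\<bar>}"
  proof (rule emeasure_mono)
   have [measurable]: "poly q \<in> borel_measurable borel" by (intro borel_measurable_continuous_onI continuous_intros)
   show "{ta. \<bar>poly q ta\<bar> < t ^ c * \<bar>coeff q c\<bar>} \<in> sets lborel" by simp
  qed
  also have "... <= ennreal (2 * t * real c)" by (rule small_values_measure[OF q(1) t])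
  finally show "emeasure lborel {ta. (\<lambda>b\<in>I. w b + ta * v b) \<in> ?E} <= ennreal (2 * t * real c)" .
 qed
qed

text \<open>Bad supports are charged with their full weight. On the others \<open>u\<close> and
  \<open>F\<close> may depend on the support, so that the determinant can be compared with a
  quantity whose size is known only support by support.\<close>

lemma sparse_anticoncentration:
 fixes N :: "'i => nat => nat => real"
 assumes fin: "finite I" and p: "0 <= p" "p <= 1" and c: "c > 0" and t: "t \<ge> 0"
  and Eb: "E \<in> sets (\<Pi>\<^sub>M i\<in>I. (borel :: real measure))"
  and good: "!!S. S \<subseteq> I ==> S \<notin> Bad ==>
   \<exists>u F. (\<forall>a. \<bar>u a\<bar> <= 1) \<and> (\<forall>a. a \<notin> S --> u a = 0) \<and> 0 < F \<and> F <= \<bar>minor N I c id id u\<bar> \<and>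
    (\<forall>z. (\<lambda>a\<in>I. if a \<in> S then z a else 0) \<in> E --> \<bar>minor N I c id id (\<lambda>a\<in>I. if a \<in> S then z a else 0)\<bar> < t ^ c * F)"
 shows "measure (\<Pi>\<^sub>M i\<in>I. sparse_gaussian p) E
   <= (\<Sum>S\<in>Pow I \<inter> Bad. support_weight p I S) + real (card I) * (2 * t * real c)"
proof -
 let ?P = "\<Pi>\<^sub>M i\<in>I. sparse_gaussian p"
 let ?G = "\<Pi>\<^sub>M i\<in>I. gaussian"
 let ?D = "minor N I c id id"
 let ?mask = "%S z. \<lambda>a\<in>I. if a \<in> S then z a else (0::real)"
 let ?l = "real (card I) * (2 * t * real c)"
 interpret P: prob_space ?P by (intro prob_space_PiM prob_space_sparse_gaussian)
 interpret G: prob_space ?G by (intro prob_space_PiM prob_space_gaussian)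
 have w0: "support_weight p I S \<ge> 0" for S :: "'i set" using p by (simp add: support_weight_def)
 have "emeasure ?P E = (\<integral>\<^sup>+x. indicator E x \<partial>?P)" using Eb by (simp add: sets_PiM_sparse)
 also have "... = (\<Sum>S\<in>Pow I. ennreal (support_weight p I S) * (\<integral>\<^sup>+z. indicator E (?mask S z) \<partial>?G))"
  by (rule sparse_mixture[OF fin p]) (use Eb in simp)
 also have "... <= (\<Sum>S\<in>Pow I. ennreal (support_weight p I S * (indicator Bad S + ?l)))"
 proof (rule sum_mono)
  fix S assume S: "S \<in> Pow I"
  have "(\<integral>\<^sup>+z. indicator E (?mask S z) \<partial>?G) <= ennreal (indicator Bad S + ?l)"
  proof (cases "S \<in> Bad")
   case True
   have "(\<integral>\<^sup>+z. indicator E (?mask S z) \<partial>?G) <= (\<integral>\<^sup>+z. 1 \<partial>?G)" by (intro nn_integral_mono) (auto simp: indicator_def)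
   also have "... = ennreal 1" using G.emeasure_space_1 by simp
   also have "... <= ennreal (indicator Bad S + ?l)" using True t by (intro ennreal_leI) simp
   finally show ?thesis .
  next
   case False
   then obtain u F where u: "\<forall>a. \<bar>u a\<bar> <= 1" "\<forall>a. a \<notin> S --> u a = 0" "0 < F" "F <= \<bar>?D u\<bar>"
    and EF: "\<forall>z. ?mask S z \<in> E --> \<bar>?D (?mask S z)\<bar> < t ^ c * F"
    using good[of S] S by blast
   let ?E' = "{z\<in>space ?G. \<bar>?D (?mask S z)\<bar> < t ^ c * F}"
   have "(%z. ?mask S z) \<in> measurable ?G (\<Pi>\<^sub>M i\<in>I. (borel :: real measure))"
    using mask_measurable by (auto cong: measurable_cong_sets simp: sets_PiM_gaussian)
   from measurable_compose[OF this minor_measurable[of N I c id id]]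
   have E': "?E' \<in> sets ?G" by measurable
   have "(\<integral>\<^sup>+z. indicator E (?mask S z) \<partial>?G) <= (\<integral>\<^sup>+z. indicator ?E' z \<partial>?G)"
    using EF by (intro nn_integral_mono) (auto simp: indicator_def)
   also have "... = emeasure ?G ?E'" using E' by simp
   also have "... <= ennreal ?l"
    by (rule gaussian_anticoncentration[OF fin _ c t u(3), of S u]) (use S u in auto)
   also have "... <= ennreal (indicator Bad S + ?l)" by (intro ennreal_leI) simp
   finally show ?thesis .
  qed
  thus "ennreal (support_weight p I S) * (\<integral>\<^sup>+z. indicator E (?mask S z) \<partial>?G) <= ennreal (support_weight p I S * (indicator Bad S + ?l))"
   using w0[of S] by (simp add: ennreal_mult' mult_left_mono)
 qed
 also have "... = ennreal (\<Sum>S\<in>Pow I. support_weight p I S * (indicator Bad S + ?l))"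
  using w0 t by (intro sum_ennreal) (auto intro!: mult_nonneg_nonneg add_nonneg_nonneg)
 also have "(\<Sum>S\<in>Pow I. support_weight p I S * (indicator Bad S + ?l))
   = (\<Sum>S\<in>Pow I. support_weight p I S * indicator Bad S) + (\<Sum>S\<in>Pow I. support_weight p I S) * ?l"
  by (simp only: distrib_left sum.distrib sum_distrib_right)
 also have "(\<Sum>S\<in>Pow I. support_weight p I S * indicator Bad S) = (\<Sum>S\<in>Pow I \<inter> Bad. support_weight p I S)"
  using fin by (simp add: indicator_def sum.inter_restrict[symmetric] if_distrib cong: if_cong)
 finally have "emeasure ?P E <= ennreal ((\<Sum>S\<in>Pow I \<inter> Bad. support_weight p I S) + ?l)"
  unfolding sum_support_weight[OF fin] mult_1 .
 moreover have "0 <= (\<Sum>S\<in>Pow I \<inter> Bad. support_weight p I S) + ?l"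
  using w0 t by (intro add_nonneg_nonneg sum_nonneg mult_nonneg_nonneg) auto
 ultimately show ?thesis by (simp only: P.emeasure_eq_measure ennreal_le_iff)
qed

text \<open>The Gaussian density is compared with that of variance 2, which leaves the factor
  \<open>exp (- R\<^sup>2 / 4)\<close>. The atom at 0 lies outside the set.\<close>

lemma sparse_tail:
 assumes p: "0 <= p" "p <= 1" and R: "R \<ge> 0"
 shows "measure (sparse_gaussian p) {x. R < \<bar>x\<bar>} <= 2 * exp (- R\<^sup>2 / 4)"
proof -
 interpret s: prob_space "sparse_gaussian p" by (rule prob_space_sparse_gaussian)
 interpret nd: prob_space "density lborel (%x. ennreal (normal_density 0 (sqrt 2) x))"
  by (rule prob_space_normal_density) simp
 let ?A = "{x::real. R < \<bar>x\<bar>}"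
 have A: "?A \<in> sets borel" by measurable
 have "emeasure gaussian ?A = (\<integral>\<^sup>+x. ennreal (std_normal_density x) * indicator ?A x \<partial>lborel)"
  using A by (simp add: emeasure_density)
 also have "... <= (\<integral>\<^sup>+x. ennreal (2 * exp (- R\<^sup>2 / 4)) * ennreal (normal_density 0 (sqrt 2) x) \<partial>lborel)"
 proof (rule nn_integral_mono)
  fix x :: real
  show "ennreal (std_normal_density x) * indicator ?A x <= ennreal (2 * exp (- R\<^sup>2 / 4)) * ennreal (normal_density 0 (sqrt 2) x)"
  proof (cases "x \<in> ?A")
   case True
   have "R\<^sup>2 <= x\<^sup>2" using True R by (subst power2_abs[of x, symmetric], intro power_mono) auto
   hence "exp (- x\<^sup>2 / 2) <= exp (- R\<^sup>2 / 4 + - x\<^sup>2 / 4)" by simp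
   also have "... = exp (- R\<^sup>2 / 4) * exp (- x\<^sup>2 / 4)" by (rule exp_add)
   finally have "std_normal_density x <= 1 / sqrt (2 * pi) * (exp (- R\<^sup>2 / 4) * exp (- x\<^sup>2 / 4))"
    by (simp add: std_normal_density_def divide_right_mono)
   also have "... <= (2 / sqrt (4 * pi)) * (exp (- R\<^sup>2 / 4) * exp (- x\<^sup>2 / 4))"
   proof (intro mult_right_mono)
    have "sqrt (4 * pi) <= sqrt (4 * (2 * pi))" by simp
    also have "... = 2 * sqrt (2 * pi)" by (simp only: real_sqrt_mult real_sqrt_four)
    finally show "1 / sqrt (2 * pi) <= 2 / sqrt (4 * pi)" by (simp add: divide_simps)
   qed auto
   also have "... = 2 * exp (- R\<^sup>2 / 4) * normal_density 0 (sqrt 2) x"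
    by (simp add: normal_density_def)
   finally show ?thesis using True by (simp add: ennreal_mult'[symmetric] ennreal_leI)
  qed simp
 qed
 also have "... = ennreal (2 * exp (- R\<^sup>2 / 4)) * (\<integral>\<^sup>+x. ennreal (normal_density 0 (sqrt 2) x) \<partial>lborel)"
  by (rule nn_integral_cmult) simp
 also have "(\<integral>\<^sup>+x. ennreal (normal_density 0 (sqrt 2) x) \<partial>lborel) = 1"
  using nd.emeasure_space_1 by (simp add: emeasure_density)
 finally have g: "emeasure gaussian ?A <= ennreal (2 * exp (- R\<^sup>2 / 4))" by simp
 have "emeasure (sparse_gaussian p) ?A = ennreal p * emeasure gaussian ?A"
  using emeasure_sparse_gaussian[OF p A] R by simp
 also have "... <= 1 * ennreal (2 * exp (- R\<^sup>2 / 4))" using p g by (intro mult_mono) auto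
 finally show ?thesis by (simp add: s.emeasure_eq_measure ennreal_le_iff)
qed

section \<open>Random supports and small determinants\<close>

lemma sum_UN_le:
 fixes f :: "'b => real"
 assumes "finite X" "!!x. x \<in> X ==> finite (A x)" "!!b. 0 <= f b"
 shows "sum f (\<Union>x\<in>X. A x) <= (\<Sum>x\<in>X. sum f (A x))"
 using assms(1,2)
proof (induction X rule: finite_induct)
 case (insert x X)
 have "sum f (\<Union>y\<in>insert x X. A y) = sum f (A x) + sum f (\<Union>y\<in>X. A y) - sum f (A x \<inter> (\<Union>y\<in>X. A y))"
  unfolding UN_insert by (rule sum_Un) (use insert in auto)
 also have "... <= sum f (A x) + sum f (\<Union>y\<in>X. A y)" using assms(3) by (simp add: sum_nonneg)
 also have "... <= (\<Sum>y\<in>insert x X. sum f (A y))" using insert by simp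
 finally show ?case .
qed simp

text \<open>For some \<open>rh\<close> and some small \<open>J\<close> a bad support misses
  \<open>T rh J - J\<close>, which has at least \<open>k - c\<close> elements. There are at most
  \<open>c * (card I + 1) ^ c\<close> pairs of \<open>rh\<close> and \<open>J\<close>, so a union
  bound suffices.\<close>

lemma bad_support_weight:
 fixes T :: "nat => 'i set => 'i set"
 assumes fin: "finite I" and p: "0 <= p" "p <= 1"
  and T: "!!rh J. rh < c ==> T rh J \<subseteq> I \<and> k <= card (T rh J)"
 defines "Bad \<equiv> {S. \<not> (\<forall>rh<c. \<forall>J\<subseteq>S. card J <= rh --> (S - J) \<inter> T rh J \<noteq> {})}"
 shows "(\<Sum>S\<in>Pow I \<inter> Bad. support_weight p I S) <= real c * (real (card I) + 1) ^ c * (1 - p) ^ (k - c)"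
proof -
 let ?A = "%rh J. {S. S \<subseteq> I \<and> S \<inter> (T rh J - J) = {}}"
 have w0: "support_weight p I S \<ge> 0" for S :: "'i set" using p by (simp add: support_weight_def)
 define X where "X = (SIGMA rh:{..<c}. {J. J \<subseteq> I \<and> card J <= rh})"
 have finX: "finite X" unfolding X_def using fin by (intro finite_SigmaI) auto
 have finA: "finite (?A rh J)" for rh J using fin by (auto intro: finite_subset[OF _ finite_Pow_iff[THEN iffD2]])
 have sub: "Pow I \<inter> Bad \<subseteq> (\<Union>x\<in>X. ?A (fst x) (snd x))"
 proof
  fix S assume S: "S \<in> Pow I \<inter> Bad"
  then obtain rh J where r: "rh < c" "J \<subseteq> S" "card J <= rh" "(S - J) \<inter> T rh J = {}" unfolding Bad_def by blast
  have "(rh, J) \<in> X" using r S by (auto simp: X_def)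
  moreover have "S \<in> ?A rh J" using r S by auto
  ultimately show "S \<in> (\<Union>x\<in>X. ?A (fst x) (snd x))" by (intro UN_I[of "(rh,J)"]) auto
 qed
 have each: "(\<Sum>S\<in>?A rh J. support_weight p I S) <= (1 - p) ^ (k - c)" if "rh < c" "J \<subseteq> I" "card J <= rh" for rh J
 proof -
  have "k <= card (T rh J)" using T that by blast
  also have "card (T rh J) <= card (T rh J - J) + card J"
   using diff_card_le_card_Diff[of J "T rh J"] that fin finite_subset by force
  finally have "k - c <= card (T rh J - J)" using that by linarith
  moreover have "(\<Sum>S\<in>?A rh J. support_weight p I S) = (1 - p) ^ card (T rh J - J)"
   using T that by (intro sum_support_weight_avoid fin) blast
  ultimately show ?thesis using p by (simp add: power_decreasing)
 qed
 have "(\<Sum>S\<in>Pow I \<inter> Bad. support_weight p I S) <= (\<Sum>S\<in>(\<Union>x\<in>X. ?A (fst x) (snd x)). support_weight p I S)"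
  using finX finA by (intro sum_mono2 sub finite_UN_I w0)
 also have "... <= (\<Sum>x\<in>X. \<Sum>S\<in>?A (fst x) (snd x). support_weight p I S)"
  by (rule sum_UN_le) (use finX finA w0 in auto)
 also have "... <= (\<Sum>x\<in>X. (1 - p) ^ (k - c))"
  by (intro sum_mono each) (auto simp: X_def)
 also have "... = real (card X) * (1 - p) ^ (k - c)" by simp
 also have "real (card X) <= real c * (real (card I) + 1) ^ c"
 proof -
  have "card X = (\<Sum>rh<c. card {J. J \<subseteq> I \<and> card J <= rh})"
   unfolding X_def using fin by (subst card_SigmaI) auto
  also have "... <= (\<Sum>rh<c. (card I + 1) ^ c)"
  proof (rule sum_mono)
   fix rh assume "rh \<in> {..<c}"
   hence "(card I + 1) ^ rh <= (card I + 1) ^ c" by (intro power_increasing) auto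
   thus "card {J. J \<subseteq> I \<and> card J <= rh} <= (card I + 1) ^ c"
    using card_small_subsets_le[OF fin, of rh] by linarith
  qed
  finally have "card X <= c * (card I + 1) ^ c" by simp
  hence "real (card X) <= real (c * (card I + 1) ^ c)" by (rule of_nat_mono)
  also have "... = real c * (real (card I) + 1) ^ c" by (simp only: of_nat_mult of_nat_power of_nat_add of_nat_1)
  finally show ?thesis .
 qed
 finally show ?thesis using p by (simp add: mult_right_mono)
qed

lemma growth_good_supports:
 fixes N :: "'i => nat => nat => real"
 assumes fin: "finite I" and th: "th > 0" and c: "c > 0" and p: "0 <= p" "p <= 1"
  and spread: "!!y z. \<exists>i<c. y i = 1 ==> \<exists>j<c. z j = 1 ==>
    k <= card {a\<in>I. th <= \<bar>\<Sum>i<c. \<Sum>j<c. y i * N a i j * z j\<bar>}"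
 obtains Bad where "(\<Sum>S\<in>Pow I \<inter> Bad. support_weight p I S) <= real c * (real (card I) + 1) ^ c * (1 - p) ^ (k - c)"
  "!!S. S \<subseteq> I ==> S \<notin> Bad ==> (th / growth_const c) ^ c <= top_minor N c c S \<and>
   th * top_minor N c (c - 1) S <= growth_const c * top_minor N c c S \<and>
   (\<exists>u. (\<forall>a. \<bar>u a\<bar> <= 1) \<and> (\<forall>a. a \<notin> S --> u a = 0) \<and> top_minor N c c S / 2 <= \<bar>minor N I c id id u\<bar>)"
proof -
 obtain T :: "nat => 'i set => 'i set" where T: "!!rh J. rh < c ==> T rh J \<subseteq> I \<and> k <= card (T rh J)"
  "!!S. S \<subseteq> I ==> (!!rh J. rh < c ==> J \<subseteq> S ==> card J <= rh ==> (S - J) \<inter> T rh J \<noteq> {}) ==>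
    (\<forall>rh<c. th * top_minor N c rh S <= growth_const c * top_minor N c (Suc rh) S)"
  proof (rule growth_sets[OF fin th, where c = c and k = k and N = N], goal_cases)
  case (1 y z)
  show ?case by (rule spread) (rule 1)+
 next
  case (2 T)
  show ?case by (rule 2(1)[OF 2(2) 2(3)])
 qed
 define Bad where "Bad = {S. \<not> (\<forall>rh<c. \<forall>J\<subseteq>S. card J <= rh --> (S - J) \<inter> T rh J \<noteq> {})}"
 show ?thesis
 proof (rule that[of Bad])
  show "(\<Sum>S\<in>Pow I \<inter> Bad. support_weight p I S) <= real c * (real (card I) + 1) ^ c * (1 - p) ^ (k - c)"
   unfolding Bad_def by (rule bad_support_weight[OF fin p T(1)])
  fix S assume S: "S \<subseteq> I" "S \<notin> Bad"
  have finS: "finite S" using S fin finite_subset by blast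
  have g: "\<forall>rh<c. th * top_minor N c rh S <= growth_const c * top_minor N c (Suc rh) S"
   by (rule T(2)[OF S(1)]) (use S(2) in \<open>auto simp: Bad_def\<close>)
  have 1: "(th / growth_const c) ^ c <= top_minor N c c S" by (rule top_minor_growth[OF finS th c g order_refl])
  have "0 < (th / growth_const c) ^ c" using th growth_const_pos[OF c] by simp
  hence "top_minor N c c S / 2 < top_minor N c c S" using 1 by linarith
  from top_minor_full[OF finS this] obtain u where u: "!!a. \<bar>u a\<bar> <= 1" "!!a. a \<notin> S ==> u a = 0"
   "top_minor N c c S / 2 < \<bar>minor N S c id id u\<bar>" by metis
  have "(\<Sum>a\<in>I. u a * N a i j) = (\<Sum>a\<in>S. u a * N a i j)" for i j
   using S(1) fin u(2) by (intro sum.mono_neutral_right) auto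
  hence "minor N I c id id u = minor N S c id id u" by (simp add: minor_def)
  moreover have "th * top_minor N c (c - 1) S <= growth_const c * top_minor N c c S" using g[rule_format, of "c - 1"] c by simp
  ultimately show "(th / growth_const c) ^ c <= top_minor N c c S \<and>
   th * top_minor N c (c - 1) S <= growth_const c * top_minor N c c S \<and>
   (\<exists>u. (\<forall>a. \<bar>u a\<bar> <= 1) \<and> (\<forall>a. a \<notin> S --> u a = 0) \<and> top_minor N c c S / 2 <= \<bar>minor N I c id id u\<bar>)"
   using 1 u by (metis less_imp_le)
 qed
qed

text \<open>For the stages in which the spread is built up, where a fixed lower bound for the
  determinant is wanted. It involves the \<open>c\<close>-th power of the threshold
  \<open>th\<close>.\<close>

lemma small_determinant_prob:
 fixes N :: "'i => nat => nat => real"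
 assumes fin: "finite I" and th: "th > 0" and c: "c > 0" and p: "0 <= p" "p <= 1" and t: "t \<ge> 0"
  and spread: "!!y z. \<exists>i<c. y i = 1 ==> \<exists>j<c. z j = 1 ==>
    k <= card {a\<in>I. th <= \<bar>\<Sum>i<c. \<Sum>j<c. y i * N a i j * z j\<bar>}"
 shows "measure (\<Pi>\<^sub>M i\<in>I. sparse_gaussian p)
   {z\<in>space (\<Pi>\<^sub>M i\<in>I. sparse_gaussian p). \<bar>minor N I c id id z\<bar> < t ^ c * ((th / growth_const c) ^ c / 2)}
   <= real c * (real (card I) + 1) ^ c * (1 - p) ^ (k - c) + real (card I) * (2 * t * real c)" (is "measure ?P ?E <= _")
proof -
 obtain Bad where Bad: "(\<Sum>S\<in>Pow I \<inter> Bad. support_weight p I S) <= real c * (real (card I) + 1) ^ c * (1 - p) ^ (k - c)"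
  "!!S. S \<subseteq> I ==> S \<notin> Bad ==> (th / growth_const c) ^ c <= top_minor N c c S \<and>
   th * top_minor N c (c - 1) S <= growth_const c * top_minor N c c S \<and>
   (\<exists>u. (\<forall>a. \<bar>u a\<bar> <= 1) \<and> (\<forall>a. a \<notin> S --> u a = 0) \<and> top_minor N c c S / 2 <= \<bar>minor N I c id id u\<bar>)"
  proof (rule growth_good_supports[OF fin th c p, where k = k and N = N], goal_cases)
  case (1 y z)
  show ?case by (rule spread) (rule 1)+
 next
  case (2 Bad)
  show ?case by (rule 2(1)[OF 2(2) 2(3)])
 qed
 have pos: "0 < (th / growth_const c) ^ c / 2" using th growth_const_pos[OF c] by simp
 have sp: "space ?P = space (\<Pi>\<^sub>M i\<in>I. (borel :: real measure))" by (rule sets_eq_imp_space_eq[OF sets_PiM_sparse])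
 note [measurable] = minor_measurable[of N I c id id]
 have "measure ?P ?E <= (\<Sum>S\<in>Pow I \<inter> Bad. support_weight p I S) + real (card I) * (2 * t * real c)"
 proof (rule sparse_anticoncentration[OF fin p c t])
  show "?E \<in> sets (\<Pi>\<^sub>M i\<in>I. (borel :: real measure))" unfolding sp by measurable
  fix S assume S: "S \<subseteq> I" "S \<notin> Bad"
  from Bad(2)[OF S] obtain u where u: "\<forall>a. \<bar>u a\<bar> <= 1" "\<forall>a. a \<notin> S --> u a = 0" "top_minor N c c S / 2 <= \<bar>minor N I c id id u\<bar>"
   and g: "(th / growth_const c) ^ c <= top_minor N c c S" by blast
  have "(th / growth_const c) ^ c / 2 <= \<bar>minor N I c id id u\<bar>" using u(3) g by linarith
  thus "\<exists>u F. (\<forall>a. \<bar>u a\<bar> <= 1) \<and> (\<forall>a. a \<notin> S --> u a = 0) \<and> 0 < F \<and> F <= \<bar>minor N I c id id u\<bar> \<and>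
    (\<forall>z. (\<lambda>a\<in>I. if a \<in> S then z a else 0) \<in> ?E --> \<bar>minor N I c id id (\<lambda>a\<in>I. if a \<in> S then z a else 0)\<bar> < t ^ c * F)"
   using u pos by (intro exI[of _ u] exI[of _ "(th / growth_const c) ^ c / 2"]) auto
 qed
 thus ?thesis using Bad(1) by linarith
qed

text \<open>Both minors are measured on the same support. There the \<open>(c - 1)\<close>-minors
  are at most \<open>top_minor N c (c - 1) S\<close> up to constants, and one growth step bounds
  this by \<open>growth_const c / th\<close> times the top minor of size \<open>c\<close>. The
  unknown size of the determinant cancels, and \<open>th\<close> enters only once.\<close>

lemma small_determinant_ratio_prob:
 fixes N :: "'i => nat => nat => real"
 assumes fin: "finite I" and th: "th > 0" and c: "c > 0" and p: "0 <= p" "p <= 1" and t: "t \<ge> 0" and R: "R \<ge> 1"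
  and spread: "!!y z. \<exists>i<c. y i = 1 ==> \<exists>j<c. z j = 1 ==>
    k <= card {a\<in>I. th <= \<bar>\<Sum>i<c. \<Sum>j<c. y i * N a i j * z j\<bar>}"
  and de: "0 <= de" "de * (2 * growth_const c * (2 * R * (real (card I) + 1)) ^ c) < t ^ c * th"
  and Eb: "E \<in> sets (\<Pi>\<^sub>M i\<in>I. (borel :: real measure))"
  and E: "!!z. z \<in> E ==> (\<forall>a\<in>I. \<bar>z a\<bar> <= R) \<and> (\<exists>f g. (\<forall>i<c-1. f i < c \<and> g i < c) \<and>
    \<bar>minor N I c id id z\<bar> <= de * \<bar>minor N I (c - 1) f g z\<bar>)"
 shows "measure (\<Pi>\<^sub>M i\<in>I. sparse_gaussian p) E
   <= real c * (real (card I) + 1) ^ c * (1 - p) ^ (k - c) + real (card I) * (2 * t * real c)"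
proof -
 obtain Bad where Bad: "(\<Sum>S\<in>Pow I \<inter> Bad. support_weight p I S) <= real c * (real (card I) + 1) ^ c * (1 - p) ^ (k - c)"
  "!!S. S \<subseteq> I ==> S \<notin> Bad ==> (th / growth_const c) ^ c <= top_minor N c c S \<and>
   th * top_minor N c (c - 1) S <= growth_const c * top_minor N c c S \<and>
   (\<exists>u. (\<forall>a. \<bar>u a\<bar> <= 1) \<and> (\<forall>a. a \<notin> S --> u a = 0) \<and> top_minor N c c S / 2 <= \<bar>minor N I c id id u\<bar>)"
  proof (rule growth_good_supports[OF fin th c p, where k = k and N = N], goal_cases)
  case (1 y z)
  show ?case by (rule spread) (rule 1)+
 next
  case (2 Bad)
  show ?case by (rule 2(1)[OF 2(2) 2(3)])
 qed
 note K = growth_const_pos[OF c]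
 have pos: "0 < (th / growth_const c) ^ c" using th K by simp
 have "measure (\<Pi>\<^sub>M i\<in>I. sparse_gaussian p) E <= (\<Sum>S\<in>Pow I \<inter> Bad. support_weight p I S) + real (card I) * (2 * t * real c)"
 proof (rule sparse_anticoncentration[OF fin p c t Eb])
  fix S assume S: "S \<subseteq> I" "S \<notin> Bad"
  have finS: "finite S" using S fin finite_subset by blast
  from Bad(2)[OF S] obtain u where u: "\<forall>a. \<bar>u a\<bar> <= 1" "\<forall>a. a \<notin> S --> u a = 0" "top_minor N c c S / 2 <= \<bar>minor N I c id id u\<bar>"
   and g: "(th / growth_const c) ^ c <= top_minor N c c S" "th * top_minor N c (c - 1) S <= growth_const c * top_minor N c c S" by blast
  let ?F = "top_minor N c c S / 2"
  have F: "0 < ?F" using g(1) pos by linarith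
  have "\<bar>minor N I c id id (\<lambda>a\<in>I. if a \<in> S then z a else 0)\<bar> < t ^ c * ?F"
   if zE: "(\<lambda>a\<in>I. if a \<in> S then z a else 0) \<in> E" for z
  proof -
   let ?z = "\<lambda>a\<in>I. if a \<in> S then z a else (0::real)"
   obtain f g' where fg: "\<forall>a\<in>I. \<bar>?z a\<bar> <= R" "\<forall>i<c-1. f i < c \<and> g' i < c"
    "\<bar>minor N I c id id ?z\<bar> <= de * \<bar>minor N I (c - 1) f g' ?z\<bar>" using E[OF zE] by blast
   \<comment> \<open>The sample scaled into the unit cube, where \<open>minor_le_top_minor\<close>
     applies; homogeneity returns the factor \<open>R ^ (c - 1)\<close>.\<close>
   define v where "v a = (if a \<in> S then z a / R else 0)" for a
   have v1: "\<bar>v a\<bar> <= 1" for a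
    using fg(1)[rule_format, of a] S(1) R by (cases "a \<in> S") (auto simp: v_def abs_divide)
   have "minor N I (c - 1) f g' ?z = minor N S (c - 1) f g' (%a. R * v a)"
   proof -
    have "(\<Sum>a\<in>I. ?z a * N a i j) = (\<Sum>a\<in>S. (R * v a) * N a i j)" for i j
     using S(1) fin R by (intro sum.mono_neutral_cong_right) (auto simp: v_def)
    thus ?thesis by (simp add: minor_def)
   qed
   also have "... = R ^ (c - 1) * minor N S (c - 1) f g' v" by (rule minor_scale)
   finally have "\<bar>minor N I (c - 1) f g' ?z\<bar> = R ^ (c - 1) * \<bar>minor N S (c - 1) f g' v\<bar>" using R by (simp add: abs_mult)
   also have "... <= R ^ (c - 1) * ((2 * (real (card S) + 1)) ^ (c - 1) * top_minor N c (c - 1) S)"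
    using R minor_le_top_minor[OF finS v1, of "c - 1" f c g' N] fg(2) by (intro mult_left_mono) auto
   also have "... = (2 * R * (real (card S) + 1)) ^ (c - 1) * top_minor N c (c - 1) S"
    by (simp only: power_mult_distrib ac_simps)
   also have "... <= (2 * R * (real (card I) + 1)) ^ c * top_minor N c (c - 1) S"
   proof (intro mult_right_mono top_minor_nonneg[OF finS])
    have "(2 * R * (real (card S) + 1)) ^ (c - 1) <= (2 * R * (real (card I) + 1)) ^ (c - 1)"
     using S(1) fin R by (intro power_mono mult_left_mono) (auto simp: card_mono)
    also have "... <= (2 * R * (real (card I) + 1)) ^ c"
    proof (rule power_increasing)
     have "1 * 1 <= (2 * R) * (real (card I) + 1)" using R by (intro mult_mono) auto
     thus "1 <= 2 * R * (real (card I) + 1)" by simp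
    qed simp
    finally show "(2 * R * (real (card S) + 1)) ^ (c - 1) <= (2 * R * (real (card I) + 1)) ^ c" .
   qed simp
   finally have m: "\<bar>minor N I (c - 1) f g' ?z\<bar> <= (2 * R * (real (card I) + 1)) ^ c * top_minor N c (c - 1) S" .
   let ?W = "(2 * R * (real (card I) + 1)) ^ c"
   have W: "?W \<ge> 0" using R by simp
   have "th * \<bar>minor N I c id id ?z\<bar> <= th * (de * \<bar>minor N I (c - 1) f g' ?z\<bar>)" using fg(3) th by simp
   also have "... <= th * (de * (?W * top_minor N c (c - 1) S))" using m de(1) th by (intro mult_left_mono) auto
   also have "... = de * ?W * (th * top_minor N c (c - 1) S)" by simp
   also have "... <= de * ?W * (growth_const c * top_minor N c c S)" using g(2) de(1) W by (intro mult_left_mono) auto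
   also have "... = (de * (2 * growth_const c * ?W)) * ?F" by simp
   also have "... < (t ^ c * th) * ?F" using de(2) F by (intro mult_strict_right_mono) auto
   finally have "th * \<bar>minor N I c id id ?z\<bar> < th * (t ^ c * ?F)" by (simp only: ac_simps)
   thus ?thesis using th by simp
  qed
  thus "\<exists>u F. (\<forall>a. \<bar>u a\<bar> <= 1) \<and> (\<forall>a. a \<notin> S --> u a = 0) \<and> 0 < F \<and> F <= \<bar>minor N I c id id u\<bar> \<and>
    (\<forall>z. (\<lambda>a\<in>I. if a \<in> S then z a else 0) \<in> E --> \<bar>minor N I c id id (\<lambda>a\<in>I. if a \<in> S then z a else 0)\<bar> < t ^ c * F)"
   using u F by (intro exI[of _ u] exI[of _ ?F]) auto
 qed
 thus ?thesis using Bad(1) by linarith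
qed

section \<open>Resampling columns\<close>

text \<open>The case \<open>c = 1\<close> with known coefficients: a support is good as soon as it
  meets a coefficient of size \<open>th\<close>, and the unit vector there serves as
  direction.\<close>

lemma single_form_prob:
 fixes v :: "'i => real"
 assumes fin: "finite I" and th: "th > 0" and p: "0 <= p" "p <= 1" and t: "t \<ge> 0"
  and k: "k <= card {a\<in>I. th <= \<bar>v a\<bar>}"
 shows "measure (\<Pi>\<^sub>M i\<in>I. sparse_gaussian p)
   {z\<in>space (\<Pi>\<^sub>M i\<in>I. sparse_gaussian p). \<bar>\<Sum>a\<in>I. z a * v a\<bar> < t * th}
   <= (1 - p) ^ k + real (card I) * (2 * t)" (is "measure ?P ?E <= _")
proof -
 define N :: "'i => nat => nat => real" where "N a i j = v a" for a i j
 have D: "minor N I 1 id id z = (\<Sum>a\<in>I. z a * v a)" for z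
  unfolding minor_def by (subst det_single[of _]) (auto simp: N_def)
 let ?T = "{a\<in>I. th <= \<bar>v a\<bar>}"
 let ?Bad = "{S. S \<inter> ?T = {}}"
 have sp: "space ?P = space (\<Pi>\<^sub>M i\<in>I. (borel :: real measure))" by (rule sets_eq_imp_space_eq[OF sets_PiM_sparse])
 have "measure ?P ?E <= (\<Sum>S\<in>Pow I \<inter> ?Bad. support_weight p I S) + real (card I) * (2 * t * real 1)"
 proof (rule sparse_anticoncentration[OF fin p _ t, where c = 1 and N = N])
  show "?E \<in> sets (\<Pi>\<^sub>M i\<in>I. (borel :: real measure))" unfolding sp by measurable
  fix S assume S: "S \<subseteq> I" "S \<notin> ?Bad"
  then obtain a0 where a0: "a0 \<in> S" "a0 \<in> I" "th <= \<bar>v a0\<bar>" by blast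
  let ?u = "%a. if a = a0 then 1 else (0::real)"
  have "(\<Sum>a\<in>I. ?u a * v a) = (\<Sum>a\<in>I. if a = a0 then v a0 else 0)" by (intro sum.cong) auto
  hence u: "(\<Sum>a\<in>I. ?u a * v a) = v a0" using fin a0 by simp
  show "\<exists>u F. (\<forall>a. \<bar>u a\<bar> <= 1) \<and> (\<forall>a. a \<notin> S --> u a = 0) \<and> 0 < F \<and> F <= \<bar>minor N I 1 id id u\<bar> \<and>
    (\<forall>z. (\<lambda>a\<in>I. if a \<in> S then z a else 0) \<in> ?E --> \<bar>minor N I 1 id id (\<lambda>a\<in>I. if a \<in> S then z a else 0)\<bar> < t ^ 1 * F)"
   unfolding D by (rule exI[of _ ?u], rule exI[of _ th]) (use a0 u th in auto)
 qed simp
 also have "(\<Sum>S\<in>Pow I \<inter> ?Bad. support_weight p I S) = (1 - p) ^ card ?T"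
 proof -
  have "Pow I \<inter> ?Bad = {S. S \<subseteq> I \<and> S \<inter> ?T = {}}" by auto
  thus ?thesis using sum_support_weight_avoid[OF fin, of ?T p] by auto
 qed
 also have "(1 - p) ^ card ?T <= (1 - p) ^ k" using k p by (intro power_decreasing) auto
 finally show ?thesis by simp
qed

section \<open>Conditional probabilities by redrawing coordinates\<close>

text \<open>For a product measure, integrating over the second argument is conditional expectation
  given the coordinates outside \<open>C\<close>.\<close>

definition resample :: "'i set => 'i set => ('i => 'a) => ('i => 'a) => 'i => 'a" where
 "resample I C w w' = (\<lambda>i\<in>I. if i \<in> C then w' i else w i)"

lemma resample_resample [simp]: "resample I C (resample I C w w'') w' = resample I C w w'"
 by (auto simp: resample_def fun_eq_iff)

lemma resample_commute:
 "C \<inter> D = {} ==> resample I C (resample I D w w'') w' = resample I D (resample I C w w') w''"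
 by (auto simp: resample_def fun_eq_iff)

locale iid_product =
 fixes I :: "'i set" and M :: "'a measure"
 assumes finite_I: "finite I" and prob_M: "prob_space M"
begin

abbreviation "P \<equiv> \<Pi>\<^sub>M i\<in>I. M"

sublocale M: prob_space M by (rule prob_M)
sublocale P: prob_space P by (intro prob_space_PiM prob_M)
sublocale PP: pair_prob_space P P ..

lemma resample_measurable [measurable]: "(%x. resample I C (fst x) (snd x)) \<in> measurable (P \<Otimes>\<^sub>M P) P"
 unfolding resample_def
proof (rule measurable_restrict)
 fix i assume "i \<in> I"
 thus "(%x. if i \<in> C then snd x i else fst x i) \<in> measurable (P \<Otimes>\<^sub>M P) M"
  by (cases "i \<in> C") (auto intro!: measurable_compose[OF measurable_snd] measurable_compose[OF measurable_fst] measurable_component_singleton)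
qed

lemma resample_space: "w \<in> space P ==> w' \<in> space P ==> resample I C w w' \<in> space P"
 by (auto simp: resample_def space_PiM PiE_def)

lemma resample_measurable_snd [measurable]: "w \<in> space P ==> resample I C w \<in> measurable P P"
 using measurable_compose[OF measurable_Pair1'[of w P P] resample_measurable[of C]] by simp

lemma distr_resample: "distr (P \<Otimes>\<^sub>M P) P (%x. resample I C (fst x) (snd x)) = P"
proof -
 interpret product_sigma_finite "%_::'i. M" by unfold_locales
 show ?thesis
 proof (rule PiM_eqI[OF finite_I])
  fix A assume A: "!!i. i \<in> I ==> A i \<in> sets M"
  let ?A1 = "\<Pi>\<^sub>E i\<in>I. if i \<in> C then space M else A i"
  let ?A2 = "\<Pi>\<^sub>E i\<in>I. if i \<in> C then A i else space M"
  have As: "i \<in> I ==> A i \<subseteq> space M" for i using A sets.sets_into_space by blast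
  have m: "Pi\<^sub>E I A \<in> sets P" using A finite_I by (intro sets_PiM_I_finite) auto
  have "(%x. resample I C (fst x) (snd x)) -` Pi\<^sub>E I A \<inter> space (P \<Otimes>\<^sub>M P) = ?A1 \<times> ?A2"
  proof (intro equalityI subsetI)
   fix x assume x: "x \<in> (%x. resample I C (fst x) (snd x)) -` Pi\<^sub>E I A \<inter> space (P \<Otimes>\<^sub>M P)"
   hence h: "resample I C (fst x) (snd x) i \<in> A i" if "i \<in> I" for i using that by auto
   have s: "i \<in> I ==> i \<notin> C ==> fst x i \<in> A i" "i \<in> I ==> i \<in> C ==> snd x i \<in> A i" for i
    using h[of i] by (simp_all add: resample_def)
   have 1: "fst x \<in> space P" "snd x \<in> space P" using x by (auto simp: space_pair_measure)
   have "fst x \<in> ?A1" "snd x \<in> ?A2" using s 1 by (auto simp: space_PiM PiE_iff)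
   thus "x \<in> ?A1 \<times> ?A2" by (cases x) auto
  next
   fix x assume x: "x \<in> ?A1 \<times> ?A2"
   hence x': "fst x \<in> ?A1" "snd x \<in> ?A2" by auto
   have 1: "fst x i \<in> (if i \<in> C then space M else A i)" "snd x i \<in> (if i \<in> C then A i else space M)" if "i \<in> I" for i
    by (rule PiE_mem[OF x'(1) that], rule PiE_mem[OF x'(2) that])
   have "fst x i \<in> space M" "snd x i \<in> space M" if "i \<in> I" for i
    using 1[OF that] As[OF that] by (auto split: if_splits)
   moreover have "fst x \<in> extensional I" "snd x \<in> extensional I" using x' by (simp_all add: PiE_def)
   ultimately have "fst x \<in> space P" "snd x \<in> space P" by (simp_all add: space_PiM PiE_iff)
   moreover have "resample I C (fst x) (snd x) i \<in> A i" if "i \<in> I" for i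
    using 1[OF that] that by (cases "i \<in> C") (auto simp: resample_def)
   hence "resample I C (fst x) (snd x) \<in> Pi\<^sub>E I A" by (auto simp: resample_def)
   ultimately show "x \<in> (%x. resample I C (fst x) (snd x)) -` Pi\<^sub>E I A \<inter> space (P \<Otimes>\<^sub>M P)"
    by (auto simp: space_pair_measure mem_Times_iff)
  qed
  hence "emeasure (distr (P \<Otimes>\<^sub>M P) P (%x. resample I C (fst x) (snd x))) (Pi\<^sub>E I A) = emeasure (P \<Otimes>\<^sub>M P) (?A1 \<times> ?A2)"
   using m by (simp add: emeasure_distr)
  also have "... = emeasure P ?A1 * emeasure P ?A2"
   using A finite_I by (intro P.emeasure_pair_measure_Times sets_PiM_I_finite) auto
  also have "emeasure P ?A1 = (\<Prod>i\<in>I. emeasure M (if i \<in> C then space M else A i))"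
   using A finite_I by (intro emeasure_PiM) auto
  also have "emeasure P ?A2 = (\<Prod>i\<in>I. emeasure M (if i \<in> C then A i else space M))"
   using A finite_I by (intro emeasure_PiM) auto
  also have "(\<Prod>i\<in>I. emeasure M (if i \<in> C then space M else A i)) * ... = (\<Prod>i\<in>I. emeasure M (A i))"
   unfolding prod.distrib[symmetric] by (intro prod.cong) (auto simp: M.emeasure_space_1)
  finally show "emeasure (distr (P \<Otimes>\<^sub>M P) P (%x. resample I C (fst x) (snd x))) (Pi\<^sub>E I A) = (\<Prod>i\<in>I. emeasure M (A i))" .
 qed simp
qed

lemma nn_integral_resample:
 assumes [measurable]: "F \<in> borel_measurable P"
 shows "(\<integral>\<^sup>+w. F w \<partial>P) = (\<integral>\<^sup>+w. (\<integral>\<^sup>+w'. F (resample I C w w') \<partial>P) \<partial>P)"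
proof -
 have "(\<integral>\<^sup>+w. F w \<partial>P) = (\<integral>\<^sup>+w. F w \<partial>distr (P \<Otimes>\<^sub>M P) P (%x. resample I C (fst x) (snd x)))" by (simp only: distr_resample)
 also have "... = (\<integral>\<^sup>+x. F (resample I C (fst x) (snd x)) \<partial>(P \<Otimes>\<^sub>M P))" by (rule nn_integral_distr) measurable
 also have "... = (\<integral>\<^sup>+w. (\<integral>\<^sup>+w'. F (resample I C w w') \<partial>P) \<partial>P)"
  using P.nn_integral_fst[of "%x. F (resample I C (fst x) (snd x))" P] by simp
 finally show ?thesis .
qed

text \<open>A supermartingale bound without filtrations. The factors before the last one do not see
  the coordinates redrawn at the last time, so integrating these out replaces the last factor by
  \<open>ka\<close>.\<close>

lemma nn_integral_adaptive_prod_le: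
 fixes Z :: "nat => ('i => 'a) => ennreal"
 assumes m: "!!t. t < N ==> Z t \<in> borel_measurable P"
  and inv: "!!t t' w w'. t' < t ==> t < N ==> w \<in> space P ==> w' \<in> space P ==> Z t' (resample I (C t) w w') = Z t' w"
  and le: "!!t w. t < N ==> w \<in> space P ==> (\<integral>\<^sup>+w'. Z t (resample I (C t) w w') \<partial>P) <= ka"
 shows "(\<integral>\<^sup>+w. (\<Prod>t<N. Z t w) \<partial>P) <= ka ^ N"
 using assms
proof (induction N)
 case 0
 show ?case by (simp add: P.emeasure_space_1)
next
 case (Suc N)
 have mZ[measurable]: "Z N \<in> borel_measurable P" "(%w. \<Prod>t<N. Z t w) \<in> borel_measurable P"
  using Suc.prems(1) by (auto intro!: borel_measurable_prod)
 have "(\<integral>\<^sup>+w. (\<Prod>t<Suc N. Z t w) \<partial>P) = (\<integral>\<^sup>+w. (\<integral>\<^sup>+w'. (\<Prod>t<Suc N. Z t (resample I (C N) w w')) \<partial>P) \<partial>P)"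
  by (rule nn_integral_resample) simp
 also have "... <= (\<integral>\<^sup>+w. ka * (\<Prod>t<N. Z t w) \<partial>P)"
 proof (rule nn_integral_mono)
  fix w assume w: "w \<in> space P"
  have "(\<integral>\<^sup>+w'. (\<Prod>t<Suc N. Z t (resample I (C N) w w')) \<partial>P) = (\<integral>\<^sup>+w'. (\<Prod>t<N. Z t w) * Z N (resample I (C N) w w') \<partial>P)"
  proof (rule nn_integral_cong)
   fix w' assume w': "w' \<in> space P"
   have "(\<Prod>t<N. Z t (resample I (C N) w w')) = (\<Prod>t<N. Z t w)"
    by (rule prod.cong[OF refl], rule Suc.prems(2)[OF _ _ w w']) auto
   thus "(\<Prod>t<Suc N. Z t (resample I (C N) w w')) = (\<Prod>t<N. Z t w) * Z N (resample I (C N) w w')" by simp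
  qed
  also have "... = (\<Prod>t<N. Z t w) * (\<integral>\<^sup>+w'. Z N (resample I (C N) w w') \<partial>P)"
   by (rule nn_integral_cmult) (use w in measurable)
  also have "... <= (\<Prod>t<N. Z t w) * ka" using Suc.prems(3)[of N, OF _ w] by (intro mult_left_mono) auto
  finally show "(\<integral>\<^sup>+w'. (\<Prod>t<Suc N. Z t (resample I (C N) w w')) \<partial>P) <= ka * (\<Prod>t<N. Z t w)" by (simp add: mult.commute)
 qed
 also have "... = ka * (\<integral>\<^sup>+w. (\<Prod>t<N. Z t w) \<partial>P)" by (rule nn_integral_cmult) simp
 also have "... <= ka * ka ^ N" using Suc.prems by (intro mult_left_mono Suc.IH) auto
 finally show ?case by simp
qed

text \<open>A trial counts only while its conditional failure probability is at most \<open>f\<close>; being a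
 function of the past, this condition costs nothing and spares us from measuring events that
 quantify over subspaces.\<close>

lemma adaptive_success:
 assumes F: "!!t. t < N ==> F t \<in> sets P" and f: "0 <= f" and be: "0 < be" "be <= 1"
  and disj: "!!t t'. t' < t ==> t < N ==> C t \<inter> C t' = {}"
  and inv: "!!t t' w w'. t' < t ==> t < N ==> w \<in> space P ==> w' \<in> space P ==>
   resample I (C t) w w' \<in> F t' \<longleftrightarrow> w \<in> F t'"
 obtains E where "E \<in> sets P" "measure P E <= (f + be) ^ N / be ^ s"
  "!!w. w \<in> space P ==> w \<notin> E ==>
   (!!t. t < N ==> measure P {w'\<in>space P. resample I (C t) w w' \<in> F t} <= f) ==> s < card {t. t < N \<and> w \<notin> F t}"
proof -
 define g where "g t w = emeasure P {w'\<in>space P. resample I (C t) w w' \<in> F t}" for t w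
 have g_m[measurable]: "g t \<in> borel_measurable P" if t: "t < N" for t
 proof -
  let ?Q = "(%x. resample I (C t) (fst x) (snd x)) -` F t \<inter> space (P \<Otimes>\<^sub>M P)"
  have Q: "?Q \<in> sets (P \<Otimes>\<^sub>M P)" by (rule measurable_sets[OF resample_measurable F[OF t]])
  have "g t w = emeasure P (Pair w -` ?Q)" if "w \<in> space P" for w
   unfolding g_def using that by (intro arg_cong[where f = "emeasure P"]) (auto simp: space_pair_measure)
  thus ?thesis using P.measurable_emeasure_Pair[OF Q] by (subst measurable_cong) auto
 qed
 have g_inv: "g t (resample I (C t) w w') = g t w" for t w w' by (simp add: g_def)
 \<comment> \<open>A conditional probability belonging to an earlier time is a function of the past:
   redrawing a later block leaves it unchanged.\<close>
 have g_inv': "g t' (resample I (C t) w w'') = g t' w" if t: "t' < t" "t < N" and w: "w \<in> space P" "w'' \<in> space P" for t t' w w''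
  unfolding g_def
 proof (rule arg_cong[where f = "emeasure P"], rule Collect_cong, rule conj_cong[OF refl])
  fix w' assume w': "w' \<in> space P"
  have "C t' \<inter> C t = {}" using disj[OF t] by blast
  thus "resample I (C t') (resample I (C t) w w'') w' \<in> F t' \<longleftrightarrow> resample I (C t') w w' \<in> F t'"
   using inv[OF t resample_space[OF w(1) w', of "C t'"] w(2)] by (simp only: resample_commute[of "C t'" "C t" I w w'' w'])
 qed
 \<comment> \<open>A failure has weight 1 and a success weight \<open>be\<close>; the weight is 0
   when the conditional failure probability exceeds \<open>f\<close>. On \<open>E\<close> the
   product of the weights is at least \<open>be ^ s\<close>, so the bound for \<open>E\<close> is
   Markov's inequality.\<close>
 define Z where "Z t w = (if g t w <= ennreal f then if w \<in> F t then 1 else ennreal be else 0)" for t w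
 define E where "E = {w\<in>space P. (\<forall>t<N. g t w <= ennreal f) \<and> card {t. t < N \<and> w \<notin> F t} <= s}"
 have Zm[measurable]: "Z t \<in> borel_measurable P" if "t < N" for t
  unfolding Z_def using F[OF that] g_m[OF that] by measurable
 have card_m: "(%w. card {t. t < N \<and> w \<notin> F t}) \<in> measurable P (count_space UNIV)"
 proof -
  have e: "card {t. t < N \<and> w \<notin> F t} = (\<Sum>t<N. if w \<notin> F t then 1 else 0)" for w
   by (simp add: sum.If_cases lessThan_def Collect_conj_eq[symmetric])
  show ?thesis unfolding e using F by measurable
 qed
 have Es: "E \<in> sets P" unfolding E_def using g_m card_m by measurable
 have Zint: "(\<integral>\<^sup>+w'. Z t (resample I (C t) w w') \<partial>P) <= ennreal (f + be)" if t: "t < N" and w: "w \<in> space P" for t w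
 proof (cases "g t w <= ennreal f")
  case False
  thus ?thesis by (simp add: Z_def g_inv)
 next
  case True
  let ?S = "{w'\<in>space P. resample I (C t) w w' \<in> F t}"
  have S: "?S \<in> sets P" using measurable_sets[OF resample_measurable_snd[OF w] F[OF t], of "C t"] by (simp add: vimage_def Int_def conj_commute)
  have "(\<integral>\<^sup>+w'. Z t (resample I (C t) w w') \<partial>P) <= (\<integral>\<^sup>+w'. indicator ?S w' + ennreal be \<partial>P)"
   using True by (intro nn_integral_mono) (auto simp: Z_def g_inv indicator_def)
  also have "... = emeasure P ?S + ennreal be" using S by (subst nn_integral_add) (auto simp: P.emeasure_space_1)
  also have "... <= ennreal f + ennreal be" using True by (intro add_right_mono) (simp add: g_def)
  finally show ?thesis using f be by simp
 qed
 have Zinv: "Z t' (resample I (C t) w w') = Z t' w" if "t' < t" "t < N" "w \<in> space P" "w' \<in> space P" for t t' w w'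
  unfolding Z_def using g_inv'[OF that] inv[OF that] by simp
 have "emeasure P E = (\<integral>\<^sup>+w. indicator E w \<partial>P)" using Es by simp
 also have "... <= (\<integral>\<^sup>+w. ennreal (1 / be ^ s) * (\<Prod>t<N. Z t w) \<partial>P)"
 proof (rule nn_integral_mono)
  fix w assume "w \<in> space P"
  show "indicator E w <= ennreal (1 / be ^ s) * (\<Prod>t<N. Z t w)"
  proof (cases "w \<in> E")
   case True
   have "(\<Prod>t<N. Z t w) = (\<Prod>t<N. if w \<in> F t then 1 else ennreal be)"
    using True by (intro prod.cong) (auto simp: Z_def E_def)
   also have "... = ennreal be ^ card {t. t < N \<and> w \<notin> F t}"
   proof -
    have "{..<N} \<inter> - {t. w \<in> F t} = {t. t < N \<and> w \<notin> F t}" by auto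
    thus ?thesis by (simp add: prod.If_cases)
   qed
   also have "... = ennreal (be ^ card {t. t < N \<and> w \<notin> F t})" using be by (simp add: ennreal_power)
   finally have e: "(\<Prod>t<N. Z t w) = ennreal (be ^ card {t. t < N \<and> w \<notin> F t})" .
   have "card {t. t < N \<and> w \<notin> F t} <= s" using True by (simp add: E_def)
   hence "be ^ s <= be ^ card {t. t < N \<and> w \<notin> F t}" using be by (intro power_decreasing) auto
   hence "1 <= 1 / be ^ s * be ^ card {t. t < N \<and> w \<notin> F t}" using be by (simp add: divide_simps)
   hence "ennreal 1 <= ennreal (1 / be ^ s * be ^ card {t. t < N \<and> w \<notin> F t})" by (rule ennreal_leI)
   also have "... = ennreal (1 / be ^ s) * (\<Prod>t<N. Z t w)" unfolding e using be by (intro ennreal_mult) auto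
   finally show ?thesis using True by simp
  qed simp
 qed
 also have "... = ennreal (1 / be ^ s) * (\<integral>\<^sup>+w. (\<Prod>t<N. Z t w) \<partial>P)"
  by (rule nn_integral_cmult) (use Zm in \<open>auto intro!: borel_measurable_prod\<close>)
 also have "... <= ennreal (1 / be ^ s) * ennreal (f + be) ^ N"
  by (intro mult_left_mono nn_integral_adaptive_prod_le[where C = C] Zm Zint Zinv) auto
 also have "ennreal (f + be) ^ N = ennreal ((f + be) ^ N)" using f be by (intro ennreal_power) simp
 also have "ennreal (1 / be ^ s) * ... = ennreal (1 / be ^ s * (f + be) ^ N)"
  using f be by (intro ennreal_mult[symmetric]) auto
 finally have "measure P E <= 1 / be ^ s * (f + be) ^ N" using f be by (simp add: P.emeasure_eq_measure ennreal_le_iff)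
 show ?thesis
 proof (rule that[OF Es])
  show "measure P E <= (f + be) ^ N / be ^ s" using \<open>measure P E <= 1 / be ^ s * (f + be) ^ N\<close> by simp
  fix w assume w: "w \<in> space P" "w \<notin> E" and al: "!!t. t < N ==> measure P {w'\<in>space P. resample I (C t) w w' \<in> F t} <= f"
  have "g t w <= ennreal f" if "t < N" for t using al[OF that] by (simp add: g_def P.emeasure_eq_measure ennreal_leI)
  thus "s < card {t. t < N \<and> w \<notin> F t}" using w by (auto simp: E_def not_le)
 qed
qed

end

lemma det_measurable:
 assumes "!!w. w \<in> space M ==> X w \<in> carrier_mat c c"
  and "!!i j. i < c ==> j < c ==> (%w. X w $$ (i,j)) \<in> borel_measurable M"
 shows "(%w. det (X w) :: real) \<in> borel_measurable M"
proof -
 have "(%w. \<Sum>pm | pm permutes {0..<c}. signof pm * (\<Prod>i=0..<c. X w $$ (i, pm i))) \<in> borel_measurable M"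
 proof (intro borel_measurable_sum borel_measurable_times borel_measurable_prod borel_measurable_const)
  fix pm i assume "pm \<in> {pm. pm permutes {0..<c}}" "i \<in> {0..<c}"
  thus "(%w. X w $$ (i, pm i)) \<in> borel_measurable M"
   using permutes_in_image[of pm "{0..<c}" i] by (intro assms(2)) auto
 qed
 thus ?thesis using assms(1) by (subst measurable_cong[where g = "%w. \<Sum>pm | pm permutes {0..<c}. signof pm * (\<Prod>i=0..<c. X w $$ (i, pm i))"])
   (auto simp: det_def')
qed

section \<open>Gram matrices of Krylov columns\<close>

text \<open>\<open>q\<close> is the number of random columns and \<open>p\<close> stands for h / n,
  the density of nonzero entries.\<close>

locale krylov =
 fixes n m q :: nat and A :: "nat => real mat" and p :: real
 assumes n_eq: "n = m * q" and n_pos: "n > 0"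
  and A_carrier [simp]: "!!i. 1 <= i ==> i <= m ==> A i \<in> carrier_mat n n"
  and A_norm: "!!i. 1 <= i ==> i <= m ==> singular_value 1 (A i) <= 1"
  and p_range: "0 <= p" "p <= 1"
begin

sublocale iid_product "{..<n} \<times> {..<q}" "sparse_gaussian p"
 by (rule iid_product.intro) (simp, rule prob_space_sparse_gaussian)

definition column :: "(nat \<times> nat => real) => nat => real vec" where
 "column w l = vec n (%a. w (a, l))"

text \<open>The sum of the rank one matrices of all vectors \<open>A b *\<^sub>v column w l\<close>
  with \<open>l\<close> in \<open>L\<close>. Smallness of this form at \<open>y\<close> expresses
  that \<open>y\<close> is almost orthogonal to the columns of K exposed so far.\<close>

definition gram :: "nat set => (nat \<times> nat => real) => real mat" where
 "gram L w = mat n n (%(i,j). \<Sum>l\<in>L. \<Sum>b=1..m. (A b *\<^sub>v column w l) $ i * (A b *\<^sub>v column w l) $ j)"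

abbreviation redraw :: "nat => (nat \<times> nat => real) => (nat \<times> nat => real) => nat \<times> nat => real" where
 "redraw l \<equiv> resample ({..<n} \<times> {..<q}) (UNIV \<times> {l})"

lemma column_carrier [simp]: "column w l \<in> carrier_vec n" "dim_vec (column w l) = n"
 by (simp_all add: column_def)

lemma image_carrier [simp]: "1 <= b ==> b <= m ==> A b *\<^sub>v column w l \<in> carrier_vec n"
 by (rule mult_mat_vec_carrier[OF A_carrier]) auto

lemma image_dim [simp]: "1 <= b ==> b <= m ==> dim_row (A b) = n" "1 <= b ==> b <= m ==> dim_col (A b) = n"
 by (simp_all add: A_carrier[THEN carrier_matD(1)] A_carrier[THEN carrier_matD(2)])

lemma column_redraw: "l < q ==> column (redraw l' w w') l = (if l = l' then column w' l else column w l)"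
 by (auto simp: column_def resample_def)

lemma gram_carrier [simp]: "gram L w \<in> carrier_mat n n" by (simp add: gram_def)

lemma gram_dim [simp]: "dim_row (gram L w) = n" "dim_col (gram L w) = n" by (simp_all add: gram_def)

lemma gram_sym [simp]: "(gram L w)\<^sup>T = gram L w"
 by (rule eq_matI) (auto simp: gram_def mult.commute)

lemma gram_quad_form:
 assumes y: "y \<in> carrier_vec n"
 shows "y \<bullet> (gram L w *\<^sub>v y) = (\<Sum>l\<in>L. \<Sum>b=1..m. (y \<bullet> (A b *\<^sub>v column w l))^2)"
proof -
 have dy: "dim_vec y = n" using y by auto
 define u where "u l b = A b *\<^sub>v column w l" for l b
 have "y \<bullet> (gram L w *\<^sub>v y) = (\<Sum>i<n. \<Sum>j<n. \<Sum>l\<in>L. \<Sum>b=1..m. y $ i * ((u l b $ i * u l b $ j) * y $ j))"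
  unfolding gram_def u_def[symmetric]
  by (simp add: scalar_prod_def dy sum_distrib_left sum_distrib_right lessThan_atLeast0)
 also have "... = (\<Sum>l\<in>L. \<Sum>b=1..m. \<Sum>i<n. \<Sum>j<n. y $ i * ((u l b $ i * u l b $ j) * y $ j))"
  by (subst (2) sum.swap, subst sum.swap, rule sum.cong[OF refl], subst (2) sum.swap, rule sum.swap)
 also have "... = (\<Sum>l\<in>L. \<Sum>b=1..m. (y \<bullet> u l b)^2)"
 proof (intro sum.cong refl)
  fix l b assume "b \<in> {1..m}"
  hence "dim_vec (u l b) = n" by (simp add: u_def)
  hence e: "y \<bullet> u l b = (\<Sum>i<n. y $ i * u l b $ i)"
   by (simp add: scalar_prod_def lessThan_atLeast0 del: index_mult_mat_vec)
  show "(\<Sum>i<n. \<Sum>j<n. y $ i * ((u l b $ i * u l b $ j) * y $ j)) = (y \<bullet> u l b)^2"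
   unfolding e power2_eq_square sum_product by (intro sum.cong refl) (simp add: mult_ac)
 qed
 finally show ?thesis by (simp only: u_def)
qed

lemma gram_nonneg: "y \<in> carrier_vec n ==> 0 <= y \<bullet> (gram L w *\<^sub>v y)"
 unfolding gram_quad_form by (intro sum_nonneg) auto

lemma gram_psd: "psd_mat n (gram L w)"
 unfolding psd_mat_def using gram_nonneg by simp

lemma gram_mono:
 assumes "L \<subseteq> L'" "finite L'" "y \<in> carrier_vec n"
 shows "y \<bullet> (gram L w *\<^sub>v y) <= y \<bullet> (gram L' w *\<^sub>v y)"
 unfolding gram_quad_form[OF assms(3)] by (intro sum_mono2 sum_nonneg) (use assms in auto)

lemma gram_Un:
 assumes "finite L" "finite L'" "L \<inter> L' = {}" shows "gram (L \<union> L') w = gram L w + gram L' w"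
 by (rule eq_matI) (auto simp: gram_def sum.union_disjoint[OF assms])

lemma gram_cong:
 assumes "!!l. l \<in> L ==> column w l = column w' l" shows "gram L w = gram L w'"
 unfolding gram_def by (rule arg_cong[where f = "mat n n"], rule ext) (use assms in \<open>auto intro!: sum.cong\<close>)

lemma gram_redraw: "L \<subseteq> {..<q} ==> l \<notin> L ==> gram L (redraw l w w') = gram L w"
 by (rule gram_cong) (auto simp: column_redraw)

lemma gram_redraw_self: "l < q ==> gram {l} (redraw l w w') = gram {l} w'"
 by (rule gram_cong) (auto simp: column_redraw)

lemma image_measurable:
 assumes "1 <= b" "b <= m" "l < q" "i < n"
 shows "(%w. (A b *\<^sub>v column w l) $ i) \<in> borel_measurable P"
proof -
 have "(%w. \<Sum>a = 0..<n. row (A b) i $ a * w (a, l)) \<in> borel_measurable P"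
 proof (intro borel_measurable_sum borel_measurable_times borel_measurable_const)
  fix a assume "a \<in> {0..<n}"
  thus "(%w. w (a, l)) \<in> borel_measurable P"
   using assms measurable_component_singleton[of "(a,l)" "{..<n} \<times> {..<q}" "%_. sparse_gaussian p"]
   by (auto cong: measurable_cong_sets)
 qed
 moreover have "(A b *\<^sub>v column w l) $ i = (\<Sum>a = 0..<n. row (A b) i $ a * w (a, l))" for w
  using assms by (simp add: scalar_prod_def column_def)
 ultimately show ?thesis by simp
qed

lemma image_inner_measurable:
 assumes "1 <= b" "b <= m" "l < q" "y \<in> carrier_vec n"
 shows "(%w. y \<bullet> (A b *\<^sub>v column w l)) \<in> borel_measurable P"
proof -
 have "y \<bullet> (A b *\<^sub>v column w l) = (\<Sum>i=0..<n. y $ i * (A b *\<^sub>v column w l) $ i)" for w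
  using assms by (simp add: scalar_prod_def del: index_mult_mat_vec)
 moreover have "(%w. \<Sum>i=0..<n. y $ i * (A b *\<^sub>v column w l) $ i) \<in> borel_measurable P"
  by (intro borel_measurable_sum borel_measurable_times borel_measurable_const image_measurable assms) auto
 ultimately show ?thesis by simp
qed

lemma gram_measurable:
 assumes "L \<subseteq> {..<q}" "i < n" "j < n"
 shows "(%w. gram L w $$ (i,j)) \<in> borel_measurable P"
proof -
 have "(%w. \<Sum>l\<in>L. \<Sum>b=1..m. (A b *\<^sub>v column w l) $ i * (A b *\<^sub>v column w l) $ j) \<in> borel_measurable P"
  by (intro borel_measurable_sum borel_measurable_times image_measurable) (use assms in auto)
 thus ?thesis using assms by (simp add: gram_def)
qed

text \<open>Only the first \<open>c\<close> blocks of a fresh column enter the determinant gain.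
  \<open>Suc\<close> translates positions counted from 0 into block numbers counted from 1.\<close>

lemma block_gram_le:
 fixes c :: nat
 defines "K \<equiv> %w l. mat n c (%(a,j). (A (Suc j) *\<^sub>v column w l) $ a)"
 assumes c: "c <= m" and y: "y \<in> carrier_vec n"
 shows "K w l \<in> carrier_mat n c" "!!j. j < c ==> col (K w l) j = A (Suc j) *\<^sub>v column w l"
  "y \<bullet> ((K w l * (K w l)\<^sup>T) *\<^sub>v y) <= y \<bullet> (gram {l} w *\<^sub>v y)"
proof -
 show K: "K w l \<in> carrier_mat n c" by (simp add: K_def)
 show col: "col (K w l) j = A (Suc j) *\<^sub>v column w l" if "j < c" for j
  using that c by (intro eq_vecI) (auto simp: K_def)
 have KT: "(K w l)\<^sup>T \<in> carrier_mat c n" using K by simp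
 have "y \<bullet> ((K w l * (K w l)\<^sup>T) *\<^sub>v y) = ((K w l)\<^sup>T *\<^sub>v y) \<bullet> ((K w l)\<^sup>T *\<^sub>v y)"
  using gram_quad[OF KT y] by simp
 also have "... = (\<Sum>j<c. (y \<bullet> (A (Suc j) *\<^sub>v column w l))^2)"
 proof -
  have "((K w l)\<^sup>T *\<^sub>v y) $ j = y \<bullet> (A (Suc j) *\<^sub>v column w l)" if j: "j < c" for j
  proof -
   have "((K w l)\<^sup>T *\<^sub>v y) $ j = col (K w l) j \<bullet> y" using j K by simp
   also have "... = y \<bullet> col (K w l) j" by (rule comm_scalar_prod[OF col_carrier_vec y]) (use j K in auto)
   finally show ?thesis by (simp only: col[OF j])
  qed
  moreover have "dim_vec ((K w l)\<^sup>T *\<^sub>v y) = c" using K by simp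
  ultimately show ?thesis by (simp add: scalar_prod_def power2_eq_square lessThan_atLeast0 del: index_mult_mat_vec)
 qed
 also have "... = (\<Sum>b\<in>Suc ` {..<c}. (y \<bullet> (A b *\<^sub>v column w l))^2)" by (simp add: sum.reindex)
 also have "... <= (\<Sum>b=1..m. (y \<bullet> (A b *\<^sub>v column w l))^2)" using c by (intro sum_mono2) auto
 finally show "y \<bullet> ((K w l * (K w l)\<^sup>T) *\<^sub>v y) <= y \<bullet> (gram {l} w *\<^sub>v y)" using y by (simp add: gram_quad_form)
qed

lemma smult_one_quad: "y \<in> carrier_vec n ==> y \<bullet> ((ta \<cdot>\<^sub>m 1\<^sub>m n) *\<^sub>v y) = ta * (y \<bullet> y)" for ta :: real
 by (subst quad_smult[of _ n]) auto

text \<open>By contradiction at the final time: if \<open>c\<close> small directions survive all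
  \<open>N\<close> columns, then at every earlier time the form is at most \<open>2 * ta\<close> on
  their span, so that every successful column multiplies the determinant by at least
  \<open>b / (2 * ta) ^ c\<close>. More than \<open>s\<close> successes exceed the budget of
  \<open>det_budget\<close>.\<close>

lemma reduction:
 fixes Q :: "(nat \<times> nat => real) => real mat" and sg :: "nat => nat"
 assumes Q: "!!w. psd_mat n (Q w)"
  and Qm: "!!i j. i < n ==> j < n ==> (%w. Q w $$ (i,j)) \<in> borel_measurable P"
  and Qinv: "!!w w' t. t < N ==> Q (redraw (sg t) w w') = Q w"
  and sg: "inj_on sg {..<N}" "sg ` {..<N} \<subseteq> {..<q}"
  and c: "1 <= c" "c <= m" and ta: "ta > 0" and b: "b > 0" and f: "0 <= f" and be: "0 < be" "be <= 1" and La: "La > 0"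
  and gain: "3 * (1 + La / ta) ^ d < (b / (2 * ta) ^ c) ^ s"
 obtains E where "E \<in> sets P" "measure P E <= (f + be) ^ N / be ^ s"
  "!!w. w \<in> space P ==> w \<notin> E ==> codim_bound n (Q w) (real n * La) d ==>
   (!!y. y \<in> carrier_vec n ==> y \<bullet> (gram (sg ` {..<N}) w *\<^sub>v y) <= La * (y \<bullet> y)) ==>
   (!!ph t. orthon n c ph ==> (!!et. comb n c ph et \<bullet> (Q w *\<^sub>v comb n c ph et) <= ta * (\<Sum>i<c. (et i)^2)) ==> t < N ==>
     measure P {w'\<in>space P. (det (mat c c (%(i,j). ph i \<bullet> (A (Suc j) *\<^sub>v column w' (sg t)))))^2 < b} <= f) ==>
   codim_bound n (Q w + gram (sg ` {..<N}) w) ta (c - 1)"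
proof -
 define rh where "rh = b / (2 * ta) ^ c"
 define S where "S t w = Q w + ta \<cdot>\<^sub>m 1\<^sub>m n + gram (sg ` {..<t}) w" for t w
 \<comment> \<open>Failure is expressed by determinants of the exposed matrix alone. This makes it
   measurable and a function of the past; the surviving directions do not occur in it.\<close>
 define F where "F t = {w\<in>space P. det (S (Suc t) w) < rh * det (S t w)}" for t
 have sgq: "sg t < q" if "t < N" for t using sg(2) that by auto
 have sgne: "sg t \<noteq> sg s" if "s < t" "t < N" for s t using inj_onD[OF sg(1), of t s] that by auto
 have Qc: "Q w \<in> carrier_mat n n" "(Q w)\<^sup>T = Q w" and Q0: "y \<in> carrier_vec n ==> 0 <= y \<bullet> (Q w *\<^sub>v y)" for w y
  using Q[of w] unfolding psd_mat_def by auto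
 have QTc: "Q w + ta \<cdot>\<^sub>m 1\<^sub>m n \<in> carrier_mat n n" for w using Qc by simp
 have Sc: "S t w \<in> carrier_mat n n" for t w unfolding S_def using Qc by simp
 have Ssym: "(S t w)\<^sup>T = S t w" for t w
 proof -
  have "(ta \<cdot>\<^sub>m 1\<^sub>m n)\<^sup>T = ta \<cdot>\<^sub>m 1\<^sub>m n" by (rule eq_matI) auto
  thus ?thesis unfolding S_def using Qc QTc by (simp add: transpose_add[of _ n n])
 qed
 have Sq: "y \<bullet> (S t w *\<^sub>v y) = y \<bullet> (Q w *\<^sub>v y) + ta * (y \<bullet> y) + y \<bullet> (gram (sg ` {..<t}) w *\<^sub>v y)"
  if y: "y \<in> carrier_vec n" for y t w
  unfolding S_def using quad_add[OF QTc gram_carrier y] quad_add[OF Qc(1) _ y, of "ta \<cdot>\<^sub>m 1\<^sub>m n"] smult_one_quad[OF y] by simp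
 have Spd: "pos_def_mat n (S t w)" for t w
  unfolding pos_def_mat_def
 proof (intro conjI Sc Ssym ballI impI)
  fix y :: "real vec" assume y: "y \<in> carrier_vec n" "y \<noteq> 0\<^sub>v n"
  have "y \<bullet> y \<noteq> 0" using sq_zero_iff[OF y(1)] y(2) by simp
  hence "0 < y \<bullet> y" using sq_nonneg[of y] by linarith
  hence "0 < ta * (y \<bullet> y)" using ta by simp
  thus "0 < y \<bullet> (S t w *\<^sub>v y)" unfolding Sq[OF y(1)] using Q0[OF y(1), of w] gram_nonneg[OF y(1), of "sg ` {..<t}" w] by linarith
 qed
 have Spos: "0 < det (S t w)" for t w by (rule pos_def_inverse[OF Spd])
 have Smeas: "(%w. det (S t w)) \<in> borel_measurable P" if t: "t <= N" for t
 proof (rule det_measurable[OF Sc])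
  fix i j assume ij: "i < n" "j < n"
  have "S t w $$ (i,j) = Q w $$ (i,j) + ta * (1\<^sub>m n) $$ (i,j) + gram (sg ` {..<t}) w $$ (i,j)" for w
   unfolding S_def using ij Qc(1)[of w] gram_carrier[of "sg ` {..<t}" w] by simp
  moreover have "(%w. Q w $$ (i,j) + ta * (1\<^sub>m n) $$ (i,j) + gram (sg ` {..<t}) w $$ (i,j)) \<in> borel_measurable P"
   using sgq t by (intro borel_measurable_add Qm gram_measurable borel_measurable_const ij) auto
  ultimately show "(%w. S t w $$ (i,j)) \<in> borel_measurable P" by simp
 qed
 have Fs: "F t \<in> sets P" if "t < N" for t
 proof -
  have "t <= N" "Suc t <= N" using that by auto
  note [measurable] = Smeas[OF this(1)] Smeas[OF this(2)]
  show ?thesis unfolding F_def by measurable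
 qed
 have Sinv: "S t' (redraw (sg t) w w') = S t' w" if t: "t' <= t" "t < N" for t t' w w'
 proof -
  have "sg t \<notin> sg ` {..<t'}"
  proof
   assume "sg t \<in> sg ` {..<t'}"
   then obtain s where "s < t'" "sg t = sg s" by auto
   thus False using sgne[of s t] t by simp
  qed
  moreover have "sg ` {..<t'} \<subseteq> {..<q}" using sgq t by auto
  ultimately show ?thesis unfolding S_def using Qinv[OF t(2)] by (simp add: gram_redraw)
 qed
 have SSuc: "S (Suc t) (redraw (sg t) w w') = S t w + gram {sg t} w'" if t: "t < N" for t w w'
 proof -
  have ni: "sg t \<notin> sg ` {..<t}"
  proof
   assume "sg t \<in> sg ` {..<t}"
   then obtain s where "s < t" "sg t = sg s" by auto
   thus False using sgne[of s t] t by simp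
  qed
  have sub: "sg ` {..<t} \<subseteq> {..<q}" using sgq t by auto
  have "sg ` {..<Suc t} = sg ` {..<t} \<union> {sg t}" by (auto simp: lessThan_Suc)
  hence "gram (sg ` {..<Suc t}) (redraw (sg t) w w') = gram (sg ` {..<t}) w + gram {sg t} w'"
   using ni sub sgq[OF t] by (simp add: gram_Un gram_redraw gram_redraw_self del: Un_insert_right)
  thus ?thesis unfolding S_def Qinv[OF t]
   using assoc_add_mat[OF QTc gram_carrier gram_carrier] by simp
 qed
 have "0 < rh" using b ta by (simp add: rh_def)
 \<comment> \<open>Otherwise the right side of \<open>gain\<close> would be at most 1, while the
   left side is at least 3.\<close>
 have rh1: "1 <= rh"
 proof (rule ccontr)
  assume "\<not> 1 <= rh"
  hence "rh ^ s <= 1" using \<open>0 < rh\<close> by (intro power_le_one) auto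
  moreover have "1 <= (1 + La / ta) ^ d" using La ta by (intro one_le_power) simp
  ultimately show False using gain unfolding rh_def by linarith
 qed
 obtain E where E: "E \<in> sets P" "measure P E <= (f + be) ^ N / be ^ s"
  "!!w. w \<in> space P ==> w \<notin> E ==>
   (!!t. t < N ==> measure P {w'\<in>space P. redraw (sg t) w w' \<in> F t} <= f) ==> s < card {t. t < N \<and> w \<notin> F t}"
 proof (rule adaptive_success[where N = N and F = F and f = f and be = be and C = "%t. UNIV \<times> {sg t}" and s = s], goal_cases)
  case (5 t t')
  thus ?case using sgne[of t' t] by auto
 next
  case (6 t t' w w')
  thus ?case unfolding F_def using Sinv[of t' t w w'] Sinv[of "Suc t'" t w w'] by (auto simp: resample_space)
 next
  case (7 E)
  show ?case by (rule 7(1)[OF 7(2,3)]) (rule 7(4))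
 qed (use Fs f be in auto)
 show ?thesis
 proof (rule that[OF E(1,2)])
  fix w assume w: "w \<in> space P" "w \<notin> E" and cb: "codim_bound n (Q w) (real n * La) d"
   and X: "!!y. y \<in> carrier_vec n ==> y \<bullet> (gram (sg ` {..<N}) w *\<^sub>v y) <= La * (y \<bullet> y)"
   and prob: "!!ph t. orthon n c ph ==> (!!et. comb n c ph et \<bullet> (Q w *\<^sub>v comb n c ph et) <= ta * (\<Sum>i<c. (et i)^2)) ==> t < N ==>
     measure P {w'\<in>space P. (det (mat c c (%(i,j). ph i \<bullet> (A (Suc j) *\<^sub>v column w' (sg t)))))^2 < b} <= f"
  let ?X = "gram (sg ` {..<N}) w"
  show "codim_bound n (Q w + ?X) ta (c - 1)"
  proof (rule ccontr)
   assume nc: "\<not> ?thesis"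
   have "Q w + ?X \<in> carrier_mat n n" "(Q w + ?X)\<^sup>T = Q w + ?X"
    using Qc by (simp_all add: transpose_add[of _ n n])
   from codim_bound_or_small[OF this c(1), of ta] nc obtain ph where
    ph: "orthon n c ph" and sm: "!!et. comb n c ph et \<bullet> ((Q w + ?X) *\<^sub>v comb n c ph et) <= ta * (\<Sum>i<c. (et i)^2)" by blast
   have sm': "comb n c ph et \<bullet> (Q w *\<^sub>v comb n c ph et) + comb n c ph et \<bullet> (?X *\<^sub>v comb n c ph et) <= ta * (\<Sum>i<c. (et i)^2)" for et
    using sm[of et] quad_add[OF Qc(1) gram_carrier comb_carrier] by simp
   have smQ: "comb n c ph et \<bullet> (Q w *\<^sub>v comb n c ph et) <= ta * (\<Sum>i<c. (et i)^2)" for et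
    using sm'[of et] gram_nonneg[OF comb_carrier] by (meson add_increasing2 le_add_same_cancel1 order_trans)
   have smS: "comb n c ph et \<bullet> (S t w *\<^sub>v comb n c ph et) <= (2 * ta) * (\<Sum>i<c. (et i)^2)" if t: "t <= N" for t et
   proof -
    have "comb n c ph et \<bullet> (gram (sg ` {..<t}) w *\<^sub>v comb n c ph et) <= comb n c ph et \<bullet> (?X *\<^sub>v comb n c ph et)"
     using t by (intro gram_mono) auto
    moreover have "comb n c ph et \<bullet> comb n c ph et = (\<Sum>i<c. (et i)^2)"
     using comb_scalar_prod_self[OF ph] by (simp add: power2_eq_square)
    ultimately show ?thesis unfolding Sq[OF comb_carrier] using sm'[of et] by (simp add: mult.assoc)
   qed
   \<comment> \<open>The frame \<open>ph\<close> comes from all columns, including later ones. Here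
     it only witnesses that the conditional failure probability at time \<open>t\<close> is small,
     and that probability is determined by the past.\<close>
   have fail: "measure P {w'\<in>space P. redraw (sg t) w w' \<in> F t} <= f" if t: "t < N" for t
   proof -
    let ?D = "%w'. det (mat c c (%(i,j). ph i \<bullet> (A (Suc j) *\<^sub>v column w' (sg t))))"
    have "(?D w')^2 < b" if F: "redraw (sg t) w w' \<in> F t" for w'
    proof -
     define K where "K = mat n c (%(a,j). (A (Suc j) *\<^sub>v column w' (sg t)) $ a)"
     note Kf = block_gram_le[OF c(2), where w = w' and l = "sg t", folded K_def]
     have Kc: "K \<in> carrier_mat n c" by (simp add: K_def)
     have Mc: "mat c c (%(i,j). ph i \<bullet> col K j) = mat c c (%(i,j). ph i \<bullet> (A (Suc j) *\<^sub>v column w' (sg t)))"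
      by (rule eq_matI) (use Kf(2)[OF zero_carrier_vec] in auto)
     have t2: "0 < 2 * ta" using ta by simp
     have "t <= N" using t by simp
     note g = det_gain[OF Spd ph Kc t2 smS[OF \<open>t <= N\<close>], unfolded Mc]
     have KK: "K * K\<^sup>T \<in> carrier_mat n n" using Kc by simp
     have qK: "y \<bullet> ((S t w + K * K\<^sup>T) *\<^sub>v y) <= y \<bullet> ((S t w + gram {sg t} w') *\<^sub>v y)" if y: "y \<in> carrier_vec n" for y
      unfolding quad_add[OF Sc KK y] quad_add[OF Sc gram_carrier y] using Kf(3)[OF y] by simp
     have Kq0: "0 <= y \<bullet> ((K * K\<^sup>T) *\<^sub>v y)" if y: "y \<in> carrier_vec n" for y
      using gram_quad[of "K\<^sup>T" c n y] Kc y by simp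
     have pd: "pos_def_mat n (S t w + K * K\<^sup>T)"
      unfolding pos_def_mat_def
     proof (intro conjI ballI impI)
      show "S t w + K * K\<^sup>T \<in> carrier_mat n n" using Sc KK by simp
      show "(S t w + K * K\<^sup>T)\<^sup>T = S t w + K * K\<^sup>T"
       using transpose_add[OF Sc KK] transpose_mult[OF Kc, of "K\<^sup>T" n] Kc Ssym by simp
      fix y :: "real vec" assume y: "y \<in> carrier_vec n" "y \<noteq> 0\<^sub>v n"
      have "0 < y \<bullet> (S t w *\<^sub>v y)" using Spd[of t w] y unfolding pos_def_mat_def by blast
      thus "0 < y \<bullet> ((S t w + K * K\<^sup>T) *\<^sub>v y)" using quad_add[OF Sc KK y(1)] Kq0[OF y(1)] by simp
     qed
     have "det (S t w) * ((?D w')^2 / (2 * ta) ^ c) <= det (S t w + K * K\<^sup>T)" by (rule g(1))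
     also have "... <= det (S t w + gram {sg t} w')"
      by (rule det_mono[OF pd _ _ qK]) (use Sc Ssym transpose_add[OF Sc gram_carrier] in auto)
     also have "... = det (S (Suc t) (redraw (sg t) w w'))" by (simp only: SSuc[OF t])
     also have "... < rh * det (S t (redraw (sg t) w w'))" using F by (simp add: F_def)
     also have "... = det (S t w) * (b / (2 * ta) ^ c)" using Sinv[OF order_refl t] by (simp add: rh_def)
     finally have "(?D w')^2 / (2 * ta) ^ c < b / (2 * ta) ^ c" by (simp only: mult_less_cancel_left_pos[OF Spos])
     thus ?thesis using ta by (simp add: divide_strict_right_mono divide_less_cancel)
    qed
    hence sub: "{w'\<in>space P. redraw (sg t) w w' \<in> F t} \<subseteq> {w'\<in>space P. (?D w')^2 < b}" by blast
    have "?D \<in> borel_measurable P"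
    proof (rule det_measurable)
     fix i j assume ij: "i < c" "j < c"
     have "ph i \<in> carrier_vec n" using ph ij by (simp add: orthon_def)
     thus "(%w'. mat c c (%(i,j). ph i \<bullet> (A (Suc j) *\<^sub>v column w' (sg t))) $$ (i,j)) \<in> borel_measurable P"
      using ij c(2) image_inner_measurable[of "Suc j" "sg t" "ph i"] sgq[OF t] by simp
    qed simp
    hence "{w'\<in>space P. (?D w')^2 < b} \<in> sets P" by measurable
    hence "measure P {w'\<in>space P. redraw (sg t) w w' \<in> F t} <= measure P {w'\<in>space P. (?D w')^2 < b}"
     using sub by (intro P.finite_measure_mono)
    also have "... <= f" by (rule prob[OF ph smQ t])
    finally show ?thesis .
   qed
   have succ: "s < card {t. t < N \<and> w \<notin> F t}" by (rule E(3)[OF w fail])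
   have "rh ^ card {t. t < T \<and> w \<notin> F t} * det (S 0 w) <= det (S T w)" if "T <= N" for T
    using that
   proof (induction T)
    case (Suc T)
    show ?case
    proof (cases "w \<in> F T")
     case True
     hence "{t. t < Suc T \<and> w \<notin> F t} = {t. t < T \<and> w \<notin> F t}" by (auto simp: less_Suc_eq)
     hence "rh ^ card {t. t < Suc T \<and> w \<notin> F t} * det (S 0 w) <= det (S T w)" using Suc by simp
     also have "... <= det (S (Suc T) w)"
     proof (rule det_mono[OF Spd Sc Ssym])
      fix y :: "real vec" assume y: "y \<in> carrier_vec n"
      have "y \<bullet> (gram (sg ` {..<T}) w *\<^sub>v y) <= y \<bullet> (gram (sg ` {..<Suc T}) w *\<^sub>v y)"
       by (intro gram_mono y) auto
      thus "y \<bullet> (S T w *\<^sub>v y) <= y \<bullet> (S (Suc T) w *\<^sub>v y)" unfolding Sq[OF y] by simp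
     qed
     finally show ?thesis .
    next
     case False
     hence "{t. t < Suc T \<and> w \<notin> F t} = insert T {t. t < T \<and> w \<notin> F t}" by (auto simp: less_Suc_eq)
     hence "rh ^ card {t. t < Suc T \<and> w \<notin> F t} * det (S 0 w) = rh * (rh ^ card {t. t < T \<and> w \<notin> F t} * det (S 0 w))" by simp
     also have "... <= rh * det (S T w)" using Suc \<open>0 < rh\<close> by (intro mult_left_mono) auto
     also have "... <= det (S (Suc T) w)" using False w(1) by (simp add: F_def not_less)
     finally show ?thesis .
    qed
   qed simp
   from this[OF order_refl] have "rh ^ card {t. t < N \<and> w \<notin> F t} * det (S 0 w) <= det (S N w)" .
   moreover have "rh ^ s <= rh ^ card {t. t < N \<and> w \<notin> F t}" using succ rh1 by (intro power_increasing) auto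
   ultimately have 1: "rh ^ s * det (S 0 w) <= det (S N w)"
    using mult_right_mono[OF _ less_imp_le[OF Spos[of 0 w]]] by (meson order_trans)
   have "det (S N w) <= 3 * (1 + La / ta) ^ d * det (Q w + ta \<cdot>\<^sub>m 1\<^sub>m n)"
    unfolding S_def by (rule det_budget[OF Q cb La ta gram_psd X])
   also have "Q w + ta \<cdot>\<^sub>m 1\<^sub>m n = S 0 w"
   proof -
    have "gram (sg ` {..<0}) w = 0\<^sub>m n n" by (rule eq_matI) (auto simp: gram_def)
    thus ?thesis unfolding S_def using QTc by simp
   qed
   finally have "rh ^ s * det (S 0 w) <= 3 * (1 + La / ta) ^ d * det (S 0 w)" using 1 by linarith
   thus False using gain Spos[of 0 w] unfolding rh_def by simp
  qed
 qed
qed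

section \<open>Spreading of almost orthogonal directions\<close>

abbreviation "cells \<equiv> {..<n} \<times> {..<q}"

lemma finite_cells: "finite cells" by simp

lemma card_cells: "real (card cells) <= (real n)^2"
proof -
 have "m \<ge> 1" using n_eq n_pos by (cases m) auto
 hence "1 * q <= m * q" by (intro mult_right_mono) auto
 hence "q <= n" using n_eq by simp
 hence "real n * real q <= real n * real n" by (intro mult_left_mono) auto
 thus ?thesis by (simp add: power2_eq_square)
qed

lemma q_le_n: "q <= n"
proof -
 have "m \<ge> 1" using n_eq n_pos by (cases m) auto
 hence "1 * q <= m * q" by (intro mult_right_mono) auto
 thus ?thesis using n_eq by simp
qed

lemma entry_measurable [measurable]: "a < n ==> l < q ==> (%w. w (a, l)) \<in> borel_measurable P"
 using measurable_component_singleton[of "(a,l)" cells "%_. sparse_gaussian p"] by (auto cong: measurable_cong_sets)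

text \<open>The cut-off \<open>n\<close> is generous. An entry exceeds it with probability of order
  \<open>exp (- n\<^sup>2 / 4)\<close>, while \<open>\<alpha>\<close> is at least
  \<open>exp (- n)\<close> in the range considered, so the excluded event is negligible against
  \<open>\<alpha>\<close>.\<close>

definition bounded_entries :: "(nat \<times> nat => real) => bool" where
 "bounded_entries w \<longleftrightarrow> (\<forall>a<n. \<forall>l<q. \<bar>w (a, l)\<bar> <= real n)"

lemma bounded_entries_measurable: "{w\<in>space P. \<not> bounded_entries w} \<in> sets P"
proof -
 have "{w\<in>space P. \<not> bounded_entries w} = (\<Union>i\<in>cells. {w\<in>space P. real n < \<bar>w i\<bar>})"
  by (auto simp: bounded_entries_def not_le)
 moreover have "{w\<in>space P. real n < \<bar>w i\<bar>} \<in> sets P" if "i \<in> cells" for i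
 proof -
  have [measurable]: "(%w. w i) \<in> borel_measurable P"
   using entry_measurable[of "fst i" "snd i"] that by (simp add: mem_Times_iff)
  show ?thesis by measurable
 qed
 ultimately show ?thesis by (auto intro!: sets.finite_UN)
qed

lemma bounded_entries_prob: "measure P {w\<in>space P. \<not> bounded_entries w} <= (real n)^2 * (2 * exp (- (real n)\<^sup>2 / 4))"
proof -
 have meas: "{w\<in>space P. real n < \<bar>w i\<bar>} \<in> sets P" if "i \<in> cells" for i
 proof -
  have [measurable]: "(%w. w i) \<in> borel_measurable P"
   using entry_measurable[of "fst i" "snd i"] that by (simp add: mem_Times_iff)
  show ?thesis by measurable
 qed
 have one: "measure P {w\<in>space P. real n < \<bar>w i\<bar>} <= 2 * exp (- (real n)\<^sup>2 / 4)" if i: "i \<in> cells" for i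
 proof -
  interpret product_prob_space "%_::nat \<times> nat. sparse_gaussian p" cells by (rule product_sparse)
  have B: "{x::real. real n < \<bar>x\<bar>} \<in> sets (sparse_gaussian p)" by simp
  have "measure (sparse_gaussian p) {x. real n < \<bar>x\<bar>} = measure (distr P (sparse_gaussian p) (%w. w i)) {x. real n < \<bar>x\<bar>}"
   using PiM_component[OF i] by simp
  also have "... = measure P ((%w. w i) -` {x. real n < \<bar>x\<bar>} \<inter> space P)"
   by (rule measure_distr[OF measurable_component_singleton[OF i] B])
  also have "(%w. w i) -` {x. real n < \<bar>x\<bar>} \<inter> space P = {w\<in>space P. real n < \<bar>w i\<bar>}" by auto
  finally show ?thesis using sparse_tail[OF p_range, of "real n"] by simp
 qed
 have "{w\<in>space P. \<not> bounded_entries w} = (\<Union>i\<in>cells. {w\<in>space P. real n < \<bar>w i\<bar>})"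
  by (auto simp: bounded_entries_def not_le)
 hence "measure P {w\<in>space P. \<not> bounded_entries w} <= (\<Sum>i\<in>cells. measure P {w\<in>space P. real n < \<bar>w i\<bar>})"
  using meas by (auto intro!: P.finite_measure_subadditive_finite)
 also have "... <= (\<Sum>i\<in>cells. 2 * exp (- (real n)\<^sup>2 / 4))" by (intro sum_mono one)
 also have "... = real (card cells) * (2 * exp (- (real n)\<^sup>2 / 4))" by simp
 also have "... <= (real n)^2 * (2 * exp (- (real n)\<^sup>2 / 4))" by (intro mult_right_mono card_cells) simp
 finally show ?thesis .
qed

lemma sum_cells_column:
 assumes "l < q"
 shows "(\<Sum>i\<in>cells. w i * (if snd i = l then g (fst i) else 0)) = (\<Sum>a<n. w (a, l) * (g a :: real))"
proof -
 have "(\<Sum>i\<in>cells. w i * (if snd i = l then g (fst i) else 0)) = (\<Sum>a<n. \<Sum>l'<q. w (a,l') * (if l' = l then g a else 0))"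
  by (simp add: sum.cartesian_product case_prod_unfold)
 also have "... = (\<Sum>a<n. w (a, l) * g a)"
 proof (rule sum.cong[OF refl])
  fix a
  have "(\<Sum>l'<q. w (a,l') * (if l' = l then g a else 0)) = (\<Sum>l'<q. if l' = l then w (a, l) * g a else 0)"
   by (rule sum.cong) auto
  thus "(\<Sum>l'<q. w (a,l') * (if l' = l then g a else 0)) = w (a, l) * g a" using assms by simp
 qed
 finally show ?thesis .
qed

lemma card_cells_column:
 assumes "l < q" "!!a. a \<in> S ==> a < n \<and> R (a, l)"
 shows "card S <= card {i\<in>cells. R i}"
proof (rule card_inj_on_le[of "%a. (a, l)"])
 show "(%a. (a, l)) ` S \<subseteq> {i\<in>cells. R i}" using assms by auto
qed (auto simp: inj_on_def)

lemma single_column_prob: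
 assumes l: "l < q" and y: "y \<in> carrier_vec n" and k: "k <= card {a. a < n \<and> th <= \<bar>y $ a\<bar>}" and th: "th > 0" and t: "t \<ge> 0"
 shows "measure P {w\<in>space P. \<bar>y \<bullet> column w l\<bar> < t * th} <= (1 - p) ^ k + (real n)^2 * (2 * t)"
proof -
 let ?v = "%i. if snd i = l then y $ fst i else 0"
 have e: "(\<Sum>i\<in>cells. w i * ?v i) = y \<bullet> column w l" for w
  unfolding sum_cells_column[OF l] using y by (simp add: scalar_prod_def column_def lessThan_atLeast0 mult.commute)
 have "card {a. a < n \<and> th <= \<bar>y $ a\<bar>} <= card {i\<in>cells. th <= \<bar>?v i\<bar>}" by (rule card_cells_column[OF l]) auto
 hence "k <= card {i\<in>cells. th <= \<bar>?v i\<bar>}" using k by linarith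
 from single_form_prob[OF finite_cells th p_range t this]
 have "measure P {w\<in>space P. \<bar>y \<bullet> column w l\<bar> < t * th} <= (1 - p) ^ k + real (card cells) * (2 * t)" unfolding e .
 also have "... <= (1 - p) ^ k + (real n)^2 * (2 * t)" using t by (intro add_left_mono mult_right_mono card_cells) auto
 finally show ?thesis .
qed

section \<open>Spread of single directions\<close>

text \<open>The spread condition with the identity in place of a combination of the
  \<open>A i\<close>. It concerns the random columns alone and is transferred to \<open>A 1\<close>
  by \<open>base_spread_imp_spread\<close>.\<close>

definition base_spread :: "nat set => nat => real => (nat \<times> nat => real) => bool" where
 "base_spread L k th w \<longleftrightarrow> (\<forall>y\<in>carrier_vec n. y \<bullet> y = 1 --> (\<Sum>l\<in>L. (y \<bullet> column w l)^2) <= th\<^sup>2 -->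
   k <= card {a. a < n \<and> th <= \<bar>y $ a\<bar>})"

lemma sq_eq_sum: "y \<in> carrier_vec n ==> y \<bullet> y = (\<Sum>a<n. (y $ a)^2)" for y :: "real vec"
 by (auto simp: scalar_prod_def power2_eq_square lessThan_atLeast0)

lemma unit_entry_le:
 assumes "y \<in> carrier_vec n" "y \<bullet> y = (1::real)" "a < n" shows "\<bar>y $ a\<bar> <= 1"
proof -
 have "(y $ a)^2 <= (\<Sum>a<n. (y $ a)^2)" using assms(3) by (intro member_le_sum) auto
 thus ?thesis using assms sq_eq_sum[of y] by (simp add: abs_square_le_1)
qed

lemma unit_large_entry:
 assumes "y \<in> carrier_vec n" "y \<bullet> y = (1::real)" shows "\<exists>a<n. 1 / real n <= \<bar>y $ a\<bar>"
proof (rule ccontr)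
 assume "\<not> ?thesis"
 hence lt: "\<bar>y $ a\<bar> < 1 / real n" if "a < n" for a using that by (meson not_le)
 have "(\<Sum>a<n. (y $ a)^2) < (\<Sum>a<n. 1 / real n)"
 proof (rule sum_strict_mono)
  fix a assume "a \<in> {..<n}"
  hence "\<bar>y $ a\<bar> < 1 / real n" using lt by simp
  moreover have "1 / real n <= 1" using n_pos by simp
  ultimately have "\<bar>y $ a\<bar> * \<bar>y $ a\<bar> <= 1 * \<bar>y $ a\<bar>" by (intro mult_right_mono) auto
  hence "(y $ a)^2 <= \<bar>y $ a\<bar>" by (simp add: power2_eq_square)
  thus "(y $ a)^2 < 1 / real n" using \<open>\<bar>y $ a\<bar> < 1 / real n\<close> by linarith
 qed (use n_pos in auto)
 thus False using assms n_pos sq_eq_sum[of y] by simp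
qed

lemma base_spread_start: "base_spread {} 1 (1 / real n) w"
 unfolding base_spread_def
proof (intro ballI impI)
 fix y :: "real vec" assume y: "y \<in> carrier_vec n" "y \<bullet> y = 1"
 obtain a where "a < n" "1 / real n <= \<bar>y $ a\<bar>" using unit_large_entry[OF y] by blast
 hence "{a. a < n \<and> 1 / real n <= \<bar>y $ a\<bar>} \<noteq> {}" by auto
 thus "1 <= card {a. a < n \<and> 1 / real n <= \<bar>y $ a\<bar>}" by (simp add: Suc_le_eq card_gt_0_iff)
qed

text \<open>For a fixed vector the \<open>N\<close> columns are independent, so the single column
  probabilities multiply; the product is obtained by redrawing the columns one after the
  other.\<close>

lemma base_step_event:
 assumes y: "y \<in> carrier_vec n" and k: "k <= card {a. a < n \<and> th <= \<bar>y $ a\<bar>}" and th: "th > 0" and t: "t \<ge> 0"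
  and sg: "inj_on sg {..<N}" "sg ` {..<N} \<subseteq> {..<q}"
 shows "{w\<in>space P. \<forall>s<N. \<bar>y \<bullet> column w (sg s)\<bar> < t * th} \<in> sets P" (is "?E \<in> _")
  "measure P {w\<in>space P. \<forall>s<N. \<bar>y \<bullet> column w (sg s)\<bar> < t * th} <= ((1 - p) ^ k + (real n)^2 * (2 * t)) ^ N"
proof -
 let ?f = "(1 - p) ^ k + (real n)^2 * (2 * t)"
 have f0: "0 <= ?f" using p_range t by simp
 let ?B = "%s. {w\<in>space P. \<bar>y \<bullet> column w (sg s)\<bar> < t * th}"
 have sgq: "sg s < q" if "s < N" for s using sg(2) that by auto
 have B: "?B s \<in> sets P" if s: "s < N" for s
 proof -
  have "(%w. \<Sum>a=0..<n. y $ a * w (a, sg s)) \<in> borel_measurable P"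
   using sgq[OF s] by (intro borel_measurable_sum borel_measurable_times entry_measurable) auto
  moreover have "y \<bullet> column w (sg s) = (\<Sum>a=0..<n. y $ a * w (a, sg s))" for w by (simp add: scalar_prod_def column_def)
  ultimately show ?thesis by simp
 qed
 have "?E = space P \<inter> (\<Inter>s\<in>{..<N}. ?B s)" by auto
 also have "... \<in> sets P" using B by (cases "N = 0") (auto intro!: sets.Int sets.finite_INT)
 finally show Es: "?E \<in> sets P" .
 define Z where "Z s w = (indicator (?B s) w :: ennreal)" for s w
 have "(\<integral>\<^sup>+w. (\<Prod>s<N. Z s w) \<partial>P) <= ennreal ?f ^ N"
 proof (rule nn_integral_adaptive_prod_le[where C = "%s. UNIV \<times> {sg s}"])
  show "Z s \<in> borel_measurable P" if "s < N" for s unfolding Z_def using B[OF that] by measurable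
  show "Z s' (redraw (sg s) w w') = Z s' w" if "s' < s" "s < N" "w \<in> space P" "w' \<in> space P" for s s' w w'
  proof -
   have "sg s' \<noteq> sg s" using that sg(1) by (auto simp: inj_on_def)
   thus ?thesis using that sgq[of s'] by (simp add: Z_def indicator_def column_redraw resample_space)
  qed
  show "(\<integral>\<^sup>+w'. Z s (redraw (sg s) w w') \<partial>P) <= ennreal ?f" if s: "s < N" and w: "w \<in> space P" for s w
  proof -
   have "(\<integral>\<^sup>+w'. Z s (redraw (sg s) w w') \<partial>P) = (\<integral>\<^sup>+w'. indicator (?B s) w' \<partial>P)"
    using w sgq[OF s] by (intro nn_integral_cong) (simp add: Z_def indicator_def column_redraw resample_space)
   also have "... = ennreal (measure P (?B s))" using B[OF s] by (simp add: P.emeasure_eq_measure)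
   also have "... <= ennreal ?f" by (intro ennreal_leI single_column_prob sgq s y k th t)
   finally show ?thesis .
  qed
 qed
 moreover have "(\<integral>\<^sup>+w. (\<Prod>s<N. Z s w) \<partial>P) = (\<integral>\<^sup>+w. indicator ?E w \<partial>P)"
 proof (rule nn_integral_cong)
  fix w assume "w \<in> space P"
  show "(\<Prod>s<N. Z s w) = indicator ?E w"
   using \<open>w \<in> space P\<close> by (cases "w \<in> ?E") (auto simp: Z_def indicator_def intro!: prod.neutral prod_zero)
 qed
 moreover have "(\<integral>\<^sup>+w. indicator ?E w \<partial>P) = ennreal (measure P ?E)"
  by (subst nn_integral_indicator[OF Es]) (rule P.emeasure_eq_measure)
 ultimately have "ennreal (measure P ?E) <= ennreal (?f ^ N)" using f0 by (simp only: ennreal_power)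
 thus "measure P ?E <= ?f ^ N" using f0 by (subst (asm) ennreal_le_iff) auto
qed

text \<open>If \<open>y\<close> had fewer than \<open>k'\<close> coordinates above the new
  threshold, it would lie near a vector with at most \<open>k'\<close> nonzero entries on a mesh,
  and there are at most \<open>(n ^ (x + 8)) ^ k'\<close> codes for these. The nearby vector
  inherits \<open>k\<close> coordinates of size \<open>th / 2\<close>, so the \<open>N\<close> fresh
  columns are unlikely to be all almost orthogonal to it.\<close>

lemma base_spread_step:
 fixes x :: nat
 assumes n3: "n \<ge> 3" and sg: "inj_on sg {..<N}" "sg ` {..<N} \<subseteq> {..<q}" and L: "finite L"
 obtains E where "E \<in> sets P" "measure P E <= (real n ^ (x + 8)) ^ k' * ((1 - p) ^ k + 12 / (real n)^2) ^ N"
  "!!w. w \<in> space P ==> w \<notin> E ==> bounded_entries w ==> base_spread L k (1 / real n ^ x) w ==>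
   base_spread (L \<union> sg ` {..<N}) k' (1 / real n ^ (x + 6)) w"
proof -
 define D where "D = n ^ (x + 6)"
 define th where "th = 1 / real n ^ x"
 \<comment> \<open>The new threshold is also the mesh width, so that dropping a small entry and
   rounding a large one cause the same error.\<close>
 define th' where "th' = 1 / real D"
 have D: "D > 0" using n_pos by (simp add: D_def)
 have th: "th > 0" and th': "th' > 0" using n_pos D by (simp_all add: th_def th'_def)
 have thD: "th' = th / real n ^ 6" by (simp add: th'_def th_def D_def power_add)
 have th2: "th' <= th / 2"
 proof -
  have "(2::real) <= real n ^ 1" using n3 by simp
  also have "... <= real n ^ 6" using n3 by (intro power_increasing) auto
  finally show ?thesis unfolding thD using th n_pos by (intro divide_left_mono) auto
 qed
 define G where "G = {..<n} \<times> {- int D..int D}"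
 have finG: "finite G" by (simp add: G_def)
 define \<J> where "\<J> = {J. J \<subseteq> G \<and> card J <= k'}"
 have fin\<J>: "finite \<J>" unfolding \<J>_def using finG by simp
 have card\<J>: "real (card \<J>) <= (real n ^ (x + 8)) ^ k'"
 proof -
  have "card {- int D..int D} = 2 * D + 1" unfolding card_atLeastAtMost_int by linarith
  hence "card G + 1 = n * (2 * D + 1) + 1" by (simp only: G_def card_cartesian_product card_lessThan)
  also have "... <= n ^ (x + 8)"
  proof -
   have nD3: "3 * (n * D) <= n * (n * D)" using n3 by (intro mult_right_mono) auto
   have "n * (2 * D + 1) + 1 = 2 * (n * D) + n + 1" by (simp add: algebra_simps)
   also have "... <= n * (n * D)"
   proof -
    have "D \<ge> 3 ^ 6" unfolding D_def using n3 by (metis le_add2 order_trans power_increasing power_mono zero_le one_le_numeral le_trans)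
    hence "2 * n <= n * D" "n \<ge> 1" using n3 by auto
    thus ?thesis using nD3 by linarith
   qed
   also have "... = n ^ (x + 8)" by (simp add: D_def power_add numeral_eq_Suc)
   finally show ?thesis .
  qed
  finally have g: "card G + 1 <= n ^ (x + 8)" .
  have "card \<J> <= (card G + 1) ^ k'" unfolding \<J>_def by (rule card_small_subsets_le[OF finG])
  also have "... <= (n ^ (x + 8)) ^ k'" using g by (intro power_mono) auto
  finally have "real (card \<J>) <= real ((n ^ (x + 8)) ^ k')" by (rule of_nat_mono)
  thus ?thesis by simp
 qed
 \<comment> \<open>A net vector is encoded by pairs of a coordinate and a multiple of
   \<open>1 / D\<close>. The sum makes the definition meaningful also for sets \<open>J\<close> that
   are not graphs.\<close>
 define yh where "yh J = vec n (%a. (\<Sum>z\<in>J. if fst z = a then real_of_int (snd z) else 0) / real D)" for J :: "(nat \<times> int) set"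
 have yhc: "yh J \<in> carrier_vec n" for J by (simp add: yh_def)
 define \<G> where "\<G> = {J\<in>\<J>. k <= card {a. a < n \<and> th / 2 <= \<bar>yh J $ a\<bar>}}"
 \<comment> \<open>Chosen so that \<open>t * (th / 2)\<close> is \<open>3 * n\<^sup>2 * th'\<close>:
   rounding moves a scalar product with a bounded column by at most \<open>n\<^sup>2 * th'\<close>,
   and the original scalar product is at most \<open>th'\<close>. The price is the term
   \<open>12 / n\<^sup>2\<close> in the failure probability.\<close>
 define t where "t = 6 / real n ^ 4"
 have t: "t \<ge> 0" by (simp add: t_def)
 have tth: "t * (th / 2) = 3 * (real n)^2 * th'"
  unfolding t_def thD using n_pos by (simp add: field_simps power2_eq_square numeral_eq_Suc)
 have nt: "(real n)^2 * (2 * t) = 12 / (real n)^2"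
  unfolding t_def using n_pos by (simp add: field_simps numeral_eq_Suc)
 define EJ where "EJ J = {w\<in>space P. \<forall>s<N. \<bar>yh J \<bullet> column w (sg s)\<bar> < t * (th / 2)}" for J
 have EJ: "EJ J \<in> sets P" "measure P (EJ J) <= ((1 - p) ^ k + 12 / (real n)^2) ^ N" if "J \<in> \<G>" for J
 proof -
  have kk: "k <= card {a. a < n \<and> th / 2 <= \<bar>yh J $ a\<bar>}" using that by (simp add: \<G>_def)
  have th2: "0 < th / 2" using th by simp
  show "EJ J \<in> sets P" unfolding EJ_def by (rule base_step_event(1)[OF yhc kk th2 t sg])
  show "measure P (EJ J) <= ((1 - p) ^ k + 12 / (real n)^2) ^ N"
   unfolding EJ_def nt[symmetric] by (rule base_step_event(2)[OF yhc kk th2 t sg])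
 qed
 show ?thesis
 proof (rule that[of "\<Union>J\<in>\<G>. EJ J"])
  have finG': "finite \<G>" unfolding \<G>_def using fin\<J> by simp
  show "(\<Union>J\<in>\<G>. EJ J) \<in> sets P" using finG' EJ by (intro sets.finite_UN) auto
  have f0: "0 <= ((1 - p) ^ k + 12 / (real n)^2) ^ N" using p_range by (intro zero_le_power add_nonneg_nonneg) auto
  have "measure P (\<Union>J\<in>\<G>. EJ J) <= (\<Sum>J\<in>\<G>. measure P (EJ J))"
   using finG' EJ by (intro P.finite_measure_subadditive_finite) auto
  also have "... <= (\<Sum>J\<in>\<G>. ((1 - p) ^ k + 12 / (real n)^2) ^ N)" by (intro sum_mono EJ)
  also have "... = real (card \<G>) * ((1 - p) ^ k + 12 / (real n)^2) ^ N" by simp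
  also have "... <= (real n ^ (x + 8)) ^ k' * ((1 - p) ^ k + 12 / (real n)^2) ^ N"
  proof (intro mult_right_mono f0)
   have "card \<G> <= card \<J>" unfolding \<G>_def using fin\<J> by (intro card_mono) auto
   thus "real (card \<G>) <= (real n ^ (x + 8)) ^ k'" using card\<J> by linarith
  qed
  finally show "measure P (\<Union>J\<in>\<G>. EJ J) <= (real n ^ (x + 8)) ^ k' * ((1 - p) ^ k + 12 / (real n)^2) ^ N" .
 next
  fix w assume w: "w \<in> space P" "w \<notin> (\<Union>J\<in>\<G>. EJ J)" and bd: "bounded_entries w" and sp: "base_spread L k (1 / real n ^ x) w"
  have mesh: "1 / real n ^ (x + 6) = th'" by (simp add: th'_def D_def)
  show "base_spread (L \<union> sg ` {..<N}) k' (1 / real n ^ (x + 6)) w"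
   unfolding base_spread_def mesh
  proof (intro ballI impI)
   fix y :: "real vec" assume y: "y \<in> carrier_vec n" "y \<bullet> y = 1"
    and small: "(\<Sum>l\<in>L \<union> sg ` {..<N}. (y \<bullet> column w l)^2) <= th'\<^sup>2"
   define T where "T = {a. a < n \<and> th' <= \<bar>y $ a\<bar>}"
   have finT: "finite T" by (simp add: T_def)
   show "k' <= card {a. a < n \<and> th' <= \<bar>y $ a\<bar>}"
   proof (rule ccontr)
    assume "\<not> k' <= card {a. a < n \<and> th' <= \<bar>y $ a\<bar>}"
    hence cT: "card T <= k'" by (simp add: T_def)
    define J where "J = (%a. (a, \<lfloor>y $ a * real D\<rfloor>)) ` T"
    have cJ: "card J <= k'" unfolding J_def using card_image_le[OF finT, of "%a. (a, \<lfloor>y $ a * real D\<rfloor>)"] cT by linarith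
    have "J \<subseteq> G"
    proof
     fix z assume "z \<in> J"
     then obtain a where a: "a \<in> T" "z = (a, \<lfloor>y $ a * real D\<rfloor>)" by (auto simp: J_def)
     hence "\<bar>y $ a\<bar> <= 1" using unit_entry_le[OF y, of a] by (simp add: T_def)
     hence "\<bar>y $ a * real D\<bar> <= real D" by (simp add: abs_mult mult_left_le_one_le)
     hence "- real D <= y $ a * real D" "y $ a * real D <= real D" by linarith+
     hence "- int D <= \<lfloor>y $ a * real D\<rfloor>" "\<lfloor>y $ a * real D\<rfloor> <= int D" by linarith+
     thus "z \<in> G" using a by (auto simp: G_def T_def)
    qed
    hence J\<J>: "J \<in> \<J>" using cJ by (simp add: \<J>_def)
    have yh_eq: "yh J $ a = (if a \<in> T then real_of_int \<lfloor>y $ a * real D\<rfloor> / real D else 0)" if a: "a < n" for a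
    proof -
     have "(\<Sum>z\<in>J. if fst z = a then real_of_int (snd z) else 0) = (\<Sum>b\<in>T. if b = a then real_of_int \<lfloor>y $ b * real D\<rfloor> else 0)"
      unfolding J_def by (subst sum.reindex) (auto simp: inj_on_def intro!: sum.cong)
     also have "... = (if a \<in> T then real_of_int \<lfloor>y $ a * real D\<rfloor> else 0)" using finT by simp
     finally show ?thesis using a by (simp add: yh_def)
    qed
    have close: "\<bar>yh J $ a - y $ a\<bar> <= th'" if a: "a < n" for a
    proof (cases "a \<in> T")
     case True
     have "\<bar>real_of_int \<lfloor>y $ a * real D\<rfloor> - y $ a * real D\<bar> <= 1" by linarith
     hence "\<bar>real_of_int \<lfloor>y $ a * real D\<rfloor> - y $ a * real D\<bar> / real D <= 1 / real D" using D by (intro divide_right_mono) auto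
     moreover have "yh J $ a - y $ a = (real_of_int \<lfloor>y $ a * real D\<rfloor> - y $ a * real D) / real D"
      using yh_eq[OF a] True D by (simp add: field_simps)
     ultimately show ?thesis unfolding th'_def by (simp add: abs_divide)
    next
     case False
     thus ?thesis using yh_eq[OF a] a by (simp add: T_def)
    qed
    have "(\<Sum>l\<in>L. (y \<bullet> column w l)^2) <= (\<Sum>l\<in>L \<union> sg ` {..<N}. (y \<bullet> column w l)^2)"
     using L by (intro sum_mono2) auto
    also have "... <= th'\<^sup>2" by (rule small)
    also have "... <= th\<^sup>2" using th2 th' th by (intro power_mono) auto
    finally have "k <= card {a. a < n \<and> th <= \<bar>y $ a\<bar>}" using sp y unfolding base_spread_def th_def by blast
    also have "... <= card {a. a < n \<and> th / 2 <= \<bar>yh J $ a\<bar>}"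
    proof (rule card_mono)
     show "{a. a < n \<and> th <= \<bar>y $ a\<bar>} \<subseteq> {a. a < n \<and> th / 2 <= \<bar>yh J $ a\<bar>}"
     proof safe
      fix a assume "a < n" "th <= \<bar>y $ a\<bar>"
      thus "th / 2 <= \<bar>yh J $ a\<bar>" using close[of a] th2 by linarith
     qed
    qed simp
    finally have J\<G>: "J \<in> \<G>" using J\<J> by (simp add: \<G>_def)
    have "w \<in> EJ J"
     unfolding EJ_def tth
    proof (intro CollectI conjI w(1) allI impI)
     fix s assume s: "s < N"
     have "(y \<bullet> column w (sg s))^2 <= (\<Sum>l\<in>L \<union> sg ` {..<N}. (y \<bullet> column w l)^2)"
      using L s by (intro member_le_sum[of "sg s" _ "%l. (y \<bullet> column w l)^2"]) auto
     hence "(y \<bullet> column w (sg s))^2 <= th'\<^sup>2" using small by linarith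
     hence 1: "\<bar>y \<bullet> column w (sg s)\<bar> <= th'" using th' by (simp add: abs_le_square_iff[symmetric])
     have sq: "sg s < q" using sg(2) s by auto
     have "yh J \<bullet> column w (sg s) - y \<bullet> column w (sg s) = (\<Sum>a<n. (yh J $ a - y $ a) * w (a, sg s))"
      by (simp add: scalar_prod_def column_def lessThan_atLeast0 sum_subtractf[symmetric] left_diff_distrib)
     hence "\<bar>yh J \<bullet> column w (sg s) - y \<bullet> column w (sg s)\<bar> <= (\<Sum>a<n. \<bar>(yh J $ a - y $ a) * w (a, sg s)\<bar>)"
      using sum_abs by metis
     also have "... <= (\<Sum>a<n. th' * real n)"
     proof (rule sum_mono)
      fix a assume "a \<in> {..<n}"
      thus "\<bar>(yh J $ a - y $ a) * w (a, sg s)\<bar> <= th' * real n"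
       unfolding abs_mult using close[of a] bd sq th' by (intro mult_mono) (auto simp: bounded_entries_def)
     qed
     also have "... = (real n)^2 * th'" by (simp add: power2_eq_square)
     finally have 2: "\<bar>yh J \<bullet> column w (sg s) - y \<bullet> column w (sg s)\<bar> <= (real n)^2 * th'" .
     have "1 <= (real n)^2" using n3 by (intro one_le_power) auto
     hence "1 * th' <= (real n)^2 * th'" using th' by (intro mult_right_mono) auto
     moreover have "0 < (real n)^2 * th'" using n_pos th' by simp
     ultimately show "\<bar>yh J \<bullet> column w (sg s)\<bar> < 3 * (real n)^2 * th'" using 1 2 by linarith
    qed
    thus False using w(2) J\<G> by blast
   qed
  qed
 qed
qed

text \<open>\<open>base_spread\<close> quantifies over uncountably many vectors; a measurable
  exceptional set \<open>E\<close> stands in for its failure. The statement is uniform in the sets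
  \<open>L\<close> of given size, so that columns can be split off in any way.\<close>

definition base_likely :: "nat => nat => nat => real => bool" where
 "base_likely u k x ep \<longleftrightarrow> (\<forall>L. L \<subseteq> {..<q} --> card L = u --> (\<exists>E\<in>sets P. measure P E <= ep \<and>
   (\<forall>w\<in>space P. w \<notin> E --> bounded_entries w --> base_spread L k (1 / real n ^ x) w)))"

lemma split_columns:
 assumes "L \<subseteq> {..<q}" "card L = u + N"
 obtains L1 sg where "L1 \<subseteq> {..<q}" "card L1 = u" "inj_on sg {..<N}" "sg ` {..<N} \<subseteq> {..<q}" "L = L1 \<union> sg ` {..<N}"
  "L1 \<inter> sg ` {..<N} = {}"
proof -
 have finL: "finite L" using assms finite_subset by blast
 obtain L1 where L1: "L1 \<subseteq> L" "card L1 = u" using obtain_subset_with_card_n[of u L] assms by auto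
 have "card (L - L1) = N" using L1 finL assms by (simp add: card_Diff_subset finite_subset)
 then obtain sg where "bij_betw sg {..<N} (L - L1)"
  using ex_bij_betw_nat_finite[of "L - L1"] finL by (auto simp: lessThan_atLeast0)
 hence "inj_on sg {..<N}" "sg ` {..<N} = L - L1" by (auto simp: bij_betw_def)
 thus ?thesis using L1 assms by (intro that[of L1 sg]) auto
qed

lemma base_likely_start: "base_likely 0 1 1 0"
 unfolding base_likely_def
proof (intro allI impI)
 fix L assume "L \<subseteq> {..<q}" "card L = 0"
 hence "L = {}" by (simp add: finite_subset)
 thus "\<exists>E\<in>sets P. measure P E <= 0 \<and> (\<forall>w\<in>space P. w \<notin> E --> bounded_entries w --> base_spread L 1 (1 / real n ^ 1) w)"
  using base_spread_start by (intro bexI[of _ "{}"]) auto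
qed

lemma base_likely_step:
 assumes "n \<ge> 3" and H: "base_likely u k x ep"
 shows "base_likely (u + N) k' (x + 6) (ep + (real n ^ (x + 8)) ^ k' * ((1 - p) ^ k + 12 / (real n)^2) ^ N)"
 unfolding base_likely_def
proof (intro allI impI)
 fix L assume "L \<subseteq> {..<q}" "card L = u + N"
 then obtain L1 sg where L1: "L1 \<subseteq> {..<q}" "card L1 = u" and sg: "inj_on sg {..<N}" "sg ` {..<N} \<subseteq> {..<q}" and Leq: "L = L1 \<union> sg ` {..<N}"
  by (rule split_columns)
 obtain E1 where E1: "E1 \<in> sets P" "measure P E1 <= ep"
  and E1': "\<forall>w\<in>space P. w \<notin> E1 --> bounded_entries w --> base_spread L1 k (1 / real n ^ x) w"
  using H[unfolded base_likely_def, THEN spec, THEN mp, THEN mp, OF L1] by (elim bexE conjE) (rule that)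
 have "finite L1" using L1 finite_subset by blast
 obtain E2 where E2: "E2 \<in> sets P" "measure P E2 <= (real n ^ (x + 8)) ^ k' * ((1 - p) ^ k + 12 / (real n)^2) ^ N"
  "!!w. w \<in> space P ==> w \<notin> E2 ==> bounded_entries w ==> base_spread L1 k (1 / real n ^ x) w ==>
   base_spread (L1 \<union> sg ` {..<N}) k' (1 / real n ^ (x + 6)) w"
 proof (rule base_spread_step[OF assms(1) sg \<open>finite L1\<close>, where x = x and k' = k' and k = k], goal_cases)
  case (1 E)
  show ?case by (rule 1(1)[OF 1(2,3)]) (rule 1(4))
 qed
 show "\<exists>E\<in>sets P. measure P E <= ep + (real n ^ (x + 8)) ^ k' * ((1 - p) ^ k + 12 / (real n)^2) ^ N \<and>
   (\<forall>w\<in>space P. w \<notin> E --> bounded_entries w --> base_spread L k' (1 / real n ^ (x + 6)) w)"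
 proof (intro bexI[of _ "E1 \<union> E2"] conjI ballI impI)
  show "measure P (E1 \<union> E2) <= ep + (real n ^ (x + 8)) ^ k' * ((1 - p) ^ k + 12 / (real n)^2) ^ N"
   using measure_Un_le[OF E1(1) E2(1)] E1(2) E2(2) by linarith
  show "E1 \<union> E2 \<in> sets P" using E1 E2 by blast
  fix w assume w: "w \<in> space P" "w \<notin> E1 \<union> E2" "bounded_entries w"
  show "base_spread L k' (1 / real n ^ (x + 6)) w" unfolding Leq using w E1' by (intro E2(3)) auto
 qed
qed

section \<open>Spread of linear combinations of the matrices\<close>

definition trans_entry :: "nat => real vec => nat => real" where
 "trans_entry i y a = (\<Sum>b<n. A i $$ (b, a) * y $ b)"

text \<open>The coefficient of the entry \<open>a\<close> of a column g in the scalar product of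
  \<open>y\<close> with the combination of the \<open>A i\<close> g with coefficients
  \<open>x\<close>; equivalently an entry of the transposed combination applied to
  \<open>y\<close>.\<close>

definition pencil :: "nat => (nat => real) => real vec => nat => real" where
 "pencil r x y a = (\<Sum>i=1..r. x i * trans_entry i y a)"

definition spread :: "nat set => nat => nat => real => (nat \<times> nat => real) => bool" where
 "spread L r k th w \<longleftrightarrow> (\<forall>y\<in>carrier_vec n. y \<bullet> y = 1 --> y \<bullet> (gram L w *\<^sub>v y) <= th\<^sup>2 -->
   (\<forall>x. (\<Sum>i=1..r. (x i)^2) = 1 --> k <= card {a. a < n \<and> th <= \<bar>pencil r x y a\<bar>}))"

lemma trans_entry_transpose:
 assumes "1 <= i" "i <= m" "a < n" "y \<in> carrier_vec n"
 shows "((A i)\<^sup>T *\<^sub>v y) $ a = trans_entry i y a"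
 using assms by (simp add: trans_entry_def scalar_prod_def lessThan_atLeast0)

lemma inner_image_column:
 assumes i: "1 <= i" "i <= m" and y: "y \<in> carrier_vec n"
 shows "y \<bullet> (A i *\<^sub>v column w l) = (\<Sum>a<n. w (a, l) * trans_entry i y a)"
proof -
 have "y \<bullet> (A i *\<^sub>v column w l) = (\<Sum>b<n. \<Sum>a<n. y $ b * (A i $$ (b, a) * w (a, l)))"
  using i y by (simp add: scalar_prod_def column_def lessThan_atLeast0 sum_distrib_left)
 also have "... = (\<Sum>a<n. \<Sum>b<n. y $ b * (A i $$ (b, a) * w (a, l)))" by (rule sum.swap)
 also have "... = (\<Sum>a<n. w (a, l) * trans_entry i y a)"
  unfolding trans_entry_def sum_distrib_left by (intro sum.cong refl) (simp add: mult_ac)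
 finally show ?thesis .
qed

lemma trans_entry_comb: "trans_entry i (comb n c ph et) a = (\<Sum>k<c. et k * trans_entry i (ph k) a)"
proof -
 have "trans_entry i (comb n c ph et) a = (\<Sum>b<n. \<Sum>k<c. A i $$ (b, a) * (et k * ph k $ b))"
  by (simp add: trans_entry_def comb_def sum_distrib_left)
 also have "... = (\<Sum>k<c. \<Sum>b<n. A i $$ (b, a) * (et k * ph k $ b))" by (rule sum.swap)
 finally show ?thesis by (simp add: trans_entry_def sum_distrib_left mult_ac)
qed

lemma trans_entry_smult: "y \<in> carrier_vec n ==> trans_entry i (s \<cdot>\<^sub>v y) a = s * trans_entry i y a"
 by (auto simp: trans_entry_def sum_distrib_left mult_ac intro!: sum.cong)

lemma trans_entry_sq_sum:
 assumes "1 <= i" "i <= m" "y \<in> carrier_vec n"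
 shows "(\<Sum>a<n. (trans_entry i y a)^2) <= y \<bullet> y"
proof -
 have "(A i)\<^sup>T *\<^sub>v y \<in> carrier_vec n" using A_carrier[OF assms(1,2)] assms(3) by simp
 from sq_eq_sum[OF this] have "((A i)\<^sup>T *\<^sub>v y) \<bullet> ((A i)\<^sup>T *\<^sub>v y) = (\<Sum>a<n. (trans_entry i y a)^2)"
  using trans_entry_transpose[OF assms(1,2) _ assms(3)] by simp
 thus ?thesis using singular_value_one_bound_transpose[OF A_carrier[OF assms(1,2)] A_norm[OF assms(1,2)] assms(3)] by linarith
qed

lemma abs_trans_entry_le:
 assumes "1 <= i" "i <= m" "y \<in> carrier_vec n" "y \<bullet> y = 1" "a < n"
 shows "\<bar>trans_entry i y a\<bar> <= 1"
proof -
 have "(trans_entry i y a)^2 <= (\<Sum>a<n. (trans_entry i y a)^2)" using assms(5) by (intro member_le_sum) auto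
 also have "... <= 1" using trans_entry_sq_sum[OF assms(1-3)] assms(4) by simp
 finally show ?thesis by (simp add: abs_square_le_1)
qed

text \<open>The origin of \<open>n ^ 4\<close>, the size \<open>La\<close> in the later determinant
  budgets: there are at most \<open>n\<close> pairs of a column and a block, and each contributes at
  most \<open>n ^ 3\<close>.\<close>

lemma gram_le:
 assumes bd: "bounded_entries w" and L: "L \<subseteq> {..<q}" and y: "y \<in> carrier_vec n"
 shows "y \<bullet> (gram L w *\<^sub>v y) <= real n ^ 4 * (y \<bullet> y)"
proof -
 have one: "(y \<bullet> (A b *\<^sub>v column w l))^2 <= (y \<bullet> y) * real n ^ 3" if lb: "l \<in> L" "b \<in> {1..m}" for l b
 proof -
  have b: "1 <= b" "b <= m" using lb by auto
  have lq: "l < q" using lb L by auto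
  have "(y \<bullet> (A b *\<^sub>v column w l))^2 <= (y \<bullet> y) * ((A b *\<^sub>v column w l) \<bullet> (A b *\<^sub>v column w l))"
   by (rule scalar_prod_Cauchy_Schwarz[OF y image_carrier[OF b]])
  also have "... <= (y \<bullet> y) * (column w l \<bullet> column w l)"
   by (intro mult_left_mono singular_value_one_bound[OF A_carrier[OF b] A_norm[OF b]]) auto
  also have "... <= (y \<bullet> y) * real n ^ 3"
  proof (intro mult_left_mono sq_nonneg)
   have "column w l \<bullet> column w l = (\<Sum>a<n. (w (a, l))^2)" by (simp add: sq_eq_sum column_def)
   also have "... <= (\<Sum>a<n. (real n)^2)"
    using bd lq by (intro sum_mono) (auto simp: bounded_entries_def abs_le_square_iff[symmetric])
   also have "... = real n ^ 3" by (simp add: numeral_eq_Suc)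
   finally show "column w l \<bullet> column w l <= real n ^ 3" .
  qed
  finally show ?thesis .
 qed
 have "y \<bullet> (gram L w *\<^sub>v y) <= (\<Sum>l\<in>L. \<Sum>b=1..m. (y \<bullet> y) * real n ^ 3)"
  unfolding gram_quad_form[OF y] by (intro sum_mono one)
 also have "... = real (card L * m) * ((y \<bullet> y) * real n ^ 3)" by simp
 also have "... <= real n * ((y \<bullet> y) * real n ^ 3)"
 proof (intro mult_right_mono of_nat_mono)
  have "card L <= q" using card_mono[OF _ L] by simp
  thus "card L * m <= n" unfolding n_eq by (simp add: mult.commute)
 qed auto
 also have "... = real n ^ 4 * (y \<bullet> y)" by (simp add: numeral_eq_Suc)
 finally show ?thesis .
qed

text \<open>\<open>spread\<close> speaks of unit vectors, whereas the growth argument produces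
  vectors with a coefficient equal to 1, hence of norm at least 1. Scaling them down to norm 1 only
  shrinks the pencil.\<close>

lemma spread_scaled:
 assumes sp: "spread L r k th w" and y: "y \<in> carrier_vec n" "1 <= y \<bullet> y" and small: "y \<bullet> (gram L w *\<^sub>v y) <= th\<^sup>2 * (y \<bullet> y)"
  and x: "1 <= (\<Sum>i=1..r. (x i)^2)" and th: "th > 0"
 shows "k <= card {a. a < n \<and> th <= \<bar>pencil r x y a\<bar>}"
proof -
 define u where "u = sqrt (y \<bullet> y)"
 define v where "v = sqrt (\<Sum>i=1..r. (x i)^2)"
 have u: "1 <= u" "u\<^sup>2 = y \<bullet> y" using y by (simp_all add: u_def)
 have v: "1 <= v" "v\<^sup>2 = (\<Sum>i=1..r. (x i)^2)" using x by (simp_all add: v_def)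
 define y' where "y' = (1 / u) \<cdot>\<^sub>v y"
 define x' where "x' i = x i / v" for i
 have y': "y' \<in> carrier_vec n" using y by (simp add: y'_def)
 have uv: "1 <= u * v" using mult_mono[OF u(1) v(1)] u v by simp
 have "(1 / u) * (1 / u) * u\<^sup>2 = 1" using u(1) by (simp add: power2_eq_square)
 hence iu: "(1 / u) * (1 / u) * (y \<bullet> y) = 1" unfolding u(2) .
 have "y' \<bullet> y' = (1 / u) * ((1 / u) * (y \<bullet> y))" unfolding y'_def using y by simp
 hence y'1: "y' \<bullet> y' = 1" using iu by (simp only: mult.assoc)
 have "gram L w *\<^sub>v y' = (1 / u) \<cdot>\<^sub>v (gram L w *\<^sub>v y)" unfolding y'_def by (rule mult_mat_vec[OF gram_carrier y(1)])
 hence "y' \<bullet> (gram L w *\<^sub>v y') = (1 / u) * ((1 / u) * (y \<bullet> (gram L w *\<^sub>v y)))"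
  unfolding y'_def using y(1) mult_mat_vec_carrier[OF gram_carrier y(1)] by simp
 also have "... <= (1 / u) * ((1 / u) * (th\<^sup>2 * (y \<bullet> y)))" using small u by (intro mult_left_mono) auto
 also have "... = ((1 / u) * (1 / u) * (y \<bullet> y)) * th\<^sup>2" by (simp only: ac_simps)
 also have "... = th\<^sup>2" unfolding iu by simp
 finally have sm': "y' \<bullet> (gram L w *\<^sub>v y') <= th\<^sup>2" .
 have x'1: "(\<Sum>i=1..r. (x' i)^2) = 1"
  unfolding x'_def power_divide sum_divide_distrib[symmetric] v(2)[symmetric] using v(1) by simp
 have "k <= card {a. a < n \<and> th <= \<bar>pencil r x' y' a\<bar>}" using sp y' y'1 sm' x'1 unfolding spread_def by blast
 also have "... <= card {a. a < n \<and> th <= \<bar>pencil r x y a\<bar>}"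
 proof (rule card_mono)
  show "{a. a < n \<and> th <= \<bar>pencil r x' y' a\<bar>} \<subseteq> {a. a < n \<and> th <= \<bar>pencil r x y a\<bar>}"
  proof safe
   fix a assume a: "th <= \<bar>pencil r x' y' a\<bar>"
   have "pencil r x y a = (\<Sum>i=1..r. (u * v) * (x' i * trans_entry i y' a))"
    unfolding pencil_def x'_def y'_def trans_entry_smult[OF y(1)] using u v by (intro sum.cong) auto
   hence "pencil r x y a = (u * v) * pencil r x' y' a" by (simp add: pencil_def sum_distrib_left)
   hence "\<bar>pencil r x y a\<bar> = (u * v) * \<bar>pencil r x' y' a\<bar>" by (simp only: abs_mult[of "u * v"] abs_of_nonneg[OF order_trans[OF zero_le_one uv]])
   moreover have "1 * \<bar>pencil r x' y' a\<bar> <= (u * v) * \<bar>pencil r x' y' a\<bar>" using uv by (intro mult_right_mono) auto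
   ultimately show "th <= \<bar>pencil r x y a\<bar>" using a by linarith
  qed
 qed simp
 finally show ?thesis .
qed

text \<open>The coefficient of the cell \<open>i\<close> in the scalar product of
  \<open>ph k\<close> with the block \<open>Suc j\<close> of column \<open>l\<close>. All cells stay
  variables, with coefficient 0 outside column \<open>l\<close>, so that the probability bounds
  apply on the full product space.\<close>

definition column_form :: "nat => (nat => real vec) => nat \<times> nat => nat => nat => real" where
 "column_form l ph i k j = (if snd i = l then trans_entry (Suc j) (ph k) (fst i) else 0)"

lemma column_form_sum:
 assumes l: "l < q" and ph: "ph k \<in> carrier_vec n" and j: "j < m"
 shows "(\<Sum>i\<in>cells. w i * column_form l ph i k j) = ph k \<bullet> (A (Suc j) *\<^sub>v column w l)"
 using sum_cells_column[OF l, of w "%a. trans_entry (Suc j) (ph k) a"] inner_image_column[of "Suc j" "ph k" w l] ph j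
 by (simp add: column_form_def)

lemma column_form_minor:
 assumes l: "l < q" and ph: "orthon n c ph" and c: "c <= m" and f: "!!i. i < rh ==> f i < c" "!!i. i < rh ==> g i < c"
 shows "minor (column_form l ph) cells rh f g w = det (mat rh rh (%(i,j). ph (f i) \<bullet> (A (Suc (g j)) *\<^sub>v column w l)))"
proof -
 have "mat rh rh (%(i,j). \<Sum>a\<in>cells. w a * column_form l ph a (f i) (g j)) = mat rh rh (%(i,j). ph (f i) \<bullet> (A (Suc (g j)) *\<^sub>v column w l))"
 proof (rule eq_matI)
  fix i j assume "i < dim_row (mat rh rh (%(i,j). ph (f i) \<bullet> (A (Suc (g j)) *\<^sub>v column w l)))"
   "j < dim_col (mat rh rh (%(i,j). ph (f i) \<bullet> (A (Suc (g j)) *\<^sub>v column w l)))"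
  hence ij: "i < rh" "j < rh" by auto
  have "ph (f i) \<in> carrier_vec n" "g j < m" using ph f ij c by (auto simp: orthon_def intro: less_le_trans)
  from column_form_sum[where ph = ph and k = "f i" and j = "g j" and w = w, OF l this] ij
  show "mat rh rh (%(i,j). \<Sum>a\<in>cells. w a * column_form l ph a (f i) (g j)) $$ (i, j) = mat rh rh (%(i,j). ph (f i) \<bullet> (A (Suc (g j)) *\<^sub>v column w l)) $$ (i, j)"
   by simp
 qed auto
 thus ?thesis by (simp only: minor_def)
qed

text \<open>A bilinear form in the compressed column is a pencil: \<open>y\<close> combines the
  frame into one vector, and \<open>z\<close>, shifted by one and padded with zeros up to
  \<open>r\<close>, supplies the coefficients.\<close>

lemma column_form_spread:
 assumes sp: "spread L r k th w" and c: "c <= r" "r <= m" and l: "l < q" and ph: "orthon n c ph"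
  and small: "!!et. comb n c ph et \<bullet> (gram L w *\<^sub>v comb n c ph et) <= th\<^sup>2 * (\<Sum>i<c. (et i)^2)" and th: "th > 0"
  and y: "\<exists>i<c. y i = 1" and z: "\<exists>j<c. z j = 1"
 shows "k <= card {a\<in>cells. th <= \<bar>\<Sum>i<c. \<Sum>j<c. y i * column_form l ph a i j * z j\<bar>}"
proof -
 define x where "x i = (if 1 <= i \<and> i <= c then z (i - 1) else 0)" for i
 let ?Y = "comb n c ph y"
 have YY: "?Y \<bullet> ?Y = (\<Sum>i<c. (y i)^2)" using comb_scalar_prod_self[OF ph, of y y] by (simp add: power2_eq_square)
 obtain i0 where i0: "i0 < c" "y i0 = 1" using y by blast
 obtain j0 where j0: "j0 < c" "z j0 = 1" using z by blast
 have "(y i0)^2 <= (\<Sum>i<c. (y i)^2)" using i0 by (intro member_le_sum) auto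
 hence Y1: "1 <= ?Y \<bullet> ?Y" using i0 YY by simp
 have "(x (Suc j0))^2 <= (\<Sum>i=1..r. (x i)^2)" using j0 c by (intro member_le_sum) auto
 hence x1: "1 <= (\<Sum>i=1..r. (x i)^2)" using j0 by (simp add: x_def)
 have "k <= card {a. a < n \<and> th <= \<bar>pencil r x ?Y a\<bar>}"
  by (rule spread_scaled[OF sp comb_carrier Y1 _ x1 th]) (use small[of y] YY in simp)
 also have "... <= card {a\<in>cells. th <= \<bar>\<Sum>i<c. \<Sum>j<c. y i * column_form l ph a i j * z j\<bar>}"
 proof (rule card_cells_column[OF l])
  fix a assume a: "a \<in> {a. a < n \<and> th <= \<bar>pencil r x ?Y a\<bar>}"
  have "pencil r x ?Y a = (\<Sum>i\<in>Suc ` {..<c}. x i * trans_entry i ?Y a)"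
   unfolding pencil_def by (rule sum.mono_neutral_right) (use c in \<open>auto simp: x_def image_Suc_lessThan\<close>)
  also have "... = (\<Sum>j<c. z j * trans_entry (Suc j) ?Y a)" by (simp add: sum.reindex x_def)
  also have "... = (\<Sum>j<c. \<Sum>i<c. y i * column_form l ph (a, l) i j * z j)"
   unfolding trans_entry_comb sum_distrib_left by (intro sum.cong refl) (simp add: column_form_def mult_ac)
  also have "... = (\<Sum>i<c. \<Sum>j<c. y i * column_form l ph (a, l) i j * z j)" by (rule sum.swap)
  finally show "a < n \<and> th <= \<bar>\<Sum>i<c. \<Sum>j<c. y i * column_form l ph (a, l) i j * z j\<bar>" using a by simp
 qed
 finally show ?thesis .
qed

lemma column_det_prob:
 assumes sp: "spread L r k th w" and c: "1 <= c" "c <= r" "r <= m" and l: "l < q" and ph: "orthon n c ph"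
  and small: "!!et. comb n c ph et \<bullet> (gram L w *\<^sub>v comb n c ph et) <= th\<^sup>2 * (\<Sum>i<c. (et i)^2)" and th: "th > 0"
  and t: "t \<ge> 0" and b: "b <= (t ^ c * ((th / growth_const c) ^ c / 2))^2"
 shows "measure P {w'\<in>space P. (det (mat c c (%(i,j). ph i \<bullet> (A (Suc j) *\<^sub>v column w' l))))^2 < b}
   <= real c * ((real n)^2 + 1) ^ c * (1 - p) ^ (k - c) + (real n)^2 * (2 * t * real c)"
proof -
 let ?X = "t ^ c * ((th / growth_const c) ^ c / 2)"
 have c0: "c > 0" using c by simp
 have X0: "0 <= ?X" using t th growth_const_pos[OF c0] by (intro mult_nonneg_nonneg) auto
 have D: "minor (column_form l ph) cells c id id w' = det (mat c c (%(i,j). ph i \<bullet> (A (Suc j) *\<^sub>v column w' l)))" for w'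
  using column_form_minor[OF l ph, of c id id w'] c by simp
 let ?S = "{w'\<in>space P. \<bar>minor (column_form l ph) cells c id id w'\<bar> < ?X}"
 have sp': "space P = space (\<Pi>\<^sub>M i\<in>cells. (borel :: real measure))" by (rule sets_eq_imp_space_eq[OF sets_PiM_sparse])
 have S: "?S \<in> sets P"
  unfolding sets_PiM_sparse sp' using minor_measurable[of "column_form l ph" cells c id id] by measurable
 have "measure P {w'\<in>space P. (det (mat c c (%(i,j). ph i \<bullet> (A (Suc j) *\<^sub>v column w' l))))^2 < b} <= measure P ?S"
 proof (rule P.finite_measure_mono[OF _ S], safe)
  fix w' assume "(det (mat c c (%(i,j). ph i \<bullet> (A (Suc j) *\<^sub>v column w' l))))^2 < b"
  hence "(minor (column_form l ph) cells c id id w')^2 < ?X\<^sup>2" using b unfolding D by linarith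
  thus "\<bar>minor (column_form l ph) cells c id id w'\<bar> < ?X" using X0 power2_less_imp_less[of "\<bar>minor (column_form l ph) cells c id id w'\<bar>" ?X] by simp
 qed
 also have "... <= real c * (real (card cells) + 1) ^ c * (1 - p) ^ (k - c) + real (card cells) * (2 * t * real c)"
  by (rule small_determinant_prob[OF finite_cells th c0 p_range t]) (rule column_form_spread[OF sp c(2,3) l ph small th])
 also have "... <= real c * ((real n)^2 + 1) ^ c * (1 - p) ^ (k - c) + (real n)^2 * (2 * t * real c)"
  using card_cells p_range t by (intro add_mono mult_right_mono mult_left_mono power_mono) auto
 finally show ?thesis .
qed

lemma codim_bound_zero:
 assumes "codim_bound n B lam 0" "y \<in> carrier_vec n" shows "lam * (y \<bullet> y) <= y \<bullet> (B *\<^sub>v y)"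
 using assms unfolding codim_bound_def by auto

lemma codim_bound_smult:
 assumes "codim_bound n B lam d" "B \<in> carrier_mat n n" "ka \<ge> 0" "lam' <= ka * lam"
 shows "codim_bound n (ka \<cdot>\<^sub>m B) lam' d"
proof -
 obtain zs where zs: "\<forall>i<d. zs i \<in> carrier_vec n" "!!y. y \<in> carrier_vec n ==> \<forall>i<d. zs i \<bullet> y = 0 ==> lam * (y \<bullet> y) <= y \<bullet> (B *\<^sub>v y)"
  using assms(1) unfolding codim_bound_def by blast
 have "lam' * (y \<bullet> y) <= y \<bullet> ((ka \<cdot>\<^sub>m B) *\<^sub>v y)" if y: "y \<in> carrier_vec n" "\<forall>i<d. zs i \<bullet> y = 0" for y
 proof -
  have "lam' * (y \<bullet> y) <= (ka * lam) * (y \<bullet> y)" using assms(4) by (intro mult_right_mono) auto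
  also have "... <= ka * (y \<bullet> (B *\<^sub>v y))" using mult_left_mono[OF zs(2)[OF y] assms(3)] by (simp add: mult.assoc)
  finally show ?thesis by (simp add: quad_smult[OF assms(2) y(1)])
 qed
 thus ?thesis unfolding codim_bound_def using zs(1) by blast
qed

end

locale krylov_sv = krylov +
 fixes \<alpha> :: real
 assumes \<alpha>_pos: "0 < \<alpha>"
  and sv_lower: "!!k x. 1 <= k ==> k <= m ==> (\<Sum>i=1..k. (x i)^2) = 1 ==> \<alpha> ^ k <= singular_value (n - k + 1) (lincomb_mats n k x A)"

section \<open>Failure of spread as smallness of a quadratic form\<close>

context krylov
begin

lemma m_le_n: "m <= n"
proof -
 have "q \<ge> 1" using n_eq n_pos by (cases q) auto
 hence "m * 1 <= m * q" by (intro mult_left_mono) auto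
 thus ?thesis using n_eq by simp
qed

lemma pencil_lincomb:
 assumes "a < n"
 shows "pencil r x y a = (\<Sum>b<n. lincomb_mats n r x A $$ (b, a) * y $ b)"
proof -
 have "(\<Sum>b<n. lincomb_mats n r x A $$ (b, a) * y $ b) = (\<Sum>b<n. \<Sum>i=1..r. x i * (A i $$ (b, a) * y $ b))"
  using assms by (simp add: lincomb_mats_def sum_distrib_right mult.assoc)
 also have "... = (\<Sum>i=1..r. \<Sum>b<n. x i * (A i $$ (b, a) * y $ b))" by (rule sum.swap)
 finally show ?thesis by (simp add: pencil_def trans_entry_def sum_distrib_left)
qed

lemma lincomb_carrier [simp]: "lincomb_mats n r x A \<in> carrier_mat n n" by (simp add: lincomb_mats_def)

text \<open>The Gram matrix of the rows, with index outside \<open>T\<close>, of the transposed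
  combination. If \<open>T\<close> contains the large coordinates of a failing pair of
  \<open>x\<close> and \<open>y\<close>, this form is small at \<open>y\<close>.\<close>

definition offrows :: "nat => (nat => real) => nat set => real mat" where
 "offrows r x T = mat n n (%(i,j). \<Sum>a\<in>{..<n} - T. lincomb_mats n r x A $$ (i, a) * lincomb_mats n r x A $$ (j, a))"

lemma offrows_carrier [simp]: "offrows r x T \<in> carrier_mat n n" by (simp add: offrows_def)

lemma offrows_quad:
 assumes y: "y \<in> carrier_vec n"
 shows "y \<bullet> (offrows r x T *\<^sub>v y) = (\<Sum>a\<in>{..<n} - T. (pencil r x y a)^2)"
proof -
 define B where "B = lincomb_mats n r x A"
 have dy: "dim_vec y = n" using y by auto
 have "y \<bullet> (offrows r x T *\<^sub>v y) = (\<Sum>i<n. \<Sum>j<n. \<Sum>a\<in>{..<n} - T. y $ i * ((B $$ (i,a) * B $$ (j,a)) * y $ j))"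
  unfolding offrows_def B_def[symmetric]
  by (simp add: scalar_prod_def dy sum_distrib_left sum_distrib_right lessThan_atLeast0)
 also have "... = (\<Sum>i<n. \<Sum>a\<in>{..<n} - T. \<Sum>j<n. y $ i * ((B $$ (i,a) * B $$ (j,a)) * y $ j))"
  by (rule sum.cong[OF refl], rule sum.swap)
 also have "... = (\<Sum>a\<in>{..<n} - T. \<Sum>i<n. \<Sum>j<n. y $ i * ((B $$ (i,a) * B $$ (j,a)) * y $ j))" by (rule sum.swap)
 also have "... = (\<Sum>a\<in>{..<n} - T. (pencil r x y a)^2)"
 proof (rule sum.cong[OF refl])
  fix a assume "a \<in> {..<n} - T"
  hence e: "pencil r x y a = (\<Sum>b<n. B $$ (b, a) * y $ b)" using pencil_lincomb[of a r x y] by (simp add: B_def)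
  show "(\<Sum>i<n. \<Sum>j<n. y $ i * ((B $$ (i,a) * B $$ (j,a)) * y $ j)) = (pencil r x y a)^2"
   unfolding e power2_eq_square sum_product by (intro sum.cong refl) (simp add: mult_ac)
 qed
 finally show ?thesis .
qed

lemma offrows_psd: "psd_mat n (offrows r x T)"
 unfolding psd_mat_def
proof (intro conjI ballI offrows_carrier)
 show "(offrows r x T)\<^sup>T = offrows r x T" by (rule eq_matI) (auto simp: offrows_def mult.commute)
 fix y :: "real vec" assume "y \<in> carrier_vec n"
 thus "0 <= y \<bullet> (offrows r x T *\<^sub>v y)" by (simp add: offrows_quad sum_nonneg)
qed

text \<open>The singular value bound costs \<open>r - 1\<close> constraints; orthogonality to the
  columns with index in \<open>T\<close> costs \<open>card T\<close> more and makes the deleted part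
  of the form vanish.\<close>

lemma offrows_codim:
 assumes r: "1 <= r" "r <= n" and be: "be > 0" "be <= singular_value (n - r + 1) (lincomb_mats n r x A)" and T: "T \<subseteq> {..<n}"
 shows "codim_bound n (offrows r x T) (be\<^sup>2) (r - 1 + card T)"
proof -
 define B where "B = lincomb_mats n r x A"
 have B: "B \<in> carrier_mat n n" by (simp add: B_def)
 have BT: "B\<^sup>T \<in> carrier_mat n n" using B by simp
 obtain zs where zs: "\<forall>i<r - 1. zs i \<in> carrier_vec n"
  "!!y. y \<in> carrier_vec n ==> \<forall>i<r - 1. zs i \<bullet> y = 0 ==> be\<^sup>2 * (y \<bullet> y) <= y \<bullet> ((B * B\<^sup>T) *\<^sub>v y)"
  using singular_value_codim_bound[OF B r be(1)] be(2) unfolding codim_bound_def B_def by blast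
 have finT: "finite T" using T finite_subset by blast
 obtain e where e: "bij_betw e {..<card T} T" using ex_bij_betw_nat_finite[OF finT] by (auto simp: lessThan_atLeast0)
 define zs' where "zs' i = (if i < r - 1 then zs i else col B (e (i - (r - 1))))" for i
 have "\<forall>i<r - 1 + card T. zs' i \<in> carrier_vec n" using zs(1) B by (auto simp: zs'_def)
 moreover have "be\<^sup>2 * (y \<bullet> y) <= y \<bullet> (offrows r x T *\<^sub>v y)" if y: "y \<in> carrier_vec n" and orth: "\<forall>i<r - 1 + card T. zs' i \<bullet> y = 0" for y
 proof -
  have "zs i \<bullet> y = 0" if "i < r - 1" for i
  proof -
   have "zs' i \<bullet> y = 0" using orth that by simp
   thus ?thesis using that by (simp add: zs'_def)
  qed
  hence "be\<^sup>2 * (y \<bullet> y) <= y \<bullet> ((B * B\<^sup>T) *\<^sub>v y)" using zs(2)[OF y] by blast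
  also have "... = (B\<^sup>T *\<^sub>v y) \<bullet> (B\<^sup>T *\<^sub>v y)" using gram_quad[OF BT y] by simp
  also have "... = (\<Sum>a<n. ((B\<^sup>T *\<^sub>v y) $ a)^2)" by (rule sq_eq_sum) (use B y in simp)
  also have "... = (\<Sum>a<n. (pencil r x y a)^2)"
  proof (rule sum.cong[OF refl])
   fix a assume a: "a \<in> {..<n}"
   have "(B\<^sup>T *\<^sub>v y) $ a = (\<Sum>b<n. B $$ (b, a) * y $ b)"
    using a B y by (auto simp: scalar_prod_def lessThan_atLeast0)
   thus "((B\<^sup>T *\<^sub>v y) $ a)^2 = (pencil r x y a)^2" using a pencil_lincomb[of a r x y] by (simp add: B_def)
  qed
  also have "... = (\<Sum>a\<in>{..<n} - T. (pencil r x y a)^2)"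
  proof (rule sum.mono_neutral_right)
   show "\<forall>a\<in>{..<n} - ({..<n} - T). (pencil r x y a)^2 = 0"
   proof
    fix a assume "a \<in> {..<n} - ({..<n} - T)"
    hence a: "a \<in> T" "a < n" by auto
    hence "a \<in> e ` {..<card T}" using e by (simp add: bij_betw_def)
    then obtain i where i: "i < card T" "e i = a" by auto
    have "zs' (r - 1 + i) \<bullet> y = 0" using orth i by simp
    hence "col B a \<bullet> y = 0" using i by (simp add: zs'_def)
    moreover have "col B a \<bullet> y = (\<Sum>b<n. B $$ (b, a) * y $ b)"
     using a B y by (auto simp: scalar_prod_def lessThan_atLeast0)
    ultimately show "(pencil r x y a)^2 = 0" using a pencil_lincomb[of a r x y] by (simp add: B_def)
   qed
  qed auto
  finally show ?thesis by (simp add: offrows_quad[OF y])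
 qed
 ultimately show ?thesis unfolding codim_bound_def by blast
qed

lemma pencil_diff:
 assumes y: "y \<in> carrier_vec n" "y \<bullet> y = 1" and r: "r <= m" and a: "a < n" and et: "!!i. 1 <= i ==> i <= r ==> \<bar>x i - x' i\<bar> <= et"
 shows "\<bar>pencil r x y a - pencil r x' y a\<bar> <= real r * et"
proof -
 have "pencil r x y a - pencil r x' y a = (\<Sum>i=1..r. (x i - x' i) * trans_entry i y a)"
  by (simp add: pencil_def sum_subtractf[symmetric] left_diff_distrib)
 hence "\<bar>pencil r x y a - pencil r x' y a\<bar> <= (\<Sum>i=1..r. \<bar>(x i - x' i) * trans_entry i y a\<bar>)" using sum_abs by metis
 also have "... <= (\<Sum>i=1..r. et * 1)"
 proof (rule sum_mono)
  fix i assume i: "i \<in> {1..r}"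
  have "0 <= et" using order_trans[OF abs_ge_zero et[of i]] i by simp
  thus "\<bar>(x i - x' i) * trans_entry i y a\<bar> <= et * 1"
   unfolding abs_mult using i r et[of i] abs_trans_entry_le[OF _ _ y a, of i] by (intro mult_mono) auto
 qed
 finally show ?thesis by simp
qed

end

context krylov_sv
begin

definition likely :: "nat => nat => nat => real => real => bool" where
 "likely u r k th ep \<longleftrightarrow> (\<forall>L. L \<subseteq> {..<q} --> card L = u --> (\<exists>E\<in>sets P. measure P E <= ep \<and>
   (\<forall>w\<in>space P. w \<notin> E --> bounded_entries w --> spread L r k th w)))"

text \<open>For \<open>r = 1\<close> the coefficient is 1 or -1. The hypothesis for one matrix
  bounds the transpose of \<open>A 1\<close> from below by \<open>\<alpha>\<close>, so the image
  \<open>z\<close> of \<open>y\<close> has norm at least \<open>\<alpha>\<close>; its pairing with a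
  column is the pairing of \<open>y\<close> with the first block. Normalising \<open>z\<close> loses
  the factor \<open>\<alpha>\<close> in the threshold.\<close>

lemma base_spread_imp_spread:
 assumes m1: "1 <= m" and b: "base_spread L k thb w" and th: "0 < th" "th <= \<alpha> * thb"
 shows "spread L 1 k th w"
 unfolding spread_def
proof (intro ballI impI allI)
 fix y :: "real vec" and x :: "nat => real"
 assume y: "y \<in> carrier_vec n" "y \<bullet> y = 1" and small: "y \<bullet> (gram L w *\<^sub>v y) <= th\<^sup>2" and x: "(\<Sum>i=1..1. (x i)^2) = 1"
 have x1: "\<bar>x 1\<bar> = 1" using x by (auto simp: power2_eq_1_iff)
 define z where "z = vec n (trans_entry 1 y)"
 have z: "z \<in> carrier_vec n" by (simp add: z_def)
 have A1: "A 1 \<in> carrier_mat n n" using m1 by simp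
 have "lincomb_mats n 1 (%_. 1) A = A 1" using A1 by (intro eq_matI) (auto simp: lincomb_mats_def)
 hence "\<alpha> <= singular_value (n - 1 + 1) (A 1)" using sv_lower[of 1 "%_. 1"] m1 by simp
 from singular_value_codim_bound[OF A1 _ _ \<alpha>_pos this] n_pos
 have "codim_bound n (A 1 * (A 1)\<^sup>T) (\<alpha>\<^sup>2) 0" by simp
 from codim_bound_zero[OF this y(1)] have "\<alpha>\<^sup>2 <= y \<bullet> ((A 1 * (A 1)\<^sup>T) *\<^sub>v y)" using y(2) by simp
 also have "... = ((A 1)\<^sup>T *\<^sub>v y) \<bullet> ((A 1)\<^sup>T *\<^sub>v y)" using gram_quad[of "(A 1)\<^sup>T" n n y] A1 y by simp
 also have "(A 1)\<^sup>T *\<^sub>v y = z"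
  by (rule eq_vecI) (use trans_entry_transpose[of 1] m1 y A1 in \<open>auto simp: z_def simp del: index_mult_mat_vec\<close>)
 finally have zz: "\<alpha>\<^sup>2 <= z \<bullet> z" .
 define u where "u = sqrt (z \<bullet> z)"
 have u2: "u\<^sup>2 = z \<bullet> z" by (simp add: u_def)
 have u: "\<alpha> <= u" unfolding u_def using zz \<alpha>_pos by (simp add: real_le_rsqrt)
 hence u0: "0 < u" using \<alpha>_pos by linarith
 define y' where "y' = (1 / u) \<cdot>\<^sub>v z"
 have y': "y' \<in> carrier_vec n" using z by (simp add: y'_def)
 have iu: "(1 / u) * (1 / u) * (z \<bullet> z) = 1" unfolding u2[symmetric] using u0 by (simp add: power2_eq_square)
 have "y' \<bullet> y' = (1 / u) * ((1 / u) * (z \<bullet> z))" unfolding y'_def using z by simp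
 hence y'1: "y' \<bullet> y' = 1" using iu by (simp only: mult.assoc)
 have inner: "y' \<bullet> column w l = (1 / u) * (y \<bullet> (A 1 *\<^sub>v column w l))" for l
 proof -
  have "z \<bullet> column w l = y \<bullet> (A 1 *\<^sub>v column w l)"
   using inner_image_column[of 1 y w l] m1 y by (simp add: scalar_prod_def z_def column_def lessThan_atLeast0 mult.commute)
  thus ?thesis unfolding y'_def using z by simp
 qed
 have "(\<Sum>l\<in>L. (y' \<bullet> column w l)^2) = (1 / u)^2 * (\<Sum>l\<in>L. (y \<bullet> (A 1 *\<^sub>v column w l))^2)"
  unfolding inner power_mult_distrib sum_distrib_left ..
 also have "... <= (1 / u)^2 * th\<^sup>2"
 proof (rule mult_left_mono)
  have "(\<Sum>l\<in>L. (y \<bullet> (A 1 *\<^sub>v column w l))^2) <= (\<Sum>l\<in>L. \<Sum>b=1..m. (y \<bullet> (A b *\<^sub>v column w l))^2)"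
  proof (rule sum_mono)
   fix l
   show "(y \<bullet> (A 1 *\<^sub>v column w l))^2 <= (\<Sum>b=1..m. (y \<bullet> (A b *\<^sub>v column w l))^2)"
    by (rule member_le_sum[of 1 "{1..m}" "%b. (y \<bullet> (A b *\<^sub>v column w l))^2"]) (use m1 in auto)
  qed
  thus "(\<Sum>l\<in>L. (y \<bullet> (A 1 *\<^sub>v column w l))^2) <= th\<^sup>2" using small gram_quad_form[OF y(1), of L w] by linarith
 qed simp
 also have "... = (th / u)^2" by (simp add: power_divide)
 also have "... <= thb\<^sup>2"
 proof (rule power_mono)
  have tb: "0 < thb" using th \<alpha>_pos by (meson less_le_trans zero_less_mult_pos)
  have "th <= u * thb" using th(2) mult_right_mono[OF u less_imp_le[OF tb]] by linarith
  thus "th / u <= thb" using u0 by (simp add: field_simps)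
  show "0 <= th / u" using u0 th by simp
 qed
 finally have "k <= card {a. a < n \<and> thb <= \<bar>y' $ a\<bar>}" using b y' y'1 unfolding base_spread_def by blast
 also have "... <= card {a. a < n \<and> th <= \<bar>pencil 1 x y a\<bar>}"
 proof (rule card_mono)
  show "{a. a < n \<and> thb <= \<bar>y' $ a\<bar>} \<subseteq> {a. a < n \<and> th <= \<bar>pencil 1 x y a\<bar>}"
  proof safe
   fix a assume a: "a < n" "thb <= \<bar>y' $ a\<bar>"
   have "y' $ a = (1 / u) * trans_entry 1 y a" using a z by (simp add: y'_def z_def)
   hence "trans_entry 1 y a = u * y' $ a" using u0 by simp
   hence "\<bar>pencil 1 x y a\<bar> = u * \<bar>y' $ a\<bar>" using x1 u0 by (simp add: pencil_def abs_mult)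
   also have "... \<ge> \<alpha> * thb"
   proof -
    have "\<alpha> * thb <= \<alpha> * \<bar>y' $ a\<bar>" using a \<alpha>_pos by simp
    also have "... <= u * \<bar>y' $ a\<bar>" using u by (intro mult_right_mono) auto
    finally show ?thesis .
   qed
   finally show "th <= \<bar>pencil 1 x y a\<bar>" using th(2) by linarith
  qed
 qed simp
 finally show "k <= card {a. a < n \<and> th <= \<bar>pencil 1 x y a\<bar>}" .
qed

lemma base_likely_imp_likely:
 assumes "1 <= m" "base_likely u k x ep" "0 < th" "th <= \<alpha> * (1 / real n ^ x)"
 shows "likely u 1 k th ep"
 unfolding likely_def
proof (intro allI impI)
 fix L assume L: "L \<subseteq> {..<q}" "card L = u"
 obtain E where E: "E \<in> sets P" "measure P E <= ep"
  and E': "\<forall>w\<in>space P. w \<notin> E --> bounded_entries w --> base_spread L k (1 / real n ^ x) w"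
  using assms(2)[unfolded base_likely_def, THEN spec, THEN mp, THEN mp, OF L] by (elim bexE conjE) (rule that)
 show "\<exists>E\<in>sets P. measure P E <= ep \<and> (\<forall>w\<in>space P. w \<notin> E --> bounded_entries w --> spread L 1 k th w)"
  using E E' base_spread_imp_spread[OF assms(1) _ assms(3,4)] by (intro bexI[of _ E]) auto
qed

end

section \<open>One passage from c to r coefficients\<close>

text \<open>\<open>ka0\<close> and \<open>ka\<close> rescale a form so that it exceeds
  \<open>n * n ^ 4\<close> off few directions, as \<open>det_budget\<close> demands.
  \<open>ta\<close> is the eigenvalue level, \<open>b1\<close> and \<open>b2\<close> are squared
  determinant thresholds for the two rounds, \<open>f\<close> bounds failure probabilities, and
  \<open>s\<close> successes suffice to exceed the budget. \<open>D\<close> is the mesh for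
  coefficients, and \<open>fin\<close> is the inequality that a failing pair contradicts.\<close>

locale stage = krylov_sv +
 fixes c k r k' N s D :: nat and ka0 ka ta th th' t b1 b2 f :: real
 assumes ka0: "ka0 \<ge> 0" "real n * real n ^ 4 <= ka0 * (\<alpha> ^ r)^2"
  and ka: "ka \<ge> 1" "real n * real n ^ 4 <= ka * ta"
  and c: "1 <= c" "c <= m" and ta: "ta > 0" "ta <= th\<^sup>2" and th: "th > 0" and t: "t \<ge> 0"
  and b1: "0 < b1" "b1 <= (t ^ c * ((th / growth_const c) ^ c / 2))^2"
  and b2: "0 < b2" "b2 <= (t ^ 1 * ((th / growth_const 1) ^ 1 / 2))^2"
  and f1: "real c * ((real n)^2 + 1) ^ c * (1 - p) ^ (k - c) + (real n)^2 * (2 * t * real c) <= f"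
  and f2: "real 1 * ((real n)^2 + 1) ^ 1 * (1 - p) ^ (k - 1) + (real n)^2 * (2 * t * real 1) <= f"
  and f: "0 < f" "f <= 1"
  and gain1: "3 * (1 + real n ^ 4 / ta) ^ (r - 1 + k') < (b1 / (2 * ta) ^ c) ^ s"
  and gain2: "3 * (1 + real n ^ 4 / ta) ^ (c - 1) < (b2 / (2 * ta) ^ 1) ^ s"
  and r: "1 <= r" "r <= m" and th': "0 < th'" and D: "0 < D" "real r <= th' * real D"
  and fin: "ka * (ka0 * (4 * real n * th'\<^sup>2) + th'\<^sup>2) < ta"
begin

text \<open>\<open>Q0\<close> leaves up to \<open>r - 1 + k'\<close> small directions, and the first
  round is affordable because each success gains a \<open>c\<close>-th power. It stops once fewer
  than \<open>c\<close> small directions are left. Rescaling by \<open>ka\<close> restores the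
  hypothesis of \<open>det_budget\<close>, and the second round, with \<open>c - 1\<close> in place
  of \<open>r - 1 + k'\<close>, can afford single directions.\<close>

lemma two_phase:
 fixes Q0 :: "real mat" and sg1 sg2 :: "nat => nat"
 assumes Q0: "psd_mat n Q0" "codim_bound n Q0 ((\<alpha> ^ r)^2) (r - 1 + k')" and L: "L \<subseteq> {..<q}"
  and sg1: "inj_on sg1 {..<N}" "sg1 ` {..<N} \<subseteq> {..<q}" "L \<inter> sg1 ` {..<N} = {}"
  and sg2: "inj_on sg2 {..<N}" "sg2 ` {..<N} \<subseteq> {..<q}" "(L \<union> sg1 ` {..<N}) \<inter> sg2 ` {..<N} = {}"
 obtains E where "E \<in> sets P" "measure P E <= 2 * ((f + f) ^ N / f ^ s)"
  "!!w y. w \<in> space P ==> w \<notin> E ==> bounded_entries w ==> spread L c k th w ==> y \<in> carrier_vec n ==>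
   ta * (y \<bullet> y) <= ka * (ka0 * (y \<bullet> (Q0 *\<^sub>v y)) + y \<bullet> (gram L w *\<^sub>v y) + y \<bullet> (gram (sg1 ` {..<N}) w *\<^sub>v y)) + y \<bullet> (gram (sg2 ` {..<N}) w *\<^sub>v y)"
proof -
 let ?L1 = "sg1 ` {..<N}" let ?L2 = "sg2 ` {..<N}"
 have Q0c: "Q0 \<in> carrier_mat n n" "Q0\<^sup>T = Q0" and Q00: "!!y. y \<in> carrier_vec n ==> 0 <= y \<bullet> (Q0 *\<^sub>v y)"
  using Q0(1) unfolding psd_mat_def by auto
 have dimQ0 [simp]: "dim_row Q0 = n" "dim_col Q0 = n" using Q0c by auto
 have trs: "(s \<cdot>\<^sub>m B)\<^sup>T = s \<cdot>\<^sub>m B\<^sup>T" for s and B :: "real mat" by (rule eq_matI) auto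
 \<comment> \<open>Including \<open>gram L\<close> makes every small direction almost orthogonal to
   the exposed columns, which is where \<open>spread\<close> applies.\<close>
 define Q1 where "Q1 w = ka0 \<cdot>\<^sub>m Q0 + gram L w" for w
 define Q2 where "Q2 w = ka \<cdot>\<^sub>m (Q1 w + gram ?L1 w)" for w
 have k0: "ka0 \<cdot>\<^sub>m Q0 \<in> carrier_mat n n" using Q0c by simp
 have Q1c: "Q1 w \<in> carrier_mat n n" for w using k0 by (simp add: Q1_def)
 have Q1q: "y \<bullet> (Q1 w *\<^sub>v y) = ka0 * (y \<bullet> (Q0 *\<^sub>v y)) + y \<bullet> (gram L w *\<^sub>v y)" if y: "y \<in> carrier_vec n" for y w
  unfolding Q1_def quad_add[OF k0 gram_carrier y] quad_smult[OF Q0c(1) y] ..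
 have Q1Xc: "Q1 w + gram ?L1 w \<in> carrier_mat n n" for w by simp
 have Q2c: "Q2 w \<in> carrier_mat n n" for w by (simp add: Q2_def)
 have Q2q: "y \<bullet> (Q2 w *\<^sub>v y) = ka * (ka0 * (y \<bullet> (Q0 *\<^sub>v y)) + y \<bullet> (gram L w *\<^sub>v y) + y \<bullet> (gram ?L1 w *\<^sub>v y))" if y: "y \<in> carrier_vec n" for y w
  unfolding Q2_def quad_smult[OF Q1Xc y] quad_add[OF Q1c gram_carrier y] Q1q[OF y] ..
 have Q1sym: "(Q1 w)\<^sup>T = Q1 w" for w
  unfolding Q1_def transpose_add[OF k0 gram_carrier] trs Q0c(2) by simp
 have Q1psd: "psd_mat n (Q1 w)" for w
  unfolding psd_mat_def using Q1c Q1sym Q1q Q00 gram_nonneg ka0(1) by (auto intro!: add_nonneg_nonneg mult_nonneg_nonneg)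
 have Q2psd: "psd_mat n (Q2 w)" for w
  unfolding psd_mat_def
 proof (intro conjI ballI Q2c)
  show "(Q2 w)\<^sup>T = Q2 w" unfolding Q2_def trs transpose_add[OF Q1c gram_carrier] Q1sym by simp
  fix y :: "real vec" assume y: "y \<in> carrier_vec n"
  show "0 <= y \<bullet> (Q2 w *\<^sub>v y)" unfolding Q2q[OF y] using Q00[OF y] gram_nonneg[OF y] ka0(1) ka(1)
   by (intro mult_nonneg_nonneg add_nonneg_nonneg) auto
 qed
 have Q1m: "(%w. Q1 w $$ (i,j)) \<in> borel_measurable P" if ij: "i < n" "j < n" for i j
 proof -
  have "Q1 w $$ (i,j) = ka0 * Q0 $$ (i,j) + gram L w $$ (i,j)" for w using ij by (simp add: Q1_def)
  thus ?thesis using gram_measurable[OF L ij] by simp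
 qed
 have Q2m: "(%w. Q2 w $$ (i,j)) \<in> borel_measurable P" if ij: "i < n" "j < n" for i j
 proof -
  have d: "dim_row (Q1 w) = n" "dim_col (Q1 w) = n" for w using Q1c[of w] by auto
  have "Q2 w $$ (i,j) = ka * (Q1 w $$ (i,j) + gram ?L1 w $$ (i,j))" for w using ij d by (simp add: Q2_def)
  thus ?thesis using gram_measurable[OF sg1(2) ij] Q1m[OF ij] by simp
 qed
 have Q1inv: "Q1 (redraw (sg1 t) w w') = Q1 w" if "t < N" for t w w'
  unfolding Q1_def using sg1(3) that L by (subst gram_redraw) auto
 have Q2inv: "Q2 (redraw (sg2 t) w w') = Q2 w" if "t < N" for t w w'
 proof -
  have "sg2 t \<notin> L" "sg2 t \<notin> ?L1" using sg2(3) that by auto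
  thus ?thesis unfolding Q2_def Q1_def using L sg1(2) by (simp add: gram_redraw)
 qed
 have n4: "(0::real) < real n ^ 4" using n_pos by simp
 have m1: "1 <= m" using c by simp
 obtain E1 where E1: "E1 \<in> sets P" "measure P E1 <= (f + f) ^ N / f ^ s"
  "!!w. w \<in> space P ==> w \<notin> E1 ==> codim_bound n (Q1 w) (real n * real n ^ 4) (r - 1 + k') ==>
   (!!y. y \<in> carrier_vec n ==> y \<bullet> (gram ?L1 w *\<^sub>v y) <= real n ^ 4 * (y \<bullet> y)) ==>
   (!!ph t. orthon n c ph ==> (!!et. comb n c ph et \<bullet> (Q1 w *\<^sub>v comb n c ph et) <= ta * (\<Sum>i<c. (et i)^2)) ==> t < N ==>
     measure P {w'\<in>space P. (det (mat c c (%(i,j). ph i \<bullet> (A (Suc j) *\<^sub>v column w' (sg1 t)))))^2 < b1} <= f) ==>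
   codim_bound n (Q1 w + gram ?L1 w) ta (c - 1)"
 proof (rule reduction[where Q = Q1 and sg = sg1 and N = N and c = c and ta = ta and b = b1 and f = f and be = f
    and La = "real n ^ 4" and d = "r - 1 + k'" and s = s], goal_cases)
  case (15 E)
  show ?case by (rule 15(1)) (fact 15(2), fact 15(3), fact 15(4))
 qed (use Q1psd Q1m Q1inv sg1 c ta b1 f n4 gain1 in auto)
 obtain E2 where E2: "E2 \<in> sets P" "measure P E2 <= (f + f) ^ N / f ^ s"
  "!!w. w \<in> space P ==> w \<notin> E2 ==> codim_bound n (Q2 w) (real n * real n ^ 4) (c - 1) ==>
   (!!y. y \<in> carrier_vec n ==> y \<bullet> (gram ?L2 w *\<^sub>v y) <= real n ^ 4 * (y \<bullet> y)) ==>
   (!!ph t. orthon n 1 ph ==> (!!et. comb n 1 ph et \<bullet> (Q2 w *\<^sub>v comb n 1 ph et) <= ta * (\<Sum>i<1. (et i)^2)) ==> t < N ==>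
     measure P {w'\<in>space P. (det (mat 1 1 (%(i,j). ph i \<bullet> (A (Suc j) *\<^sub>v column w' (sg2 t)))))^2 < b2} <= f) ==>
   codim_bound n (Q2 w + gram ?L2 w) ta (1 - 1)"
 proof (rule reduction[where Q = Q2 and sg = sg2 and N = N and c = 1 and ta = ta and b = b2 and f = f and be = f
    and La = "real n ^ 4" and d = "c - 1" and s = s], goal_cases)
  case (15 E)
  show ?case by (rule 15(1)) (fact 15(2), fact 15(3), fact 15(4))
 qed (use Q2psd Q2m Q2inv sg2 m1 ta b2 f n4 gain2 in auto)
 show ?thesis
 proof (rule that[of "E1 \<union> E2"])
  show "E1 \<union> E2 \<in> sets P" using E1 E2 by blast
  show "measure P (E1 \<union> E2) <= 2 * ((f + f) ^ N / f ^ s)"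
   using measure_Un_le[OF E1(1) E2(1)] E1(2) E2(2) by linarith
  fix w and y :: "real vec"
  assume w: "w \<in> space P" "w \<notin> E1 \<union> E2" and bd: "bounded_entries w" and sp: "spread L c k th w" and y: "y \<in> carrier_vec n"
  have w1: "w \<notin> E1" "w \<notin> E2" using w by auto
  have cb1: "codim_bound n (Q1 w + gram ?L1 w) ta (c - 1)"
  proof (rule E1(3)[OF w(1) w1(1)])
   have "codim_bound n (ka0 \<cdot>\<^sub>m Q0) (real n * real n ^ 4) (r - 1 + k')" by (rule codim_bound_smult[OF Q0(2) Q0c(1) ka0])
   thus "codim_bound n (Q1 w) (real n * real n ^ 4) (r - 1 + k')"
    by (rule codim_bound_mono) (use quad_add[OF k0 gram_carrier] gram_nonneg in \<open>auto simp: Q1_def\<close>)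
   show "!!y. y \<in> carrier_vec n ==> y \<bullet> (gram ?L1 w *\<^sub>v y) <= real n ^ 4 * (y \<bullet> y)" by (rule gram_le[OF bd sg1(2)])
   fix ph t' assume ph: "orthon n c ph" and sm: "!!et. comb n c ph et \<bullet> (Q1 w *\<^sub>v comb n c ph et) <= ta * (\<Sum>i<c. (et i)^2)" and t': "t' < N"
   have "comb n c ph et \<bullet> (gram L w *\<^sub>v comb n c ph et) <= th\<^sup>2 * (\<Sum>i<c. (et i)^2)" for et
   proof -
    have "0 <= ka0 * (comb n c ph et \<bullet> (Q0 *\<^sub>v comb n c ph et))" using ka0(1) Q00[OF comb_carrier] by simp
    moreover have "ta * (\<Sum>i<c. (et i)^2) <= th\<^sup>2 * (\<Sum>i<c. (et i)^2)" using ta by (intro mult_right_mono sum_nonneg) auto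
    ultimately show ?thesis using sm[of et] unfolding Q1q[OF comb_carrier] by linarith
   qed
   moreover have "sg1 t' < q" using sg1(2) t' by auto
   ultimately show "measure P {w'\<in>space P. (det (mat c c (%(i,j). ph i \<bullet> (A (Suc j) *\<^sub>v column w' (sg1 t')))))^2 < b1} <= f"
    using column_det_prob[OF sp c(1) order_refl c(2) _ ph _ th t b1(2), of "sg1 t'"] f1 by (meson order_trans)
  qed
  have cb2: "codim_bound n (Q2 w + gram ?L2 w) ta (1 - 1)"
  proof (rule E2(3)[OF w(1) w1(2)])
   show "codim_bound n (Q2 w) (real n * real n ^ 4) (c - 1)"
    unfolding Q2_def by (rule codim_bound_smult[OF cb1 Q1Xc _ ka(2)]) (use ka in simp)
   show "!!y. y \<in> carrier_vec n ==> y \<bullet> (gram ?L2 w *\<^sub>v y) <= real n ^ 4 * (y \<bullet> y)" by (rule gram_le[OF bd sg2(2)])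
   fix ph t' assume ph: "orthon n 1 ph" and sm: "!!et. comb n 1 ph et \<bullet> (Q2 w *\<^sub>v comb n 1 ph et) <= ta * (\<Sum>i<1. (et i)^2)" and t': "t' < N"
   have "comb n 1 ph et \<bullet> (gram L w *\<^sub>v comb n 1 ph et) <= th\<^sup>2 * (\<Sum>i<1. (et i)^2)" for et
   proof -
    let ?c = "comb n 1 ph et"
    define R where "R = ka0 * (?c \<bullet> (Q0 *\<^sub>v ?c)) + ?c \<bullet> (gram L w *\<^sub>v ?c) + ?c \<bullet> (gram ?L1 w *\<^sub>v ?c)"
    have 0: "0 <= ka0 * (?c \<bullet> (Q0 *\<^sub>v ?c))" "0 <= ?c \<bullet> (gram L w *\<^sub>v ?c)" "0 <= ?c \<bullet> (gram ?L1 w *\<^sub>v ?c)"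
     using ka0(1) Q00[OF comb_carrier] gram_nonneg[OF comb_carrier] by simp_all
    have R: "?c \<bullet> (gram L w *\<^sub>v ?c) <= R" "0 <= R" unfolding R_def using 0 by linarith+
    have "1 * R <= ka * R" using ka(1) R by (intro mult_right_mono) auto
    moreover have "ka * R <= ta * (\<Sum>i<1. (et i)^2)" using sm[of et] unfolding Q2q[OF comb_carrier] R_def .
    moreover have "ta * (\<Sum>i<1. (et i)^2) <= th\<^sup>2 * (\<Sum>i<1. (et i)^2)" using ta by (intro mult_right_mono sum_nonneg) auto
    ultimately show ?thesis using R(1) by linarith
   qed
   moreover have "sg2 t' < q" using sg2(2) t' by auto
   ultimately show "measure P {w'\<in>space P. (det (mat 1 1 (%(i,j). ph i \<bullet> (A (Suc j) *\<^sub>v column w' (sg2 t')))))^2 < b2} <= f"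
    using column_det_prob[OF sp order_refl c(1) c(2) _ ph _ th t b2(2), of "sg2 t'"] f2 by (meson order_trans)
  qed
  have "ta * (y \<bullet> y) <= y \<bullet> ((Q2 w + gram ?L2 w) *\<^sub>v y)" using codim_bound_zero[OF _ y] cb2 by simp
  thus "ta * (y \<bullet> y) <= ka * (ka0 * (y \<bullet> (Q0 *\<^sub>v y)) + y \<bullet> (gram L w *\<^sub>v y) + y \<bullet> (gram ?L1 w *\<^sub>v y)) + y \<bullet> (gram ?L2 w *\<^sub>v y)"
   unfolding quad_add[OF Q2c gram_carrier y] Q2q[OF y] .
 qed
qed

text \<open>The union bound runs over mesh cells of \<open>x\<close> and sets \<open>T\<close> only.
  For a fixed choice \<open>two_phase\<close> bounds a form from below for all \<open>y\<close> at
  once, and a failing \<open>y\<close> would make that form too small.\<close>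

lemma spread_stage:
 fixes sg1 sg2 :: "nat => nat"
 assumes L: "L \<subseteq> {..<q}"
  and sg1: "inj_on sg1 {..<N}" "sg1 ` {..<N} \<subseteq> {..<q}" "L \<inter> sg1 ` {..<N} = {}"
  and sg2: "inj_on sg2 {..<N}" "sg2 ` {..<N} \<subseteq> {..<q}" "(L \<union> sg1 ` {..<N}) \<inter> sg2 ` {..<N} = {}"
 obtains E where "E \<in> sets P" "measure P E <= real (2 * D + 1) ^ r * real (n + 1) ^ k' * (2 * ((f + f) ^ N / f ^ s))"
  "!!w. w \<in> space P ==> w \<notin> E ==> bounded_entries w ==> spread L c k th w ==>
   spread (L \<union> sg1 ` {..<N} \<union> sg2 ` {..<N}) r k' th' w"
proof -
 let ?L1 = "sg1 ` {..<N}" let ?L2 = "sg2 ` {..<N}"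
 define X where "X = {x. (\<Sum>i=1..r. (x i)^2) = (1::real)}"
 define cell where "cell x = (\<lambda>i\<in>{1..r}. \<lfloor>x i * real D\<rfloor>)" for x :: "nat => real"
 \<comment> \<open>A cell is represented by one of its points on the sphere, because the singular
   value hypothesis is available for unit coefficients only.\<close>
 define rep where "rep z = (SOME x. x \<in> X \<and> cell x = z)" for z
 define \<T> where "\<T> = {T. T \<subseteq> {..<n} \<and> card T <= k'}"
 have rep: "rep (cell x) \<in> X" "cell (rep (cell x)) = cell x" if "x \<in> X" for x
  using someI[of "%x'. x' \<in> X \<and> cell x' = cell x" x] that by (simp_all add: rep_def)
 have cellsub: "cell ` X \<subseteq> ({1..r} \<rightarrow>\<^sub>E {- int D..int D})"
 proof
  fix z assume "z \<in> cell ` X"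
  then obtain x where x: "x \<in> X" "z = cell x" by auto
  have "\<lfloor>x i * real D\<rfloor> \<in> {- int D..int D}" if i: "i \<in> {1..r}" for i
  proof -
   have "(x i)^2 <= (\<Sum>i=1..r. (x i)^2)" using i by (intro member_le_sum) auto
   hence "\<bar>x i\<bar> <= 1" using x by (simp add: X_def abs_square_le_1)
   hence "\<bar>x i * real D\<bar> <= real D" by (simp add: abs_mult mult_left_le_one_le)
   hence "- real D <= x i * real D" "x i * real D <= real D" by linarith+
   hence "- int D <= \<lfloor>x i * real D\<rfloor>" "\<lfloor>x i * real D\<rfloor> <= int D" by linarith+
   thus ?thesis by simp
  qed
  thus "z \<in> ({1..r} \<rightarrow>\<^sub>E {- int D..int D})" unfolding x(2) cell_def by auto
 qed
 have finP: "finite ({1..r} \<rightarrow>\<^sub>E {- int D..int D})" by (intro finite_PiE) auto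
 have cardP: "card ({1..r} \<rightarrow>\<^sub>E {- int D..int D}) = (2 * D + 1) ^ r"
 proof -
  have "card {- int D..int D} = 2 * D + 1" unfolding card_atLeastAtMost_int by linarith
  thus ?thesis by (simp add: card_PiE)
 qed
 define Z where "Z = cell ` X \<times> \<T>"
 have fin\<T>: "finite \<T>" by (simp add: \<T>_def)
 have finZ: "finite Z" unfolding Z_def using finite_subset[OF cellsub finP] fin\<T> by simp
 have cardZ: "real (card Z) <= real (2 * D + 1) ^ r * real (n + 1) ^ k'"
 proof -
  have "card (cell ` X) <= (2 * D + 1) ^ r" using card_mono[OF finP cellsub] cardP by simp
  moreover have "card \<T> <= (n + 1) ^ k'" unfolding \<T>_def using card_small_subsets_le[of "{..<n}" k'] by simp
  ultimately have "card Z <= (2 * D + 1) ^ r * (n + 1) ^ k'" unfolding Z_def card_cartesian_product by (rule mult_le_mono)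
  hence "real (card Z) <= real ((2 * D + 1) ^ r * (n + 1) ^ k')" by (rule of_nat_mono)
  thus ?thesis by (simp only: of_nat_mult of_nat_power)
 qed
 let ?good = "%z E. E \<in> sets P \<and> measure P E <= 2 * ((f + f) ^ N / f ^ s) \<and>
  (\<forall>w y. w \<in> space P --> w \<notin> E --> bounded_entries w --> spread L c k th w --> y \<in> carrier_vec n -->
   ta * (y \<bullet> y) <= ka * (ka0 * (y \<bullet> (offrows r (rep (fst z)) (snd z) *\<^sub>v y)) + y \<bullet> (gram L w *\<^sub>v y) + y \<bullet> (gram ?L1 w *\<^sub>v y)) + y \<bullet> (gram ?L2 w *\<^sub>v y))"
 have ex: "\<forall>z\<in>Z. \<exists>E. ?good z E"
 proof
  fix z assume z: "z \<in> Z"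
  have X: "rep (fst z) \<in> X" using z rep by (auto simp: Z_def)
  have T: "snd z \<subseteq> {..<n}" "card (snd z) <= k'" using z by (auto simp: Z_def \<T>_def)
  have ar: "0 < \<alpha> ^ r" using \<alpha>_pos by simp
  have "\<alpha> ^ r <= singular_value (n - r + 1) (lincomb_mats n r (rep (fst z)) A)"
   using sv_lower[OF r] X by (simp add: X_def)
  from offrows_codim[OF r(1) order_trans[OF r(2) m_le_n] ar this T(1)]
  have cb: "codim_bound n (offrows r (rep (fst z)) (snd z)) ((\<alpha> ^ r)^2) (r - 1 + k')"
   by (rule codim_bound_mono) (use T in auto)
  show "\<exists>E. ?good z E"
  proof (rule two_phase[OF offrows_psd cb L sg1 sg2], goal_cases)
   case (1 E)
   show ?case by (rule exI[of _ E]) (use 1 in blast)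
  qed
 qed
 then obtain EE where EE: "\<forall>z\<in>Z. ?good z (EE z)" by (rule bchoice[THEN exE])
 show ?thesis
 proof (rule that[of "\<Union>z\<in>Z. EE z"])
  show "(\<Union>z\<in>Z. EE z) \<in> sets P" using finZ EE by (intro sets.finite_UN) auto
  have p0: "0 <= 2 * ((f + f) ^ N / f ^ s)" using f by simp
  have "measure P (\<Union>z\<in>Z. EE z) <= (\<Sum>z\<in>Z. measure P (EE z))"
   using finZ EE by (intro P.finite_measure_subadditive_finite) auto
  also have "... <= (\<Sum>z\<in>Z. 2 * ((f + f) ^ N / f ^ s))" using EE by (intro sum_mono) auto
  also have "... = real (card Z) * (2 * ((f + f) ^ N / f ^ s))" by simp
  also have "... <= real (2 * D + 1) ^ r * real (n + 1) ^ k' * (2 * ((f + f) ^ N / f ^ s))"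
   by (rule mult_right_mono[OF cardZ p0])
  finally show "measure P (\<Union>z\<in>Z. EE z) <= real (2 * D + 1) ^ r * real (n + 1) ^ k' * (2 * ((f + f) ^ N / f ^ s))" .
 next
  fix w assume w: "w \<in> space P" "w \<notin> (\<Union>z\<in>Z. EE z)" and bd: "bounded_entries w" and sp: "spread L c k th w"
  have finL: "finite L" using L finite_subset by blast
  show "spread (L \<union> ?L1 \<union> ?L2) r k' th' w"
   unfolding spread_def
  proof (intro ballI impI allI)
   fix y :: "real vec" and x :: "nat => real"
   assume y: "y \<in> carrier_vec n" "y \<bullet> y = 1" and small: "y \<bullet> (gram (L \<union> ?L1 \<union> ?L2) w *\<^sub>v y) <= th'\<^sup>2"
    and x: "(\<Sum>i=1..r. (x i)^2) = 1"
   show "k' <= card {a. a < n \<and> th' <= \<bar>pencil r x y a\<bar>}"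
   proof (rule ccontr)
    define T where "T = {a. a < n \<and> th' <= \<bar>pencil r x y a\<bar>}"
    assume "\<not> k' <= card {a. a < n \<and> th' <= \<bar>pencil r x y a\<bar>}"
    hence T: "T \<in> \<T>" unfolding \<T>_def T_def by auto
    have xX: "x \<in> X" using x by (simp add: X_def)
    define x' where "x' = rep (cell x)"
    have zZ: "(cell x, T) \<in> Z" using xX T by (simp add: Z_def)
    have close: "\<bar>x i - x' i\<bar> <= 1 / real D" if i: "1 <= i" "i <= r" for i
    proof -
     have "cell x' i = cell x i" using rep(2)[OF xX] by (simp add: x'_def)
     hence "\<lfloor>x' i * real D\<rfloor> = \<lfloor>x i * real D\<rfloor>" using i by (simp add: cell_def)
     hence "\<bar>x i * real D - x' i * real D\<bar> <= 1" by linarith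
     hence "\<bar>x i - x' i\<bar> * real D <= 1" by (simp add: left_diff_distrib[symmetric] abs_mult)
     thus ?thesis using D by (simp add: field_simps)
    qed
    \<comment> \<open>Passing from \<open>x\<close> to its representative moves each pencil entry by
      at most \<open>r / D\<close>, and \<open>D\<close> was chosen to keep this below
      \<open>th'\<close>.\<close>
    have off: "(pencil r x' y a)^2 <= 4 * th'\<^sup>2" if a: "a \<in> {..<n} - T" for a
    proof -
     have a': "a < n" "\<bar>pencil r x y a\<bar> < th'" using a by (auto simp: T_def not_le)
     have "\<bar>pencil r x y a - pencil r x' y a\<bar> <= real r * (1 / real D)" by (rule pencil_diff[OF y r(2) a'(1) close])
     also have "... <= th'" using D by (simp add: field_simps)
     finally have "\<bar>pencil r x' y a\<bar> <= \<bar>2 * th'\<bar>" using a'(2) by linarith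
     hence "(pencil r x' y a)^2 <= (2 * th')^2" by (simp only: abs_le_square_iff)
     thus ?thesis by (simp add: power_mult_distrib)
    qed
    have "(\<Sum>a\<in>{..<n} - T. (pencil r x' y a)^2) <= (\<Sum>a\<in>{..<n} - T. 4 * th'\<^sup>2)" by (rule sum_mono[OF off])
    also have "... = real (card ({..<n} - T)) * (4 * th'\<^sup>2)" by simp
    also have "... <= real n * (4 * th'\<^sup>2)"
     using card_mono[of "{..<n}" "{..<n} - T"] by (intro mult_right_mono) auto
    finally have q0: "y \<bullet> (offrows r x' T *\<^sub>v y) <= 4 * real n * th'\<^sup>2" using offrows_quad[OF y(1), of r x' T] by simp
    have gs: "y \<bullet> (gram (L \<union> ?L1 \<union> ?L2) w *\<^sub>v y) = y \<bullet> (gram L w *\<^sub>v y) + y \<bullet> (gram ?L1 w *\<^sub>v y) + y \<bullet> (gram ?L2 w *\<^sub>v y)"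
     unfolding gram_quad_form[OF y(1)] using finL sg1(3) sg2(3)
     by (subst sum.union_disjoint, simp, simp, simp, subst sum.union_disjoint) auto
    have g0: "0 <= y \<bullet> (gram L' w *\<^sub>v y)" for L' by (rule gram_nonneg[OF y(1)])
    have "\<forall>w y. w \<in> space P --> w \<notin> EE (cell x, T) --> bounded_entries w --> spread L c k th w --> y \<in> carrier_vec n -->
     ta * (y \<bullet> y) <= ka * (ka0 * (y \<bullet> (offrows r x' T *\<^sub>v y)) + y \<bullet> (gram L w *\<^sub>v y) + y \<bullet> (gram ?L1 w *\<^sub>v y)) + y \<bullet> (gram ?L2 w *\<^sub>v y)"
     using EE[THEN bspec, OF zZ] by (simp add: x'_def)
    moreover have "w \<notin> EE (cell x, T)" using w(2) zZ by blast
    ultimately have "ta * (y \<bullet> y) <= ka * (ka0 * (y \<bullet> (offrows r x' T *\<^sub>v y)) + y \<bullet> (gram L w *\<^sub>v y) + y \<bullet> (gram ?L1 w *\<^sub>v y)) + y \<bullet> (gram ?L2 w *\<^sub>v y)"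
     using w(1) bd sp y(1) by blast
    also have "... <= ka * (ka0 * (y \<bullet> (offrows r x' T *\<^sub>v y)) + y \<bullet> (gram L w *\<^sub>v y) + y \<bullet> (gram ?L1 w *\<^sub>v y)) + ka * (y \<bullet> (gram ?L2 w *\<^sub>v y))"
     using mult_right_mono[OF ka(1) g0[of ?L2]] by simp
    also have "... = ka * (ka0 * (y \<bullet> (offrows r x' T *\<^sub>v y)) + y \<bullet> (gram (L \<union> ?L1 \<union> ?L2) w *\<^sub>v y))"
     unfolding gs by (simp only: distrib_left add.assoc)
    also have "... <= ka * (ka0 * (4 * real n * th'\<^sup>2) + th'\<^sup>2)"
     using ka(1) ka0(1) q0 small by (intro mult_left_mono add_mono) auto
    finally show False using fin y(2) by simp
   qed
  qed
 qed
qed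

lemma likely_stage:
 assumes H: "likely u c k th ep"
 shows "likely (u + N + N) r k' th' (ep + real (2 * D + 1) ^ r * real (n + 1) ^ k' * (2 * ((f + f) ^ N / f ^ s)))"
 unfolding likely_def
proof (intro allI impI)
 fix L assume "L \<subseteq> {..<q}" "card L = u + N + N"
 then obtain L2 sg2 where L2: "L2 \<subseteq> {..<q}" "card L2 = u + N" and sg2: "inj_on sg2 {..<N}" "sg2 ` {..<N} \<subseteq> {..<q}"
  and Leq: "L = L2 \<union> sg2 ` {..<N}" and dj2: "L2 \<inter> sg2 ` {..<N} = {}" by (rule split_columns)
 from L2 obtain L1 sg1 where L1: "L1 \<subseteq> {..<q}" "card L1 = u" and sg1: "inj_on sg1 {..<N}" "sg1 ` {..<N} \<subseteq> {..<q}"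
  and L2eq: "L2 = L1 \<union> sg1 ` {..<N}" and dj1: "L1 \<inter> sg1 ` {..<N} = {}" by (rule split_columns)
 obtain E1 where E1: "E1 \<in> sets P" "measure P E1 <= ep"
  and E1': "\<forall>w\<in>space P. w \<notin> E1 --> bounded_entries w --> spread L1 c k th w"
  using H[unfolded likely_def, THEN spec, THEN mp, THEN mp, OF L1] by (elim bexE conjE) (rule that)
 let ?ep = "real (2 * D + 1) ^ r * real (n + 1) ^ k' * (2 * ((f + f) ^ N / f ^ s))"
 obtain E2 where E2: "E2 \<in> sets P" "measure P E2 <= ?ep"
  "!!w. w \<in> space P ==> w \<notin> E2 ==> bounded_entries w ==> spread L1 c k th w ==> spread L r k' th' w"
 proof (rule spread_stage[OF L1(1) sg1 dj1 sg2 dj2[unfolded L2eq]], goal_cases)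
  case (1 E)
  show ?case by (rule 1(1)[OF 1(2,3)]) (use 1(4) Leq L2eq in simp)
 qed
 show "\<exists>E\<in>sets P. measure P E <= ep + ?ep \<and> (\<forall>w\<in>space P. w \<notin> E --> bounded_entries w --> spread L r k' th' w)"
 proof (intro bexI[of _ "E1 \<union> E2"] conjI ballI impI)
  show "measure P (E1 \<union> E2) <= ep + ?ep" using measure_Un_le[OF E1(1) E2(1)] E1(2) E2(2) by linarith
  show "E1 \<union> E2 \<in> sets P" using E1 E2 by blast
  fix w assume w: "w \<in> space P" "w \<notin> E1 \<union> E2" "bounded_entries w"
  show "spread L r k' th' w" using w E1' by (intro E2(3)) auto
 qed
qed

end

section \<open>Choice of parameters\<close>

text \<open>One factor \<open>\<alpha>\<close> absorbs any power of \<open>n\<close> of moderate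
  degree. By \<open>const_le\<close> numerical constants are absorbed too, after being bounded by
  \<open>n ^ 50\<close>.\<close>

locale small_param =
 fixes n :: nat and \<alpha> :: real
 assumes n3: "3 <= n" and \<alpha>0: "0 < \<alpha>" and n\<alpha>100: "real n ^ 100 * \<alpha> <= 1"
begin

lemma n\<alpha>: "j <= 100 ==> real n ^ j * \<alpha> <= 1"
proof -
 assume "j <= 100"
 hence "real n ^ j <= real n ^ 100" using n3 by (intro power_increasing) auto
 hence "real n ^ j * \<alpha> <= real n ^ 100 * \<alpha>" using \<alpha>0 by (intro mult_right_mono) auto
 thus ?thesis using n\<alpha>100 by linarith
qed

lemma const_le: "j <= 50 ==> x <= 3 ^ 50 ==> x * real n ^ j * \<alpha> <= 1"
proof -
 assume j: "j <= 50" and x: "x <= 3 ^ 50"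
 have "(3::real) ^ 50 <= real n ^ 50" using n3 by (intro power_mono) auto
 hence "x * real n ^ j <= real n ^ 50 * real n ^ j" using x by (intro mult_right_mono) auto
 hence "x * real n ^ j * \<alpha> <= (real n ^ 50 * real n ^ j) * \<alpha>" by (rule mult_right_mono) (use \<alpha>0 in simp)
 also have "... = real n ^ (50 + j) * \<alpha>" by (simp only: power_add)
 also have "... <= 1" using j by (intro n\<alpha>) simp
 finally show ?thesis .
qed

lemma \<alpha>16: "16 * \<alpha> <= 1" using const_le[of 0 16] by simp

lemma \<alpha>1: "\<alpha> <= 1" "\<alpha> < 1" using \<alpha>16 \<alpha>0 by linarith+

lemma dec: "a <= b ==> \<alpha> ^ b <= \<alpha> ^ a" using \<alpha>0 \<alpha>1 by (intro power_decreasing) auto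

lemma half: "a < b ==> \<alpha> ^ b <= \<alpha> ^ a / 2"
proof -
 assume "a < b"
 hence "\<alpha> ^ b <= \<alpha> ^ Suc a" by (intro dec) simp
 also have "... <= (1 / 2) * \<alpha> ^ a" using \<alpha>16 \<alpha>0 by simp
 finally show ?thesis by simp
qed

text \<open>The constant is at most \<open>(512 * n\<^sup>2) ^ c\<close>, and each of the
  \<open>c\<close> factors is absorbed by one \<open>\<alpha>\<close>.\<close>

lemma growth_const_small:
 assumes "1 <= c" "c <= n" shows "growth_const c * \<alpha> ^ c <= 1"
proof -
 have "growth_const c <= 16 ^ c * (8 * real n) ^ c * (4 * real n) ^ c"
  unfolding growth_const_def
 proof (intro mult_mono power_mono)
  have "(16::real) ^ 1 <= 16 ^ c" using assms by (intro power_increasing) auto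
  thus "(16::real) <= 16 ^ c" by simp
 qed (use assms in auto)
 also have "... = (512 * real n ^ 2) ^ c"
 proof -
  have "16 * (8 * real n) * (4 * real n) = 512 * real n ^ 2" by (simp add: power2_eq_square)
  thus ?thesis by (simp only: power_mult_distrib[symmetric])
 qed
 finally have "growth_const c * \<alpha> ^ c <= (512 * real n ^ 2) ^ c * \<alpha> ^ c" using \<alpha>0 by (intro mult_right_mono) auto
 also have "... = (512 * real n ^ 2 * \<alpha>) ^ c" by (simp add: power_mult_distrib)
 also have "... <= 1" using \<alpha>0 const_le[of 2 512] by (intro power_le_one) auto
 finally show ?thesis .
qed

text \<open>The exponents add up: \<open>17 * c\<close> from the spread threshold, \<open>c\<close>
  from the growth constant, \<open>c + 1\<close> from \<open>t\<close>, and 1 for the factor 1 / 2,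
  in total \<open>19 * c + 2\<close>; the outer 2 is the square. The second round uses it with
  \<open>d = 1\<close>.\<close>

lemma threshold:
 assumes c: "1 <= c" "c <= n" and d: "1 <= d"
  and g: "growth_const d * \<alpha> ^ c <= 1"
 shows "(\<alpha> ^ (2 * (19 * c + 2))) ^ d <= ((\<alpha> ^ (c + 1)) ^ d * ((\<alpha> ^ (17 * c) / growth_const d) ^ d / 2))^2"
proof -
 have K: "growth_const d > 0" using d by (intro growth_const_pos) simp
 have "\<alpha> ^ c <= 1 / growth_const d" using g K by (simp add: field_simps)
 hence "\<alpha> ^ (18 * c + 1) * \<alpha> ^ c <= \<alpha> ^ (18 * c + 1) * (1 / growth_const d)" using \<alpha>0 by (intro mult_left_mono) auto
 moreover have "\<alpha> ^ (18 * c + 1) * \<alpha> ^ c = \<alpha> ^ (19 * c + 1)"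
  unfolding power_add[symmetric] by (rule arg_cong[where f = "%e. \<alpha> ^ e"]) simp
 moreover have "\<alpha> ^ (18 * c + 1) = \<alpha> ^ (c + 1) * \<alpha> ^ (17 * c)"
  unfolding power_add[symmetric] by (rule arg_cong[where f = "%e. \<alpha> ^ e"]) simp
 ultimately have 1: "\<alpha> ^ (19 * c + 1) <= \<alpha> ^ (c + 1) * (\<alpha> ^ (17 * c) / growth_const d)"
  by (simp only: times_divide_eq_right mult_1_right)
 have "(\<alpha> ^ (19 * c + 2)) ^ d = (\<alpha> ^ (19 * c + 1)) ^ d * \<alpha> ^ d" by (simp add: power_mult_distrib[symmetric] mult.commute)
 also have "... <= (\<alpha> ^ (19 * c + 1)) ^ d * (1 / 2)"
  using half[of 0 d] d \<alpha>0 by (intro mult_left_mono) auto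
 also have "... <= (\<alpha> ^ (c + 1) * (\<alpha> ^ (17 * c) / growth_const d)) ^ d * (1 / 2)"
  using 1 \<alpha>0 by (intro mult_right_mono power_mono) auto
 also have "... = (\<alpha> ^ (c + 1)) ^ d * ((\<alpha> ^ (17 * c) / growth_const d) ^ d / 2)" by (simp only: power_mult_distrib)
 finally have "((\<alpha> ^ (19 * c + 2)) ^ d)^2 <= ((\<alpha> ^ (c + 1)) ^ d * ((\<alpha> ^ (17 * c) / growth_const d) ^ d / 2))^2"
  using \<alpha>0 by (intro power_mono) auto
 moreover have "((\<alpha> ^ (19 * c + 2)) ^ d)^2 = (\<alpha> ^ (2 * (19 * c + 2))) ^ d"
  unfolding power_mult[symmetric] by (rule arg_cong[where f = "%e. \<alpha> ^ e"]) simp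
 ultimately show ?thesis by simp
qed

text \<open>For \<open>k = c * k1\<close> the sparse term is the \<open>c\<close>-th power of
  \<open>(1 - p) ^ (k1 - 1)\<close>, hence at most \<open>\<alpha> ^ (8 * c)\<close>. The polynomial
  factors are at most \<open>(n ^ 4) ^ c\<close> and use up one of the eight powers.\<close>

lemma failure_bounds:
 fixes p :: real
 assumes c: "1 <= c" "c <= n" and p: "0 <= p" "p <= 1" and PP: "(1 - p) ^ (k1 - 1) <= \<alpha> ^ 8"
 shows "real c * ((real n)^2 + 1) ^ c * (1 - p) ^ (c * k1 - c) + (real n)^2 * (2 * \<alpha> ^ (c + 1) * real c) <= \<alpha> ^ c"
  "real 1 * ((real n)^2 + 1) ^ 1 * (1 - p) ^ (c * k1 - 1) + (real n)^2 * (2 * \<alpha> ^ (c + 1) * real 1) <= \<alpha> ^ c"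
  "real c * ((real n)^2 + 1) ^ c * (1 - p) ^ (c * k1 - c) <= \<alpha> ^ (7 * c)"
proof -
 have e: "c * k1 - c = (k1 - 1) * c" by (simp only: diff_mult_distrib mult_1 mult.commute[of c k1])
 have "(1 - p) ^ (c * k1 - c) = ((1 - p) ^ (k1 - 1)) ^ c" unfolding e power_mult ..
 also have "... <= (\<alpha> ^ 8) ^ c" using PP p by (intro power_mono) auto
 finally have q: "(1 - p) ^ (c * k1 - c) <= (\<alpha> ^ 8) ^ c" .
 have n1: "1 <= real n" using n3 by simp
 have n2: "(real n)^2 + 1 <= real n ^ 3"
 proof -
  have "1 <= (real n)^2" using n1 by (intro one_le_power)
  hence "(real n)^2 + 1 <= 3 * (real n)^2" by linarith
  also have "... <= real n * (real n)^2" using n3 by (intro mult_right_mono) auto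
  finally show ?thesis by (simp add: power2_eq_square numeral_eq_Suc)
 qed
 have cn: "real c <= real n ^ c"
 proof -
  have "real c <= real n ^ 1" using c by simp
  also have "... <= real n ^ c" using n1 c by (intro power_increasing) auto
  finally show ?thesis .
 qed
 have n4: "real n ^ 4 * \<alpha> ^ 8 <= \<alpha> ^ 7"
  using mult_right_mono[OF n\<alpha>[of 4], of "\<alpha> ^ 7"] \<alpha>0 by (simp add: numeral_eq_Suc mult_ac)
 have sec: "(real n)^2 * (2 * \<alpha> ^ (c + 1) * real d) <= \<alpha> ^ c / 2" if d: "d <= n" for d
 proof -
  have "(real n)^2 * (2 * \<alpha> ^ (c + 1) * real d) <= (real n)^2 * (2 * \<alpha> ^ (c + 1) * real n)"
   using d \<alpha>0 by (intro mult_left_mono) auto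
  also have "... = (4 * real n ^ 3 * \<alpha>) * (\<alpha> ^ c / 2)" by (simp add: power2_eq_square numeral_eq_Suc)
  also have "... <= 1 * (\<alpha> ^ c / 2)" using const_le[of 3 4] \<alpha>0 by (intro mult_right_mono) auto
  finally show ?thesis by simp
 qed
 have "real c * ((real n)^2 + 1) ^ c * (1 - p) ^ (c * k1 - c) <= real n ^ c * (real n ^ 3) ^ c * (\<alpha> ^ 8) ^ c"
  using q cn n2 p by (intro mult_mono power_mono) auto
 also have "... = (real n ^ 4 * \<alpha> ^ 8) ^ c"
  by (simp only: power_mult_distrib[symmetric]) (simp add: numeral_eq_Suc mult_ac)
 also have "... <= (\<alpha> ^ 7) ^ c" using n4 \<alpha>0 by (intro power_mono) auto
 also have "... = \<alpha> ^ (7 * c)" by (simp add: power_mult)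
 finally show support: "real c * ((real n)^2 + 1) ^ c * (1 - p) ^ (c * k1 - c) <= \<alpha> ^ (7 * c)" .
 also have "... <= \<alpha> ^ c / 2" using c by (intro half) simp
 finally show "real c * ((real n)^2 + 1) ^ c * (1 - p) ^ (c * k1 - c) + (real n)^2 * (2 * \<alpha> ^ (c + 1) * real c) <= \<alpha> ^ c"
  using sec[OF c(2)] by linarith
 have "(1 - p) ^ (c * k1 - 1) <= (1 - p) ^ (c * k1 - c)" using p c by (intro power_decreasing) auto
 hence "(1 - p) ^ (c * k1 - 1) <= \<alpha> ^ (8 * c)" using q by (simp add: power_mult)
 hence "real 1 * ((real n)^2 + 1) ^ 1 * (1 - p) ^ (c * k1 - 1) <= real n ^ 3 * \<alpha> ^ (8 * c)"
  using n2 p by (simp only: of_nat_1 mult_1 power_one_right) (intro mult_mono, auto)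
 also have "... <= real n ^ 3 * \<alpha> ^ (c + 2)" using c by (intro mult_left_mono dec) auto
 also have "... = (real n ^ 3 * \<alpha>) * \<alpha> ^ (c + 1)" by simp
 also have "... <= 1 * \<alpha> ^ (c + 1)" using \<alpha>0 by (intro mult_right_mono n\<alpha>) auto
 also have "1 * \<alpha> ^ (c + 1) <= \<alpha> ^ c / 2" using half[of c "c + 1"] by simp
 finally show "real 1 * ((real n)^2 + 1) ^ 1 * (1 - p) ^ (c * k1 - 1) + (real n)^2 * (2 * \<alpha> ^ (c + 1) * real 1) <= \<alpha> ^ c"
  using sec[of 1] n3 by linarith
qed

text \<open>Counted in powers of \<open>1 / \<alpha>\<close>: the budget is at most
  \<open>1 + (3 * y + 1) * d\<close>, and each of the \<open>s\<close> successes brings at least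
  \<open>(y - 1) * c\<close>, the quotient of \<open>\<alpha> ^ (2 * y)\<close> by the level
  \<open>\<alpha> ^ (3 * y)\<close> up to the factor 2.\<close>

lemma gain:
 assumes y: "1 <= y" and e: "1 + (3 * y + 1) * d <= (y - 1) * (c * s)"
 shows "3 * (1 + real n ^ 4 / \<alpha> ^ (3 * y)) ^ d < ((\<alpha> ^ (2 * y)) ^ c / (2 * \<alpha> ^ (3 * y)) ^ c) ^ s"
proof -
 let ?g = "1 / \<alpha>"
 have g1: "1 <= ?g" using \<alpha>0 \<alpha>1 by simp
 have "1 + real n ^ 4 / \<alpha> ^ (3 * y) <= ?g ^ (3 * y + 1)"
 proof -
  have "1 <= 1 / \<alpha> ^ (3 * y)" using \<alpha>0 \<alpha>1 by (simp add: power_le_one)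
  hence "1 + real n ^ 4 / \<alpha> ^ (3 * y) <= (real n ^ 4 + 1) * (1 / \<alpha> ^ (3 * y))" by (simp add: add_divide_distrib)
  also have "... <= ?g * (1 / \<alpha> ^ (3 * y))"
  proof (rule mult_right_mono)
   have "real n ^ 4 + 1 <= 2 * real n ^ 4" using n3 by simp
   also have "... <= ?g" using const_le[of 4 2] \<alpha>0 by (simp add: field_simps)
   finally show "real n ^ 4 + 1 <= ?g" .
  qed (use \<alpha>0 in simp)
  also have "... = ?g ^ (3 * y + 1)" by (simp add: power_divide)
  finally show ?thesis .
 qed
 hence "(1 + real n ^ 4 / \<alpha> ^ (3 * y)) ^ d <= (?g ^ (3 * y + 1)) ^ d" using \<alpha>0 by (intro power_mono) auto
 hence "3 * (1 + real n ^ 4 / \<alpha> ^ (3 * y)) ^ d <= 3 * (?g ^ (3 * y + 1)) ^ d" by (intro mult_left_mono) auto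
 moreover have "(0::real) < (?g ^ (3 * y + 1)) ^ d" using \<alpha>0 by simp
 moreover have "3 < ?g" using \<alpha>16 \<alpha>0 by (simp add: field_simps)
 ultimately have "3 * (1 + real n ^ 4 / \<alpha> ^ (3 * y)) ^ d < ?g * (?g ^ (3 * y + 1)) ^ d"
  by (intro le_less_trans[OF _ mult_strict_right_mono])
 also have "... = ?g ^ (1 + (3 * y + 1) * d)" by (simp only: power_add power_mult power_one_right)
 also have "... <= ?g ^ ((y - 1) * (c * s))" by (rule power_increasing[OF e g1])
 also have "... = ((?g ^ (y - 1)) ^ c) ^ s" by (simp only: power_mult)
 also have "... <= ((\<alpha> ^ (2 * y)) ^ c / (2 * \<alpha> ^ (3 * y)) ^ c) ^ s"
 proof -
  have "?g ^ (y - 1) <= \<alpha> ^ (2 * y) / (2 * \<alpha> ^ (3 * y))"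
  proof -
   have "\<alpha> ^ y = \<alpha> * \<alpha> ^ (y - 1)" using y by (simp add: power_eq_if)
   hence "2 * \<alpha> ^ y <= \<alpha> ^ (y - 1)" using mult_right_mono[of "2 * \<alpha>" 1 "\<alpha> ^ (y - 1)"] \<alpha>16 \<alpha>0 by simp
   hence "1 / \<alpha> ^ (y - 1) <= 1 / (2 * \<alpha> ^ y)" using \<alpha>0 by (intro divide_left_mono) auto
   moreover have "\<alpha> ^ (2 * y) / (2 * \<alpha> ^ (3 * y)) = 1 / (2 * \<alpha> ^ y)"
   proof -
    have "\<alpha> ^ (3 * y) = \<alpha> ^ (2 * y) * \<alpha> ^ y" by (simp add: power_add[symmetric])
    thus ?thesis using \<alpha>0 by simp
   qed
   ultimately show ?thesis by (simp add: power_divide)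
  qed
  thus ?thesis unfolding power_divide[symmetric] using \<alpha>0 by (intro power_mono) auto
 qed
 finally show ?thesis .
qed

text \<open>The origin of the exponent 17. With threshold \<open>\<alpha> ^ (E * c)\<close> one has
  \<open>y = (E + 2) * c + 2\<close>, and after quadrupling the exponents must satisfy
  \<open>8 * E * c >= 6 * y + 2 * r + 1\<close>. For \<open>c = 1\<close> and \<open>r = 4\<close>
  this means \<open>2 * E >= 33\<close>, and 17 is the least integer that qualifies.\<close>

lemma closing:
 assumes "1 <= c" "r <= 4 * c" "y = 19 * c + 2"
 shows "real n ^ 5 / \<alpha> ^ (3 * y) * (real n ^ 5 / \<alpha> ^ (2 * r) * (4 * real n * (\<alpha> ^ (68 * c))^2) + (\<alpha> ^ (68 * c))^2) < \<alpha> ^ (3 * y)"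
proof -
 define e where "e = 136 * c - 6 * y - 2 * r - 1"
 have "136 * c = 3 * y + 3 * y + 2 * r + 1 + e" using assms by (simp add: e_def)
 moreover have "(\<alpha> ^ (68 * c))^2 = \<alpha> ^ (136 * c)" by (simp add: power_mult[symmetric] mult.commute)
 ultimately have s: "(\<alpha> ^ (68 * c))^2 = \<alpha> ^ (3 * y) * \<alpha> ^ (3 * y) * \<alpha> ^ (2 * r) * (\<alpha> * \<alpha> ^ e)"
  by (simp only: power_add power_one_right mult.assoc)
 have "real n ^ 5 / \<alpha> ^ (3 * y) * (real n ^ 5 / \<alpha> ^ (2 * r) * (4 * real n * (\<alpha> ^ (68 * c))^2) + (\<alpha> ^ (68 * c))^2)
   = (real n ^ 5 * (real n ^ 5 * (4 * real n) + \<alpha> ^ (2 * r)) * \<alpha>) * (\<alpha> ^ e * \<alpha> ^ (3 * y))"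
 proof -
  have gen: "T > 0 ==> R > 0 ==> N / T * (N / R * (M * (T * T * R * (\<alpha> * F))) + T * T * R * (\<alpha> * F)) = (N * (N * M + R) * \<alpha>) * (F * T)"
   for T R N M F :: real by (simp add: field_simps)
  show ?thesis unfolding s by (rule gen) (use \<alpha>0 in simp_all)
 qed
 also have "... <= (1 / 2) * (\<alpha> ^ e * \<alpha> ^ (3 * y))"
 proof (rule mult_right_mono)
  have "\<alpha> ^ (2 * r) <= 1" using \<alpha>0 \<alpha>1 by (intro power_le_one) auto
  also have "1 <= real n ^ 6" using n3 by (intro one_le_power) simp
  finally have "real n ^ 5 * (4 * real n) + \<alpha> ^ (2 * r) <= 5 * real n ^ 6" by (simp add: numeral_eq_Suc)
  hence "real n ^ 5 * (real n ^ 5 * (4 * real n) + \<alpha> ^ (2 * r)) * \<alpha> <= real n ^ 5 * (5 * real n ^ 6) * \<alpha>"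
   using \<alpha>0 by (intro mult_right_mono mult_left_mono) auto
  also have "... = (10 * real n ^ 11 * \<alpha>) / 2" by (simp add: numeral_eq_Suc)
  also have "... <= 1 / 2" using const_le[of 11 10] by (intro divide_right_mono) auto
  finally show "real n ^ 5 * (real n ^ 5 * (4 * real n) + \<alpha> ^ (2 * r)) * \<alpha> <= 1 / 2" .
 qed (use \<alpha>0 in simp)
 also have "... < \<alpha> ^ (3 * y)"
 proof -
  have "\<alpha> ^ e * \<alpha> ^ (3 * y) <= 1 * \<alpha> ^ (3 * y)" using \<alpha>0 \<alpha>1 by (intro mult_right_mono power_le_one) auto
  moreover have "0 < \<alpha> ^ (3 * y)" using \<alpha>0 by simp
  ultimately show ?thesis by linarith
 qed
 finally show ?thesis .
qed

text \<open>The fourth power of \<open>2 * \<alpha> ^ c\<close> is at most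
  \<open>\<alpha> ^ (3 * c)\<close>, so \<open>4 * M\<close> columns yield
  \<open>\<alpha> ^ (3 * c * M)\<close>. The lower bound on \<open>M\<close> lets this exponent
  exceed by 4 the sum of those of the mesh, of the sets \<open>T\<close>, of the factor 2 and of the
  division by \<open>f ^ s\<close>.\<close>

lemma union_bound:
 assumes c: "1 <= c" "c <= m" "m <= n" and r: "r <= 4 * c" "r <= n" and D: "real D <= real r / \<alpha> ^ (68 * c) + 1"
  and M: "8 * k1 + 100 * m + 10 <= M"
 shows "real (2 * D + 1) ^ r * real (n + 1) ^ (4 * c * k1) * (2 * ((\<alpha> ^ c + \<alpha> ^ c) ^ (4 * M) / (\<alpha> ^ c) ^ (16 * (k1 + 1)))) <= \<alpha> ^ 4"
proof -
 let ?g = "1 / \<alpha>"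
 have g0: "0 < ?g" using \<alpha>0 by simp
 have g1: "1 <= ?g" using \<alpha>0 \<alpha>1 by simp
 have inv1: "1 <= 1 / \<alpha> ^ (68 * c)" using \<alpha>0 \<alpha>1 by (simp add: power_le_one)
 have "real (2 * D + 1) <= 2 * (real r / \<alpha> ^ (68 * c)) + 3" using D by simp
 also have "... <= 5 * (real n * (1 / \<alpha> ^ (68 * c)))"
 proof -
  have "real r * (1 / \<alpha> ^ (68 * c)) <= real n * (1 / \<alpha> ^ (68 * c))" using r \<alpha>0 by (intro mult_right_mono) auto
  moreover have "1 * 1 <= real n * (1 / \<alpha> ^ (68 * c))" using inv1 n3 by (intro mult_mono) auto
  ultimately show ?thesis by simp
 qed
 also have "... <= ?g * (1 / \<alpha> ^ (68 * c))"
 proof -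
  have "5 * real n <= ?g" using const_le[of 1 5] \<alpha>0 by (simp add: field_simps)
  hence "(5 * real n) * (1 / \<alpha> ^ (68 * c)) <= ?g * (1 / \<alpha> ^ (68 * c))" using \<alpha>0 by (intro mult_right_mono) auto
  thus ?thesis by (simp only: mult.assoc)
 qed
 also have "... = ?g ^ (68 * c + 1)" by (simp add: power_divide)
 finally have "real (2 * D + 1) ^ r <= (?g ^ (68 * c + 1)) ^ r" by (intro power_mono) auto
 also have "... <= (?g ^ (68 * c + 1)) ^ (4 * c)" using r g1 by (intro power_increasing one_le_power)
 also have "... = ?g ^ ((68 * c + 1) * (4 * c))" by (simp only: power_mult)
 finally have 1: "real (2 * D + 1) ^ r <= ?g ^ ((68 * c + 1) * (4 * c))" .
 have "real (n + 1) <= 2 * real n" using n3 by simp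
 also have "2 * real n <= ?g" using const_le[of 1 2] \<alpha>0 by (simp add: field_simps)
 finally have 2: "real (n + 1) ^ (4 * c * k1) <= ?g ^ (4 * c * k1)" by (intro power_mono) auto
 have "(\<alpha> ^ c + \<alpha> ^ c) ^ 4 = 16 * \<alpha> ^ (4 * c)" by (simp add: mult_2[symmetric] power_mult_distrib power_mult[symmetric] mult.commute)
 also have "\<alpha> ^ (4 * c) = \<alpha> ^ (3 * c) * \<alpha> * \<alpha> ^ (c - 1)"
 proof -
  have e: "4 * c = 3 * c + 1 + (c - 1)" using c by simp
  show ?thesis by (subst e) (simp only: power_add power_one_right)
 qed
 also have "16 * (\<alpha> ^ (3 * c) * \<alpha> * \<alpha> ^ (c - 1)) = \<alpha> ^ (3 * c) * (16 * \<alpha>) * \<alpha> ^ (c - 1)" by simp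
 also have "... <= \<alpha> ^ (3 * c) * 1 * 1" using \<alpha>16 \<alpha>0 \<alpha>1 by (intro mult_mono power_le_one) auto
 finally have "((\<alpha> ^ c + \<alpha> ^ c) ^ 4) ^ M <= (\<alpha> ^ (3 * c)) ^ M" using \<alpha>0 by (intro power_mono) auto
 hence 3: "(\<alpha> ^ c + \<alpha> ^ c) ^ (4 * M) <= \<alpha> ^ (3 * c * M)" by (simp add: power_mult)
 have 4: "2 <= ?g" using \<alpha>16 \<alpha>0 by (simp add: field_simps)
 let ?E = "(68 * c + 1) * (4 * c) + 4 * c * k1 + 1 + c * (16 * (k1 + 1))"
 have e5: "1 / (\<alpha> ^ c) ^ (16 * (k1 + 1)) = ?g ^ (c * (16 * (k1 + 1)))" by (simp only: power_mult[symmetric] power_divide power_one)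
 have "real (2 * D + 1) ^ r * real (n + 1) ^ (4 * c * k1) * (2 * ((\<alpha> ^ c + \<alpha> ^ c) ^ (4 * M) / (\<alpha> ^ c) ^ (16 * (k1 + 1))))
   = real (2 * D + 1) ^ r * real (n + 1) ^ (4 * c * k1) * (2 * ((\<alpha> ^ c + \<alpha> ^ c) ^ (4 * M) * ?g ^ (c * (16 * (k1 + 1)))))"
  unfolding e5[symmetric] by simp
 also have "... <= ?g ^ ((68 * c + 1) * (4 * c)) * ?g ^ (4 * c * k1) * (?g * (\<alpha> ^ (3 * c * M) * ?g ^ (c * (16 * (k1 + 1)))))"
  using 1 2 3 4 \<alpha>0 g0 by (intro mult_mono mult_nonneg_nonneg) auto
 also have "... = ?g ^ ?E * \<alpha> ^ (3 * c * M)" by (simp only: power_add power_one_right mult_ac)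
 also have "... <= ?g ^ ?E * \<alpha> ^ (?E + 4)"
 proof (intro mult_left_mono dec)
  have "?E + 4 = c * (272 * c + 20 * k1 + 20) + 5" by (simp add: algebra_simps)
  also have "... <= c * (272 * c + 20 * k1 + 20) + c * 5" using c by simp
  also have "... = c * (272 * c + 20 * k1 + 25)" by (simp add: algebra_simps)
  also have "... <= c * (3 * M)" using c M by (intro mult_left_mono) auto
  finally show "?E + 4 <= 3 * c * M" by simp
 qed (use g0 in simp)
 also have "... = \<alpha> ^ 4"
 proof -
  have "?g ^ e * \<alpha> ^ (e + 4) = (?g * \<alpha>) ^ e * \<alpha> ^ 4" for e by (simp only: power_add power_mult_distrib mult.assoc)
  moreover have "?g * \<alpha> = 1" using \<alpha>0 by simp
  ultimately show ?thesis by (simp only: power_one mult_1)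
 qed
 finally show ?thesis .
qed

end

context krylov_sv
begin

lemma likely_mono:
 assumes "likely u r k th ep" "ep <= ep'" shows "likely u r k th ep'"
 unfolding likely_def
proof (intro allI impI)
 fix L assume "L \<subseteq> {..<q}" "card L = u"
 from assms(1)[unfolded likely_def, THEN spec, THEN mp, THEN mp, OF this]
 obtain E where "E \<in> sets P" "measure P E <= ep" "\<forall>w\<in>space P. w \<notin> E --> bounded_entries w --> spread L r k th w"
  by (elim bexE conjE) (rule that)
 thus "\<exists>E\<in>sets P. measure P E <= ep' \<and> (\<forall>w\<in>space P. w \<notin> E --> bounded_entries w --> spread L r k th w)"
  using assms(2) by (intro bexI[of _ E]) auto
qed

text \<open>The invariant keeps \<open>k1\<close> large coordinates per coefficient and the exponent
  17 per coefficient: for \<open>r = 4 * c\<close> the new values are \<open>r * k1\<close> and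
  \<open>17 * r\<close>. The columns consumed, \<open>8 * M\<close>, do not depend on
  \<open>c\<close>.\<close>

lemma likely_power_stage:
 assumes n3: "3 <= n" and small: "real n ^ 100 * \<alpha> <= 1"
  and c: "1 <= c" "c <= m" and r: "1 <= r" "r <= m" "r <= 4 * c"
  and PP: "(1 - p) ^ (k1 - 1) <= \<alpha> ^ 8" and k1: "m <= k1" and M: "8 * k1 + 100 * m + 10 <= M"
  and H: "likely u c (c * k1) (\<alpha> ^ (17 * c)) ep"
 shows "likely (u + 4 * M + 4 * M) r (4 * c * k1) (\<alpha> ^ (68 * c)) (ep + \<alpha> ^ 4)"
proof -
 interpret small_param n \<alpha> by unfold_locales (use n3 small \<alpha>_pos in auto)
 define y where "y = 19 * c + 2"
 define D where "D = nat \<lceil>real r / \<alpha> ^ (68 * c)\<rceil>"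
 have cn: "c <= n" "r <= n" using c r m_le_n by auto
 have Dr: "real r / \<alpha> ^ (68 * c) <= real D" "real D <= real r / \<alpha> ^ (68 * c) + 1"
 proof -
  have 0: "0 <= real r / \<alpha> ^ (68 * c)" using \<alpha>0 by simp
  show "real r / \<alpha> ^ (68 * c) <= real D" unfolding D_def by (rule real_nat_ceiling_ge)
  show "real D <= real r / \<alpha> ^ (68 * c) + 1" unfolding D_def using 0 by linarith
 qed
 have Dp: "0 < D"
 proof -
  have "0 < real r / \<alpha> ^ (68 * c)" using r \<alpha>0 by simp
  thus ?thesis using Dr(1) by linarith
 qed
 \<comment> \<open>The level is \<open>\<alpha> ^ (3 * y)\<close> and the squared determinant
   threshold \<open>\<alpha> ^ (2 * y)\<close> per direction. The factor 16 in the number of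
   successes is taken large enough that \<open>16 * (y - 1)\<close> exceeds
   \<open>4 * (3 * y + 1)\<close>, four being the growth of the number of large coordinates.\<close>
 have "stage n m q A p \<alpha> c (c * k1) r (4 * c * k1) (16 * (k1 + 1)) D (real n ^ 5 / \<alpha> ^ (2 * r)) (real n ^ 5 / \<alpha> ^ (3 * y))
  (\<alpha> ^ (3 * y)) (\<alpha> ^ (17 * c)) (\<alpha> ^ (68 * c)) (\<alpha> ^ (c + 1)) ((\<alpha> ^ (2 * y)) ^ c) ((\<alpha> ^ (2 * y)) ^ 1) (\<alpha> ^ c)"
 proof unfold_locales
  show "0 <= real n ^ 5 / \<alpha> ^ (2 * r)" using \<alpha>0 by simp
  show "real n * real n ^ 4 <= real n ^ 5 / \<alpha> ^ (2 * r) * (\<alpha> ^ r)^2"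
  proof -
   have "real n * real n ^ 4 = real n ^ 5" by (simp add: numeral_eq_Suc)
   moreover have "(\<alpha> ^ r)^2 = \<alpha> ^ (2 * r)" by (simp only: power_mult[symmetric] mult.commute)
   ultimately show ?thesis using \<alpha>0 by simp
  qed
  have "\<alpha> ^ (3 * y) <= 1" using \<alpha>0 \<alpha>1 by (intro power_le_one) auto
  moreover have "1 <= real n ^ 5" using n3 by (intro one_le_power) simp
  ultimately show "1 <= real n ^ 5 / \<alpha> ^ (3 * y)" using \<alpha>0 by (simp add: field_simps)
  show "real n * real n ^ 4 <= real n ^ 5 / \<alpha> ^ (3 * y) * \<alpha> ^ (3 * y)" using \<alpha>0 by (simp add: numeral_eq_Suc)
  show "\<alpha> ^ (3 * y) <= (\<alpha> ^ (17 * c))^2"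
   unfolding power_mult[symmetric] by (rule dec) (simp add: y_def)
  show "(\<alpha> ^ (2 * y)) ^ c <= ((\<alpha> ^ (c + 1)) ^ c * ((\<alpha> ^ (17 * c) / growth_const c) ^ c / 2))^2"
   unfolding y_def by (rule threshold[OF c(1) cn(1) c(1) growth_const_small[OF c(1) cn(1)]])
  show "(\<alpha> ^ (2 * y)) ^ 1 <= ((\<alpha> ^ (c + 1)) ^ 1 * ((\<alpha> ^ (17 * c) / growth_const 1) ^ 1 / 2))^2"
  proof -
   have "growth_const 1 * \<alpha> ^ c <= growth_const 1 * \<alpha> ^ 1"
    using growth_const_pos[of 1] c by (intro mult_left_mono dec) auto
   also have "... <= 1" using growth_const_small[of 1] n3 by simp
   finally show ?thesis unfolding y_def by (rule threshold[OF c(1) cn(1) order_refl])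
  qed
  show "real c * ((real n)^2 + 1) ^ c * (1 - p) ^ (c * k1 - c) + (real n)^2 * (2 * \<alpha> ^ (c + 1) * real c) <= \<alpha> ^ c"
   by (rule failure_bounds(1)[OF c(1) cn(1) p_range PP])
  show "real 1 * ((real n)^2 + 1) ^ 1 * (1 - p) ^ (c * k1 - 1) + (real n)^2 * (2 * \<alpha> ^ (c + 1) * real 1) <= \<alpha> ^ c"
   by (rule failure_bounds(2)[OF c(1) cn(1) p_range PP])
  show "3 * (1 + real n ^ 4 / \<alpha> ^ (3 * y)) ^ (r - 1 + 4 * c * k1) < ((\<alpha> ^ (2 * y)) ^ c / (2 * \<alpha> ^ (3 * y)) ^ c) ^ (16 * (k1 + 1))"
  proof (rule gain)
   define Z where "Z = c * (k1 + 1)"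
   have Z1: "1 <= Z" using c by (simp add: Z_def)
   have cZ: "Z <= c * Z" using c by simp
   have "(3 * y + 1) * (r - 1 + 4 * c * k1) <= (3 * y + 1) * (4 * Z)" using r by (intro mult_left_mono) (auto simp: Z_def)
   also have "... = 228 * (c * Z) + 28 * Z" by (simp add: y_def algebra_simps)
   also have "1 + ... <= 304 * (c * Z) + 16 * Z" using Z1 cZ by linarith
   also have "... = (y - 1) * (c * (16 * (k1 + 1)))" by (simp add: y_def Z_def algebra_simps)
   finally show "1 + (3 * y + 1) * (r - 1 + 4 * c * k1) <= (y - 1) * (c * (16 * (k1 + 1)))" by simp
  qed (simp add: y_def)
  show "3 * (1 + real n ^ 4 / \<alpha> ^ (3 * y)) ^ (c - 1) < ((\<alpha> ^ (2 * y)) ^ 1 / (2 * \<alpha> ^ (3 * y)) ^ 1) ^ (16 * (k1 + 1))"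
  proof (rule gain)
   have "1 + (3 * y + 1) * (c - 1) <= 1 * (k1 + 1) + (3 * y + 1) * (k1 + 1)" using c k1 by (intro add_mono mult_left_mono) auto
   also have "... <= ((y - 1) * 16) * (k1 + 1)" unfolding distrib_right[symmetric] using c by (intro mult_right_mono) (auto simp: y_def)
   finally show "1 + (3 * y + 1) * (c - 1) <= (y - 1) * (1 * (16 * (k1 + 1)))" by (simp only: mult_1 mult.assoc)
  qed (simp add: y_def)
  show "real r <= \<alpha> ^ (68 * c) * real D" using Dr(1) \<alpha>0 by (simp add: field_simps)
  show "real n ^ 5 / \<alpha> ^ (3 * y) * (real n ^ 5 / \<alpha> ^ (2 * r) * (4 * real n * (\<alpha> ^ (68 * c))^2) + (\<alpha> ^ (68 * c))^2) < \<alpha> ^ (3 * y)"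
   by (rule closing[OF c(1) r(3) y_def])
 qed (use c r Dp \<alpha>0 \<alpha>1 in \<open>auto simp: power_le_one\<close>)
 from stage.likely_stage[OF this H, where N = "4 * M"] show ?thesis
  by (rule likely_mono) (use union_bound[OF c m_le_n r(3) cn(2) Dr(2) M] in simp)
qed

lemma likely_levels:
 assumes n3: "3 <= n" and small: "real n ^ 100 * \<alpha> <= 1"
  and PP: "(1 - p) ^ (k1 - 1) <= \<alpha> ^ 8" and k1: "m <= k1" and M: "8 * k1 + 100 * m + 10 <= M"
  and H: "likely u 1 k1 (\<alpha> ^ 17) ep" and J: "4 ^ J <= m"
 shows "likely (u + 8 * M * J) (4 ^ J) (4 ^ J * k1) (\<alpha> ^ (17 * 4 ^ J)) (ep + real J * \<alpha> ^ 4)"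
 using J
proof (induction J)
 case 0
 show ?case using H by simp
next
 case (Suc J)
 have 4: "(4::nat) ^ Suc J = 4 * 4 ^ J" by simp
 have "4 ^ J <= m" using Suc.prems by simp
 from Suc.IH[OF this]
 have "likely (u + 8 * M * J + 4 * M + 4 * M) (4 ^ Suc J) (4 * 4 ^ J * k1) (\<alpha> ^ (68 * 4 ^ J)) (ep + real J * \<alpha> ^ 4 + \<alpha> ^ 4)"
  using Suc.prems by (intro likely_power_stage[OF n3 small _ _ _ _ _ PP k1 M]) auto
 moreover have "u + 8 * M * J + 4 * M + 4 * M = u + 8 * M * Suc J" by simp
 moreover have "ep + real J * \<alpha> ^ 4 + \<alpha> ^ 4 = ep + real (Suc J) * \<alpha> ^ 4" by (simp add: distrib_right)
 moreover have "68 * (4::nat) ^ J = 17 * 4 ^ Suc J" by simp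
 ultimately show ?case by (simp only: 4)
qed

end

section \<open>Logarithmic scales and the number of columns\<close>

text \<open>Three quarters of the exponent are given up to absorb \<open>12 / n\<^sup>2\<close>: for
  \<open>u <= 1\<close> this uses \<open>u >= 48 / n\<^sup>2\<close>, for larger \<open>u\<close> it
  uses that \<open>exp (- u)\<close> is at least \<open>1 / n\<close>.\<close>

lemma exp_failure:
 fixes u n :: real
 assumes n: "16 <= n" and u: "48 / n\<^sup>2 <= u" "u <= ln n"
 shows "exp (- u) + 12 / n\<^sup>2 <= exp (- u / 4)"
proof -
 have u0: "0 <= u" using u(1) n by (meson divide_nonneg_nonneg order_trans zero_le_numeral zero_le_power2)
 have "exp (- u) * (1 + 3 * u / 4) <= exp (- u) * exp (3 * u / 4)" by (intro mult_left_mono exp_ge_add_one_self) auto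
 also have "... = exp (- u / 4)" by (simp add: exp_add[symmetric])
 finally have 1: "exp (- u) + exp (- u) * (3 * u / 4) <= exp (- u / 4)" by (simp add: distrib_left)
 have "12 / n\<^sup>2 <= exp (- u) * (3 * u / 4)"
 proof (cases "u <= 1")
  case True
  have "exp (1::real) <= 3" by (rule exp_le)
  hence "1 / 3 <= exp (- 1 :: real)" by (simp add: exp_minus field_simps)
  also have "... <= exp (- u)" using True by simp
  finally have "1 / 3 * (3 * u / 4) <= exp (- u) * (3 * u / 4)" using u0 by (intro mult_right_mono) auto
  moreover have "12 / n\<^sup>2 = (48 / n\<^sup>2) / 4" by simp
  ultimately show ?thesis using u(1) by linarith
 next
  case False
  have "12 / n\<^sup>2 = (12 / n) * (1 / n)" by (simp add: power2_eq_square)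
  also have "... <= (3 / 4) * (1 / n)" using n by (intro mult_right_mono) (auto simp: field_simps)
  also have "1 / n = exp (- ln n)" using n by (simp add: exp_minus divide_inverse)
  also have "3 / 4 * exp (- ln n) <= (3 * u / 4) * exp (- u)" using False u by (intro mult_mono) auto
  finally show ?thesis by (simp add: mult.commute)
 qed
 thus ?thesis using 1 by linarith
qed

lemma one_minus_power_le_exp:
 assumes "0 <= p" "p <= (1::real)" shows "(1 - p) ^ k <= exp (- (real k * p))"
proof -
 have "1 - p <= exp (- p)" using exp_ge_add_one_self[of "- p"] by simp
 hence "(1 - p) ^ k <= exp (- p) ^ k" using assms by (intro power_mono) auto
 thus ?thesis by (simp add: exp_of_nat_mult[symmetric])
qed

text \<open>\<open>Th\<close> is the number of columns divided by log n, since there are of the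
  order of log n steps to share the columns. \<open>La\<^sup>2 <= a\<close> is the hypothesis on
  \<open>\<alpha>\<close>; the bounds on \<open>Th\<close> and \<open>p * Th\<close> come from those
  on n and h.\<close>

locale krylov_large = krylov_sv +
 fixes La a Th :: real
 assumes La_def: "La = ln (real n)" and a_def: "a = ln (1 / \<alpha>)" and Th_def: "Th = real q / La"
  and La_large: "100 <= La" and a_large: "La\<^sup>2 <= a"
  and Th_m: "1000000 * real m <= Th" and Th_a: "1000000 * a <= Th" and p_Th: "1000000 * a <= p * Th" and p_large: "La / real n <= p"
begin

lemma exp_forms: "real n ^ j = exp (real j * La)" "\<alpha> ^ j = exp (- (real j * a))"
proof -
 have "exp La = real n" using n_pos by (simp add: La_def)
 thus "real n ^ j = exp (real j * La)" by (simp add: exp_of_nat_mult)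
 have "exp (- a) = \<alpha>" using \<alpha>_pos by (simp add: a_def ln_div)
 hence "\<alpha> ^ j = exp (real j * (- a))" by (simp only: exp_of_nat_mult)
 thus "\<alpha> ^ j = exp (- (real j * a))" by simp
qed

lemma a_big: "100 * La <= a" "10000 <= a"
proof -
 have "100 * La <= La * La" using La_large by (intro mult_right_mono) auto
 thus "100 * La <= a" using a_large by (simp add: power2_eq_square)
 thus "10000 <= a" using La_large by linarith
qed

lemma n_big: "1000 <= real n"
proof -
 have "La <= real n" using ln_le_minus_one[of "real n"] n_pos by (simp add: La_def)
 have "1 + La / 2 <= exp (La / 2)" by (rule exp_ge_add_one_self)
 hence "50 <= exp (La / 2)" using La_large by linarith
 hence "50 * 50 <= exp (La / 2) * exp (La / 2)" by (intro mult_mono) auto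
 also have "... = real n ^ 1" unfolding exp_forms by (simp add: exp_add[symmetric])
 finally show ?thesis by simp
qed

lemma q_eq: "real q = Th * La" using La_large by (simp add: Th_def)

text \<open>The net for one doubling has entropy \<open>2 ^ (i + 1) * (6 * i + 9) * La\<close>, and
  each of the \<open>N\<close> columns gains \<open>2 ^ i * p / 4\<close>. Since \<open>i\<close> is
  at most \<open>1.5 * La\<close>, the entropy is at most of order
  \<open>2 ^ i * La\<^sup>2\<close>, hence of order \<open>2 ^ i * a\<close>, and
  \<open>N * p\<close> is a large multiple of \<open>a\<close>.\<close>

lemma base_chain:
 assumes N: "real N \<ge> Th / 20 - 1" and lt: "!!j. j < i ==> 2 ^ j * p < La"
 shows "base_likely (i * N) (2 ^ i) (1 + 6 * i) (real i * \<alpha> ^ 4)"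
 using lt
proof (induction i)
 case 0
 show ?case using base_likely_start by simp
next
 case (Suc i)
 let ?k = "real (2 ^ i)"
 have n3: "3 <= n" using n_big by linarith
 have ip: "?k * p < La" using Suc.prems[of i] by simp
 have k1: "1 <= ?k" by simp
 \<comment> \<open>\<open>p\<close> is at least \<open>La / n\<close>, so
   \<open>2 ^ i * p < La\<close> forces \<open>2 ^ i < n\<close>.\<close>
 have iLa: "real i <= 1.5 * La"
 proof -
  have "?k * (La / real n) <= ?k * p" using p_large by (intro mult_left_mono) auto
  hence "(?k / real n) * La < 1 * La" using ip by simp
  hence "?k / real n < 1" using La_large by (simp only: mult_less_cancel_right_pos)
  hence "?k < real n" using n_pos by simp
  hence "ln (2 ^ i) < La" unfolding La_def using n_pos by simp
  hence "real i * ln 2 < La" by (simp add: ln_realpow)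
  moreover have "real i * (2 / 3) <= real i * ln 2" using ln2_ge_two_thirds by (intro mult_left_mono) auto
  ultimately show ?thesis by linarith
 qed
 have u: "48 / (real n)^2 <= ?k * p"
 proof -
  have "48 / (real n)^2 = (48 / real n) * (1 / real n)" by (simp add: power2_eq_square)
  also have "... <= La * (1 / real n)"
  proof (rule mult_right_mono)
   have "48 / real n <= 1" using n_big by simp
   thus "48 / real n <= La" using La_large by linarith
  qed simp
  also have "... <= p" using p_large by simp
  also have "... <= ?k * p" using mult_right_mono[OF k1 p_range(1)] by simp
  finally show ?thesis .
 qed
 have "(1 - p) ^ (2 ^ i) + 12 / (real n)^2 <= exp (- (?k * p)) + 12 / (real n)^2"
  using one_minus_power_le_exp[OF p_range, of "2 ^ i"] by simp
 also have "... <= exp (- (?k * p) / 4)" by (rule exp_failure) (use n_big u ip in \<open>auto simp: La_def\<close>)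
 finally have f: "(1 - p) ^ (2 ^ i) + 12 / (real n)^2 <= exp (- (?k * p) / 4)" .
 have f0: "0 <= (1 - p) ^ (2 ^ i) + 12 / (real n)^2" using p_range by (intro add_nonneg_nonneg) auto
 have step: "(real n ^ (1 + 6 * i + 8)) ^ (2 ^ Suc i) * ((1 - p) ^ (2 ^ i) + 12 / (real n)^2) ^ N <= \<alpha> ^ 4"
 proof -
  have "(real n ^ (1 + 6 * i + 8)) ^ (2 ^ Suc i) * ((1 - p) ^ (2 ^ i) + 12 / (real n)^2) ^ N
    <= (real n ^ (1 + 6 * i + 8)) ^ (2 ^ Suc i) * exp (- (?k * p) / 4) ^ N"
   using f f0 by (intro mult_left_mono power_mono) auto
  also have "... = exp (real (2 ^ Suc i) * (real (1 + 6 * i + 8) * La) + real N * (- (?k * p) / 4))"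
   unfolding exp_forms(1) by (simp only: exp_of_nat_mult exp_add)
  also have "... = exp (2 * ?k * (real (1 + 6 * i + 8) * La) - real N * (?k * p / 4))" by simp
  also have "... <= exp (- (real 4 * a))"
  proof -
   have "real (1 + 6 * i + 8) <= 10 * La" using iLa La_large by simp
   hence "real (1 + 6 * i + 8) * La <= 10 * La * La" using La_large by (intro mult_right_mono) auto
   also have "... <= 10 * a" using a_large by (simp add: power2_eq_square)
   finally have 1: "2 * ?k * (real (1 + 6 * i + 8) * La) <= 2 * ?k * (10 * a)" by (intro mult_left_mono) auto
   have "(Th / 20 - 1) * p <= real N * p" using N p_range by (intro mult_right_mono) auto
   hence "1000 * a <= real N * p" using p_Th p_range a_big by (simp add: algebra_simps)
   hence "?k * (1000 * a) <= ?k * (real N * p)" by (intro mult_left_mono) auto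
   moreover have "1 * a <= ?k * a" using a_big k1 by (intro mult_right_mono) auto
   ultimately have "2 * ?k * (real (1 + 6 * i + 8) * La) - (?k * (real N * p)) / 4 <= - (4 * a)" using 1 a_big by linarith
   thus ?thesis by (simp add: mult_ac)
  qed
  also have "... = \<alpha> ^ 4" by (simp only: exp_forms)
  finally show ?thesis .
 qed
 have "base_likely (i * N) (2 ^ i) (1 + 6 * i) (real i * \<alpha> ^ 4)" using Suc by simp
 from base_likely_step[OF n3 this, of N "2 ^ Suc i"]
 have "base_likely (i * N + N) (2 ^ Suc i) (1 + 6 * i + 6)
   (real i * \<alpha> ^ 4 + (real n ^ (1 + 6 * i + 8)) ^ (2 ^ Suc i) * ((1 - p) ^ (2 ^ i) + 12 / (real n)^2) ^ N)" .
 moreover have "real i * \<alpha> ^ 4 + (real n ^ (1 + 6 * i + 8)) ^ (2 ^ Suc i) * ((1 - p) ^ (2 ^ i) + 12 / (real n)^2) ^ N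
   <= real (Suc i) * \<alpha> ^ 4" using step by (simp add: distrib_right)
 ultimately have "base_likely (i * N + N) (2 ^ Suc i) (1 + 6 * i + 6) (real (Suc i) * \<alpha> ^ 4)"
  unfolding base_likely_def by (meson order_trans)
 thus ?case by (simp add: add.commute)
qed

text \<open>This is \<open>k1\<close>, the number of large coordinates per coefficient: large enough
  for \<open>sparse_support_bound\<close>, small enough that a quarter of the columns pays for its
  net.\<close>

definition "block_size = nat \<lfloor>Th / 1000\<rfloor>"

lemma block_size_bounds: "Th / 1000 - 1 <= real block_size" "real block_size <= Th / 1000"
proof -
 have "0 <= Th" using Th_a a_big by linarith
 thus "Th / 1000 - 1 <= real block_size" "real block_size <= Th / 1000" unfolding block_size_def by linarith+
qed

text \<open>Doubling stops at the first \<open>i\<close> with \<open>2 ^ i * p >= La\<close>. From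
  there on a column fails with probability at most \<open>exp (- La / 2)\<close>, which is small
  enough to reach \<open>block_size\<close> in one step.\<close>

lemma likely_first:
 obtains u ep where "real u <= real q / 3" "ep <= 2 * La * \<alpha> ^ 4" "likely u 1 block_size (\<alpha> ^ 17) ep"
proof -
 have n3: "3 <= n" using n_big by linarith
 have Th0: "10000000000 <= Th" using Th_a a_big by linarith
 define N where "N = nat \<lfloor>Th / 20\<rfloor>"
 have N: "Th / 20 - 1 <= real N" "real N <= Th / 20" unfolding N_def using Th0 by linarith+
 define N1 where "N1 = nat \<lfloor>real q / 4\<rfloor>"
 have N1: "real q / 4 - 1 <= real N1" "real N1 <= real q / 4" unfolding N1_def by linarith+
 have p0: "0 < p" using p_large La_large n_pos by (meson divide_pos_pos less_le_trans of_nat_0_less_iff zero_less_numeral)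
 have "\<exists>i. La <= 2 ^ i * p"
 proof -
  obtain i where "La / p < 2 ^ i" using real_arch_pow[of 2 "La / p"] by auto
  hence "La < 2 ^ i * p" using p0 by (simp add: field_simps)
  thus ?thesis using less_imp_le by blast
 qed
 define i where "i = (LEAST i. La <= 2 ^ i * p)"
 have i: "La <= 2 ^ i * p" unfolding i_def by (rule LeastI_ex) fact
 have lt: "2 ^ j * p < La" if "j < i" for j using not_less_Least[of j "%i. La <= 2 ^ i * p"] that by (simp add: i_def)
 have bl: "base_likely (i * N) (2 ^ i) (1 + 6 * i) (real i * \<alpha> ^ 4)" by (rule base_chain[OF N(1) lt])
 have iLa: "real i <= 1.5 * La + 1"
 proof (cases i)
  case (Suc j)
  have "2 ^ j * p < La" using lt[of j] Suc by simp
  moreover have "2 ^ j * (La / real n) <= 2 ^ j * p" using p_large by (intro mult_left_mono) auto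
  ultimately have "2 ^ j * (La / real n) < 1 * La" by linarith
  hence "(2 ^ j / real n) * La < 1 * La" by simp
  hence "2 ^ j / real n < 1" using La_large by (simp only: mult_less_cancel_right_pos)
  hence "2 ^ j < real n" using n_pos by simp
  hence "ln (2 ^ j) < La" unfolding La_def using n_pos by simp
  hence "real j * ln 2 < La" by (simp add: ln_realpow)
  moreover have "real j * (2 / 3) <= real j * ln 2" using ln2_ge_two_thirds by (intro mult_left_mono) auto
  ultimately show ?thesis using Suc by simp
 qed (use La_large in simp)
 let ?k1 = block_size
 have step: "(real n ^ (1 + 6 * i + 8)) ^ ?k1 * ((1 - p) ^ (2 ^ i) + 12 / (real n)^2) ^ N1 <= \<alpha> ^ 4"
 proof -
  have n1: "exp (- La) = 1 / real n" using n_pos by (simp add: La_def exp_minus divide_inverse)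
  have "(1 - p) ^ (2 ^ i) <= exp (- (real (2 ^ i) * p))" by (rule one_minus_power_le_exp[OF p_range])
  also have "... <= exp (- La)" using i by simp
  finally have "(1 - p) ^ (2 ^ i) <= 1 / real n" using n1 by simp
  moreover have "12 / (real n)^2 <= 1 / real n" using n_big by (simp add: power2_eq_square field_simps)
  ultimately have "(1 - p) ^ (2 ^ i) + 12 / (real n)^2 <= 2 * exp (- La)" using n1 by simp
  also have "... <= exp (La / 2) * exp (- La)"
  proof (rule mult_right_mono)
   show "2 <= exp (La / 2)" using exp_ge_add_one_self[of "La / 2"] La_large by linarith
  qed simp
  also have "... = exp (- La / 2)" by (simp add: exp_add[symmetric])
  finally have f: "(1 - p) ^ (2 ^ i) + 12 / (real n)^2 <= exp (- La / 2)" .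
  have f0: "0 <= (1 - p) ^ (2 ^ i) + 12 / (real n)^2" using p_range by (intro add_nonneg_nonneg) auto
  have "(real n ^ (1 + 6 * i + 8)) ^ ?k1 * ((1 - p) ^ (2 ^ i) + 12 / (real n)^2) ^ N1
    <= (real n ^ (1 + 6 * i + 8)) ^ ?k1 * exp (- La / 2) ^ N1"
   using f f0 by (intro mult_left_mono power_mono) auto
  also have "... = exp (real ?k1 * (real (1 + 6 * i + 8) * La) + real N1 * (- La / 2))"
   unfolding exp_forms(1) by (simp only: exp_of_nat_mult exp_add)
  also have "... = exp (real ?k1 * (real (1 + 6 * i + 8) * La) - real N1 * (La / 2))" by simp
  also have "... <= exp (- (real 4 * a))"
  proof -
   have "real (1 + 6 * i + 8) <= 10 * La" using iLa La_large by simp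
   hence "real ?k1 * (real (1 + 6 * i + 8) * La) <= (Th / 1000) * (10 * La * La)"
    using block_size_bounds La_large Th0 by (intro mult_mono mult_right_mono) auto
   also have "... = real q * La / 100" by (simp add: q_eq)
   finally have 1: "real ?k1 * (real (1 + 6 * i + 8) * La) <= real q * La / 100" .
   have q1: "1000 <= real q" using mult_mono[of 1000 Th 1 La] Th0 La_large by (simp add: q_eq)
   hence N1La: "real q / 5 * La <= real N1 * La" using N1 La_large by (intro mult_right_mono) auto
   have "1000000 * a * 1 <= Th * La" using Th_a La_large a_big Th0 by (intro mult_mono) auto
   moreover have "real q * 1 <= real q * La" using La_large by (intro mult_left_mono) auto
   ultimately have "1000000 * a * 1 <= real q * La" using q_eq by linarith
   hence "real ?k1 * (real (1 + 6 * i + 8) * La) - real N1 * La / 2 <= - (4 * a)" using 1 N1La a_big by linarith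
   thus ?thesis by simp
  qed
  also have "... = \<alpha> ^ 4" by (simp only: exp_forms)
  finally show ?thesis .
 qed
 from base_likely_step[OF n3 bl, of N1 ?k1]
 have "base_likely (i * N + N1) ?k1 (1 + 6 * i + 6)
   (real i * \<alpha> ^ 4 + (real n ^ (1 + 6 * i + 8)) ^ ?k1 * ((1 - p) ^ (2 ^ i) + 12 / (real n)^2) ^ N1)" .
 hence L: "likely (i * N + N1) 1 ?k1 (\<alpha> ^ 17)
   (real i * \<alpha> ^ 4 + (real n ^ (1 + 6 * i + 8)) ^ ?k1 * ((1 - p) ^ (2 ^ i) + 12 / (real n)^2) ^ N1)"
 proof (rule base_likely_imp_likely[rotated])
  show "1 <= m" using n_eq n_pos by (cases m) auto
  show "0 < \<alpha> ^ 17" using \<alpha>_pos by simp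
  \<comment> \<open>One factor \<open>\<alpha>\<close> is the loss in passing from
    \<open>base_spread\<close> to \<open>spread\<close>. The other sixteen dominate the accumulated
    mesh, whose exponent \<open>6 * i + 7\<close> is at most \<open>16 * La\<close>.\<close>
  have "\<alpha> ^ 17 = \<alpha> * \<alpha> ^ 16" by (simp add: numeral_eq_Suc)
  also have "... <= \<alpha> * (1 / real n ^ (1 + 6 * i + 6))"
  proof (rule mult_left_mono)
   have "real (1 + 6 * i + 6) <= 16 * La" using iLa La_large by simp
   hence "real (1 + 6 * i + 6) * La <= 16 * La * La" using La_large by (intro mult_right_mono) auto
   hence "real (1 + 6 * i + 6) * La <= real 16 * a" using a_large by (simp add: power2_eq_square)
   hence "exp (- (real 16 * a)) <= exp (- (real (1 + 6 * i + 6) * La))" by simp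
   also have "... = 1 / exp (real (1 + 6 * i + 6) * La)" by (simp only: exp_minus divide_inverse mult_1)
   finally show "\<alpha> ^ 16 <= 1 / real n ^ (1 + 6 * i + 6)" unfolding exp_forms .
  qed (use \<alpha>_pos in simp)
  finally show "\<alpha> ^ 17 <= \<alpha> * (1 / real n ^ (1 + 6 * i + 6))" .
 qed
 show ?thesis
 proof (rule that[OF _ _ L])
  have "real i * real N <= (1.5 * La + 1) * (Th / 20)" using iLa N La_large by (intro mult_mono) auto
  also have "... = 1.5 / 20 * (Th * La) + Th / 20" by (simp add: algebra_simps)
  finally have "real i * real N <= 1.5 / 20 * real q + Th / 20" by (simp add: q_eq)
  moreover have "Th * 100 <= real q" unfolding q_eq using La_large Th0 by (intro mult_left_mono) auto
  ultimately have "real i * real N + real N1 <= real q / 3" using N1 by linarith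
  thus "real (i * N + N1) <= real q / 3" by simp
  have "real i * \<alpha> ^ 4 + (real n ^ (1 + 6 * i + 8)) ^ ?k1 * ((1 - p) ^ (2 ^ i) + 12 / (real n)^2) ^ N1 <= (real i + 1) * \<alpha> ^ 4"
   using step by (simp add: distrib_right)
  also have "... <= 2 * La * \<alpha> ^ 4" using iLa La_large \<alpha>_pos by (intro mult_right_mono) auto
  finally show "real i * \<alpha> ^ 4 + (real n ^ (1 + 6 * i + 8)) ^ ?k1 * ((1 - p) ^ (2 ^ i) + 12 / (real n)^2) ^ N1 <= 2 * La * \<alpha> ^ 4" .
 qed
qed

lemma small_\<alpha>: "real n ^ 100 * \<alpha> <= 1"
proof -
 have "real n ^ 100 * \<alpha> ^ 1 = exp (100 * La - a)" unfolding exp_forms by (simp add: exp_diff exp_minus divide_inverse)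
 also have "... <= 1" using a_big by simp
 finally show ?thesis by simp
qed

lemma sparse_support_bound: "(1 - p) ^ (block_size - 1) <= \<alpha> ^ 8"
proof -
 have "(Th / 1000 - 2) * p <= real (block_size - 1) * p" using block_size_bounds p_range by (intro mult_right_mono) linarith+
 moreover have "(Th / 1000 - 2) * p = p * Th / 1000 - 2 * p" by (simp add: left_diff_distrib)
 ultimately have "8 * a <= real (block_size - 1) * p" using p_Th p_range a_big by linarith
 hence "exp (- (real (block_size - 1) * p)) <= exp (- (real 8 * a))" by simp
 thus ?thesis using one_minus_power_le_exp[OF p_range, of "block_size - 1"] unfolding exp_forms by linarith
qed

lemma m_le_block_size: "m <= block_size"
proof -
 have "m \<ge> 1" using n_eq n_pos by (cases m) auto
 hence "real m <= real block_size" using block_size_bounds(1) Th_m by linarith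
 thus ?thesis by simp
qed

text \<open>Quadrupling reaches the largest power of 4 that is at most \<open>m\<close>, and one
  more passage with \<open>r = m\<close> covers all coefficients. At most half of the columns are
  used, so a fresh column is available for the final argument.\<close>

lemma likely_last:
 obtains u J ep where "u < q" "4 ^ J <= m" "m < 4 * 4 ^ J" "ep <= 4 * La * \<alpha> ^ 4"
  "likely u m (4 * 4 ^ J * block_size) (\<alpha> ^ (68 * 4 ^ J)) ep"
proof -
 have n3: "3 <= n" using n_big by linarith
 have m1: "1 <= m" using n_eq n_pos by (cases m) auto
 have Th0: "10000000000 <= Th" using Th_a a_big by linarith
 obtain u ep where u: "real u <= real q / 3" "ep <= 2 * La * \<alpha> ^ 4" "likely u 1 block_size (\<alpha> ^ 17) ep"
  by (rule likely_first)
 define M where "M = nat \<lfloor>Th / 100\<rfloor>"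
 have M: "Th / 100 - 1 <= real M" "real M <= Th / 100" unfolding M_def using Th0 by linarith+
 have "real (8 * block_size + 100 * m + 10) <= real M" using M(1) block_size_bounds(2) Th_m Th0 by simp
 hence M': "8 * block_size + 100 * m + 10 <= M" by (simp only: of_nat_le_iff)
 obtain J where J: "4 ^ J <= m" "m < 4 ^ (J + 1)" using ex_power_ivl1[of 4 m] m1 by auto
 have JLa: "real J <= La"
 proof -
  have "4 ^ J <= real n" using J(1) m_le_n by (metis of_nat_le_iff of_nat_numeral of_nat_power order_trans)
  hence "ln (4 ^ J) <= La" unfolding La_def using n_pos by (subst ln_le_cancel_iff) auto
  hence "real J * ln 4 <= La" by (simp add: ln_realpow)
  moreover have "(1::real) <= ln 4"
  proof -
   have "ln (4::real) = 2 * ln 2" using ln_realpow[of 2 2] by simp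
   thus ?thesis using ln2_ge_two_thirds by simp
  qed
  hence "real J * 1 <= real J * ln 4" by (intro mult_left_mono) auto
  ultimately show ?thesis by linarith
 qed
 have H: "likely (u + 8 * M * J) (4 ^ J) (4 ^ J * block_size) (\<alpha> ^ (17 * 4 ^ J)) (ep + real J * \<alpha> ^ 4)"
  by (rule likely_levels[OF n3 small_\<alpha> sparse_support_bound m_le_block_size M' u(3) J(1)])
 have "likely (u + 8 * M * J + 4 * M + 4 * M) m (4 * 4 ^ J * block_size) (\<alpha> ^ (68 * 4 ^ J)) (ep + real J * \<alpha> ^ 4 + \<alpha> ^ 4)"
  by (rule likely_power_stage[OF n3 small_\<alpha> _ J(1) m1 order_refl _ sparse_support_bound m_le_block_size M' H]) (use J in auto)
 thus ?thesis
 proof (rule that[rotated 4])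
  show "4 ^ J <= m" "m < 4 * 4 ^ J" using J by simp_all
  have "8 * (real M * (real J + 1)) <= 8 * (Th / 100 * (2 * La))" using M JLa La_large Th0 by (intro mult_left_mono mult_mono) auto
  also have "... = 16 / 100 * real q" by (simp add: q_eq)
  finally have "real u + 8 * (real M * (real J + 1)) <= real q / 2" using u(1) by linarith
  moreover have "0 < real q" using Th0 La_large by (simp add: q_eq)
  ultimately have "real (u + 8 * M * J + 4 * M + 4 * M) < real q" by (simp add: algebra_simps)
  thus "u + 8 * M * J + 4 * M + 4 * M < q" by (simp only: of_nat_less_iff)
  have "(real J + 1) * \<alpha> ^ 4 <= (2 * La) * \<alpha> ^ 4" using JLa La_large \<alpha>_pos by (intro mult_right_mono) auto
  thus "ep + real J * \<alpha> ^ 4 + \<alpha> ^ 4 <= 4 * La * \<alpha> ^ 4" using u(2) by (simp add: algebra_simps)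
 qed
qed

end

section \<open>The smallest singular value\<close>

lemma orthon_complement:
 assumes W: "!!i. i < d ==> W i \<in> carrier_vec n" and k: "d + k <= n"
 shows "\<exists>ph. orthon n k ph \<and> (\<forall>i<k. \<forall>j<d. W j \<bullet> ph i = 0)"
 using k
proof (induction k)
 case 0
 show ?case by (simp add: orthon_def)
next
 case (Suc k)
 then obtain ph where ph: "orthon n k ph" "\<forall>i<k. \<forall>j<d. W j \<bullet> ph i = 0" by auto
 have phc: "i < k ==> ph i \<in> carrier_vec n" for i using ph(1) by (simp add: orthon_def)
 define W' where "W' i = (if i < d then W i else ph (i - d))" for i
 have W'c: "W' i \<in> carrier_vec n" if "i < d + k" for i using W phc that by (simp add: W'_def)
 obtain et where et: "et \<in> carrier_vec n" "et \<noteq> 0\<^sub>v n" "!!i. i < d + k ==> W' i \<bullet> et = 0"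
 proof (rule homogeneous_solution[where p = "d + k" and N = n and W = W'], goal_cases)
  case 1
  show ?case using Suc.prems by simp
 next
  case (2 i)
  thus ?case by (intro W'c)
 next
  case (3 et)
  show ?case by (rule 3(1)[OF 3(2,3)]) (rule 3(4))
 qed
 obtain s where s: "(s \<cdot>\<^sub>v et) \<bullet> (s \<cdot>\<^sub>v et) = 1" using normalize_vec[OF et(1,2)] by blast
 define u where "u = s \<cdot>\<^sub>v et"
 have u: "u \<in> carrier_vec n" "u \<bullet> u = 1" using et s by (simp_all add: u_def)
 have Wu: "W j \<bullet> u = 0" if "j < d" for j
  using et(3)[of j] that W[OF that] et(1) by (simp add: u_def W'_def)
 have phu: "ph j \<bullet> u = 0" if "j < k" for j
  using et(3)[of "d + j"] that phc[OF that] et(1) by (simp add: u_def W'_def)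
 have uph: "u \<bullet> ph j = 0" if "j < k" for j using phu[OF that] comm_scalar_prod[OF u(1) phc[OF that]] by simp
 have "orthon n (Suc k) (ph(k := u))"
  using ph(1) u phu uph unfolding orthon_def by (auto simp: less_Suc_eq)
 moreover have "\<forall>i<Suc k. \<forall>j<d. W j \<bullet> (ph(k := u)) i = 0" using ph(2) Wu by (auto simp: less_Suc_eq)
 ultimately show ?case by blast
qed

text \<open>Cramer's rule: coordinate \<open>i0\<close> of det M times x is row \<open>i0\<close> of
  the adjugate applied to M x. The largest cofactor in that row is kept.\<close>

lemma adj_small:
 fixes M :: "real mat"
 assumes M: "M \<in> carrier_mat c c" and x: "x \<in> carrier_vec c" and Mx: "!!i. i < c ==> \<bar>(M *\<^sub>v x) $ i\<bar> <= ep" and i0: "i0 < c"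
 obtains k where "k < c" "\<bar>det M\<bar> * \<bar>x $ i0\<bar> <= real c * ep * \<bar>det (mat_delete M k i0)\<bar>"
proof -
 define F where "F = (%k. \<bar>det (mat_delete M k i0)\<bar>) ` {..<c}"
 have F: "finite F" "F \<noteq> {}" using i0 by (auto simp: F_def)
 have "Max F \<in> F" using F by (rule Max_in)
 then obtain k where k: "k < c" "Max F = \<bar>det (mat_delete M k i0)\<bar>" by (auto simp: F_def)
 have le: "\<bar>det (mat_delete M j i0)\<bar> <= \<bar>det (mat_delete M k i0)\<bar>" if "j < c" for j
  unfolding k(2)[symmetric] using F that by (intro Max_ge) (auto simp: F_def)
 have adj: "adj_mat M \<in> carrier_mat c c" "adj_mat M * M = det M \<cdot>\<^sub>m 1\<^sub>m c" using adj_mat[OF M] by auto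
 have "(adj_mat M * M) *\<^sub>v x = adj_mat M *\<^sub>v (M *\<^sub>v x)" by (rule assoc_mult_mat_vec[OF adj(1) M x])
 hence "((det M \<cdot>\<^sub>m 1\<^sub>m c) *\<^sub>v x) $ i0 = (adj_mat M *\<^sub>v (M *\<^sub>v x)) $ i0" by (simp add: adj(2))
 moreover have "((det M \<cdot>\<^sub>m 1\<^sub>m c) *\<^sub>v x) $ i0 = det M * x $ i0"
  using smult_mat_mult_vec[of "1\<^sub>m c" c c x "det M"] x i0 by simp
 moreover have "(adj_mat M *\<^sub>v (M *\<^sub>v x)) $ i0 = (\<Sum>j=0..<c. adj_mat M $$ (i0, j) * (M *\<^sub>v x) $ j)"
 proof -
  have "(adj_mat M *\<^sub>v y) $ i0 = (\<Sum>j=0..<c. adj_mat M $$ (i0, j) * y $ j)" if "dim_vec y = c" for y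
   using adj(1) i0 that by (auto simp: scalar_prod_def)
  from this[of "M *\<^sub>v x"] show ?thesis using M by simp
 qed
 ultimately have e: "det M * x $ i0 = (\<Sum>j=0..<c. adj_mat M $$ (i0, j) * (M *\<^sub>v x) $ j)" by simp
 have "\<bar>det M\<bar> * \<bar>x $ i0\<bar> <= (\<Sum>j=0..<c. \<bar>adj_mat M $$ (i0, j) * (M *\<^sub>v x) $ j\<bar>)"
  unfolding abs_mult[symmetric] e by (rule sum_abs)
 also have "... <= (\<Sum>j=0..<c. \<bar>det (mat_delete M k i0)\<bar> * ep)"
 proof (rule sum_mono)
  fix j assume j: "j \<in> {0..<c}"
  have "adj_mat M $$ (i0, j) = cofactor M j i0" using j i0 M by (simp add: adj_mat_def)
  hence "\<bar>adj_mat M $$ (i0, j)\<bar> = \<bar>det (mat_delete M j i0)\<bar>" by (simp add: cofactor_def abs_mult)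
  thus "\<bar>adj_mat M $$ (i0, j) * (M *\<^sub>v x) $ j\<bar> <= \<bar>det (mat_delete M k i0)\<bar> * ep"
   unfolding abs_mult using le[of j] Mx[of j] j by (intro mult_mono) auto
 qed
 finally show ?thesis using k(1) by (intro that[of k]) (simp_all add: mult_ac)
qed

section \<open>Approximate kernel vectors and the compressed column\<close>

context krylov
begin

definition kentry :: "(nat \<times> nat => real) => nat => nat => real" where
 "kentry w r s = (A (s div q + 1) *\<^sub>v column w (s mod q)) $ r"

lemma q_pos: "0 < q" using n_eq n_pos by (cases q) auto

lemma block_index: "s < n ==> s div q < m"
 using n_eq by (simp add: less_mult_imp_div_less)

lemma krylov_entry:
 assumes "r < n" "s < n"
 shows "krylov_mat n m q A (mat n q w) $$ (r, s) = kentry w r s"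
proof -
 have "1 <= s div q + 1" "s div q + 1 <= m" using block_index[OF assms(2)] by auto
 hence "A (s div q + 1) \<in> carrier_mat n n" by (rule A_carrier)
 moreover have "s mod q < q" using q_pos by simp
 moreover from this have "col (mat n q w) (s mod q) = column w (s mod q)" by (auto simp: column_def)
 moreover have "s < m * q" using assms(2) n_eq by simp
 ultimately show ?thesis using assms(1) by (simp add: krylov_mat_def kentry_def)
qed

text \<open>The constants are relaxed by a factor 2 against those of a unit vector with image of
  norm \<open>ep\<close>, which leaves room for rational \<open>z\<close>. The large coefficient has
  to sit in one of the \<open>m\<close> columns of K that come from column \<open>j\<close> of
  G.\<close>

definition near_kernel :: "real => nat => (nat \<times> nat => real) => (nat => real) => bool" where
 "near_kernel ep j w z \<longleftrightarrow> (\<forall>r<n. \<bar>\<Sum>s<n. kentry w r s * z s\<bar> <= 2 * ep) \<and> (\<exists>i<m. 1 / (2 * real n) <= \<bar>z (i * q + j)\<bar>)"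

text \<open>Rational coefficients make this a countable union of measurable events.\<close>

definition degenerate :: "real => nat => (nat \<times> nat => real) set" where
 "degenerate ep j = {w\<in>space P. bounded_entries w \<and> (\<exists>z\<in>({..<n} \<rightarrow>\<^sub>E \<rat>). near_kernel ep j w z)}"

lemma degenerate_sets: "degenerate ep j \<in> sets P"
proof -
 have c: "countable ({..<n} \<rightarrow>\<^sub>E (\<rat> :: real set))" by (intro countable_PiE countable_rat) auto
 have km: "(%w. kentry w r s) \<in> borel_measurable P" if "r < n" "s < n" for r s
  unfolding kentry_def using block_index[OF that(2)] q_pos that(1) by (intro image_measurable) auto
 have one: "{w\<in>space P. near_kernel ep j w z} \<in> sets P" for z
 proof -
  have S: "{w\<in>space P. \<forall>r<n. \<bar>\<Sum>s<n. kentry w r s * z s\<bar> <= 2 * ep} \<in> sets P"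
  proof -
   have "{w\<in>space P. \<bar>\<Sum>s<n. kentry w r s * z s\<bar> <= 2 * ep} \<in> sets P" if "r < n" for r
   proof -
    have "(%w. \<Sum>s<n. kentry w r s * z s) \<in> borel_measurable P"
     by (intro borel_measurable_sum borel_measurable_times km that) auto
    thus ?thesis by (intro borel_measurable_le borel_measurable_abs borel_measurable_const)
   qed
   hence "(\<Inter>r\<in>{..<n}. {w\<in>space P. \<bar>\<Sum>s<n. kentry w r s * z s\<bar> <= 2 * ep}) \<in> sets P"
    using n_pos by (intro sets.finite_INT) auto
   moreover have "(\<Inter>r\<in>{..<n}. {w\<in>space P. \<bar>\<Sum>s<n. kentry w r s * z s\<bar> <= 2 * ep}) = {w\<in>space P. \<forall>r<n. \<bar>\<Sum>s<n. kentry w r s * z s\<bar> <= 2 * ep}"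
    using n_pos by auto
   ultimately show ?thesis by (simp only:)
  qed
  show ?thesis
  proof (cases "\<exists>i<m. 1 / (2 * real n) <= \<bar>z (i * q + j)\<bar>")
   case True
   hence "near_kernel ep j w z \<longleftrightarrow> (\<forall>r<n. \<bar>\<Sum>s<n. kentry w r s * z s\<bar> <= 2 * ep)" for w unfolding near_kernel_def by blast
   thus ?thesis using S by (simp only:)
  next
   case False
   hence "{w\<in>space P. near_kernel ep j w z} = {}" unfolding near_kernel_def by blast
   thus ?thesis by (simp only: sets.empty_sets)
  qed
 qed
 have "degenerate ep j = (space P - {w\<in>space P. \<not> bounded_entries w}) \<inter> (\<Union>z\<in>({..<n} \<rightarrow>\<^sub>E \<rat>). {w\<in>space P. near_kernel ep j w z})"
  by (auto simp: degenerate_def)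
 also have "... \<in> sets P" using bounded_entries_measurable one c by (intro sets.Int sets.Diff sets.countable_UN') auto
 finally show ?thesis .
qed

lemma singular_imp_degenerate:
 assumes w: "w \<in> space P" "bounded_entries w" and sv: "singular_value n (krylov_mat n m q A (mat n q w)) <= ep" and ep: "ep > 0"
 shows "\<exists>j<q. w \<in> degenerate ep j"
proof -
 define K where "K = krylov_mat n m q A (mat n q w)"
 have K: "K \<in> carrier_mat n n" using n_eq by (simp add: K_def krylov_mat_def)
 obtain z where z: "z \<in> carrier_vec n" "z \<bullet> z = 1" "(K *\<^sub>v z) \<bullet> (K *\<^sub>v z) <= ep\<^sup>2"
  by (rule singular_value_least[OF K n_pos sv[folded K_def]])
 have Kz: "\<bar>\<Sum>s<n. kentry w r s * z $ s\<bar> <= ep" if r: "r < n" for r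
 proof -
  have "(K *\<^sub>v z) $ r = (\<Sum>s<n. kentry w r s * z $ s)"
  proof -
   have "(K *\<^sub>v z) $ r = (\<Sum>s<n. K $$ (r, s) * z $ s)" using r K z by (auto simp: scalar_prod_def lessThan_atLeast0)
   also have "... = (\<Sum>s<n. kentry w r s * z $ s)" using krylov_entry[OF r] by (intro sum.cong) (auto simp: K_def)
   finally show ?thesis .
  qed
  moreover have "((K *\<^sub>v z) $ r)^2 <= (K *\<^sub>v z) \<bullet> (K *\<^sub>v z)"
  proof -
   have "K *\<^sub>v z \<in> carrier_vec n" using K z by simp
   thus ?thesis using r by (subst sq_eq_sum) (auto intro!: member_le_sum[of r "{..<n}" "%a. ((K *\<^sub>v z) $ a)^2"] simp del: index_mult_mat_vec)
  qed
  ultimately have "(\<Sum>s<n. kentry w r s * z $ s)^2 <= ep\<^sup>2" using z(3) by simp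
  thus ?thesis using ep by (simp add: abs_le_square_iff[symmetric])
 qed
 obtain s0 where s0: "s0 < n" "1 / real n <= \<bar>z $ s0\<bar>" using unit_large_entry[OF z(1,2)] by blast
 define B where "B = (\<Sum>r<n. \<Sum>s<n. \<bar>kentry w r s\<bar>)"
 have B0: "0 <= B" unfolding B_def by (intro sum_nonneg) auto
 \<comment> \<open>The accuracy of the rational approximation: each row sum may move by at most
   \<open>ep\<close>, and the largest coordinate may lose at most half of
   \<open>1 / n\<close>.\<close>
 define et where "et = min (ep / (B + 1)) (1 / (2 * real n))"
 have et: "0 < et" "B * et <= ep" "et <= 1 / (2 * real n)"
 proof -
  show "0 < et" "et <= 1 / (2 * real n)" using ep B0 n_pos by (auto simp: et_def)
  have "B * et <= (B + 1) * (ep / (B + 1))" using B0 ep \<open>0 < et\<close> by (intro mult_mono) (auto simp: et_def)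
  thus "B * et <= ep" using B0 by simp
 qed
 have "\<exists>x\<in>\<rat>. z $ s - et < x \<and> x < z $ s + et" for s using et(1) by (intro Rats_dense_in_real) simp
 then obtain x where x: "!!s. x s \<in> \<rat>" "!!s. z $ s - et < x s \<and> x s < z $ s + et" by metis
 define z' where "z' = restrict x {..<n}"
 have z'E: "z' \<in> ({..<n} \<rightarrow>\<^sub>E \<rat>)" using x(1) by (simp add: z'_def)
 have close: "\<bar>z' s - z $ s\<bar> <= et" if "s < n" for s using x(2)[of s] that by (simp add: z'_def abs_le_iff)
 have 1: "\<bar>\<Sum>s<n. kentry w r s * z' s\<bar> <= 2 * ep" if r: "r < n" for r
 proof -
  have "(\<Sum>s<n. kentry w r s * z' s) - (\<Sum>s<n. kentry w r s * z $ s) = (\<Sum>s<n. kentry w r s * (z' s - z $ s))"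
   by (simp add: sum_subtractf[symmetric] right_diff_distrib)
  also have "\<bar>...\<bar> <= (\<Sum>s<n. \<bar>kentry w r s\<bar> * et)"
  proof (rule order_trans[OF sum_abs], rule sum_mono)
   fix s assume "s \<in> {..<n}"
   thus "\<bar>kentry w r s * (z' s - z $ s)\<bar> <= \<bar>kentry w r s\<bar> * et" unfolding abs_mult using close by (intro mult_left_mono) auto
  qed
  also have "... = (\<Sum>s<n. \<bar>kentry w r s\<bar>) * et" by (simp add: sum_distrib_right)
  also have "... <= B * et"
  proof (rule mult_right_mono)
   show "(\<Sum>s<n. \<bar>kentry w r s\<bar>) <= B" unfolding B_def
    by (rule member_le_sum[of r "{..<n}" "%r. \<Sum>s<n. \<bar>kentry w r s\<bar>"]) (use r in \<open>auto intro: sum_nonneg\<close>)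
  qed (use et in simp)
  finally show ?thesis using Kz[OF r] et(2) by linarith
 qed
 have 2: "1 / (2 * real n) <= \<bar>z' s0\<bar>"
 proof -
  have "1 / real n = 1 / (2 * real n) + 1 / (2 * real n)" by simp
  thus ?thesis using s0(2) close[OF s0(1)] et(3) by linarith
 qed
 have "s0 = s0 div q * q + s0 mod q" by simp
 hence "near_kernel ep (s0 mod q) w z'"
  unfolding near_kernel_def using 1 2 block_index[OF s0(1)] by metis
 hence "w \<in> degenerate ep (s0 mod q)" using w z'E by (auto simp: degenerate_def)
 thus ?thesis using q_pos by (intro exI[of _ "s0 mod q"]) simp
qed

text \<open>The columns of G other than \<open>j\<close> contribute
  \<open>m * (q - 1) = n - m\<close> vectors, so \<open>m\<close> orthonormal vectors fit into their
  complement.\<close>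

lemma column_orthogonal_frame:
 assumes j: "j < q"
 obtains ph where "orthon n m ph" "!!k b l. k < m ==> 1 <= b ==> b <= m ==> l < q ==> l \<noteq> j ==> ph k \<bullet> (A b *\<^sub>v column w l) = 0"
proof -
 let ?S = "{1..m} \<times> ({..<q} - {j})"
 have fin: "finite ?S" by simp
 have card: "card ?S = m * (q - 1)" using j by (simp add: card_cartesian_product)
 obtain e where e: "bij_betw e {..<m * (q - 1)} ?S" using ex_bij_betw_nat_finite[OF fin] card by (auto simp: lessThan_atLeast0)
 define W where "W i = A (fst (e i)) *\<^sub>v column w (snd (e i))" for i
 have eS: "e i \<in> ?S" if "i < m * (q - 1)" for i using e that by (auto simp: bij_betw_def)
 have Wc: "W i \<in> carrier_vec n" if "i < m * (q - 1)" for i using eS[OF that] unfolding W_def by (intro image_carrier) auto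
 have "m * (q - 1) + m = m * (q - 1 + 1)" by (simp only: distrib_left mult_1_right)
 hence "m * (q - 1) + m <= n" using j n_eq by simp
 have "\<exists>ph. orthon n m ph \<and> (\<forall>i<m. \<forall>j<m * (q - 1). W j \<bullet> ph i = 0)"
 proof (rule orthon_complement)
  show "W i \<in> carrier_vec n" if "i < m * (q - 1)" for i by (rule Wc[OF that])
  show "m * (q - 1) + m <= n" by fact
 qed
 then obtain ph where ph: "orthon n m ph" "\<forall>i<m. \<forall>j<m * (q - 1). W j \<bullet> ph i = 0" by blast
 show ?thesis
 proof (rule that[OF ph(1)])
  fix k b l assume h: "k < m" "1 <= b" "b <= m" "l < q" "l \<noteq> j"
  hence "(b, l) \<in> e ` {..<m * (q - 1)}" using e by (simp add: bij_betw_def)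
  then obtain i where i: "i < m * (q - 1)" "e i = (b, l)" by auto
  have "W i \<bullet> ph k = 0" using ph(2) i h by blast
  moreover have "ph k \<in> carrier_vec n" using ph(1) h by (simp add: orthon_def)
  ultimately have "ph k \<bullet> W i = 0" using comm_scalar_prod[OF _ Wc[OF i(1)]] by simp
  thus "ph k \<bullet> (A b *\<^sub>v column w l) = 0" using i by (simp add: W_def)
 qed
qed

text \<open>Pairing with the frame kills all columns of K except the \<open>m\<close> that come from
  column \<open>j\<close>. Their coefficients \<open>x\<close> form an approximate kernel vector of
  the compressed matrix \<open>M\<close>, and \<open>adj_small\<close> compares its determinant with
  an \<open>(m - 1)\<close>-minor.\<close>

lemma degenerate_minor:
 assumes j: "j < q" and v: "v \<in> degenerate ep j" and ph: "orthon n m ph" and ep: "0 <= ep"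
  and orth: "!!k b l. k < m ==> 1 <= b ==> b <= m ==> l < q ==> l \<noteq> j ==> ph k \<bullet> (A b *\<^sub>v column v l) = 0"
 shows "\<exists>f\<in>({..<m - 1} \<rightarrow>\<^sub>E {..<m}). \<exists>g\<in>({..<m - 1} \<rightarrow>\<^sub>E {..<m}).
  \<bar>minor (column_form j ph) cells m id id v\<bar> <= 4 * real n ^ 3 * ep * \<bar>minor (column_form j ph) cells (m - 1) f g v\<bar>"
proof -
 from v obtain z where z: "!!r. r < n ==> \<bar>\<Sum>s<n. kentry v r s * z s\<bar> <= 2 * ep"
  and "\<exists>i<m. 1 / (2 * real n) <= \<bar>z (i * q + j)\<bar>" by (auto simp: degenerate_def near_kernel_def)
 then obtain i0 where i0: "i0 < m" "1 / (2 * real n) <= \<bar>z (i0 * q + j)\<bar>" by blast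
 define M where "M = mat m m (%(k,i). ph k \<bullet> (A (Suc i) *\<^sub>v column v j))"
 have M: "M \<in> carrier_mat m m" by (simp add: M_def)
 define x where "x = vec m (%i. z (i * q + j))"
 have x: "x \<in> carrier_vec m" by (simp add: x_def)
 have phc: "ph k \<in> carrier_vec n" "ph k \<bullet> ph k = 1" if "k < m" for k using ph that by (simp_all add: orthon_def)
 have Mx: "\<bar>(M *\<^sub>v x) $ k\<bar> <= 2 * real n * ep" if k: "k < m" for k
 proof -
  have inner: "ph k \<bullet> (A (s div q + 1) *\<^sub>v column v (s mod q)) = (\<Sum>r<n. ph k $ r * kentry v r s)" if "s < n" for s
  proof -
   have "dim_vec (A (s div q + 1) *\<^sub>v column v (s mod q)) = n" using block_index[OF that] by simp
   thus ?thesis by (simp add: scalar_prod_def kentry_def lessThan_atLeast0 del: index_mult_mat_vec)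
  qed
  let ?f = "%s. ph k \<bullet> (A (s div q + 1) *\<^sub>v column v (s mod q)) * z s"
  have "(M *\<^sub>v x) $ k = (\<Sum>i<m. ph k \<bullet> (A (Suc i) *\<^sub>v column v j) * z (i * q + j))"
   using k by (simp add: M_def x_def scalar_prod_def lessThan_atLeast0)
  also have "... = (\<Sum>i<m. ?f (i * q + j))" using j by simp
  also have "... = (\<Sum>s\<in>(%i. i * q + j) ` {..<m}. ?f s)"
   by (subst sum.reindex) (use q_pos in \<open>auto simp: inj_on_def\<close>)
  also have "... = (\<Sum>s<n. ?f s)"
  proof (rule sum.mono_neutral_left)
   show "(%i. i * q + j) ` {..<m} \<subseteq> {..<n}"
   proof safe
    fix i assume "i < m"
    hence "(i + 1) * q <= m * q" by (intro mult_right_mono) auto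
    thus "i * q + j < n" using j n_eq by (simp add: algebra_simps)
   qed
   show "\<forall>s\<in>{..<n} - (%i. i * q + j) ` {..<m}. ?f s = 0"
   proof
    fix s assume s: "s \<in> {..<n} - (%i. i * q + j) ` {..<m}"
    have sm: "s div q < m" using block_index[of s] s by simp
    have "s mod q \<noteq> j"
    proof
     assume "s mod q = j"
     hence "s = s div q * q + j" by (metis div_mult_mod_eq)
     thus False using s sm by blast
    qed
    thus "?f s = 0" using orth[OF k, of "s div q + 1" "s mod q"] sm q_pos by simp
   qed
  qed simp
  also have "... = (\<Sum>s<n. (\<Sum>r<n. ph k $ r * kentry v r s) * z s)" using inner by (intro sum.cong refl) auto
  also have "... = (\<Sum>s<n. \<Sum>r<n. ph k $ r * (kentry v r s * z s))" by (simp add: sum_distrib_right mult.assoc)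
  also have "... = (\<Sum>r<n. \<Sum>s<n. ph k $ r * (kentry v r s * z s))" by (rule sum.swap)
  also have "... = (\<Sum>r<n. ph k $ r * (\<Sum>s<n. kentry v r s * z s))" by (simp add: sum_distrib_left)
  finally have e: "(M *\<^sub>v x) $ k = (\<Sum>r<n. ph k $ r * (\<Sum>s<n. kentry v r s * z s))" .
  have "\<bar>(M *\<^sub>v x) $ k\<bar> <= (\<Sum>r<n. \<bar>ph k $ r * (\<Sum>s<n. kentry v r s * z s)\<bar>)" unfolding e by (rule sum_abs)
  also have "... <= (\<Sum>r<n. 1 * (2 * ep))"
  proof (rule sum_mono)
   fix r assume "r \<in> {..<n}"
   thus "\<bar>ph k $ r * (\<Sum>s<n. kentry v r s * z s)\<bar> <= 1 * (2 * ep)"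
    unfolding abs_mult using unit_entry_le[OF phc[OF k], of r] z[of r] by (intro mult_mono) auto
  qed
  finally show ?thesis by simp
 qed
 obtain k where k: "k < m" "\<bar>det M\<bar> * \<bar>x $ i0\<bar> <= real m * (2 * real n * ep) * \<bar>det (mat_delete M k i0)\<bar>"
  by (rule adj_small[OF M x Mx i0(1)])
 let ?d = "\<bar>det (mat_delete M k i0)\<bar>"
 have "\<bar>det M\<bar> * (1 / (2 * real n)) <= \<bar>det M\<bar> * \<bar>x $ i0\<bar>" using i0 by (intro mult_left_mono) (auto simp: x_def)
 also have "... <= real m * (2 * real n * ep) * ?d" by (rule k(2))
 also have "... <= real n * (2 * real n * ep) * ?d" using m_le_n ep by (intro mult_right_mono) auto
 finally have "\<bar>det M\<bar> * (1 / (2 * real n)) * (2 * real n) <= real n * (2 * real n * ep) * ?d * (2 * real n)" by (rule mult_right_mono) simp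
 hence main: "\<bar>det M\<bar> <= 4 * real n ^ 3 * ep * ?d" using n_pos by (simp add: numeral_eq_Suc mult_ac)
 \<comment> \<open>The increasing enumerations that skip the deleted row \<open>k\<close> and the
   deleted column \<open>i0\<close>.\<close>
 define f where "f = (\<lambda>a\<in>{..<m - 1}. if a < k then a else Suc a)"
 define g where "g = (\<lambda>a\<in>{..<m - 1}. if a < i0 then a else Suc a)"
 have fg: "f \<in> ({..<m - 1} \<rightarrow>\<^sub>E {..<m})" "g \<in> ({..<m - 1} \<rightarrow>\<^sub>E {..<m})" by (auto simp: f_def g_def)
 have fgi: "i < m - 1 ==> f i < m" "i < m - 1 ==> g i < m" for i by (auto simp: f_def g_def)
 have D1: "minor (column_form j ph) cells m id id v = det M"
  using column_form_minor[OF j ph order_refl, of m id id v] by (simp add: M_def)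
 have D2: "minor (column_form j ph) cells (m - 1) f g v = det (mat_delete M k i0)"
 proof -
  have "mat_delete M k i0 = mat (m - 1) (m - 1) (%(a,b). ph (f a) \<bullet> (A (Suc (g b)) *\<^sub>v column v j))"
   by (rule eq_matI) (auto simp: mat_delete_def M_def f_def g_def)
  thus ?thesis using column_form_minor[OF j ph order_refl, of "m - 1" f g v] fgi by simp
 qed
 show ?thesis by (rule bexI[OF _ fg(1)], rule bexI[OF _ fg(2)]) (use main D1 D2 in simp)
qed

end

context krylov_large
begin

lemma a_le_n: "a <= real n" "La <= real n"
proof -
 have "Th * 1 <= Th * La" using Th_a a_big La_large by (intro mult_left_mono) auto
 hence "Th <= real n" using q_eq q_le_n by (metis mult.right_neutral of_nat_le_iff order_trans)
 thus "a <= real n" using Th_a a_big by linarith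
 thus "La <= real n" using a_big La_large by linarith
qed

definition "escape = measure P {w\<in>space P. \<not> bounded_entries w}"

lemma escape_le: "escape <= 2 * (real n)^2 * \<alpha>\<^sup>2"
proof -
 have "2 * a <= (real n)^2 / 4"
 proof -
  have "8 * real n <= real n * real n" using n_big by (intro mult_right_mono) auto
  thus ?thesis using a_le_n(1) by (simp add: power2_eq_square)
 qed
 hence "exp (- (real n)\<^sup>2 / 4) <= exp (- (real 2 * a))" by simp
 also have "... = \<alpha>\<^sup>2" unfolding exp_forms ..
 finally have "(real n)^2 * (2 * exp (- (real n)\<^sup>2 / 4)) <= (real n)^2 * (2 * \<alpha>\<^sup>2)" by (intro mult_left_mono) auto
 thus ?thesis using bounded_entries_prob unfolding escape_def by (simp add: mult_ac)
qed

text \<open>The columns other than \<open>j\<close> are frozen and determine the frame, so the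
  redrawn column is independent of it. The frame is exactly orthogonal to the exposed columns;
  therefore \<open>spread\<close> applies, and the event becomes one about a ratio of minors in the
  redrawn column.\<close>

lemma degenerate_section:
 assumes j: "j < q" and w: "w \<in> space P" and L: "L \<subseteq> {..<q} - {j}" and J: "4 ^ J <= m" "m < 4 * 4 ^ J"
  and sp: "spread L m (4 * 4 ^ J * block_size) (\<alpha> ^ (68 * 4 ^ J)) w"
 shows "measure P {w'\<in>space P. redraw j w w' \<in> degenerate (\<alpha> ^ (500 * m)) j} <= escape + (2 * real n ^ 3 * \<alpha>\<^sup>2 + \<alpha>\<^sup>2)"
proof -
 have n3: "3 <= n" using n_big by linarith
 interpret small_param n \<alpha> by unfold_locales (use n3 small_\<alpha> \<alpha>_pos in auto)
 have m1: "1 <= m" using n_eq n_pos by (cases m) auto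
 let ?kk = "4 * 4 ^ J * block_size" let ?th = "\<alpha> ^ (68 * 4 ^ J)" let ?ep = "\<alpha> ^ (500 * m)"
 define de where "de = 4 * real n ^ 3 * ?ep"
 have th0: "0 < ?th" using \<alpha>0 by simp
 have th_m: "\<alpha> ^ (68 * m) <= ?th" using J by (intro dec) simp
 obtain ph where ph: "orthon n m ph" and orth: "!!k b l. k < m ==> 1 <= b ==> b <= m ==> l < q ==> l \<noteq> j ==> ph k \<bullet> (A b *\<^sub>v column w l) = 0"
  by (rule column_orthogonal_frame[OF j, of w]) blast
 let ?N = "column_form j ph"
 define Fs where "Fs = ({..<m - 1} \<rightarrow>\<^sub>E {..<m})"
 have finFs: "finite Fs" unfolding Fs_def by (intro finite_PiE) auto
 \<comment> \<open>The index maps range over a finite set, which keeps this event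
   measurable.\<close>
 define F where "F = (space P - {w\<in>space P. \<not> bounded_entries w}) \<inter>
   (\<Union>f\<in>Fs. \<Union>g\<in>Fs. {w'\<in>space P. \<bar>minor ?N cells m id id w'\<bar> <= de * \<bar>minor ?N cells (m - 1) f g w'\<bar>})"
 have sp': "space P = space (\<Pi>\<^sub>M i\<in>cells. (borel :: real measure))" by (rule sets_eq_imp_space_eq[OF sets_PiM_sparse])
 have Fs: "F \<in> sets P"
  unfolding F_def
 proof (intro sets.Int sets.Diff sets.finite_UN finFs bounded_entries_measurable)
  fix f g
  note [measurable] = minor_measurable[of ?N cells m id id] minor_measurable[of ?N cells "m - 1" f g]
  show "{w'\<in>space P. \<bar>minor ?N cells m id id w'\<bar> <= de * \<bar>minor ?N cells (m - 1) f g w'\<bar>} \<in> sets P"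
   unfolding sets_PiM_sparse sp' by measurable
 qed auto
 have smallness: "!!et. comb n m ph et \<bullet> (gram L w *\<^sub>v comb n m ph et) <= ?th\<^sup>2 * (\<Sum>i<m. (et i)^2)"
 proof -
  fix et
  have phc: "ph k \<in> carrier_vec n" if "k < m" for k using ph that by (simp add: orthon_def)
  have "comb n m ph et \<bullet> (gram L w *\<^sub>v comb n m ph et) = 0"
   unfolding gram_quad_form[OF comb_carrier]
  proof (intro sum.neutral ballI)
   fix l b assume lb: "l \<in> L" "b \<in> {1..m}"
   have ic: "A b *\<^sub>v column w l \<in> carrier_vec n" using lb by (intro image_carrier) auto
   have "comb n m ph et \<bullet> (A b *\<^sub>v column w l) = (A b *\<^sub>v column w l) \<bullet> comb n m ph et" by (rule comm_scalar_prod[OF comb_carrier ic])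
   also have "... = (\<Sum>k<m. et k * ((A b *\<^sub>v column w l) \<bullet> ph k))" by (rule scalar_prod_comb[OF ic phc])
   also have "... = 0"
   proof (intro sum.neutral ballI)
    fix k assume "k \<in> {..<m}"
    hence k: "k < m" by simp
    have "(A b *\<^sub>v column w l) \<bullet> ph k = ph k \<bullet> (A b *\<^sub>v column w l)" by (rule comm_scalar_prod[OF ic phc[OF k]])
    also have "... = 0" using orth[OF k, of b l] lb L by auto
    finally show "et k * ((A b *\<^sub>v column w l) \<bullet> ph k) = 0" by simp
   qed
   finally show "(comb n m ph et \<bullet> (A b *\<^sub>v column w l))^2 = 0" by simp
  qed
  thus "comb n m ph et \<bullet> (gram L w *\<^sub>v comb n m ph et) <= ?th\<^sup>2 * (\<Sum>i<m. (et i)^2)" by (simp add: sum_nonneg)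
 qed
 have "measure P F <= real m * (real (card cells) + 1) ^ m * (1 - p) ^ (?kk - m) + real (card cells) * (2 * \<alpha>\<^sup>2 * real m)"
 proof (rule small_determinant_ratio_prob[where th = ?th and R = "real n" and de = de and N = ?N])
  show "finite cells" by simp
  show "0 < ?th" by (rule th0)
  show "0 < m" using m1 by simp
  show "0 <= p" "p <= 1" by (rule p_range)+
  show "0 <= \<alpha>\<^sup>2" by simp
  show "1 <= real n" using n3 by simp
  show "F \<in> sets (\<Pi>\<^sub>M i\<in>cells. (borel :: real measure))" using Fs by (simp only: sets_PiM_sparse)
  show "0 <= de" using \<alpha>0 by (simp add: de_def)
  \<comment> \<open>Of the exponent 500 per unit of \<open>m\<close>, three are spent on growth
    constant, cell count and cubic factor. The remaining 497 have to beat 70, that is 2 from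
    \<open>\<alpha>\<^sup>2\<close> and 68 from the threshold.\<close>
  show "de * (2 * growth_const m * (2 * real n * (real (card cells) + 1)) ^ m) < (\<alpha>\<^sup>2) ^ m * ?th"
  proof -
   have cc: "2 * real n * (real (card cells) + 1) <= 4 * real n ^ 3"
   proof -
    have "1 <= (real n)^2" using n3 by (intro one_le_power) simp
    hence "real (card cells) + 1 <= 2 * (real n)^2" using card_cells by linarith
    hence "2 * real n * (real (card cells) + 1) <= 2 * real n * (2 * (real n)^2)" by (intro mult_left_mono) auto
    thus ?thesis by (simp add: numeral_eq_Suc)
   qed
   have W: "(2 * real n * (real (card cells) + 1)) ^ m * \<alpha> ^ m <= 1"
   proof -
    have "(2 * real n * (real (card cells) + 1)) ^ m * \<alpha> ^ m = (2 * real n * (real (card cells) + 1) * \<alpha>) ^ m" by (simp only: power_mult_distrib)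
    also have "... <= 1"
    proof (rule power_le_one)
     show "0 <= 2 * real n * (real (card cells) + 1) * \<alpha>" using \<alpha>0 by simp
     have "2 * real n * (real (card cells) + 1) * \<alpha> <= 4 * real n ^ 3 * \<alpha>" using cc \<alpha>0 by (intro mult_right_mono) auto
     also have "... <= 1" by (rule const_le) auto
     finally show "2 * real n * (real (card cells) + 1) * \<alpha> <= 1" .
    qed
    finally show ?thesis .
   qed
   have G: "growth_const m * \<alpha> ^ m <= 1" by (rule growth_const_small[OF m1 m_le_n])
   have G0: "0 < growth_const m" using m1 by (intro growth_const_pos) simp
   have e: "?ep = \<alpha> ^ (497 * m) * (\<alpha> ^ m * \<alpha> ^ m * \<alpha> ^ m)"
    unfolding power_add[symmetric] by (rule arg_cong[where f = "%e. \<alpha> ^ e"]) simp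
   have am: "\<alpha> ^ m <= \<alpha>" using dec[of 1 m] m1 by simp
   have "de * (2 * growth_const m * (2 * real n * (real (card cells) + 1)) ^ m)
     = \<alpha> ^ (497 * m) * ((growth_const m * \<alpha> ^ m) * (((2 * real n * (real (card cells) + 1)) ^ m * \<alpha> ^ m) * (8 * real n ^ 3 * \<alpha> ^ m)))"
    unfolding de_def e by (simp only: mult_ac)
   also have "... <= \<alpha> ^ (497 * m) * (1 * (1 * 1))"
   proof (intro mult_left_mono mult_mono G W)
    have "8 * real n ^ 3 * \<alpha> ^ m <= 8 * real n ^ 3 * \<alpha>" using am by (intro mult_left_mono) auto
    thus "8 * real n ^ 3 * \<alpha> ^ m <= 1" using const_le[of 3 8] by simp
   qed (use \<alpha>0 G0 in auto)
   also have "... = \<alpha> ^ (497 * m)" by simp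
   also have "... < \<alpha> ^ (70 * m)" using \<alpha>0 \<alpha>1 m1 by (intro power_strict_decreasing) auto
   also have "... = (\<alpha>\<^sup>2) ^ m * \<alpha> ^ (68 * m)" unfolding power_mult[symmetric] power_add[symmetric] by (rule arg_cong[where f = "%e. \<alpha> ^ e"]) simp
   also have "... <= (\<alpha>\<^sup>2) ^ m * ?th" using th_m by (intro mult_left_mono) auto
   finally show ?thesis .
  qed
  show "?kk <= card {a\<in>cells. ?th <= \<bar>\<Sum>i<m. \<Sum>j'<m. y i * ?N a i j' * z j'\<bar>}"
   if "\<exists>i<m. y i = 1" "\<exists>j<m. z j = 1" for y z
   by (rule column_form_spread[OF sp order_refl order_refl j ph smallness th0 that])
  show "(\<forall>a\<in>cells. \<bar>z a\<bar> <= real n) \<and> (\<exists>f g. (\<forall>i<m - 1. f i < m \<and> g i < m) \<and> \<bar>minor ?N cells m id id z\<bar> <= de * \<bar>minor ?N cells (m - 1) f g z\<bar>)"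
   if "z \<in> F" for z
  proof
   show "\<forall>a\<in>cells. \<bar>z a\<bar> <= real n" using that by (auto simp: F_def bounded_entries_def)
   have "\<exists>f\<in>Fs. \<exists>g\<in>Fs. \<bar>minor ?N cells m id id z\<bar> <= de * \<bar>minor ?N cells (m - 1) f g z\<bar>"
    using that by (simp only: F_def Int_iff UN_iff mem_Collect_eq) blast
   then obtain f g where "f \<in> Fs" "g \<in> Fs" "\<bar>minor ?N cells m id id z\<bar> <= de * \<bar>minor ?N cells (m - 1) f g z\<bar>"
    by (elim bexE) (rule that)
   thus "\<exists>f g. (\<forall>i<m - 1. f i < m \<and> g i < m) \<and> \<bar>minor ?N cells m id id z\<bar> <= de * \<bar>minor ?N cells (m - 1) f g z\<bar>"
    by (intro exI[of _ f] exI[of _ g]) (auto simp: Fs_def PiE_def Pi_def)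
  qed
 qed
 also have "... <= \<alpha>\<^sup>2 + 2 * real n ^ 3 * \<alpha>\<^sup>2"
 proof (rule add_mono)
  have "m * block_size <= ?kk" using J by (intro mult_right_mono) auto
  hence "(1 - p) ^ (?kk - m) <= (1 - p) ^ (m * block_size - m)" using p_range by (intro power_decreasing diff_le_mono) auto
  hence "real m * (real (card cells) + 1) ^ m * (1 - p) ^ (?kk - m) <= real m * ((real n)^2 + 1) ^ m * (1 - p) ^ (m * block_size - m)"
   using card_cells p_range by (intro mult_mono power_mono) auto
  also have "... <= \<alpha> ^ (7 * m)" by (rule failure_bounds(3)[OF m1 m_le_n p_range sparse_support_bound])
  also have "... <= \<alpha>\<^sup>2" using m1 by (intro dec) simp
  finally show "real m * (real (card cells) + 1) ^ m * (1 - p) ^ (?kk - m) <= \<alpha>\<^sup>2" .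
  have "real (card cells) * (2 * \<alpha>\<^sup>2 * real m) <= (real n)^2 * (2 * \<alpha>\<^sup>2 * real n)"
   using card_cells m_le_n by (intro mult_mono) auto
  also have "... = 2 * real n ^ 3 * \<alpha>\<^sup>2" by (simp add: numeral_eq_Suc)
  finally show "real (card cells) * (2 * \<alpha>\<^sup>2 * real m) <= 2 * real n ^ 3 * \<alpha>\<^sup>2" .
 qed
 finally have PF: "measure P F <= \<alpha>\<^sup>2 + 2 * real n ^ 3 * \<alpha>\<^sup>2" .
 have "{w'\<in>space P. redraw j w w' \<in> degenerate ?ep j} \<subseteq> {w\<in>space P. \<not> bounded_entries w} \<union> F"
 proof
  fix w' assume "w' \<in> {w'\<in>space P. redraw j w w' \<in> degenerate ?ep j}"
  hence w': "w' \<in> space P" "redraw j w w' \<in> degenerate ?ep j" by auto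
  show "w' \<in> {w\<in>space P. \<not> bounded_entries w} \<union> F"
  proof (cases "bounded_entries w'")
   case True
   have "\<exists>f\<in>Fs. \<exists>g\<in>Fs. \<bar>minor ?N cells m id id (redraw j w w')\<bar> <= 4 * real n ^ 3 * ?ep * \<bar>minor ?N cells (m - 1) f g (redraw j w w')\<bar>"
    unfolding Fs_def
    by (rule degenerate_minor[OF j w'(2) ph]) (use \<alpha>0 orth in \<open>auto simp: column_redraw\<close>)
   then obtain f g where fg: "f \<in> Fs" "g \<in> Fs"
    "\<bar>minor ?N cells m id id (redraw j w w')\<bar> <= de * \<bar>minor ?N cells (m - 1) f g (redraw j w w')\<bar>" unfolding de_def by blast
   have eq: "minor ?N cells rh f g (redraw j w w') = minor ?N cells rh f g w'"
    if "!!i. i < rh ==> f i < m" "!!i. i < rh ==> g i < m" for rh f g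
   proof -
    have "minor ?N cells rh f g v = det (mat rh rh (%(i,j'). ph (f i) \<bullet> (A (Suc (g j')) *\<^sub>v column v j)))" for v
     by (rule column_form_minor[OF j ph order_refl]) (erule that(1), erule that(2))
    thus ?thesis using j by (simp add: column_redraw)
   qed
   have "f i < m" "g i < m" if "i < m - 1" for i using fg that by (auto simp: Fs_def PiE_def Pi_def)
   hence "\<bar>minor ?N cells m id id w'\<bar> <= de * \<bar>minor ?N cells (m - 1) f g w'\<bar>"
    using fg(3) eq[of m id id] eq[of "m - 1" f g] by simp
   hence "w' \<in> F" using w'(1) True fg by (auto simp: F_def)
   thus ?thesis by simp
  qed (use w' in simp)
 qed
 hence "measure P {w'\<in>space P. redraw j w w' \<in> degenerate ?ep j} <= measure P ({w\<in>space P. \<not> bounded_entries w} \<union> F)"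
  using Fs bounded_entries_measurable by (intro P.finite_measure_mono) auto
 also have "... <= escape + measure P F" unfolding escape_def using Fs bounded_entries_measurable by (intro measure_Un_le)
 finally show ?thesis using PF by linarith
qed

lemma degenerate_prob:
 assumes j: "j < q"
 shows "measure P (degenerate (\<alpha> ^ (500 * m)) j) <= 4 * real n * \<alpha>\<^sup>2 + 2 * escape + (2 * real n ^ 3 * \<alpha>\<^sup>2 + \<alpha>\<^sup>2)"
proof -
 let ?D = "degenerate (\<alpha> ^ (500 * m)) j" let ?U = "{w\<in>space P. \<not> bounded_entries w}" let ?b = "escape + (2 * real n ^ 3 * \<alpha>\<^sup>2 + \<alpha>\<^sup>2)"
 have n3: "3 <= n" using n_big by linarith
 interpret small_param n \<alpha> by unfold_locales (use n3 small_\<alpha> \<alpha>_pos in auto)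
 obtain u J ep where u: "u < q" and J: "4 ^ J <= m" "m < 4 * 4 ^ J" and ep: "ep <= 4 * La * \<alpha> ^ 4"
  and H: "likely u m (4 * 4 ^ J * block_size) (\<alpha> ^ (68 * 4 ^ J)) ep" by (rule likely_last)
 have "u <= card ({..<q} - {j})" using u j by simp
 then obtain L where L: "L \<subseteq> {..<q} - {j}" "card L = u" using obtain_subset_with_card_n[of u "{..<q} - {j}"] by metis
 have "L \<subseteq> {..<q}" using L by blast
 from H[unfolded likely_def, THEN spec, THEN mp, THEN mp, OF this L(2)]
 obtain E where E: "E \<in> sets P" "measure P E <= ep"
  and E': "\<forall>w\<in>space P. w \<notin> E --> bounded_entries w --> spread L m (4 * 4 ^ J * block_size) (\<alpha> ^ (68 * 4 ^ J)) w"
  by (elim bexE conjE) (rule that)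
 have b0: "0 <= ?b" by (intro add_nonneg_nonneg) (auto simp: escape_def)
 have "emeasure P ?D = (\<integral>\<^sup>+w. indicator ?D w \<partial>P)" using degenerate_sets by simp
 also have "... = (\<integral>\<^sup>+w. (\<integral>\<^sup>+w'. indicator ?D (redraw j w w') \<partial>P) \<partial>P)"
  by (rule nn_integral_resample) (use degenerate_sets in simp)
 also have "... <= (\<integral>\<^sup>+w. (indicator E w + indicator ?U w) + ennreal ?b \<partial>P)"
 proof (rule nn_integral_mono)
  fix w assume w: "w \<in> space P"
  have S: "{w'\<in>space P. redraw j w w' \<in> ?D} \<in> sets P"
   using measurable_sets[OF resample_measurable_snd[OF w] degenerate_sets] by (simp add: vimage_def Int_def conj_commute)
  have "(\<integral>\<^sup>+w'. indicator ?D (redraw j w w') \<partial>P) = (\<integral>\<^sup>+w'. indicator {w'\<in>space P. redraw j w w' \<in> ?D} w' \<partial>P)"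
   by (intro nn_integral_cong) (simp add: indicator_def)
  also have "... = emeasure P {w'\<in>space P. redraw j w w' \<in> ?D}" by (rule nn_integral_indicator[OF S])
  also have "... <= (indicator E w + indicator ?U w) + ennreal ?b"
  proof (cases "w \<in> E \<or> w \<in> ?U")
   case True
   hence "(1::ennreal) <= indicator E w + indicator ?U w" by (auto simp: indicator_def)
   moreover have "emeasure P {w'\<in>space P. redraw j w w' \<in> ?D} <= 1" by (rule P.emeasure_le_1)
   ultimately show ?thesis by (meson add_increasing2 order_trans zero_le)
  next
   case False
   hence "spread L m (4 * 4 ^ J * block_size) (\<alpha> ^ (68 * 4 ^ J)) w" using E' w by auto
   from degenerate_section[OF j w L(1) J this]
   have "emeasure P {w'\<in>space P. redraw j w w' \<in> ?D} <= ennreal ?b" by (simp only: P.emeasure_eq_measure ennreal_leI)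
   thus ?thesis by (simp add: add_increasing)
  qed
  finally show "(\<integral>\<^sup>+w'. indicator ?D (redraw j w w') \<partial>P) <= (indicator E w + indicator ?U w) + ennreal ?b" .
 qed
 also have "... = (emeasure P E + emeasure P ?U) + ennreal ?b"
  using E(1) bounded_entries_measurable by (simp add: nn_integral_add P.emeasure_space_1)
 also have "... = ennreal (measure P E + escape + ?b)"
  unfolding P.emeasure_eq_measure escape_def[symmetric]
  using b0 by (simp only: ennreal_plus[symmetric] measure_nonneg add_nonneg_nonneg escape_def)
 finally have "measure P ?D <= measure P E + escape + ?b"
  using b0 by (subst (asm) P.emeasure_eq_measure, subst (asm) ennreal_le_iff) (auto simp: escape_def)
 moreover have "ep <= 4 * real n * \<alpha>\<^sup>2"
 proof -
  have "4 * La * \<alpha> ^ 4 <= 4 * real n * \<alpha>\<^sup>2" using a_le_n(2) La_large \<alpha>0 by (intro mult_mono dec) auto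
  thus ?thesis using ep by linarith
 qed
 ultimately show ?thesis using E(2) by linarith
qed

theorem smallest_singular_value_prob:
 "measure P {w\<in>space P. singular_value n (krylov_mat n m q A (mat n q w)) <= \<alpha> ^ (500 * m)} <= \<alpha>"
proof (cases "{w\<in>space P. singular_value n (krylov_mat n m q A (mat n q w)) <= \<alpha> ^ (500 * m)} \<in> sets P")
 \<comment> \<open>A set outside the sigma algebra has measure 0 by convention.\<close>
 case False
 thus ?thesis using \<alpha>_pos by (simp add: measure_notin_sets)
next
 case True
 have n3: "3 <= n" using n_big by linarith
 interpret small_param n \<alpha> by unfold_locales (use n3 small_\<alpha> \<alpha>_pos in auto)
 let ?T = "{w\<in>space P. singular_value n (krylov_mat n m q A (mat n q w)) <= \<alpha> ^ (500 * m)}"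
 let ?U = "{w\<in>space P. \<not> bounded_entries w}" let ?D = "degenerate (\<alpha> ^ (500 * m))"
 have "?T \<subseteq> ?U \<union> (\<Union>j\<in>{..<q}. ?D j)"
 proof
  fix w assume w: "w \<in> ?T"
  show "w \<in> ?U \<union> (\<Union>j\<in>{..<q}. ?D j)"
  proof (cases "bounded_entries w")
   case bd: True
   have "\<exists>j<q. w \<in> ?D j" by (rule singular_imp_degenerate[OF _ bd]) (use w \<alpha>0 in auto)
   thus ?thesis by auto
  qed (use w in simp)
 qed
 hence "measure P ?T <= measure P (?U \<union> (\<Union>j\<in>{..<q}. ?D j))"
  using bounded_entries_measurable degenerate_sets by (intro P.finite_measure_mono sets.Un sets.finite_UN) auto
 also have "... <= measure P ?U + measure P (\<Union>j\<in>{..<q}. ?D j)"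
  using bounded_entries_measurable degenerate_sets by (intro measure_Un_le sets.finite_UN) auto
 also have "measure P (\<Union>j\<in>{..<q}. ?D j) <= (\<Sum>j<q. measure P (?D j))"
  using degenerate_sets by (intro P.finite_measure_subadditive_finite) auto
 also have "... <= (\<Sum>j<q. 4 * real n * \<alpha>\<^sup>2 + 2 * escape + (2 * real n ^ 3 * \<alpha>\<^sup>2 + \<alpha>\<^sup>2))"
  by (intro sum_mono degenerate_prob) simp
 also have "... = real q * (4 * real n * \<alpha>\<^sup>2 + 2 * escape + (2 * real n ^ 3 * \<alpha>\<^sup>2 + \<alpha>\<^sup>2))" by simp
 also have "... <= real n * (10 * real n ^ 3 * \<alpha>\<^sup>2 + \<alpha>\<^sup>2)"
 proof (rule mult_mono)
  have "real n <= real n ^ 3" "(real n)^2 <= real n ^ 3" using n3 by (auto intro: power_increasing self_le_power)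
  hence "real n * \<alpha>\<^sup>2 <= real n ^ 3 * \<alpha>\<^sup>2" "(real n)^2 * \<alpha>\<^sup>2 <= real n ^ 3 * \<alpha>\<^sup>2" by (intro mult_right_mono; simp)+
  thus "4 * real n * \<alpha>\<^sup>2 + 2 * escape + (2 * real n ^ 3 * \<alpha>\<^sup>2 + \<alpha>\<^sup>2) <= 10 * real n ^ 3 * \<alpha>\<^sup>2 + \<alpha>\<^sup>2"
   using escape_le unfolding mult.assoc by linarith
 qed (use q_le_n in \<open>auto simp: escape_def intro!: add_nonneg_nonneg\<close>)
 finally have "measure P ?T <= escape + real n * (10 * real n ^ 3 * \<alpha>\<^sup>2 + \<alpha>\<^sup>2)" by (simp add: escape_def)
 also have "... <= 13 * real n ^ 4 * \<alpha>\<^sup>2"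
 proof -
  have "real n <= real n ^ 4" "(real n)^2 <= real n ^ 4" using n3 by (auto intro: power_increasing self_le_power)
  hence "real n * \<alpha>\<^sup>2 <= real n ^ 4 * \<alpha>\<^sup>2" "(real n)^2 * \<alpha>\<^sup>2 <= real n ^ 4 * \<alpha>\<^sup>2" by (intro mult_right_mono; simp)+
  moreover have "real n * (10 * real n ^ 3 * \<alpha>\<^sup>2 + \<alpha>\<^sup>2) = 10 * (real n ^ 4 * \<alpha>\<^sup>2) + real n * \<alpha>\<^sup>2" by (simp add: algebra_simps numeral_eq_Suc)
  ultimately show ?thesis using escape_le unfolding mult.assoc by linarith
 qed
 also have "... = (13 * real n ^ 4 * \<alpha>) * \<alpha>" by (simp add: power2_eq_square)
 also have "... <= 1 * \<alpha>" using const_le[of 4 13] \<alpha>0 by (intro mult_right_mono) auto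
 finally show ?thesis by simp
qed

end

section \<open>The absolute constant\<close>

theorem theorem1p10:
  shows "\<exists>c::real. c > 0 \<and>
    (\<forall>(n::nat) (m::nat) (A :: nat \<Rightarrow> real mat) (\<alpha>::real) (h::real).
      n > 0 \<longrightarrow> m > 0 \<longrightarrow> m dvd n \<longrightarrow>
      real n > c * (real m)\<^sup>2 * ln (real n) + 1 \<longrightarrow>
      (\<forall>i\<in>{1..m}. A i \<in> carrier_mat n n \<and> singular_value 1 (A i) \<le> 1) \<longrightarrow>
      0 < \<alpha> \<longrightarrow> \<alpha> \<le> real n powr (- ln (real n)) \<longrightarrow>
      (\<forall>k\<in>{1..m}. \<forall>x :: nat \<Rightarrow> real. (\<Sum>i=1..k. (x i)\<^sup>2) = 1 \<longrightarrow>
         singular_value (n - k + 1) (lincomb_mats n k x A) \<ge> \<alpha> ^ k) \<longrightarrow>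
      0 \<le> h \<longrightarrow> h \<le> real n \<longrightarrow>
      h \<ge> c * real m * ln (real n) * ln (1 / \<alpha>) \<longrightarrow>
      measure (sparse_gaussian_entries n (n div m) (h / real n))
        {g \<in> space (sparse_gaussian_entries n (n div m) (h / real n)).
           singular_value n (krylov_mat n m (n div m) A (mat n (n div m) g)) \<le> \<alpha> ^ (500 * m)}
        \<le> \<alpha>)"
proof -
 \<comment> \<open>The factor \<open>exp 100\<close> forces ln n to be at least 100, and 1000000
   supplies the numerical margins of \<open>krylov_large\<close>.\<close>
 define c :: real where "c = 1000000 * exp 100"
 have c0: "c > 0" and c1: "1000000 <= c" "2 * exp 100 <= c" by (auto simp: c_def)
 show ?thesis
 proof (rule exI[of _ c], intro conjI c0 allI impI)
  fix n m :: nat and A :: "nat => real mat" and \<alpha> h :: real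
  assume n0: "n > 0" and m0: "m > 0" and dv: "m dvd n" and nbig: "real n > c * (real m)^2 * ln (real n) + 1"
   and A: "\<forall>i\<in>{1..m}. A i \<in> carrier_mat n n \<and> singular_value 1 (A i) <= 1"
   and \<alpha>: "0 < \<alpha>" "\<alpha> <= real n powr (- ln (real n))"
   and sv: "\<forall>k\<in>{1..m}. \<forall>x :: nat => real. (\<Sum>i=1..k. (x i)^2) = 1 -->
     singular_value (n - k + 1) (lincomb_mats n k x A) \<ge> \<alpha> ^ k"
   and h: "0 <= h" "h <= real n" "h \<ge> c * real m * ln (real n) * ln (1 / \<alpha>)"
  define q where "q = n div m"
  have nq: "n = m * q" using dv by (simp add: q_def)
  define La where "La = ln (real n)"
  define a where "a = ln (1 / \<alpha>)"
  have m1: "1 <= real m" using m0 by simp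
  have "La \<ge> 0" using n0 by (simp add: La_def)
  have "n \<noteq> 1" using nbig by auto
  hence n2: "2 <= n" using n0 by linarith
  have "1 / 2 <= ln (2::real)" using ln2_ge_two_thirds by linarith
  also have "... <= La" using n2 by (simp add: La_def)
  finally have L2: "1 / 2 <= La" .
  have big: "c * (real m)^2 * La < real n" using nbig by (simp add: La_def)
  have L100: "100 <= La"
  proof -
   have "exp 100 <= c * 1 * (1 / 2)" using c1 by simp
   also have "... <= c * (real m)^2 * La" using c0 L2 m1 by (intro mult_mono mult_left_mono) auto
   also have "... <= real n" using big by simp
   finally have "ln (exp 100) <= La" unfolding La_def by (intro ln_mono) (use n0 in auto)
   thus ?thesis by simp
  qed
  have aL: "La\<^sup>2 <= a"
  proof -
   have "ln \<alpha> <= ln (real n powr (- ln (real n)))" using \<alpha> n0 by (intro ln_mono) auto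
   also have "... = - La\<^sup>2" using n0 by (simp add: ln_powr La_def power2_eq_square)
   finally show ?thesis using \<alpha> by (simp add: a_def ln_div)
  qed
  have a1: "1 <= a"
  proof -
   have "1 <= La\<^sup>2" using L100 by (intro one_le_power) simp
   thus ?thesis using aL by linarith
  qed
  have hc: "c * real m * La * a <= h" using h(3) by (simp add: La_def a_def)
  have qLa: "c * real m * La <= real q"
  proof -
   have "real m * (c * real m * La) <= real m * real q" using big nq by (simp add: power2_eq_square mult_ac)
   thus ?thesis using m0 by simp
  qed
  have p1: "0 <= h / real n" "h / real n <= 1" using h n0 by auto
  have pTh: "c * a <= (h / real n) * (real q / La)"
  proof -
   \<comment> \<open>Since q / n is 1 / m, the lower bound on h becomes a lower bound on
     \<open>p * Th\<close>.\<close>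
   have e: "(h / real n) * (real q / La) = h / (real m * La)" using nq n0 by simp
   have "c * a * (real m * La) <= h" using hc by (simp add: mult_ac)
   thus ?thesis unfolding e using m0 L100 by (simp add: pos_le_divide_eq)
  qed
  have ca: "1000000 * a <= c * a" using c1 a1 by (intro mult_right_mono) auto
  have Th0: "0 <= real q / La" using L100 by simp
  interpret krylov_large n m q A "h / real n" \<alpha> La a "real q / La"
  proof unfold_locales
   show "1000000 * real m <= real q / La"
   proof -
    have "1000000 * real m * La <= c * real m * La" using c1 L100 by (intro mult_right_mono) auto
    hence "1000000 * real m * La <= real q" using qLa by linarith
    thus ?thesis using L100 by (simp add: pos_le_divide_eq)
   qed
   show "1000000 * a <= h / real n * (real q / La)" using pTh ca by linarith
   moreover have "h / real n * (real q / La) <= 1 * (real q / La)" using p1 Th0 by (intro mult_right_mono)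
   ultimately show "1000000 * a <= real q / La" by linarith
   show "La / real n <= h / real n"
   proof (rule divide_right_mono)
    have "1 * La * 1 <= (c * real m) * La * a"
    proof (intro mult_mono)
     have "1 * 1 <= c * real m" using c1 m1 by (intro mult_mono) auto
     thus "1 <= c * real m" by simp
    qed (use L100 a1 c0 in auto)
    thus "La <= h" using hc by simp
   qed simp
  qed (use nq n0 A p1 \<alpha> sv L100 aL in \<open>auto simp: La_def a_def\<close>)
  show "measure (sparse_gaussian_entries n (n div m) (h / real n))
    {g \<in> space (sparse_gaussian_entries n (n div m) (h / real n)).
      singular_value n (krylov_mat n m (n div m) A (mat n (n div m) g)) <= \<alpha> ^ (500 * m)} <= \<alpha>"
   using smallest_singular_value_prob by (simp only: sparse_gaussian_entries_def q_def)
 qed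
qed

end
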